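(* Let $A$ be a real $d\times d$ matrix all of whose eigenvalues have strictly negative real parts, let $B$ be a real $d\times m$ matrix such that $(A,B)$ is a controllable pair, and let $a\in\mathbb{R}^d$ and $\gamma\in\mathbb{R}^m$ be not both zero. Let $\kappa>0$, $\zeta_2>0$. Consider the system $$dv(t)=Av(t)\,dt+B\,dW(t),\qquad\ddot\varphi(t)+2\zeta_2\dot\varphi(t)+\bigl(\kappa^2-\langle a,v(t)\rangle\bigr)\varphi(t)=\sum_{\ell=1}^m\gamma_\ell\,\varphi(t)\,\dot W_\ell(t).$$ Let $m$ be the unique stationary probability measure on $M=\mathbb{R}^d\times\mathbb{R}/(2\pi\mathbb{Z})$ of the diffusion $(v(t),\psi(t))$ described in the context, and let $$Q(v,\psi)=\bigl(1-\kappa^2+\langle a,v\rangle\bigr)\sin\psi\cos\psi-2\zeta_2\sin^2\psi+\frac{\|\gamma\|^2}{2}\cos^2\psi\cos2\psi .$$ (i) For every initial condition $(v,\varphi,\dot\varphi)$ with $(\varphi,\dot\varphi)\ne(0,0)$, $$\mathbb{P}^{(v,\varphi,\dot\varphi)}\Bigl(\frac1t\log\|(\varphi(t),\dot\varphi(t))\|\to\int_MQ\,dm\ \text{ as }t\to\infty\Bigr)=1.$$ (ii) The Lyapunov exponent $\lambda:=\lim_{t\to\infty}\frac1t\log\|(\varphi(t),\dot\varphi(t))\|$ exists as an almost-sure limit for all initial conditions $(v,\varphi,\dot\varphi)$ with $(\varphi,\dot\varphi)\ne(0,0)$, and $$\lambda=\int_MQ(v,\psi)\,dm(v,\psi).$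$
   Context: $W=(W_1,\dots,W_m)$ is a standard $m$-dimensional Brownian motion (the integer $m$ is not to be confused with the measure $m$). $(A,B)$ is a controllable pair if $\mathrm{rank}\{B,AB,\dots,A^{d-1}B\}=d$. The equation for $\varphi$ is understood as the It\^o (equivalently Stratonovich) system $d\varphi=\dot\varphi\,dt$, $d\dot\varphi=[-2\zeta_2\dot\varphi-(\kappa^2-\langle a,v\rangle)\varphi]dt+\varphi\sum_\ell\gamma_\ell\,dW_\ell$. Writing $(\varphi,\dot\varphi)=\|(\varphi,\dot\varphi)\|(\cos\psi,\sin\psi)$, the angle satisfies the It\^o equation $d\psi(t)=h(v(t),\psi(t))\,dt+\sum_{\ell}\gamma_\ell\cos^2\psi(t)\,dW_\ell(t)$ with $h(v,\psi)=-1+(1-\kappa^2+\langle a,v\rangle)\cos^2\psi-2\zeta_2\sin\psi\cos\psi-\|\gamma\|^2\sin\psi\cos^3\psi$; together with $dv=Av\,dt+B\,dW$ this defines a diffusion $(v(t),\psi(t))$ on $M$, which has a unique stationary probability measure $m$ under the stated hypotheses. $\mathbb{P}^{(v,\varphi,\dot\varphi)}$ is the law with the indicated (deterministic) initial condition. *)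

theory Defs
  imports "HOL-Probability.Probability"
begin

section \<open>Linear algebra\<close>

definition hurwitz :: "real^'d^'d \<Rightarrow> bool" where
  "hurwitz A \<longleftrightarrow>
     (\<forall>(\<mu>::complex) (z::complex^'d).
        z \<noteq> 0 \<and> (\<chi> i j. complex_of_real (A $ i $ j)) *v z = \<mu> *s z \<longrightarrow> Re \<mu> < 0)"

text \<open>The rank of the block matrix \<open>[B, AB, \<dots>, A^(d-1) B]\<close> is the dimension of the span of its
  columns, which are the columns of the blocks.\<close>

definition controllable :: "real^'d^'d \<Rightarrow> real^'m^'d \<Rightarrow> bool" where
  "controllable A B \<longleftrightarrow>
     dim (\<Union>k<CARD('d). columns (((\<lambda>C. A ** C) ^^ k) B)) = CARD('d)"


section \<open>The circle \<open>\<real>/2\<pi>\<int>\<close> with its quotient topology\<close>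

quotient_type circle = real / "\<lambda>x y. \<exists>k::int. y = x + 2 * pi * of_int k"
  morphisms rep_circle to_circle
proof (rule equivpI)
  show "reflp (\<lambda>x y. \<exists>k::int. y = x + 2 * pi * of_int k)"
    by (rule reflpI, rule exI[of _ 0]) simp
  show "symp (\<lambda>x y. \<exists>k::int. y = x + 2 * pi * of_int k)"
  proof (rule sympI, elim exE)
    fix x y k assume "y = x + 2 * pi * of_int k"
    then show "\<exists>k::int. x = y + 2 * pi * of_int k"
      by (intro exI[of _ "- k"]) simp
  qed
  show "transp (\<lambda>x y. \<exists>k::int. y = x + 2 * pi * of_int k)"
  proof (rule transpI, elim exE)
    fix x y z k l
    assume "y = x + 2 * pi * of_int k" "z = y + 2 * pi * of_int l"
    then show "\<exists>k::int. z = x + 2 * pi * of_int k"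
      by (intro exI[of _ "k + l"]) (simp add: algebra_simps)
  qed
qed

instantiation circle :: topological_space
begin

definition open_circle :: "circle set \<Rightarrow> bool" where
  "open_circle U \<longleftrightarrow> open (to_circle -` U)"

instance
  by standard (auto simp: open_circle_def vimage_Union)

end

text \<open>The function \<open>Q\<close> on \<open>\<real>\<^sup>d \<times> \<real>/2\<pi>\<int>\<close>; its defining formula is \<open>2\<pi>\<close>-periodic in the angle.\<close>

lift_definition Q :: "real^'d \<Rightarrow> real^'m \<Rightarrow> real \<Rightarrow> real \<Rightarrow> real^'d \<Rightarrow> circle \<Rightarrow> real" is
  "\<lambda>a \<gamma> \<kappa> \<zeta>\<^sub>2 v \<psi>.
     (1 - \<kappa>\<^sup>2 + a \<bullet> v) * sin \<psi> * cos \<psi> - 2 * \<zeta>\<^sub>2 * (sin \<psi>)\<^sup>2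
       + (norm \<gamma>)\<^sup>2 / 2 * (cos \<psi>)\<^sup>2 * cos (2 * \<psi>)"
proof (elim exE)
  fix a v :: "real^'d" and \<gamma> :: "real^'m" and \<kappa> \<zeta>\<^sub>2 x y :: real and k :: int
  assume y: "y = x + 2 * pi * of_int k"
  have "sin y = sin x" "cos y = cos x"
    by (simp_all add: y sin_add cos_add)
  then show "(1 - \<kappa>\<^sup>2 + a \<bullet> v) * sin x * cos x - 2 * \<zeta>\<^sub>2 * (sin x)\<^sup>2
       + (norm \<gamma>)\<^sup>2 / 2 * (cos x)\<^sup>2 * cos (2 * x)
     = (1 - \<kappa>\<^sup>2 + a \<bullet> v) * sin y * cos y - 2 * \<zeta>\<^sub>2 * (sin y)\<^sup>2
       + (norm \<gamma>)\<^sup>2 / 2 * (cos y)\<^sup>2 * cos (2 * y)"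
    by (simp add: cos_double)
qed


section \<open>Brownian motion, Ito integral, Ito equations\<close>

text \<open>Processes are indexed by \<open>real\<close>; only times \<open>t \<ge> 0\<close> matter.\<close>

definition adapted_continuous ::
  "'w measure \<Rightarrow> (real \<Rightarrow> 'w measure) \<Rightarrow> (real \<Rightarrow> 'w \<Rightarrow> 'e::euclidean_space) \<Rightarrow> bool" where
  "adapted_continuous P F X \<longleftrightarrow>
     (\<forall>t\<ge>0. X t \<in> borel_measurable (F t)) \<and>
     (\<forall>\<omega>\<in>space P. continuous_on {0..} (\<lambda>t. X t \<omega>))"

definition brownian_motion ::
  "'w measure \<Rightarrow> (real \<Rightarrow> 'w measure) \<Rightarrow> (real \<Rightarrow> 'w \<Rightarrow> real^'m) \<Rightarrow> bool" where
  "brownian_motion P F W \<longleftrightarrow>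
     prob_space P \<and> filtration (space P) F \<and> (\<forall>t. sets (F t) \<subseteq> sets P) \<and>
     adapted_continuous P F W \<and> (AE \<omega> in P. W 0 \<omega> = 0) \<and>
     (\<forall>s t. 0 \<le> s \<and> s < t \<longrightarrow>
        prob_space.indep_set P (sets (F s))
          {(\<lambda>\<omega>. W t \<omega> - W s \<omega>) -` S \<inter> space P | S. S \<in> sets borel} \<and>
        prob_space.indep_vars P (\<lambda>_. borel) (\<lambda>l \<omega>. (W t \<omega> - W s \<omega>) $ l) UNIV \<and>
        (\<forall>l. distributed P lborel (\<lambda>\<omega>. (W t \<omega> - W s \<omega>) $ l) (normal_density 0 (sqrt (t - s)))))"

text \<open>A simple integrand \<open>(n, \<tau>, \<xi>)\<close> stands for the step process with value \<open>\<xi> i\<close> on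
  \<open>(\<tau> i, \<tau> (i+1)]\<close> for \<open>i < n\<close>, and \<open>0\<close> elsewhere.\<close>

type_synonym ('w, 'e) simple_integrand = "nat \<times> (nat \<Rightarrow> real) \<times> (nat \<Rightarrow> 'w \<Rightarrow> 'e)"

definition simple_integrand ::
  "'w measure \<Rightarrow> (real \<Rightarrow> 'w measure) \<Rightarrow> ('w, 'e::euclidean_space) simple_integrand \<Rightarrow> bool" where
  "simple_integrand P F = (\<lambda>(n, \<tau>, \<xi>).
     0 \<le> \<tau> 0 \<and> (\<forall>i<n. \<tau> i < \<tau> (Suc i)) \<and>
     (\<forall>i<n. \<xi> i \<in> borel_measurable (F (\<tau> i)) \<and> bounded (\<xi> i ` space P)))"

definition simple_value ::
  "('w, 'e::euclidean_space) simple_integrand \<Rightarrow> real \<Rightarrow> 'w \<Rightarrow> 'e" where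
  "simple_value = (\<lambda>(n, \<tau>, \<xi>) s \<omega>. \<Sum>i<n. if \<tau> i < s \<and> s \<le> \<tau> (Suc i) then \<xi> i \<omega> else 0)"

definition simple_integral ::
  "(real \<Rightarrow> 'w \<Rightarrow> real) \<Rightarrow> ('w, 'e::euclidean_space) simple_integrand \<Rightarrow> real \<Rightarrow> 'w \<Rightarrow> 'e" where
  "simple_integral w =
     (\<lambda>(n, \<tau>, \<xi>) t \<omega>. \<Sum>i<n. (w (min t (\<tau> (Suc i))) \<omega> - w (min t (\<tau> i)) \<omega>) *\<^sub>R \<xi> i \<omega>)"

text \<open>\<open>ito_integral P F w H I\<close>: the process \<open>I\<close> is a continuous version of \<open>t \<mapsto> \<integral>\<^sub>0\<^sup>t H dw\<close>, for a
  scalar Brownian motion \<open>w\<close> and a continuous adapted integrand \<open>H\<close>. Both limits below are in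
  probability. Since the filtration is not assumed to be complete, \<open>I t\<close> is only required to be
  \<open>P\<close>-measurable; as a limit in probability it is automatically \<open>F t\<close>-measurable up to null sets.\<close>

definition ito_integral ::
  "'w measure \<Rightarrow> (real \<Rightarrow> 'w measure) \<Rightarrow> (real \<Rightarrow> 'w \<Rightarrow> real) \<Rightarrow>
   (real \<Rightarrow> 'w \<Rightarrow> 'e::euclidean_space) \<Rightarrow> (real \<Rightarrow> 'w \<Rightarrow> 'e) \<Rightarrow> bool" where
  "ito_integral P F w H I \<longleftrightarrow>
     adapted_continuous P F H \<and>
     (\<forall>t\<ge>0. I t \<in> borel_measurable P) \<and>
     (\<forall>\<omega>\<in>space P. continuous_on {0..} (\<lambda>t. I t \<omega>)) \<and>
     (\<exists>S :: nat \<Rightarrow> ('w, 'e) simple_integrand.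
        (\<forall>n. simple_integrand P F (S n)) \<and>
        (\<forall>t\<ge>0. \<forall>\<epsilon>>0.
           (\<lambda>n. measure P {\<omega> \<in> space P.
               ennreal \<epsilon> < (\<integral>\<^sup>+s\<in>{0..t}. ennreal ((norm (simple_value (S n) s \<omega> - H s \<omega>))\<^sup>2) \<partial>lborel)})
             \<longlonglongrightarrow> 0) \<and>
        (\<forall>t\<ge>0. \<forall>\<epsilon>>0.
           (\<lambda>n. measure P {\<omega> \<in> space P. \<epsilon> < norm (simple_integral w (S n) t \<omega> - I t \<omega>)})
             \<longlonglongrightarrow> 0))"

text \<open>Solutions of \<open>dX = b(X) dt + \<Sum>\<^sub>l \<sigma>\<^sub>l(X) dW\<^sub>l\<close>.\<close>

definition sde_solution ::
  "'w measure \<Rightarrow> (real \<Rightarrow> 'w measure) \<Rightarrow> (real \<Rightarrow> 'w \<Rightarrow> real^'m) \<Rightarrow>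
   ('e::euclidean_space \<Rightarrow> 'e) \<Rightarrow> ('m \<Rightarrow> 'e \<Rightarrow> 'e) \<Rightarrow> (real \<Rightarrow> 'w \<Rightarrow> 'e) \<Rightarrow> bool" where
  "sde_solution P F W b \<sigma> X \<longleftrightarrow>
     adapted_continuous P F X \<and>
     (\<exists>I. (\<forall>l. ito_integral P F (\<lambda>t \<omega>. W t \<omega> $ l) (\<lambda>t \<omega>. \<sigma> l (X t \<omega>)) (I l)) \<and>
          (AE \<omega> in P. \<forall>t\<ge>0.
             X t \<omega> = X 0 \<omega> + integral {0..t} (\<lambda>s. b (X s \<omega>)) + (\<Sum>l\<in>UNIV. I l t \<omega>)))"


section \<open>The oscillator and its angular diffusion\<close>

definition oscillator_solution ::
  "'w measure \<Rightarrow> (real \<Rightarrow> 'w measure) \<Rightarrow> (real \<Rightarrow> 'w \<Rightarrow> real^'m) \<Rightarrow>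
   real^'d^'d \<Rightarrow> real^'m^'d \<Rightarrow> real^'d \<Rightarrow> real^'m \<Rightarrow> real \<Rightarrow> real \<Rightarrow>
   (real \<Rightarrow> 'w \<Rightarrow> (real^'d) \<times> real \<times> real) \<Rightarrow> bool" where
  "oscillator_solution P F W A B a \<gamma> \<kappa> \<zeta>\<^sub>2 =
     sde_solution P F W
       (\<lambda>(v, \<phi>, \<phi>'). (A *v v, \<phi>', - 2 * \<zeta>\<^sub>2 * \<phi>' - (\<kappa>\<^sup>2 - a \<bullet> v) * \<phi>))
       (\<lambda>l (v, \<phi>, \<phi>'). (column l B, 0, \<gamma> $ l * \<phi>))"

definition angular_drift ::
  "real^'d \<Rightarrow> real^'m \<Rightarrow> real \<Rightarrow> real \<Rightarrow> real^'d \<Rightarrow> real \<Rightarrow> real" where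
  "angular_drift a \<gamma> \<kappa> \<zeta>\<^sub>2 v \<psi> =
     - 1 + (1 - \<kappa>\<^sup>2 + a \<bullet> v) * (cos \<psi>)\<^sup>2 - 2 * \<zeta>\<^sub>2 * sin \<psi> * cos \<psi>
       - (norm \<gamma>)\<^sup>2 * sin \<psi> * (cos \<psi>)^3"

text \<open>The diffusion \<open>Y\<close> on \<open>M = \<real>\<^sup>d \<times> \<real>/2\<pi>\<int>\<close> is the projection of a solution of the Ito system for
  \<open>(v, \<psi>)\<close> with a real-valued lift \<open>\<psi>\<close> of the angle.\<close>

definition angular_diffusion ::
  "'w measure \<Rightarrow> (real \<Rightarrow> 'w measure) \<Rightarrow> (real \<Rightarrow> 'w \<Rightarrow> real^'m) \<Rightarrow>
   real^'d^'d \<Rightarrow> real^'m^'d \<Rightarrow> real^'d \<Rightarrow> real^'m \<Rightarrow> real \<Rightarrow> real \<Rightarrow>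
   (real \<Rightarrow> 'w \<Rightarrow> (real^'d) \<times> circle) \<Rightarrow> bool" where
  "angular_diffusion P F W A B a \<gamma> \<kappa> \<zeta>\<^sub>2 Y \<longleftrightarrow>
     (\<exists>X. sde_solution P F W
            (\<lambda>(v, \<psi>). (A *v v, angular_drift a \<gamma> \<kappa> \<zeta>\<^sub>2 v \<psi>))
            (\<lambda>l (v, \<psi>). (column l B, \<gamma> $ l * (cos \<psi>)\<^sup>2)) X \<and>
          Y = (\<lambda>t \<omega>. (fst (X t \<omega>), to_circle (snd (X t \<omega>)))))"

text \<open>\<open>K t x\<close> is the law at time \<open>t\<close> of the diffusion on \<open>M\<close> started at \<open>x\<close>. The coefficients are
  regular enough for solutions to exist and be unique in law, so that \<open>K t\<close> is determined for
  \<open>t \<ge> 0\<close> and does not depend on the choice of \<open>(P, F, W)\<close>.\<close>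

definition transition_function ::
  "'w measure \<Rightarrow> (real \<Rightarrow> 'w measure) \<Rightarrow> (real \<Rightarrow> 'w \<Rightarrow> real^'m) \<Rightarrow>
   real^'d^'d \<Rightarrow> real^'m^'d \<Rightarrow> real^'d \<Rightarrow> real^'m \<Rightarrow> real \<Rightarrow> real \<Rightarrow>
   (real \<Rightarrow> (real^'d) \<times> circle \<Rightarrow> ((real^'d) \<times> circle) measure) \<Rightarrow> bool" where
  "transition_function P F W A B a \<gamma> \<kappa> \<zeta>\<^sub>2 K \<longleftrightarrow>
     (\<forall>t\<ge>0. K t \<in> borel \<rightarrow>\<^sub>M prob_algebra borel) \<and>
     (\<forall>x. (\<exists>Y. angular_diffusion P F W A B a \<gamma> \<kappa> \<zeta>\<^sub>2 Y \<and> (AE \<omega> in P. Y 0 \<omega> = x)) \<and>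
          (\<forall>Y. angular_diffusion P F W A B a \<gamma> \<kappa> \<zeta>\<^sub>2 Y \<and> (AE \<omega> in P. Y 0 \<omega> = x) \<longrightarrow>
             (\<forall>t\<ge>0. distr P borel (Y t) = K t x)))"

definition stationary_measure ::
  "'w measure \<Rightarrow> (real \<Rightarrow> 'w measure) \<Rightarrow> (real \<Rightarrow> 'w \<Rightarrow> real^'m) \<Rightarrow>
   real^'d^'d \<Rightarrow> real^'m^'d \<Rightarrow> real^'d \<Rightarrow> real^'m \<Rightarrow> real \<Rightarrow> real \<Rightarrow>
   ((real^'d) \<times> circle) measure \<Rightarrow> bool" where
  "stationary_measure P F W A B a \<gamma> \<kappa> \<zeta>\<^sub>2 \<mu> \<longleftrightarrow>
     prob_space \<mu> \<and> sets \<mu> = sets borel \<and>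
     (\<exists>K. transition_function P F W A B a \<gamma> \<kappa> \<zeta>\<^sub>2 K \<and> (\<forall>t\<ge>0. \<mu> \<bind> K t = \<mu>))"

text \<open>\<open>has_growth_rate \<dots> v\<^sub>0 \<phi>\<^sub>0 \<phi>\<^sub>0' \<Lambda>\<close>: from the initial condition \<open>(v\<^sub>0, \<phi>\<^sub>0, \<phi>\<^sub>0')\<close>,
  \<open>1/t log \<parallel>(\<phi>(t), \<phi>'(t))\<parallel> \<rightarrow> \<Lambda>\<close> almost surely. The norm on \<open>real \<times> real\<close> is Euclidean.\<close>

definition has_growth_rate ::
  "'w measure \<Rightarrow> (real \<Rightarrow> 'w measure) \<Rightarrow> (real \<Rightarrow> 'w \<Rightarrow> real^'m) \<Rightarrow>
   real^'d^'d \<Rightarrow> real^'m^'d \<Rightarrow> real^'d \<Rightarrow> real^'m \<Rightarrow> real \<Rightarrow> real \<Rightarrow>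
   real^'d \<Rightarrow> real \<Rightarrow> real \<Rightarrow> real \<Rightarrow> bool" where
  "has_growth_rate P F W A B a \<gamma> \<kappa> \<zeta>\<^sub>2 v\<^sub>0 \<phi>\<^sub>0 \<phi>\<^sub>0' \<Lambda> \<longleftrightarrow>
     (\<forall>X. oscillator_solution P F W A B a \<gamma> \<kappa> \<zeta>\<^sub>2 X \<and> (AE \<omega> in P. X 0 \<omega> = (v\<^sub>0, \<phi>\<^sub>0, \<phi>\<^sub>0')) \<longrightarrow>
        (AE \<omega> in P. ((\<lambda>t. 1 / t * ln (norm (snd (X t \<omega>)))) \<longlongrightarrow> \<Lambda>) at_top))"

end

theory Submission
 imports Defs "HOL-Computational_Algebra.Fundamental_Theorem_Algebra"
begin

text \<open>Along a fixed path the solution is an explicit functional of the noise, because \<open>\<phi>' - \<langle>\<gamma>, W\<rangle> \<phi>\<close>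
solves a random differential equation. Ito's formula for a continuous logarithm of \<open>z = \<phi> + i \<phi>'\<close> has
the angular equation as its imaginary part, and as its real part \<open>log \<bar>z(t)\<bar> = log \<bar>z(0)\<bar> + \<integral> Q + M(t)\<close>
with \<open>M\<close> a martingale whose bracket is at most \<open>\<bar>\<gamma>\<bar>\<^sup>2 t\<close>, so \<open>M(t) / t\<close> vanishes. A Lyapunov form for the
Hurwitz matrix bounds the time averages of \<open>\<bar>v\<bar>\<^sup>2\<close>; hence the occupation measures of \<open>(v, z / \<bar>z\<bar>)\<close> are tight
and \<open>Q\<close>, of linear growth, can be truncated. A law of large numbers makes every limit point stationary,
so uniqueness forces the limit \<open>\<mu>\<close>.\<close>

text \<open>Ito integrals are given only as limits in probability of simple integrals, over a
  filtration that need not be complete. Each is therefore identified with the limit of left-point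
  sums on uniform grids; the probability then rests on finite sums of adapted weights times Brownian
  increments, with truncation on the grid in place of stopping times.

  The hypothesis on \<open>\<mu>\<close> speaks of laws of solutions of the angular equation, the
  path estimates of an explicit flow. They meet only if the angle of the flow agrees almost surely
  with that of every solution. The angular drift is Lipschitz in the angle with a constant growing
  with the unbounded \<open>v\<close>, so this uniqueness is localized in \<open>v\<close>. The flow
  offers continuity in the starting point along every path, hence the Feller property; its
  Euler-Maruyama scheme carries the Markov property.

  Points of the quotient circle become rays in the punctured complex plane, where \<open>z\<close>
  depends linearly on its initial value and compactness in a Euclidean space applies.\<close>

abbreviation itg :: "real => (real => 'a::real_normed_vector) => 'a" where
"itg T f == integral {0..T} f"

abbreviation cont0 :: "(real => 'a::topological_space) => bool" where
"cont0 f == continuous_on {0..} f"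

abbreviation bmeas :: "'a measure => ('a => 'b::topological_space) set" where
"bmeas M == borel_measurable M"

abbreviation evn (binder "EVN " 10) where
"evn p == eventually p sequentially"

notation LIMSEQ ("((_)/ ----> (_))" [60, 60] 60)
notation inner (infix "*." 70)
notation tendsto (infixr "--->" 55)

lemmas hk_combine = Henstock_Kurzweil_Integration.integral_combine
 and hk_diff = Henstock_Kurzweil_Integration.integral_diff
 and hk_nonneg = Henstock_Kurzweil_Integration.integral_nonneg
 and hk_add = Henstock_Kurzweil_Integration.integral_add
 and cont_integrable = integrable_continuous_interval
 and cont_subset = continuous_on_subset
 and cont_bmeas = borel_measurable_continuous_onI
 and cont_compose = continuous_on_compose2
 and cont_tendsto = continuous_on_tendsto_compose
 and bmeas_const = borel_measurable_const
 and bi_integral_sum = Bochner_Integration.integral_sum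
 and bi_integrable_sum = Bochner_Integration.integrable_sum
 and bi_integrable_bound = Bochner_Integration.integrable_bound
 and bi_integrable_add = Bochner_Integration.integrable_add
 and bi_integrable_diff = Bochner_Integration.integrable_diff
 and bmeas_times = borel_measurable_times
 and bmeas_diff = borel_measurable_diff
 and bmeas_sum = borel_measurable_sum
 and bmeas_inner = borel_measurable_inner
 and bmeas_add = borel_measurable_add
 and bmeas_power = borel_measurable_power
 and bmeas_LIMSEQ = borel_measurable_LIMSEQ_metric
 and bmeas_scaleR = borel_measurable_scaleR
 and bmeas_Pair = borel_measurable_Pair
 and bmeas_divide = borel_measurable_divide
 and meas_comp = measurable_compose
 and power2_eq = power2_eq_square
 and dominated_conv = integral_dominated_convergence


section \<open>Integral equations and uniform grids\<close>

definition grid :: "real => nat => nat => real" where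
"grid T n i = T * real i / real n"

abbreviation cell where "cell T n i == {grid T n i..grid T n (Suc i)}"

lemma grid_0 [simp]: "grid T n 0 = 0"
by (simp add: grid_def)

lemma grid_n: "n > 0 ==> grid T n n = T"
by (simp add: grid_def)

lemma grid_step: "grid T n (Suc i) - grid T n i = T / n"
by (simp add: grid_def distrib_left add_divide_distrib)

lemma grid_mono: "0 <= T ==> i <= j ==> grid T n i <= grid T n j"
by (simp add: grid_def divide_right_mono mult_left_mono)

lemma grid_nonneg: "0 <= T ==> 0 <= grid T n i"
by (simp add: grid_def)

lemma grid_le: "0 <= T ==> i <= n ==> grid T n i <= T"
by (cases "n = 0") (auto simp: grid_def field_simps intro: mult_left_mono)

text \<open>\<open>e n\<close> is the supremum of the oscillation of \<open>X\<close> over time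
  differences up to \<open>T / n\<close>, which uniform continuity sends to zero. One number per
  mesh serves every cell; several paths share a modulus once they are joined into a tuple-valued
  path.\<close>

lemma grid_modulus:
fixes X :: "real => 'a::metric_space"
assumes X: "continuous_on {0..T} X" and T: "0 <= T"
obtains e :: "nat => real" where "e ----> 0"
 "!!n i r r'. [|i < n; r : cell T n i; r' : cell T n i|]
   ==> dist (X r) (X r') <= e n"
proof -
define S where "S n = {dist (X r) (X r') | r r'. r : {0..T} & r' : {0..T} & abs (r - r') <= T / real n}" for n :: nat
define e where "e n = Sup (S n)" for n
have "bounded (X ` {0..T})" by (intro compact_imp_bounded compact_continuous_image X compact_Icc)
then obtain B where B: "!!x y. x : X ` {0..T} ==> y : X ` {0..T} ==> dist x y <= B" by (meson bounded_two_points)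
have bdd: "bdd_above (S n)" for n by (rule bdd_aboveI[of _ B]) (auto simp: S_def intro!: B)
have zero: "0 : S n" for n unfolding S_def using T by (auto intro!: exI[of _ 0])
have e0: "e ----> 0"
proof (rule LIMSEQ_I)
 fix eps :: real assume eps: "0 < eps"
 have "uniformly_continuous_on {0..T} X" by (intro compact_uniformly_continuous X compact_Icc)
 then obtain d where d: "d > 0" "!!x y. x : {0..T} ==> y : {0..T} ==> dist x y < d ==> dist (X x) (X y) < eps / 2"
  unfolding uniformly_continuous_on_def using eps half_gt_zero by metis
 obtain N :: nat where N: "T / d < real N" using reals_Archimedean2 by blast
 show "EX N. ALL n>=N. norm (e n - 0) < eps"
 proof (intro exI allI impI)
  fix n assume n: "Suc N <= n"
  have "T / real n < d"
  proof -
   have "T < d * real N" using N d(1) by (simp add: field_simps)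
   also have "... <= d * real n" using n d(1) by (intro mult_left_mono) auto
   finally show ?thesis using n by (simp add: field_simps)
  qed
  then have "x <= eps / 2" if "x : S n" for x using that d(2) unfolding S_def by (fastforce simp: dist_real_def)
  then have "e n <= eps / 2" unfolding e_def using zero by (intro cSup_least) auto
  moreover have "0 <= e n" unfolding e_def using zero bdd by (intro cSup_upper)
  ultimately show "norm (e n - 0) < eps" using eps by simp
 qed
qed
show ?thesis
proof (rule that[OF e0])
 fix n i :: nat and r r' :: real
 assume i: "i < n" and r: "r : cell T n i" "r' : cell T n i"
 have "0 <= grid T n i" "grid T n (Suc i) <= T" using T i by (auto intro: grid_nonneg grid_le)
 then have "r : {0..T}" "r' : {0..T}" "abs (r - r') <= T / real n" using r grid_step[of T n i] by auto
 then have "dist (X r) (X r') : S n" unfolding S_def by blast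
 then show "dist (X r) (X r') <= e n" unfolding e_def using bdd by (intro cSup_upper)
qed
qed

section \<open>Riemann sums over grid cells\<close>

lemma integral_norm_le_const:
fixes f :: "real => 'a::euclidean_space"
assumes "a <= b" "f integrable_on {a..b}" "!!t. t : {a..b} ==> norm (f t) <= B"
shows "norm (integral {a..b} f) <= B * (b - a)"
proof -
have "0 <= B" using order_trans[OF norm_ge_zero assms(3)[of a]] assms(1) by simp
then have "norm (integral {a..b} f) <= B * measure lborel (cbox a b)"
 using assms by (intro has_integral_bound[of B f]) (auto intro: integrable_integral)
then show ?thesis using assms(1) by simp
qed

lemma integral_grid_sum:
fixes f :: "real => 'a::euclidean_space"
assumes f: "continuous_on {0..T} f" and T: "0 <= T" and k: "k <= n"
shows "(SUM i<k. integral (cell T n i) f) = itg (grid T n k) f"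
using k
proof (induction k)
case (Suc k)
have "f integrable_on {0..grid T n (Suc k)}" using T Suc.prems grid_le[of T "Suc k" n] by (intro cont_integrable cont_subset[OF f]) auto
then have "itg (grid T n k) f + integral (cell T n k) f = itg (grid T n (Suc k)) f" using T by (intro hk_combine grid_nonneg grid_mono) auto
then show ?case using Suc by simp
qed simp

text \<open>The integrand may change from cell to cell: this is how coefficients frozen at an
  endpoint of a cell are compared with the moving ones.\<close>

lemma sum_integral_close:
fixes f :: "real => 'a::euclidean_space"
assumes f: "continuous_on {0..T} f" and T: "0 <= T" and n: "n > 0"
 and H: "!!i. i < n ==> H i integrable_on (cell T n i)"
 and close: "!!i r. i < n ==> r : cell T n i ==> norm (H i r - f r) <= e"
shows "norm ((SUM i<n. integral (cell T n i) (H i)) - itg T f) <= e * T"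
proof -
have fi: "f integrable_on (cell T n i)" if "i < n" for i using T that grid_le[of T "Suc i" n] grid_nonneg[of T n i]
 by (intro cont_integrable cont_subset[OF f]) auto
have "norm (integral (cell T n i) (H i) - integral (cell T n i) f) <= e * (T / n)" if "i < n" for i
proof -
 have e: "0 <= e" using order_trans[OF norm_ge_zero close[OF that, of "grid T n i"]] grid_mono[OF T, of i "Suc i" n] by simp
 have "integral (cell T n i) (H i) - integral (cell T n i) f
   = integral (cell T n i) (%r. H i r - f r)" using H fi that by (simp add: hk_diff)
 also have "norm ... <= e * (grid T n (Suc i) - grid T n i)" using H[OF that] fi[OF that] close[OF that] grid_mono[OF T, of i "Suc i" n] e
  by (intro integral_norm_le_const) (auto intro: integrable_diff)
 finally show ?thesis by (simp add: grid_step)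
qed
then have "norm (SUM i<n. integral (cell T n i) (H i) - integral (cell T n i) f) <= (SUM i<n. e * (T / n))" by (intro sum_norm_le) auto
also have "... = e * T" using n by simp
finally show ?thesis using integral_grid_sum[OF f T, of n n] n by (simp add: sum_subtractf grid_n)
qed

lemma riemann_sum_tendsto:
fixes f :: "real => 'a::euclidean_space"
assumes f: "continuous_on {0..T} f" and T: "0 <= T"
shows "(%n. SUM i<n. (T / n) *\<^sub>R f (grid T n i)) ----> itg T f"
proof -
obtain e where e: "e ----> 0"
 "!!n i r r'. [|i < n; r : cell T n i; r' : cell T n i|] ==> dist (f r) (f r') <= e n" using grid_modulus[OF f T] by metis
have "norm ((SUM i<n. (T / n) *\<^sub>R f (grid T n i)) - itg T f) <= e n * T" if "n > 0" for n
proof -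
 have "(SUM i<n. (T / n) *\<^sub>R f (grid T n i)) = (SUM i<n. integral (cell T n i) (%_. f (grid T n i)))"
  by (rule sum.cong) (use grid_mono[OF T] in "auto simp: grid_step")
 then show ?thesis using sum_integral_close[OF f T that, of "%i _. f (grid T n i)" "e n"] e(2)[of _ n] grid_mono[OF T]
  by (auto simp: dist_norm)
qed
then have "EVN n. norm ((SUM i<n. (T / n) *\<^sub>R f (grid T n i)) - itg T f) <= e n * T"
 by (auto intro: eventually_mono[OF eventually_gt_at_top[of 0]])
then have "(%n. (SUM i<n. (T / n) *\<^sub>R f (grid T n i)) - itg T f) ----> 0"
 by (rule Lim_null_comparison) (rule tendsto_mult_left_zero[OF e(1)])
then show ?thesis by (rule LIM_zero_cancel)
qed

lemma riemann_sum_tendsto_shift: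
fixes f :: "real => 'a::euclidean_space"
assumes f: "continuous_on {a..a + T} f" and T: "0 <= T"
shows "(%n. SUM i<n. (T / n) *\<^sub>R f (a + grid T n i)) ----> integral {a..a + T} f"
proof -
have "continuous_on {0..T} (%r. f (a + r))" by (intro cont_compose[OF f]) (auto intro!: continuous_intros)
moreover have "itg T (%r. f (a + r)) = integral {a..a + T} f" using integral_shift[of 0 a T f] f by (simp add: o_def add.commute)
ultimately show ?thesis using riemann_sum_tendsto[of T "%r. f (a + r)"] T by simp
qed

lemma continuous_on_atLeast_local:
fixes f :: "real => 'a::topological_space"
assumes "!!T. 0 <= T ==> continuous_on {0..T} f"
shows "cont0 f"
proof -
have "continuous (at x within {0..}) f" if "x >= 0" for x
proof -
 have "continuous (at x within {0..x + 1}) f" using assms[of "x + 1"] that by (auto simp: continuous_on_eq_continuous_within)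
 moreover have "at x within {0..x + 1} = at x within {0..}" by (rule at_within_nhd[of _ "{x - 1<..<x + 1}"]) auto
 ultimately show ?thesis by simp
qed
then show ?thesis by (simp add: continuous_on_eq_continuous_within)
qed

section \<open>Gronwall estimates for integral equations and Euler schemes\<close>

lemma continuous_on_indefinite_integral:
fixes f :: "real => 'a::euclidean_space"
assumes f: "cont0 f"
shows "cont0 (%t. itg t f)"
by (intro continuous_on_atLeast_local indefinite_integral_continuous_1 cont_integrable
   cont_subset[OF f]) auto

text \<open>The product of \<open>c + L * itg t g\<close> and \<open>exp (- L * t)\<close> has
  nonpositive derivative, so it stays below its initial value \<open>c\<close>.\<close>

lemma gronwall:
fixes g :: "real => real"
assumes g: "continuous_on {0..T} g" and L: "0 <= L"
 and bound: "!!t. t : {0..T} ==> g t <= c + L * itg t g"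
 and t: "t : {0..T}"
shows "g t <= c * exp (L * t)"
proof -
define G where "G t = (c + L * itg t g) * exp (- L * t)" for t
have cont: "continuous_on {0..t} G" unfolding G_def using g t
 by (intro continuous_intros indefinite_integral_continuous_1 cont_integrable) (auto intro: cont_subset)
have "G t <= G 0"
proof (rule DERIV_nonpos_imp_decreasing_open[of 0 t G])
 fix x assume x: "0 < x" "x < t"
 have "((%t. itg t g) has_real_derivative g x) (at x within {0..T})" using g x t by (intro integral_has_real_derivative) auto
 moreover have "x : interior {0..T}" using x t by (simp add: interior_atLeastAtMost_real)
 ultimately have "((%t. itg t g) has_real_derivative g x) (at x)" using at_within_interior by metis
 then have "(G has_real_derivative (L * g x) * exp (- L * x) + (c + L * itg x g) * (exp (- L * x) * (- L))) (at x)"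
  unfolding G_def by (auto intro!: derivative_eq_intros)
 moreover have "(L * g x) * exp (- L * x) + (c + L * itg x g) * (exp (- L * x) * (- L)) <= 0"
 proof -
  have "L * (g x - (c + L * itg x g)) * exp (- L * x) <= 0" using bound[of x] x t L by (intro mult_nonpos_nonneg mult_nonneg_nonpos) auto
  then show ?thesis by (simp add: algebra_simps)
 qed
 ultimately show "EX y. DERIV G x :> y & y <= 0" by blast
qed (use t cont in auto)
then have "(c + L * itg t g) * exp (- L * t) <= c" by (simp add: G_def)
then have "(c + L * itg t g) <= c * exp (L * t)" by (simp add: exp_minus field_simps)
then show ?thesis using bound[OF t] by linarith
qed

text \<open>The error \<open>e\<close> absorbs whatever separates the two drifts besides the states,
  such as a difference in other coefficients. With \<open>e = 0\<close> and equal starts it is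
  uniqueness.\<close>

lemma integral_eq_perturbation:
fixes x y a b :: "real => 'a::euclidean_space"
assumes a: "continuous_on {0..T} a" and b: "continuous_on {0..T} b"
 and x: "!!t. t : {0..T} ==> x t = x0 + itg t a"
 and y: "!!t. t : {0..T} ==> y t = y0 + itg t b"
 and L: "0 <= L" and e: "0 <= e"
 and close: "!!r. r : {0..T} ==> norm (a r - b r) <= L * norm (x r - y r) + e"
 and t: "t : {0..T}"
shows "norm (x t - y t) <= (norm (x0 - y0) + e * T) * exp (L * t)"
proof (rule gronwall[OF _ L _ t])
have xc: "continuous_on {0..T} x" "continuous_on {0..T} y"
proof -
 have "continuous_on {0..T} (%t. x0 + itg t a)" "continuous_on {0..T} (%t. y0 + itg t b)"
  using a b by (auto intro!: continuous_intros indefinite_integral_continuous_1 cont_integrable)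
 then show "continuous_on {0..T} x" "continuous_on {0..T} y" by (auto intro: continuous_on_eq simp: x y)
qed
show c: "continuous_on {0..T} (%t. norm (x t - y t))" using xc by (intro continuous_intros)
fix t assume t: "t : {0..T}"
have sub: "{0..t} <= {0..T}" using t by auto
have ai: "a integrable_on {0..t}" "b integrable_on {0..t}" using a b sub by (auto intro!: cont_integrable intro: cont_subset)
have ni: "(%t. norm (x t - y t)) integrable_on {0..t}" using c sub by (auto intro!: cont_integrable intro: cont_subset)
have "x t - y t = (x0 - y0) + itg t (%r. a r - b r)" using x[OF t] y[OF t] ai by (simp add: hk_diff)
then have "norm (x t - y t) <= norm (x0 - y0) + norm (itg t (%r. a r - b r))" using norm_triangle_ineq by metis
also have "norm (itg t (%r. a r - b r)) <= itg t (%r. L * norm (x r - y r) + e)" using close sub ai ni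
 by (intro integral_norm_bound_integral integrable_diff integrable_add integrable_on_mult_right) auto
also have "... = L * itg t (%r. norm (x r - y r)) + e * t" using ni t by (subst hk_add) (auto intro!: integrable_on_mult_right)
also have "e * t <= e * T" using e t by (intro mult_left_mono) auto
finally show "norm (x t - y t) <= norm (x0 - y0) + e * T + L * itg t (%r. norm (x r - y r))" by simp
qed

text \<open>Discrete Gronwall. The slopes \<open>G k\<close> only have to be near the drift
  \<open>a\<close> on the cell; this admits schemes whose slope looks at the driver at the right end
  of the cell.\<close>

lemma euler_scheme_error:
fixes x a :: "real => 'a::euclidean_space" and X G :: "nat => 'a"
assumes a: "continuous_on {0..T} a" and T: "0 <= T"
 and x: "!!t. t : {0..T} ==> x t = X 0 + itg t a"
 and X: "!!k. k < n ==> X (Suc k) = X k + (T / n) *\<^sub>R G k"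
 and L: "0 <= L" and e: "0 <= e"
 and close: "!!k r. k < n ==> r : cell T n k ==>
   norm (G k - a r) <= L * norm (X k - x (grid T n k)) + e"
 and k: "k <= n"
shows "norm (X k - x (grid T n k)) <= e * T * exp (L * T)"
proof (cases "n = 0")
case True
then show ?thesis using k x[of 0] T e by simp
next
case False
let ?D = "T / real n"
have D: "0 <= ?D" using T by simp
\<comment> \<open>A bound linear in \<open>k\<close> times a geometric factor reproduces itself: one
  step multiplies by \<open>1 + ?D * L\<close> and adds \<open>?D * e\<close>.\<close>
have "k <= n ==> norm (X k - x (grid T n k)) <= real k * ?D * e * (1 + ?D * L) ^ k" for k
proof (induction k)
 case 0
 then show ?case using x[of 0] T by simp
next
 case (Suc k)
 let ?g = "grid T n k" and ?g' = "grid T n (Suc k)"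
 have g: "0 <= ?g" "?g <= ?g'" "?g' <= T" using T Suc.prems by (auto intro: grid_nonneg grid_mono grid_le)
 have ai: "a integrable_on {0..?g'}" "a integrable_on {?g..?g'}" using g by (auto intro!: cont_integrable cont_subset[OF a])
 have "x ?g' - x ?g = integral {?g..?g'} a" using x[of ?g] x[of ?g'] g by (simp flip: hk_combine[OF g(1,2) ai(1)])
 then have "X (Suc k) - x ?g' = (X k - x ?g) + (?D *\<^sub>R G k - integral {?g..?g'} a)"
  using X[of k] Suc.prems by (simp add: algebra_simps)
 also have "?D *\<^sub>R G k - integral {?g..?g'} a = integral {?g..?g'} (%r. G k - a r)"
 proof -
  have "integral {?g..?g'} (%r. G k - a r) = integral {?g..?g'} (%r. G k) - integral {?g..?g'} a"
   by (rule hk_diff[OF integrable_const_ivl ai(2)])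
  also have "integral {?g..?g'} (%r. G k) = (?g' - ?g) *\<^sub>R G k" using g by simp
  also have "?g' - ?g = ?D" by (rule grid_step)
  finally show ?thesis by simp
 qed
 finally have "norm (X (Suc k) - x ?g') <= norm (X k - x ?g) + norm (integral {?g..?g'} (%r. G k - a r))" using norm_triangle_ineq by metis
 also have "norm (integral {?g..?g'} (%r. G k - a r)) <= (L * norm (X k - x ?g) + e) * (?g' - ?g)"
  using close[of k] Suc.prems ai g L e by (intro integral_norm_le_const) (auto intro: integrable_diff)
 also have "... = ?D * L * norm (X k - x ?g) + ?D * e" unfolding grid_step by (simp add: algebra_simps)
 also have "norm (X k - x ?g) + (?D * L * norm (X k - x ?g) + ?D * e) = (1 + ?D * L) * norm (X k - x ?g) + ?D * e * 1"
  by (simp add: algebra_simps)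
 also have "... <= (1 + ?D * L) * (real k * ?D * e * (1 + ?D * L) ^ k) + ?D * e * (1 + ?D * L) ^ Suc k"
 proof (rule add_mono)
  have DL: "0 <= ?D * L" by (rule mult_nonneg_nonneg[OF D L])
  then have "1 <= (1 + ?D * L) ^ Suc k" by (intro one_le_power) simp
  then show "?D * e * 1 <= ?D * e * (1 + ?D * L) ^ Suc k" by (rule mult_left_mono) (rule mult_nonneg_nonneg[OF D e])
  show "(1 + ?D * L) * norm (X k - x ?g) <= (1 + ?D * L) * (real k * ?D * e * (1 + ?D * L) ^ k)"
   by (rule mult_left_mono[OF Suc.IH]) (use DL Suc.prems in simp_all)
 qed
 also have "... = real (Suc k) * ?D * e * (1 + ?D * L) ^ Suc k"
 proof -
  have "(1 + d * L) * (m * d * e * p) + d * e * ((1 + d * L) * p) = (1 + m) * d * e * ((1 + d * L) * p)" for d m p :: real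
   by (simp add: algebra_simps)
  from this[of ?D "real k" "(1 + ?D * L) ^ k"] show ?thesis by simp
 qed
 finally show ?case by simp
qed
then have "norm (X k - x (grid T n k)) <= real k * ?D * e * (1 + ?D * L) ^ k" using k by blast
also have "... <= T * e * exp (L * T)"
proof (intro mult_mono)
 have "(1 + ?D * L) ^ k <= (1 + ?D * L) ^ n" using k mult_nonneg_nonneg[OF D L] by (intro power_increasing) auto
 also have "... <= exp (?D * L) ^ n" using mult_nonneg_nonneg[OF D L] exp_ge_add_one_self[of "?D * L"] by (intro power_mono) auto
 also have "... = exp (L * T)" using False by (simp flip: exp_of_nat_mult)
 finally show "(1 + ?D * L) ^ k <= exp (L * T)" .
 show "real k * ?D <= T" using k T False by (simp add: field_simps mult_left_mono)
qed (use T e D L in auto)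
finally show ?thesis by (simp add: mult_ac)
qed

section \<open>Picard iteration\<close>

primrec picard :: "(real => 'a => 'a) => 'a => nat => real => 'a::euclidean_space" where
"picard f x0 0 t = x0"
| "picard f x0 (Suc n) t = x0 + itg t (%s. f s (picard f x0 n s))"

text \<open>The Lipschitz constant is only local in time. On \<open>[0, T]\<close>, in the weight
  \<open>exp (2 * L * t)\<close>, every iteration halves the distance of successive iterates, since
  the integral of \<open>L * exp (2 * L * s)\<close> is at most \<open>exp (2 * L * t) / 2\<close>.
  The iterates do not depend on \<open>T\<close>, hence neither does their limit.\<close>

lemma picard_exists:
fixes f :: "real => 'a::euclidean_space => 'a"
assumes lip: "!!T. EX L. ALL t:{0..T}. ALL x y. norm (f t x - f t y) <= L * norm (x - y)"
 and cont: "!!x. cont0 x ==> cont0 (%t. f t (x t))"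
obtains x where "cont0 x" "!!t. t >= 0 ==> x t = x0 + itg t (%s. f s (x s))"
proof -
define P where "P = picard f x0"
have Pc: "cont0 (P n)" for n
proof (induction n)
 case (Suc n)
 then show ?case unfolding P_def picard.simps by (intro continuous_intros continuous_on_indefinite_integral cont) simp
qed (simp add: P_def)
\<comment> \<open>The limit as a telescoping series, in the form required by the Weierstrass
  test.\<close>
define x where "x t = x0 + (\<Sum>n. P (Suc n) t - P n t)" for t
have unif: "uniform_limit {0..T} P x sequentially" and lim: "!!t. t : {0..T} ==> (%n. itg t (%s. f s (P n s))) ----> itg t (%s. f s (x s))"
 if T: "0 <= T" for T
proof -
 obtain L' where L': "!!t x y. t : {0..T} ==> norm (f t x - f t y) <= L' * norm (x - y)" using lip by blast
 define L where "L = max 1 L'"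
 have L: "norm (f t x - f t y) <= L * norm (x - y)" if "t : {0..T}" for t x y
  using L'[OF that, of x y] by (smt (verit) L_def mult_right_mono norm_ge_zero)
 have L1: "L >= 1" by (simp add: L_def)
 have fP: "continuous_on {0..T} (%s. f s (P n s))" for n by (rule cont_subset[OF cont[OF Pc]]) auto
 have PT: "continuous_on {0..T} (P n)" for n by (rule cont_subset[OF Pc]) auto
 have "bounded ((%t. P (Suc 0) t - P 0 t) ` {0..T})"
  by (rule compact_imp_bounded[OF compact_continuous_image[OF continuous_on_diff[OF PT PT] compact_Icc]])
 then obtain C where C0: "C > 0" and "ALL y:(%t. P (Suc 0) t - P 0 t) ` {0..T}. norm y <= C" unfolding bounded_pos by blast
 then have C: "!!t. t : {0..T} ==> norm (P (Suc 0) t - P 0 t) <= C" by simp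
 have step: "norm (P (Suc n) t - P n t) <= C * (1/2)^n * exp (2 * L * t)" if "t : {0..T}" for n t using that
 proof (induction n arbitrary: t)
  case 0
  have "C * 1 <= C * exp (2 * L * t)" using 0 L1 C0 by (intro mult_left_mono) auto
  then show ?case using C[OF 0] by simp
 next
  case (Suc n)
  have sub: "{0..t} <= {0..T}" using Suc.prems by auto
  have exps: "((%s. C * (1/2)^n * L * exp (2 * L * s)) has_integral C * (1/2)^n * (exp (2 * L * t) / 2) - C * (1/2)^n * (exp (2 * L * 0) / 2)) {0..t}"
   using Suc.prems L1 by (intro fundamental_theorem_of_calculus)
     (auto intro!: derivative_eq_intros simp flip: has_real_derivative_iff_has_vector_derivative)
  have fPt: "(%s. f s (P n s)) integrable_on {0..t}" for n by (rule cont_integrable[OF cont_subset[OF fP sub]])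
  have PS: "P (Suc n) t = x0 + itg t (%s. f s (P n s))" for n by (simp add: P_def)
  have "P (Suc (Suc n)) t - P (Suc n) t = itg t (%s. f s (P (Suc n) s) - f s (P n s))" unfolding PS hk_diff[OF fPt fPt] by simp
  also have "norm ... <= itg t (%s. C * (1/2)^n * L * exp (2 * L * s))"
  proof (intro integral_norm_bound_integral)
   show "(%s. f s (P (Suc n) s) - f s (P n s)) integrable_on {0..t}" by (intro integrable_diff fPt)
   fix s assume "s : {0..t}"
   then have s: "s : {0..T}" using sub by auto
   have "norm (f s (P (Suc n) s) - f s (P n s)) <= L * norm (P (Suc n) s - P n s)" using L[OF s] .
   also have "... <= L * (C * (1/2)^n * exp (2 * L * s))" using Suc.IH[OF s] L1 by (intro mult_left_mono) auto
   finally show "norm (f s (P (Suc n) s) - f s (P n s)) <= C * (1/2)^n * L * exp (2 * L * s)" by (simp add: mult_ac)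
  qed (use exps in "auto simp: integrable_on_def")
  also have "... = C * (1/2)^n * (exp (2 * L * t) / 2) - C * (1/2)^n * (exp (2 * L * 0) / 2)" using exps by (rule integral_unique)
  also have "... <= C * (1/2)^Suc n * exp (2 * L * t)" using C0 by simp
  finally show ?case .
 qed
 have "uniform_limit {0..T} (%n t. SUM i<n. P (Suc i) t - P i t) (%t. \<Sum>i. P (Suc i) t - P i t) sequentially"
 proof (rule Weierstrass_m_test)
  fix n t assume t: "t : {0..T}"
  have "C * (1/2)^n * exp (2 * L * t) <= C * (1/2)^n * exp (2 * L * T)" using t C0 L1 by (intro mult_left_mono) auto
  then show "norm (P (Suc n) t - P n t) <= C * (1/2)^n * exp (2 * L * T)" using step[OF t, of n] by linarith
 qed (auto intro!: summable_mult2 summable_mult summable_geometric)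
 from uniform_limit_add[OF uniform_limit_const this]
 have u: "uniform_limit {0..T} (%n t. x0 + (SUM i<n. P (Suc i) t - P i t)) x sequentially" unfolding x_def .
 have tel: "x0 + (SUM i<n. P (Suc i) t - P i t) = P n t" for n t using sum_lessThan_telescope[of "%i. P i t" n] by (simp add: P_def)
 show U: "uniform_limit {0..T} P x sequentially" using u unfolding tel by simp
 fix t assume t: "t : {0..T}"
 have "uniform_limit {0..t} (%n s. f s (P n s)) (%s. f s (x s)) sequentially"
 proof (rule uniform_limitI)
  fix e :: real assume e: "e > 0"
  have "EVN n. ALL s:{0..T}. dist (P n s) (x s) < e / L" using uniform_limitD[OF U, of "e / L"] e L1 by simp
  then show "EVN n. ALL s:{0..t}. dist (f s (P n s)) (f s (x s)) < e"
  proof eventually_elim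
   case (elim n)
   show ?case
   proof
    fix s assume "s : {0..t}"
    then have s: "s : {0..T}" using t by auto
    then have "L * norm (P n s - x s) < e" using elim L1 by (simp add: dist_norm field_simps)
    then show "dist (f s (P n s)) (f s (x s)) < e" using L[OF s, of "P n s" "x s"] by (simp add: dist_norm)
   qed
  qed
 qed
 then obtain I J where I: "!!n. ((%s. f s (P n s)) has_integral I n) {0..t}"
  "((%s. f s (x s)) has_integral J) {0..t}" "(I ---> J) sequentially"
 proof (rule uniform_limit_integral)
  have "{0..t} <= {0..T}" using t by auto
  then show "continuous_on {0..t} (%s. f s (P n s))" for n by (rule cont_subset[OF fP])
 qed auto
 then show "(%n. itg t (%s. f s (P n s))) ----> itg t (%s. f s (x s))" using integral_unique[OF I(1)] integral_unique[OF I(2)] by simp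
qed
have "continuous_on {0..T} x" if T: "0 <= T" for T by (rule uniform_limit_theorem[OF _ unif[OF T]])
   (auto intro!: always_eventually cont_subset[OF Pc])
then have "cont0 x" by (rule continuous_on_atLeast_local)
moreover have "x t = x0 + itg t (%s. f s (x s))" if t: "t >= 0" for t
proof -
 have "(%n. P (Suc n) t) ----> x t" using tendsto_uniform_limitI[OF unif[OF t]] t by (auto intro: LIMSEQ_Suc)
 moreover have "(%n. P (Suc n) t) ----> x0 + itg t (%s. f s (x s))"
  unfolding P_def picard.simps unfolding P_def[symmetric] using lim[OF t, of t] t by (intro tendsto_intros) auto
 ultimately show ?thesis by (rule LIMSEQ_unique)
qed
ultimately show ?thesis by (rule that)
qed


section \<open>A Lyapunov form for a Hurwitz matrix\<close>

definition poly_act :: "(complex^'d => complex^'d) => complex poly => complex^'d => complex^'d" where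
"poly_act T p z = (SUM i<=degree p. coeff p i *s (T ^^ i) z)"

lemma poly_act_eq:
assumes "degree p <= N"
shows "poly_act T p z = (SUM i<=N. coeff p i *s (T ^^ i) z)"
unfolding poly_act_def using assms
by (intro sum.mono_neutral_left) (auto simp: coeff_eq_0)

lemma poly_act_add: "poly_act T (p + q) z = poly_act T p z + poly_act T q z"
proof -
let ?N = "max (degree p) (degree q)"
have "degree (p + q) <= ?N" by (rule degree_add_le_max)
then show ?thesis by (simp add: poly_act_eq[of _ ?N] vector_sadd_rdistrib sum.distrib)
qed

lemma poly_act_smult: "poly_act T (smult a p) z = a *s poly_act T p z"
by (simp add: poly_act_eq[of "smult a p" "degree p"] degree_smult_le poly_act_def
  vector_smult_assoc vec.scale_sum_right)

locale complex_linear =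
fixes T :: "complex^'d => complex^'d"
assumes T_add: "T (x + y) = T x + T y" and T_scale: "T (c *s x) = c *s T x"
begin

lemma zero: "T 0 = 0"
using T_scale[of 0 0] by simp

lemma sum: "T (sum f S) = (SUM i:S. T (f i))"
by (induction S rule: infinite_finite_induct) (auto simp: zero T_add)

lemma poly_act_pCons: "poly_act T (pCons a p) z = a *s z + T (poly_act T p z)"
proof -
have "poly_act T (pCons a p) z = (SUM i<=Suc (degree p). coeff (pCons a p) i *s (T ^^ i) z)" by (rule poly_act_eq) (rule degree_pCons_le)
also have "... = a *s z + (SUM i<=degree p. coeff p i *s T ((T ^^ i) z))" by (subst sum.atMost_Suc_shift) simp
also have "(SUM i<=degree p. coeff p i *s T ((T ^^ i) z)) = T (poly_act T p z)" by (simp add: poly_act_def sum T_scale)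
finally show ?thesis .
qed

lemma poly_act_0: "poly_act T 0 z = 0"
by (simp add: poly_act_def)

lemma poly_act_mult: "poly_act T (p * q) z = poly_act T p (poly_act T q z)"
by (induction p) (simp_all add: poly_act_0 poly_act_add poly_act_smult poly_act_pCons)

lemma poly_act_linear_factor: "poly_act T [:- x, 1:] z = T z - x *s z"
by (simp add: poly_act_pCons poly_act_0 zero)

text \<open>With \<open>y = T z - x z\<close> the orbit of \<open>z\<close> under \<open>1 + h T\<close> solves the perturbed geometric recursion
 \<open>z\<^sub>k\<^sub>+\<^sub>1 = (1 + h x) z\<^sub>k + h y\<^sub>k\<close>, so summability passes from \<open>y\<close> to \<open>z\<close>.\<close>

lemma summable_orbit:
fixes h :: real
assumes ev: "!!x w. x :# M ==> w ~= 0 ==> T w = x *s w ==> cmod (1 + of_real h * x) < 1"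
 and z: "poly_act T (\<Prod>x\<in>#M. [:- x, 1:]) z = 0"
shows "summable (%k. norm (((%z. z + of_real h *s T z) ^^ k) z))"
using assms
proof (induction M arbitrary: z)
case empty
have "poly_act T 1 z = z" unfolding one_pCons by (simp add: poly_act_pCons poly_act_0 zero)
then have "z = 0" using empty by simp
moreover have "((%z. z + of_real h *s T z) ^^ k) 0 = 0" for k by (induction k) (simp_all add: zero)
ultimately show ?case by simp
next
case (add x M)
let ?C = "%z. z + of_real h *s T z"
show ?case
proof (cases "EX w. w ~= 0 & T w = x *s w")
 case True
 then obtain w where "w ~= 0" "T w = x *s w" by blast
 then have q: "cmod (1 + of_real h * x) < 1" by (rule add.prems(1)[of x, rotated]) simp
 define y where "y = T z - x *s z"
 \<comment> \<open>The factors commute, so the one for \<open>x\<close> may act on \<open>z\<close>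
   first and leave \<open>y\<close> annihilated by the others.\<close>
 have "poly_act T ((\<Prod>x\<in>#M. [:- x, 1:]) * [:- x, 1:]) z = 0" using add.prems(2) by (simp add: mult.commute)
 then have "poly_act T (\<Prod>x\<in>#M. [:- x, 1:]) y = 0" unfolding poly_act_mult poly_act_linear_factor y_def .
 then have ys: "summable (%k. norm ((?C ^^ k) y))" using add.prems(1) by (intro add.IH) auto
 define a where "a k = norm ((?C ^^ k) z)" for k
 define b where "b k = abs h * norm ((?C ^^ k) y)" for k
 define C where "C = ?C"
 have Cadd: "C (u + v) = C u + C v" for u v by (simp add: C_def vec_eq_iff T_add algebra_simps)
 have Cscale: "C (c *s u) = c *s C u" for u c by (simp add: C_def vec_eq_iff T_scale algebra_simps)
 have Cpow: "(C ^^ k) (c *s u + d *s v) = c *s (C ^^ k) u + d *s (C ^^ k) v" for k c d u v by (induction k) (simp_all add: Cadd Cscale)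
 have "C z = (1 + of_real h * x) *s z + of_real h *s y" by (simp add: C_def y_def vec_eq_iff algebra_simps)
 then have step: "(C ^^ Suc k) z = (1 + of_real h * x) *s (C ^^ k) z + of_real h *s (C ^^ k) y" for k
  unfolding funpow_Suc_right o_apply by (simp only: Cpow)
 have nrm: "norm (c *s u) = cmod c * norm u" for c and u :: "complex^'d"
  by (simp add: norm_vec_def L2_set_right_distrib norm_mult vector_scalar_mult_def)
 have "a (Suc k) <= cmod (1 + of_real h * x) * a k + b k" for k
  unfolding a_def b_def C_def[symmetric] step by (rule order_trans[OF norm_triangle_ineq]) (simp only: nrm norm_of_real order_refl)
 then have ab: "a (Suc k) <= cmod (1 + of_real h * x) * a k + b k" for k .
 have a0: "a k >= 0" "b k >= 0" for k by (auto simp: a_def b_def)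
 have bs: "summable b" unfolding b_def using ys by (rule summable_mult)
 let ?q = "cmod (1 + of_real h * x)"
 \<comment> \<open>Summing the recursion bounds every partial sum, because \<open>?q < 1\<close>
   lets the sum on the right be absorbed on the left.\<close>
 have bound: "(SUM k<n. a k) <= (a 0 + suminf b) / (1 - ?q)" for n
 proof -
  have "(SUM k<n. a k) <= (SUM k<Suc n. a k)" using a0 by simp
  also have "... = a 0 + (SUM k<n. a (Suc k))" by (rule sum.lessThan_Suc_shift)
  also have "(SUM k<n. a (Suc k)) <= (SUM k<n. ?q * a k + b k)" by (intro sum_mono ab)
  also have "... = ?q * (SUM k<n. a k) + (SUM k<n. b k)" by (simp add: sum.distrib sum_distrib_left)
  also have "(SUM k<n. b k) <= suminf b" using a0 bs by (intro sum_le_suminf) auto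
  finally have "(1 - ?q) * (SUM k<n. a k) <= a 0 + suminf b" by (simp add: algebra_simps)
  then show ?thesis using q by (simp add: field_simps)
 qed
 have "summable a" using a0 bound by (intro summableI_nonneg_bounded) auto
 then show ?thesis unfolding a_def .
next
 \<comment> \<open>If \<open>x\<close> is no eigenvalue, \<open>T - x\<close> is injective and its
   factor can be cancelled; so only eigenvalues have to satisfy the bound.\<close>
 case False
 have "poly_act T ([:- x, 1:] * (\<Prod>x\<in>#M. [:- x, 1:])) z = 0" using add.prems(2) by simp
 then have "T (poly_act T (\<Prod>x\<in>#M. [:- x, 1:]) z) = x *s poly_act T (\<Prod>x\<in>#M. [:- x, 1:]) z"
  unfolding poly_act_mult poly_act_linear_factor by simp
 then have "poly_act T (\<Prod>x\<in>#M. [:- x, 1:]) z = 0" using False by blast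
 then show ?thesis using add.prems(1) by (intro add.IH) auto
qed
qed

text \<open>The \<open>?N + 1\<close> iterates \<open>z, T z, ..., (T ^^ ?N) z\<close>, with
  \<open>?N\<close> the real dimension, are linearly dependent. If two of them coincide, their
  difference is the relation.\<close>

lemma annihilating_poly: "EX p. p ~= 0 & poly_act T p z = 0"
proof -
let ?N = "DIM(complex^'d)"
let ?f = "%i. (T ^^ i) z"
have "EX c::nat => real. (EX i<=?N. c i ~= 0) & (SUM i<=?N. c i *\<^sub>R ?f i) = 0"
proof (cases "inj_on ?f {..?N}")
 case True
 then have "card (?f ` {..?N}) = Suc ?N" by (simp add: card_image)
 then have "dependent (?f ` {..?N})" by (intro dependent_biggerset) simp_all
 then obtain u v where u: "v : ?f ` {..?N}" "u v ~= 0" "(SUM v:?f ` {..?N}. u v *\<^sub>R v) = 0"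
  using dependent_finite[of "?f ` {..?N}"] by auto
 have "(SUM i<=?N. u (?f i) *\<^sub>R ?f i) = 0" using u(3) sum.reindex[OF True, of "%v. u v *\<^sub>R v"] by (simp add: o_def)
 then show ?thesis using u(1,2) by (intro exI[of _ "%i. u (?f i)"]) auto
next
 case False
 then obtain i j where ij: "i <= ?N" "j <= ?N" "i ~= j" "?f i = ?f j" by (auto simp: inj_on_def)
 let ?c = "%k. (if k = i then 1 else 0) + (if k = j then - 1 else (0::real))"
 have "(SUM k<=?N. ?c k *\<^sub>R ?f k) = (SUM k<=?N. (if k = i then ?f k else 0) + (if k = j then - ?f k else 0))"
  by (rule sum.cong) (auto simp: scaleR_add_left)
 also have "... = 0" using ij by (simp add: sum.distrib)
 finally show ?thesis using ij by (intro exI[of _ ?c] conjI exI[of _ i]) auto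
qed
then obtain c :: "nat => real" and i where c: "i <= ?N" "c i ~= 0" "(SUM i<=?N. c i *\<^sub>R ?f i) = 0" by blast
define p where "p = (SUM j<=?N. monom (complex_of_real (c j)) j)"
have co: "coeff p k = (if k <= ?N then of_real (c k) else 0)" for k unfolding p_def coeff_sum coeff_monom by simp
have "p ~= 0" using c co[of i] by (metis coeff_0 of_real_eq_0_iff)
moreover have "degree p <= ?N" by (rule degree_le) (simp add: co)
then have "poly_act T p z = (SUM i<=?N. c i *\<^sub>R ?f i)"
 by (simp add: poly_act_eq co vec_eq_iff vector_scalar_mult_def) (simp add: scaleR_conv_of_real)
ultimately show ?thesis using c(3) by auto
qed

end

text \<open>\<open>|1 + h x|^2 = 1 + h (2 Re x + h |x|^2)\<close>, which is below 1 as soon as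
  \<open>0 < h < - 2 Re x / |x|^2\<close>.\<close>

lemma eventually_cmod_less_one:
assumes "Re x < 0"
shows "\<forall>\<^sub>F h in at_right (0::real). cmod (1 + of_real h * x) < 1"
proof -
have x: "cmod x > 0" using assms by auto
have "eventually (%h. h < - 2 * Re x / (cmod x)^2) (at_right 0)"
 using assms x by (intro order_tendstoD(2)[OF tendsto_ident_at]) (simp add: field_simps)
moreover have "eventually (%h::real. h > 0) (at_right 0)" by (rule eventually_at_right_less)
ultimately show ?thesis
proof eventually_elim
 case (elim h)
 have "h * (h * (cmod x)^2) < h * (- 2 * Re x)" using elim x by (intro mult_strict_left_mono) (auto simp: field_simps)
 then have "(cmod (1 + of_real h * x))^2 < 1\<^sup>2" unfolding cmod_power2 by (simp add: power2_eq algebra_simps)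
 then show ?case by (rule power2_less_imp_less) simp
qed
qed

text \<open>Finitely many linear factors annihilate the basis vectors, so a single \<open>h\<close>
  serves all eigenvalues among their roots. The complexification \<open>emb\<close> preserves norms
  and intertwines the real and the complex step; general vectors follow by expansion in the
  basis.\<close>

lemma hurwitz_summable:
fixes A :: "real^'d^'d"
assumes "hurwitz A"
obtains h where "h > 0" "!!x. summable (%k. norm (((%x. x + h *\<^sub>R (A *v x)) ^^ k) x))"
proof -
define T where "T z = (\<chi> i j. complex_of_real (A $ i $ j)) *v z" for z
interpret complex_linear T
 by standard (simp_all add: T_def matrix_vector_right_distrib vec.scale matrix_vector_mult_scaleR vector_scalar_commute)
define emb :: "real^'d => complex^'d" where "emb x = (\<chi> i. complex_of_real (x $ i))" for x
have "EX M. poly_act T (\<Prod>x\<in>#M. [:- x, 1:]) z = 0" for z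
proof -
 obtain p where p: "p ~= 0" "poly_act T p z = 0" using annihilating_poly by blast
 obtain M where "p = smult (lead_coeff p) (\<Prod>x\<in>#M. [:- x, 1:])" using alg_closed_imp_factorization[OF p(1)] by blast
 then have "lead_coeff p *s poly_act T (\<Prod>x\<in>#M. [:- x, 1:]) z = 0"
  using p(2) poly_act_smult[of T "lead_coeff p" "\<Prod>x\<in>#M. [:- x, 1:]" z] by simp
 then show ?thesis using p(1) by (intro exI[of _ M]) (simp add: vec_eq_iff)
qed
then obtain M where M: "!!z. poly_act T (\<Prod>x\<in>#M z. [:- x, 1:]) z = 0" by metis
\<comment> \<open>Only roots that are eigenvalues enter: about the others the Hurwitz property says
  nothing.\<close>
define S where "S = {x. (EX b:(Basis :: (real^'d) set). x :# M (emb b)) & (EX w. w ~= 0 & T w = x *s w)}"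
have "finite S"
proof (rule finite_subset)
 show "S <= (UN b:Basis. set_mset (M (emb b)))" by (auto simp: S_def)
qed auto
moreover have "ALL x:S. \<forall>\<^sub>F h in at_right (0::real). cmod (1 + of_real h * x) < 1"
 using assms by (auto simp: S_def hurwitz_def T_def intro!: eventually_cmod_less_one)
ultimately have "\<forall>\<^sub>F h in at_right (0::real). ALL x:S. cmod (1 + of_real h * x) < 1" by (rule eventually_ball_finite)
then have "\<forall>\<^sub>F h in at_right (0::real). h > 0 & (ALL x:S. cmod (1 + of_real h * x) < 1)"
 by (intro eventually_conj eventually_at_right_less)
then obtain h where h: "h > 0" "!!x. x : S ==> cmod (1 + of_real h * x) < 1"
 using eventually_happens trivial_limit_at_right_real by (metis (mono_tags, lifting))
let ?C = "%x. x + h *\<^sub>R (A *v x)"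
have embC: "emb (?C x) = emb x + of_real h *s T (emb x)" for x by (simp add: emb_def T_def vec_eq_iff matrix_vector_mult_def)
have embCk: "emb ((?C ^^ k) x) = ((%z. z + of_real h *s T z) ^^ k) (emb x)" for k x by (induction k) (simp_all add: embC)
have embn: "norm (emb x) = norm x" for x by (simp add: emb_def norm_vec_def)
have base: "summable (%k. norm ((?C ^^ k) b))" if "b : Basis" for b
proof -
 have "summable (%k. norm (((%z. z + of_real h *s T z) ^^ k) (emb b)))"
  by (rule summable_orbit[OF _ M]) (use that h(2) in "auto simp: S_def")
 then show ?thesis by (simp add: embn flip: embCk)
qed
have Ck: "linear (?C ^^ k)" for k
proof (induction k)
 case (Suc k)
 have "linear ?C" by (auto intro!: linearI simp: matrix_vector_right_distrib matrix_vector_mult_scaleR algebra_simps)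
 then show ?case using Suc linear_compose[of "?C ^^ k" ?C] by (simp add: o_def)
qed (simp add: linear_id[unfolded id_def])
have "summable (%k. norm ((?C ^^ k) x))" for x
proof (rule summable_comparison_test)
 have "norm ((?C ^^ k) x) <= (SUM b:Basis. abs (x *. b) * norm ((?C ^^ k) b))" for k
 proof -
  have "(?C ^^ k) x = (?C ^^ k) (SUM b:Basis. (x *. b) *\<^sub>R b)" by (simp add: euclidean_representation)
  also have "... = (SUM b:Basis. (x *. b) *\<^sub>R (?C ^^ k) b)" by (simp add: linear_sum[OF Ck] linear_scale[OF Ck])
  also have "norm ... <= (SUM b:Basis. abs (x *. b) * norm ((?C ^^ k) b))" by (rule order_trans[OF norm_sum]) simp
  finally show ?thesis .
 qed
 then show "EX N. ALL n>=N. norm (norm ((?C ^^ n) x)) <= (SUM b:Basis. abs (x *. b) * norm ((?C ^^ n) b))" by simp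
 show "summable (%k. SUM b:Basis. abs (x *. b) * norm ((?C ^^ k) b))" by (intro summable_sum summable_mult base)
qed
then show ?thesis using h(1) by (rule that[rotated])
qed

text \<open>Let \<open>C = 1 + h A\<close> and let \<open>s\<close> sum the inner products of the
  orbits under \<open>C\<close>. Splitting off the first term gives the discrete Lyapunov identity
  \<open>s (C x) (C x) = s x x - |x|^2\<close>. Expanding the left side in \<open>h\<close> leaves
  \<open>2 h s x (A x) <= - |x|^2\<close>, because the \<open>h^2\<close> term is nonnegative. The
  sum of powers replaces the usual integral over \<open>exp (t A)\<close>.\<close>

lemma hurwitz_lyapunov:
fixes A :: "real^'d^'d"
assumes "hurwitz A"
obtains s :: "real^'d => real^'d => real" and c where "bounded_bilinear s" "!!x y. s x y = s y x"
 "!!x. (norm x)^2 <= s x x" "c > 0" "!!x. 2 * s x (A *v x) <= - c * (norm x)^2"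
proof -
obtain h where h: "h > 0" and sm: "!!x. summable (%k. norm (((%x. x + h *\<^sub>R (A *v x)) ^^ k) x))"
 using hurwitz_summable[OF assms] by metis
define C where "C = (%x. x + h *\<^sub>R (A *v x))"
define s where "s x y = (\<Sum>k. (C ^^ k) x *. (C ^^ k) y)" for x y
have Ck: "linear (C ^^ k)" for k
proof (induction k)
 case (Suc k)
 have "linear C" by (auto intro!: linearI simp: C_def matrix_vector_right_distrib matrix_vector_mult_scaleR algebra_simps)
 then show ?case using Suc linear_compose[of "C ^^ k" C] by (simp add: o_def)
qed (simp add: linear_id[unfolded id_def])
have sums: "summable (%k. (C ^^ k) x *. (C ^^ k) y)" for x y
proof -
 have sx: "summable (%k. norm ((C ^^ k) x))" for x using sm unfolding C_def .
 have "Bseq (%k. norm ((C ^^ k) y))" using summable_LIMSEQ_zero[OF sx] by (rule convergent_imp_Bseq[OF convergentI])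
 then obtain K where K: "!!k. norm (norm ((C ^^ k) y)) <= K" by (auto simp: Bseq_def)
 show ?thesis
 proof (rule summable_comparison_test')
 show "summable (%k. norm ((C ^^ k) x) * K)" using sx by (intro summable_mult2)
 fix n show "norm ((C ^^ n) x *. (C ^^ n) y) <= norm ((C ^^ n) x) * K"
  using Cauchy_Schwarz_ineq2[of "(C ^^ n) x" "(C ^^ n) y"] mult_left_mono[OF K[of n], of "norm ((C ^^ n) x)"] by simp
 qed
qed
have sym: "s x y = s y x" for x y by (simp add: s_def inner_commute)
have add: "s (x + x') y = s x y + s x' y" for x x' y by (simp add: s_def linear_add[OF Ck] inner_add_left suminf_add[OF sums sums])
have scale: "s (r *\<^sub>R x) y = r * s x y" for r x y by (simp add: s_def linear_scale[OF Ck] suminf_mult[OF sums])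
have add': "s x (y + y') = s x y + s x y'" for x y y' using add[of y y' x] by (metis sym)
have scale': "s x (r *\<^sub>R y) = r * s x y" for r x y using scale[of r y x] by (metis sym)
have "bilinear s" unfolding bilinear_def by (auto intro!: linearI simp: add scale add' scale')
then have bb: "bounded_bilinear s" by (simp add: bilinear_conv_bounded_bilinear)
have split: "s x x = (norm x)^2 + s (C x) (C x)" for x
 using suminf_split_head[OF sums[of x x]] by (simp add: s_def funpow_Suc_right power2_norm_eq_inner del: funpow.simps(2))
have pos: "s x x >= 0" for x unfolding s_def by (intro suminf_nonneg sums) auto
show ?thesis
proof (rule that[OF bb sym])
 show "(norm x)^2 <= s x x" for x using split[of x] pos[of "C x"] by simp
 show "1 / h > 0" using h by simp
 fix x
 have "s (C x) (C x) = s x x + 2 * h * s x (A *v x) + h^2 * s (A *v x) (A *v x)"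
  unfolding C_def add scale add' scale' sym[of "A *v x" x] by (simp add: power2_eq algebra_simps)
 then have "2 * h * s x (A *v x) <= - (norm x)\<^sup>2"
  using split[of x] mult_nonneg_nonneg[OF zero_le_power2[of h] pos[of "A *v x"]] by linarith
 then show "2 * s x (A *v x) <= - (1 / h) * (norm x)^2" using h by (simp add: field_simps)
qed
qed


section \<open>Weak compactness in Euclidean spaces\<close>

text \<open>Compactness is transferred from the real line, where it is Helly's theorem: with
 \<open>unfold_bits\<close> a continuous function (Schoenberg's space-filling curve, on growing cubes) and
 \<open>fold_bits\<close> a Borel right inverse of it, a sequence of measures is pushed forward along
 \<open>fold_bits\<close>, and its limit is pushed back along \<open>unfold_bits\<close>.\<close>

definition clamp_wave :: "real => real" where
"clamp_wave t = max 0 (min 1 (1/2 - cos (pi * t)))"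

text \<open>The point of the Cantor set with ternary digits \<open>2 * e i\<close>.\<close>

definition cantor_code :: "(nat => real) => real" where
"cantor_code e = (\<Sum>i. 2 * e i / 3 ^ Suc i)"

lemma summable_cantor_code:
fixes e :: "nat => real"
assumes "!!i. e i : {0, 1}"
shows "summable (%i. 2 * e i / 3 ^ Suc i)"
proof (rule summable_comparison_test')
show "summable (%i. 2 * (1/3) ^ i :: real)" by (intro summable_mult summable_geometric) simp
show "norm (2 * e n / 3 ^ Suc n) <= 2 * (1/3) ^ n" for n using assms[of n] by (auto simp: power_one_over field_simps)
qed

lemma cantor_code_rec:
fixes e :: "nat => real"
assumes "!!i. e i : {0, 1}"
shows "3 * cantor_code e = 2 * e 0 + cantor_code (%i. e (Suc i))"
proof -
have "summable (%i. 2 * e i / 3 ^ Suc i)" by (rule summable_cantor_code) (rule assms)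
from suminf_split_head[OF this] have "cantor_code e = 2 * e 0 / 3 + (\<Sum>i. 2 * e (Suc i) / 3 ^ Suc (Suc i))"
 by (simp add: cantor_code_def)
also have "(\<Sum>i. 2 * e (Suc i) / 3 ^ Suc (Suc i)) = (\<Sum>i. (2 * e (Suc i) / 3 ^ Suc i) / 3)" by simp
also have "... = cantor_code (%i. e (Suc i)) / 3" unfolding cantor_code_def using assms by (intro suminf_divide summable_cantor_code) blast
finally show ?thesis by simp
qed

lemma cantor_code_bounds:
fixes e :: "nat => real"
assumes "!!i. e i : {0, 1}"
shows "0 <= cantor_code e" "cantor_code e <= 1"
proof -
have e: "0 <= e i" for i using assms[of i] by auto
show "0 <= cantor_code e" unfolding cantor_code_def by (intro suminf_nonneg summable_cantor_code assms) (simp add: e)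
have "cantor_code e <= (\<Sum>i. 2 / 3 * (1 / 3) ^ i)" unfolding cantor_code_def
proof (intro suminf_le summable_cantor_code assms summable_mult summable_geometric)
 show "2 * e n / 3 ^ Suc n <= 2 / 3 * (1 / 3) ^ n" for n using assms[of n] by (auto simp: power_one_over field_simps)
qed simp
also have "... = 2 / 3 * (1 / (1 - 1 / 3))" by (subst suminf_mult) (auto simp: suminf_geometric summable_geometric)
finally show "cantor_code e <= 1" by simp
qed

lemma clamp_wave_shift: "clamp_wave (2 * of_int n + t) = clamp_wave t"
proof -
have "cos (pi * (2 * of_int n + t)) = cos (pi * t + 2 * pi * of_int n)" by (simp add: algebra_simps)
also have "... = cos (pi * t)" by (simp add: cos_add)
finally show ?thesis by (simp add: clamp_wave_def)
qed

lemma clamp_wave_cantor_0: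
fixes e :: "nat => real"
assumes "!!i. e i : {0, 1}"
shows "clamp_wave (cantor_code e) = e 0"
proof -
define r where "r = cantor_code (%i. e (Suc i))"
have r: "0 <= r" "r <= 1" unfolding r_def using assms by (intro cantor_code_bounds; blast)+
have c: "cantor_code e = (2 * e 0 + r) / 3" using cantor_code_rec[of e] assms by (simp add: r_def)
consider "e 0 = 0" | "e 0 = 1" using assms[of 0] by auto
then show ?thesis
proof cases
 case 1
 have "cos (pi / 3) <= cos (pi * (r / 3))" using r by (intro cos_monotone_0_pi_le) auto
 then show ?thesis using 1 by (simp add: clamp_wave_def c cos_60)
next
 case 2
 have "cos (pi * ((2 + r) / 3)) <= cos (pi - pi / 3)" using r by (intro cos_monotone_0_pi_le) (auto simp: field_simps)
 also have "... = - 1 / 2" by (simp only: cos_pi_minus cos_60)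
 finally show ?thesis using 2 by (simp add: clamp_wave_def c)
qed
qed

text \<open>Multiplication by 3 shifts the digits. The digit split off is 0 or 2 and the offset
  stays even, so the period 2 of the wave swallows both.\<close>

lemma clamp_wave_cantor:
fixes e :: "nat => real"
assumes "!!i. e i : {0, 1}"
shows "clamp_wave (3 ^ i * (2 * of_int m + cantor_code e)) = e i"
proof -
have "EX N::int. 3 ^ i * (2 * of_int m + cantor_code e) = 2 * of_int N + cantor_code (%j. e (i + j))"
proof (induction i)
 case (Suc i)
 then obtain N :: int where N: "3 ^ i * (2 * of_int m + cantor_code e) = 2 * of_int N + cantor_code (%j. e (i + j))" by blast
 have e0: "e i = of_int (if e i = 0 then 0 else 1)" using assms[of i] by auto
 have "3 ^ Suc i * (2 * of_int m + cantor_code e) = 3 * (2 * of_int N + cantor_code (%j. e (i + j)))" using N by simp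
 also have "... = 2 * of_int (3 * N) + 3 * cantor_code (%j. e (i + j))" by simp
 also have "3 * cantor_code (%j. e (i + j)) = 2 * e (i + 0) + cantor_code (%j. e (i + Suc j))" using assms by (intro cantor_code_rec) blast
 also have "2 * of_int (3 * N) + (2 * e (i + 0) + cantor_code (%j. e (i + Suc j)))
   = 2 * of_int (3 * N + (if e i = 0 then 0 else 1)) + cantor_code (%j. e (Suc i + j))" using e0 by simp
 finally show ?case by blast
qed (auto intro!: exI[of _ m])
then obtain N :: int where "3 ^ i * (2 * of_int m + cantor_code e) = 2 * of_int N + cantor_code (%j. e (i + j))" by blast
then show ?thesis using clamp_wave_cantor_0[of "%j. e (i + j)"] assms by (simp add: clamp_wave_shift)
qed

section \<open>Coding points of a Euclidean space by real numbers\<close>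

definition binary_digit :: "nat => real => real" where
"binary_digit k y = of_int \<lfloor>2 ^ Suc k * y\<rfloor> - 2 * of_int \<lfloor>2 ^ k * y\<rfloor>"

lemma binary_digit: "binary_digit k y : {0, 1}"
proof -
have "2 * \<lfloor>2 ^ k * y\<rfloor> <= \<lfloor>2 ^ Suc k * y\<rfloor>" "\<lfloor>2 ^ Suc k * y\<rfloor> <= 2 * \<lfloor>2 ^ k * y\<rfloor> + 1"
 by (simp_all add: le_floor_iff floor_le_iff) linarith+
then have "\<lfloor>2 ^ Suc k * y\<rfloor> = 2 * \<lfloor>2 ^ k * y\<rfloor> | \<lfloor>2 ^ Suc k * y\<rfloor> = 2 * \<lfloor>2 ^ k * y\<rfloor> + 1" by linarith
then show ?thesis by (auto simp: binary_digit_def)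
qed

lemma binary_digits_sums:
assumes "0 <= y" "y < 1"
shows "(%k. binary_digit k y / 2 ^ Suc k) sums y"
proof -
have "(SUM k<n. binary_digit k y / 2 ^ Suc k) = of_int \<lfloor>2 ^ n * y\<rfloor> / 2 ^ n" for n
proof (induction n)
 case 0
 have "\<lfloor>y\<rfloor> = 0" using assms by linarith
 then show ?case by simp
qed (simp add: binary_digit_def field_simps)
moreover have "(%n. of_int \<lfloor>2 ^ n * y\<rfloor> / 2 ^ n) ----> y"
proof (rule LIM_zero_cancel, rule Lim_null_comparison)
 show "(%n. (1/2::real) ^ n) ----> 0" by (rule LIMSEQ_power_zero) simp
 have "abs (of_int \<lfloor>2 ^ n * y\<rfloor> / 2 ^ n - y) <= (1/2) ^ n" for n
 proof -
  have "abs (of_int \<lfloor>2 ^ n * y\<rfloor> - 2 ^ n * y) <= 1" by linarith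
  then have "abs (of_int \<lfloor>2 ^ n * y\<rfloor> - 2 ^ n * y) / 2 ^ n <= 1 / 2 ^ n" by (intro divide_right_mono) auto
  moreover have "of_int \<lfloor>2 ^ n * y\<rfloor> / 2 ^ n - y = (of_int \<lfloor>2 ^ n * y\<rfloor> - 2 ^ n * y) / 2 ^ n"
   by (simp add: diff_divide_distrib)
  ultimately show ?thesis by (simp add: power_one_over)
 qed
 then show "EVN n. norm (of_int \<lfloor>2 ^ n * y\<rfloor> / 2 ^ n - y) <= (1/2) ^ n" by simp
qed
ultimately show ?thesis unfolding sums_def by simp
qed

text \<open>Interleaves the digits of all coordinates into one sequence.\<close>

definition digit_index :: "'a::euclidean_space => nat => nat" where
"digit_index b k = prod_encode (to_nat_on Basis b, k)"

text \<open>An integer, so that \<open>2 * cube_scale x\<close> is a period of the wave, and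
  strictly above \<open>norm x\<close>, so that the rescaled coordinates stay below 1 and have
  binary expansions.\<close>

definition cube_scale :: "'a::euclidean_space => real" where
"cube_scale x = of_int (\<lfloor>norm x\<rfloor> + 1)"

definition all_digits :: "'a::euclidean_space => nat => real" where
"all_digits x i = binary_digit (snd (prod_decode i))
  ((x *. from_nat_into Basis (fst (prod_decode i)) / cube_scale x + 1) / 2)"

definition fold_bits :: "'a::euclidean_space => real" where
"fold_bits x = 2 * cube_scale x + cantor_code (all_digits x)"

text \<open>For \<open>t = 2 * L + r\<close> with an integer \<open>L\<close> and
  \<open>0 <= r <= 1\<close>, the triangle wave \<open>arccos (cos (pi * t)) / pi\<close> equals
  \<open>r\<close>, so the scalar factor is \<open>L\<close>. The series reassembles each coordinate
  from its binary digits, and \<open>[0, 1]\<close> is rescaled to \<open>[-1, 1]\<close>. The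
  formula is continuous also at those \<open>t\<close> that code no point.\<close>

definition unfold_bits :: "real => 'a::euclidean_space" where
"unfold_bits t = ((t - arccos (cos (pi * t)) / pi) / 2) *\<^sub>R
  (SUM b:Basis. (2 * (\<Sum>k. clamp_wave (3 ^ digit_index b k * t) / 2 ^ Suc k) - 1) *\<^sub>R b)"

lemma cube_scale: "norm x < cube_scale x" "cube_scale x <= norm x + 1" "0 < cube_scale x"
using real_of_int_floor_add_one_gt[of "norm x"] of_int_floor_le[of "norm x"] norm_ge_zero[of x]
by (simp_all add: cube_scale_def add_nonneg_pos)

lemma unfold_fold_bits: "unfold_bits (fold_bits x) = (x::'a::euclidean_space)"
proof -
define L where "L = cube_scale x"
define r where "r = cantor_code (all_digits x)"
have dig: "all_digits x i : {0, 1}" for i unfolding all_digits_def by (rule binary_digit)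
have r: "0 <= r" "r <= 1" unfolding r_def using cantor_code_bounds dig by blast+
have L: "L = of_int (\<lfloor>norm x\<rfloor> + 1)" "0 < L" "norm x < L" using cube_scale[of x] by (auto simp: L_def cube_scale_def)
have "cos (pi * (2 * L + r)) = cos (pi * r + 2 * pi * of_int (\<lfloor>norm x\<rfloor> + 1))" by (simp add: L(1) algebra_simps)
also have "... = cos (pi * r)" by (simp only: cos_add cos_int_2pin sin_int_2pin)
finally have "arccos (cos (pi * (2 * L + r))) = pi * r" using r by (simp add: arccos_cos)
then have scale: "((fold_bits x - arccos (cos (pi * fold_bits x)) / pi) / 2) = L" by (simp add: fold_bits_def L_def r_def)
have digit: "(\<Sum>k. clamp_wave (3 ^ digit_index b k * fold_bits x) / 2 ^ Suc k) = (x *. b / L + 1) / 2" if b: "b : Basis" for b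
proof -
 have "abs (x *. b) < L" using Basis_le_norm[OF b, of x] L(3) by simp
 then have y: "0 <= (x *. b / L + 1) / 2" "(x *. b / L + 1) / 2 < 1" using L(2) by (auto simp: field_simps abs_if split: if_splits)
 have "clamp_wave (3 ^ digit_index b k * fold_bits x) = binary_digit k ((x *. b / L + 1) / 2)" for k
  using clamp_wave_cantor[of "all_digits x" "digit_index b k" "\<lfloor>norm x\<rfloor> + 1"] dig b
  by (simp add: fold_bits_def cube_scale_def[symmetric] all_digits_def digit_index_def L_def from_nat_into_to_nat_on countable_finite
    del: of_int_add)
 then show ?thesis using sums_unique[OF binary_digits_sums[OF y]] by simp
qed
have digit2: "2 * (\<Sum>k. clamp_wave (3 ^ digit_index b k * fold_bits x) / 2 ^ Suc k) - 1 = x *. b / L" if "b : Basis" for b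
 unfolding digit[OF that] by (simp add: add_divide_distrib)
have "unfold_bits (fold_bits x) = L *\<^sub>R (SUM b:Basis. (x *. b / L) *\<^sub>R b)"
 unfolding unfold_bits_def scale by (intro arg_cong2[where f = scaleR] refl sum.cong) (simp_all only: digit2)
also have "... = (SUM b:Basis. (x *. b) *\<^sub>R b)" using L(2) by (simp add: scaleR_sum_right)
finally show ?thesis by (simp add: euclidean_representation)
qed

lemma continuous_unfold_bits: "continuous_on UNIV (unfold_bits :: real => 'a::euclidean_space)"
proof -
have "continuous_on UNIV (%t. \<Sum>k. clamp_wave (3 ^ digit_index (b::'a) k * t) / 2 ^ Suc k)" for b
proof (rule uniform_limit_theorem[OF _ Weierstrass_m_test[where M = "%k. (1/2) ^ k"]])
 show "EVN n. continuous_on UNIV (%x. SUM k<n. clamp_wave (3 ^ digit_index b k * x) / 2 ^ Suc k)"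
  unfolding clamp_wave_def by (intro always_eventually allI continuous_intros) auto
 show "norm (clamp_wave (3 ^ digit_index b n * x) / 2 ^ Suc n) <= (1/2) ^ n" for n x
  unfolding clamp_wave_def by (auto simp: power_one_over field_simps max_def min_def)
qed (auto intro: summable_geometric)
moreover have "continuous_on UNIV (%t. arccos (cos (pi * t)))" by (intro continuous_on_arccos continuous_intros) auto
ultimately show ?thesis unfolding unfold_bits_def by (intro continuous_intros) auto
qed

lemma measurable_fold_bits: "fold_bits : bmeas borel"
proof -
have c [measurable]: "cube_scale : bmeas borel" unfolding cube_scale_def[abs_def] by measurable
have "(%x. all_digits x i) : bmeas borel" for i unfolding all_digits_def binary_digit_def by measurable
then have "(%x. cantor_code (all_digits x)) : bmeas borel"
 unfolding cantor_code_def by (intro borel_measurable_suminf bmeas_divide bmeas_times) simp_all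
then show ?thesis unfolding fold_bits_def[abs_def] by (intro bmeas_add bmeas_times bmeas_const c)
qed

lemma fold_bits_bounds:
"2 <= fold_bits x" "fold_bits x <= 2 * norm x + 3"
proof -
have "all_digits x i : {0, 1}" for i unfolding all_digits_def by (rule binary_digit)
then have "0 <= cantor_code (all_digits x)" "cantor_code (all_digits x) <= 1" by (rule cantor_code_bounds)+
moreover have "1 <= cube_scale x" using norm_ge_zero[of x] by (simp add: cube_scale_def)
ultimately show "2 <= fold_bits x" "fold_bits x <= 2 * norm x + 3" using cube_scale[of x] by (auto simp: fold_bits_def)
qed

text \<open>As \<open>unfold_bits (fold_bits x) = x\<close>, the integral of \<open>f\<close> under
  \<open>mu n\<close> is that of \<open>f\<close> composed with \<open>unfold_bits\<close> under the
  image measure, and this test function is bounded and continuous. So \<open>fold_bits\<close> may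
  be merely Borel; its linear growth preserves tightness.\<close>

theorem prokhorov_euclidean:
fixes mu :: "nat => 'a::euclidean_space measure"
assumes prob: "!!n. prob_space (mu n)" and sets: "!!n. sets (mu n) = sets borel"
 and tight: "!!e. e > 0 ==> EX R. ALL n. measure (mu n) (cball 0 R) > 1 - e"
obtains r m where "strict_mono (r :: nat => nat)" "prob_space m" "sets m = sets borel"
 "!!(f :: 'a => real) c. continuous_on UNIV f ==> (!!x. abs (f x) <= c) ==>
   (%n. \<integral>x. f x \<partial>mu (r n)) ----> (LINT x|m. f x)"
proof -
define nu where "nu n = distr (mu n) borel fold_bits" for n
have fm [measurable]: "fold_bits : mu n \<rightarrow>\<^sub>M borel" for n
 using measurable_fold_bits by (simp add: measurable_cong_sets[OF sets refl])
have rd: "real_distribution (nu n)" for n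
proof -
 interpret prob_space "mu n" by (rule prob)
 show ?thesis unfolding nu_def by (intro real_distribution.intro real_distribution_axioms.intro prob_space_distr) auto
qed
have "tight nu" unfolding tight_def
proof (intro conjI allI impI)
 fix e :: real assume "e > 0"
 then obtain R where R: "!!n. measure (mu n) (cball 0 R) > 1 - e" using tight by blast
 have "measure (nu n) {1<..2 * abs R + 3} > 1 - e" for n
 proof -
  interpret prob_space "mu n" by (rule prob)
  have sp: "space (mu n) = UNIV" using sets_eq_imp_space_eq[OF sets] by simp
  have "cball 0 R <= fold_bits -` {1<..2 * abs R + 3} Int space (mu n)"
  proof
   fix x :: 'a assume "x : cball 0 R"
   then show "x : fold_bits -` {1<..2 * abs R + 3} Int space (mu n)" using fold_bits_bounds[of x] by (auto simp: sp)
  qed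
  then have "measure (mu n) (cball 0 R) <= measure (nu n) {1<..2 * abs R + 3}"
   unfolding nu_def by (subst measure_distr) (auto intro!: finite_measure_mono)
  then show ?thesis using R[of n] by linarith
 qed
 then show "EX a b. a < b & (ALL n. 1 - e < measure (nu n) {a<..b})" by (intro exI[of _ 1] exI[of _ "2 * abs R + 3"]) auto
qed (rule rd)
from tight_imp_convergent_subsubsequence[OF this strict_mono_id]
obtain r M where r: "strict_mono (r :: nat => nat)" and M: "real_distribution M" and conv: "weak_conv_m (nu \<circ> id \<circ> r) M"
 by blast
interpret M: real_distribution M by (rule M)
have um [measurable]: "unfold_bits : bmeas (borel :: real measure)" using continuous_unfold_bits by (rule cont_bmeas)
show ?thesis
proof (rule that[OF r])
 show "prob_space (distr M borel (unfold_bits :: real => 'a))" by (rule M.prob_space_distr) simp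
 fix f :: "'a => real" and c assume f: "continuous_on UNIV f" "!!x. abs (f x) <= c"
 have fb [measurable]: "f : bmeas borel" using f(1) by (rule cont_bmeas)
 have "continuous_on UNIV (%t. f (unfold_bits t))" by (rule cont_compose[OF f(1) continuous_unfold_bits]) auto
 then have cont: "!!t. isCont (%t. f (unfold_bits t)) t" by (simp add: continuous_on_eq_continuous_at)
 have "(%n. \<integral>t. f (unfold_bits t) \<partial>(nu \<circ> id \<circ> r) n) ----> (LINT t|M. f (unfold_bits t))"
  by (rule weak_conv_imp_integral_bdd_continuous_conv[OF _ M conv cont, of c]) (use rd f(2) in auto)
 moreover have "(LINT t|(nu \<circ> id \<circ> r) n. f (unfold_bits t)) = (LINT x|mu (r n). f x)" for n
  by (simp add: nu_def integral_distr unfold_fold_bits)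
 ultimately show "(%n. \<integral>x. f x \<partial>mu (r n)) ----> (LINT x|distr M borel unfold_bits. f x)" by (simp add: integral_distr)
qed simp
qed

text \<open>Finite intersections from a countable base form a countable intersection-stable
  generator of the Borel sets, and the indicator of each such open set is a pointwise limit of
  truncated multiples of the distance to its complement.\<close>

theorem countable_determining_class:
obtains F :: "nat => 'a::euclidean_space => real" where
 "!!n. continuous_on UNIV (F n)" "!!n x. 0 <= F n x & F n x <= 1"
 "!!mu nu. prob_space mu ==> prob_space nu ==> sets mu = sets borel ==> sets nu = sets borel ==>
   (!!n. (LINT x|mu. F n x) = (LINT x|nu. F n x)) ==> mu = nu"
proof -
obtain B :: "'a set set" where B: "countable B" "topological_basis B" using ex_countable_basis by blast
define U where "U = {\<Inter>S | S. finite S & S <= B}"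
have U_count: "countable U" unfolding U_def using countable_Collect_finite_subset[OF B(1)] by (simp add: setcompr_eq_image)
have U_open: "open u" if "u : U" for u using that topological_basis_open[OF B(2)] by (auto simp: U_def intro!: open_Inter)
have U_univ: "UNIV : U" unfolding U_def by (auto intro!: exI[of _ "{}"])
have U_int: "Int_stable U" unfolding Int_stable_def U_def
proof (clarify)
 fix S S' assume "finite S" "S <= B" "finite S'" "S' <= B"
 then show "EX S''. \<Inter> S Int \<Inter> S' = \<Inter> S'' & finite S'' & S'' <= B" by (intro exI[of _ "S Un S'"]) auto
qed
have BU: "B <= U" unfolding U_def
proof
 fix b assume "b : B"
 then show "b : {\<Inter> S |S. finite S & S <= B}" by (auto intro!: exI[of _ "{b}"])
qed
have sig: "sets borel = sigma_sets UNIV U"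
proof
 have "sets (borel :: 'a measure) = sigma_sets UNIV B" by (subst borel_eq_countable_basis[OF B]) (rule sets_measure_of, simp)
 also have "... <= sigma_sets UNIV U" using BU by (rule sigma_sets_mono')
 finally show "sets (borel :: 'a measure) <= sigma_sets UNIV U" .
 show "sigma_sets UNIV U <= sets borel"
 proof -
  have "U <= sets borel" using U_open by auto
  then show ?thesis using sets.sigma_sets_subset[of U "borel :: 'a measure"] by simp
 qed
qed
\<comment> \<open>\<open>infdist\<close> to the empty set is 0, which would give the wrong function
  for \<open>u = UNIV\<close>.\<close>
define f where "f u k x = (if u = UNIV then 1 else min 1 (real k * infdist x (- u)))" for u :: "'a set" and k x
have f_cont: "continuous_on UNIV (f u k)" for u k unfolding f_def by (cases "u = UNIV") (auto intro!: continuous_intros)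
have f_bnd: "0 <= f u k x & f u k x <= 1" for u k x unfolding f_def by (auto simp: infdist_nonneg)
have f_lim: "(%k. f u k x) ----> indicator u x" if "u : U" for u x
proof (cases "x : u & u ~= UNIV")
 case True
 have "infdist x (- u) > 0" using in_closed_iff_infdist_zero[of "- u" x] U_open[OF that] True infdist_nonneg[of x "- u"]
  by (auto simp: closed_def less_le)
 then obtain N :: nat where "inverse (infdist x (- u)) < real N" using reals_Archimedean2 by blast
 then have "1 <= real k * infdist x (- u)" if "k >= N" for k
 proof -
  have "inverse (infdist x (- u)) <= real k" using that \<open>_ < real N\<close> by simp
  then show ?thesis using \<open>infdist x (- u) > 0\<close> by (simp add: field_simps)
 qed
 then have "EVN k. f u k x = 1" using True by (intro eventually_sequentiallyI[of N]) (auto simp: f_def)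
 then show ?thesis using True by (simp add: tendsto_eventually)
next
 case False
 show ?thesis
 proof (cases "x : u")
  case True
  then show ?thesis using False by (simp add: f_def)
 next
  case False
  then have "u ~= UNIV" "infdist x (- u) = 0" by auto
  then show ?thesis using False by (simp add: f_def)
 qed
qed
show ?thesis
proof (rule that[of "%n. f (from_nat_into U (fst (prod_decode n))) (snd (prod_decode n))"])
 fix mu nu :: "'a measure"
 assume P: "prob_space mu" "prob_space nu" and S: "sets mu = sets borel" "sets nu = sets borel"
  and eq: "!!n. (LINT x|mu. f (from_nat_into U (fst (prod_decode n))) (snd (prod_decode n)) x)
    = (LINT x|nu. f (from_nat_into U (fst (prod_decode n))) (snd (prod_decode n)) x)"
 have lim: "(%k. \<integral>x. f u k x \<partial>m) ----> measure m u" if "u : U" "prob_space m" "sets m = sets borel" for u m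
 proof -
  interpret prob_space m by fact
  have um: "u : sets m" using U_open[OF that(1)] that(3) by simp
  have fm: "f u k : bmeas m" for k using cont_bmeas[OF f_cont] by (simp add: measurable_cong_sets[OF that(3) refl])
  have "(%k. \<integral>x. f u k x \<partial>m) ----> (LINT x|m. indicator u x)" by (rule dominated_conv[where w = "%_. 1"])
     (use fm um f_bnd f_lim[OF that(1)] in auto)
  then show ?thesis using um by simp
 qed
 have "measure mu u = measure nu u" if u: "u : U" for u
 proof (rule LIMSEQ_unique[OF lim[OF u P(1) S(1)]])
  have "(LINT x|mu. f u k x) = (LINT x|nu. f u k x)" for k
   using eq[of "prod_encode (to_nat_on U u, k)"] u U_count by (simp add: from_nat_into_to_nat_on)
  then show "(%k. \<integral>x. f u k x \<partial>mu) ----> measure nu u" using lim[OF u P(2) S(2)] by simp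
 qed
 then have "emeasure mu u = emeasure nu u" if "u : U" for u
  using that P by (simp add: finite_measure.emeasure_eq_measure prob_space.finite_measure)
 then show "mu = nu" using U_univ P by (intro measure_eqI_generator_eq[OF U_int, of UNIV _ _ "%_. UNIV"])
   (auto simp: S sig prob_space.emeasure_space_1 finite_measure.emeasure_finite prob_space.finite_measure)
qed (use f_cont f_bnd in auto)
qed

section \<open>The cylinder\<close>

text \<open>Places the cylinder at \<open>|z| = 1\<close> in a Euclidean space, where compactness
  and determining classes are available. The inverse \<open>cyl_proj\<close> accepts any nonzero
  \<open>z\<close> and keeps only its ray.\<close>

definition cyl_embed :: "(real^'d) \<times> circle => (real^'d) * complex" where
"cyl_embed x = (fst x, cis (rep_circle (snd x)))"

definition cyl_proj :: "(real^'d) * complex => (real^'d) \<times> circle" where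
"cyl_proj x = (fst x, to_circle (Arg (snd x)))"

lemma to_circle_eq_iff: "to_circle x = to_circle y \<longleftrightarrow> cis x = cis y"
proof -
have "to_circle x = to_circle y \<longleftrightarrow> (EX k::int. y = x + 2 * pi * of_int k)" using circle.abs_eq_iff by blast
also have "... \<longleftrightarrow> cis x = cis y" using sin_cos_eq_iff[of y x] by (auto simp: complex_eq_iff)
finally show ?thesis .
qed

lemma to_circle_rep: "to_circle (rep_circle c) = c"
by (rule Quotient_abs_rep[OF Quotient_circle])

lemma cis_rep_circle: "cis (rep_circle (to_circle x)) = cis x"
using to_circle_rep[of "to_circle x"] by (simp add: to_circle_eq_iff)

lemma cyl_proj_embed: "cyl_proj (cyl_embed x) = x"
proof -
have "cis (Arg (cis (rep_circle (snd x)))) = cis (rep_circle (snd x))" by (subst cis_Arg) (simp_all add: sgn_eq)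
then have "to_circle (Arg (cis (rep_circle (snd x)))) = to_circle (rep_circle (snd x))" by (simp add: to_circle_eq_iff)
then show ?thesis by (simp add: cyl_proj_def cyl_embed_def to_circle_rep)
qed

lemma cyl_embed_proj: "z ~= 0 ==> cyl_embed (cyl_proj (v, z)) = (v, sgn z)"
by (simp add: cyl_embed_def cyl_proj_def cis_rep_circle cis_Arg)

lemma cyl_proj_polar: "r > 0 ==> cyl_proj (v, of_real r * cis x) = (v, to_circle x)"
by (simp add: cyl_proj_def to_circle_eq_iff cis_Arg sgn_eq norm_mult)

lemma continuous_to_circle: "continuous_on UNIV to_circle"
by (simp add: continuous_on_open_vimage open_circle_def)

lemma continuous_cyl_embed: "continuous_on UNIV cyl_embed"
proof -
have "continuous_on UNIV (%c. cis (rep_circle c))" unfolding continuous_on_open_vimage[OF open_UNIV]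
proof (intro allI impI)
 fix S :: "complex set" assume S: "open S"
 have "open (cis -` S)" by (rule open_vimage[OF S]) (intro continuous_intros)
 moreover have "to_circle -` ((%c. cis (rep_circle c)) -` S) = cis -` S" by (auto simp: cis_rep_circle)
 ultimately show "open ((%c. cis (rep_circle c)) -` S Int UNIV)" by (simp add: open_circle_def)
qed
then have "continuous_on UNIV (%x::(real^'d) \<times> circle. cis (rep_circle (snd x)))"
 by (rule cont_compose) (auto intro!: continuous_intros)
then show ?thesis unfolding cyl_embed_def by (rule continuous_on_Pair[OF continuous_on_fst[OF continuous_on_id]])
qed

lemma measurable_cyl_embed [measurable]: "cyl_embed : borel \<rightarrow>\<^sub>M borel"
using continuous_cyl_embed by (rule cont_bmeas)

text \<open>\<open>Arg\<close> jumps along the negative real axis, but the class of the angle does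
  not: off that axis \<open>Arg z\<close> is continuous, and off the positive one
  \<open>Arg (- z) + pi\<close> represents the same class continuously. The two open sets and the
  zero section cover the space.\<close>

lemma measurable_cyl_proj [measurable]: "(cyl_proj :: (real^'d) * complex => _) : borel \<rightarrow>\<^sub>M borel"
proof (rule borel_measurableI)
fix S :: "((real^'d) \<times> circle) set" assume S: "open S"
define g1 where "g1 x = (fst x, to_circle (Arg (snd x)))" for x :: "(real^'d) * complex"
define g2 where "g2 x = (fst x, to_circle (Arg (- snd x) + pi))" for x :: "(real^'d) * complex"
define g3 where "g3 x = (fst x, to_circle (Arg 0))" for x :: "(real^'d) * complex"
let ?U1 = "{x :: (real^'d) * complex. snd x : - \<real>\<^sub>\<le>\<^sub>0}" and ?U2 = "{x :: (real^'d) * complex. - snd x : - \<real>\<^sub>\<le>\<^sub>0}"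
have o: "open ?U1" "open ?U2"
proof -
 have "open (snd -` (- \<real>\<^sub>\<le>\<^sub>0) :: ((real^'d) * complex) set)"
  by (rule open_vimage) (auto simp: open_Compl intro!: continuous_on_snd continuous_on_id)
 moreover have "open ((%x. - snd x) -` (- \<real>\<^sub>\<le>\<^sub>0) :: ((real^'d) * complex) set)"
  by (rule open_vimage) (auto simp: open_Compl intro!: continuous_on_minus continuous_on_snd continuous_on_id)
 ultimately show "open ?U1" "open ?U2" by (simp_all add: vimage_def)
qed
have tc: "continuous_on A (%x. to_circle (f x))" if "continuous_on A f" for A :: "((real^'d) * complex) set" and f
 by (rule cont_compose[OF continuous_to_circle that]) auto
have c: "continuous_on ?U1 g1" "continuous_on ?U2 g2" "continuous_on UNIV g3" unfolding g1_def g2_def g3_def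
 by (intro continuous_on_Pair tc continuous_intros cont_compose[OF continuous_on_Arg]; auto)+
have "open (g1 -` S Int ?U1)" "open (g2 -` S Int ?U2)" "open (g3 -` S Int UNIV)"
 using continuous_on_open_vimage[OF o(1), of g1] c(1) continuous_on_open_vimage[OF o(2), of g2] c(2)
  continuous_on_open_vimage[OF open_UNIV, of g3] c(3) S by auto
moreover have "cyl_proj -` S Int space borel = (g1 -` S Int ?U1) Un (g2 -` S Int ?U2) Un (g3 -` S Int {x. snd x = 0})"
proof -
 have e1: "cyl_proj x = g1 x" for x by (simp add: cyl_proj_def g1_def)
 have e2: "cyl_proj x = g2 x" if "snd x ~= 0" for x
 proof -
  have "cis (Arg (- snd x) + pi) = cis (Arg (snd x))" using that by (simp add: cis_mult[symmetric] cis_Arg sgn_minus)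
  then show ?thesis by (simp add: cyl_proj_def g2_def to_circle_eq_iff)
 qed
 have e3: "cyl_proj x = g3 x" if "snd x = 0" for x using that by (simp add: cyl_proj_def g3_def)
 have cover: "z : - \<real>\<^sub>\<le>\<^sub>0 | - z : - \<real>\<^sub>\<le>\<^sub>0 | z = 0" for z :: complex
  by (auto simp: complex_nonpos_Reals_iff complex_eq_iff)
 have "x : cyl_proj -` S \<longleftrightarrow> x : (g1 -` S Int ?U1) Un (g2 -` S Int ?U2) Un (g3 -` S Int {x. snd x = 0})" for x
  using e1[of x] e2[of x] e3[of x] cover[of "snd x"] by (cases "snd x = 0") auto
 then show ?thesis by (intro set_eqI) (simp only: space_borel Int_UNIV_right)
qed
moreover have "{x :: (real^'d) * complex. snd x = 0} : sets borel" by (intro borel_closed closed_Collect_eq continuous_intros)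
ultimately show "cyl_proj -` S Int space borel : sets borel" by (auto intro!: sets.Un sets.Int borel_open)
qed

lemma cyl_measure_eqI:
fixes mu nu :: "((real^'d) \<times> circle) measure"
assumes S: "sets mu = sets borel" "sets nu = sets borel"
 and eq: "distr mu borel cyl_embed = distr nu borel cyl_embed"
shows "mu = nu"
proof -
have "distr (distr m borel cyl_embed) borel cyl_proj = m" if "sets m = sets borel" for m :: "((real^'d) \<times> circle) measure"
proof -
 have "cyl_embed : m \<rightarrow>\<^sub>M borel" using measurable_cyl_embed by (simp add: measurable_cong_sets[OF that refl])
 then have "distr (distr m borel cyl_embed) borel cyl_proj = distr m borel (%x. x)" by (subst distr_distr) (auto simp: o_def cyl_proj_embed)
 then show ?thesis using distr_id2[OF that[symmetric]] by simp
qed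
then show ?thesis using S eq by metis
qed


section \<open>Convergence in probability\<close>

lemma strict_mono_choice:
assumes "!!n. eventually (P n) sequentially"
obtains r :: "nat => nat" where "strict_mono r" "!!n. P n (r n)"
proof -
obtain N where N: "!!n m. N n <= m ==> P n m" using assms unfolding eventually_sequentially by metis
define r where "r = rec_nat (N 0) (%n k. max (Suc k) (N (Suc n)))"
have "strict_mono r" by (rule strict_monoI_Suc) (simp add: r_def)
moreover have "N n <= r n" for n by (cases n) (simp_all add: r_def)
ultimately show ?thesis using N by (intro that) auto
qed

context prob_space
begin

definition in_prob :: "(nat => 'a => real) => ('a => real) => bool" where
"in_prob X Z \<longleftrightarrow> (ALL n. X n : bmeas M) & Z : bmeas M &
  (ALL e>0. (%n. prob {om : space M. e < abs (X n om - Z om)}) ----> 0)"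

lemma in_prob_measurable:
assumes "in_prob X Z"
shows "X n : bmeas M" "Z : bmeas M"
using assms by (auto simp: in_prob_def)

lemma in_prob_subseq:
assumes "in_prob X Z" "strict_mono r"
shows "in_prob (%n. X (r n)) Z"
using assms(1) LIMSEQ_subseq_LIMSEQ[OF _ assms(2), unfolded o_def] by (auto simp: in_prob_def)

text \<open>Borel-Cantelli along a subsequence on which a deviation above \<open>(1/2)^n\<close> has
  probability below \<open>(1/2)^n\<close>.\<close>

lemma in_prob_AE_subseq:
assumes X: "in_prob X Z"
obtains r :: "nat => nat" where "strict_mono r" "AE om in M. (%n. X (r n) om) ----> Z om"
proof -
note [measurable] = in_prob_measurable[OF X]
have "eventually (%m. prob {om : space M. (1/2)^n < abs (X m om - Z om)} < (1/2)^n) sequentially" for n :: nat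
 using X by (intro order_tendstoD(2)[where y = 0]) (auto simp: in_prob_def)
then obtain r :: "nat => nat" where r: "strict_mono r" "!!n. prob {om : space M. (1/2)^n < abs (X (r n) om - Z om)} < (1/2)^n"
 using strict_mono_choice[of "%n m. prob {om : space M. (1/2)^n < abs (X m om - Z om)} < (1/2)^n"] by blast
have "summable (%n. prob {om : space M. (1/2)^n < abs (X (r n) om - Z om)})" by (rule summable_comparison_test'[where g = "%n. (1/2)^n"])
   (auto intro: summable_geometric less_imp_le r(2))
then have "AE om in M. EVN n. om : space M - {om : space M. (1/2)^n < abs (X (r n) om - Z om)}"
 by (intro borel_cantelli_AE1) (auto simp: emeasure_eq_measure)
then have "AE om in M. (%n. X (r n) om) ----> Z om"
proof eventually_elim
 case (elim om)
 then have "EVN n. norm (X (r n) om - Z om) <= (1/2)^n" by eventually_elim auto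
 then have "(%n. X (r n) om - Z om) ----> 0" by (rule Lim_null_comparison) (rule LIMSEQ_power_zero, simp)
 then show ?case by (rule LIM_zero_cancel)
qed
with r(1) show ?thesis by (rule that)
qed

lemma AE_in_prob:
assumes [measurable]: "!!n. X n : bmeas M" "Z : bmeas M"
 and conv: "AE om in M. (%n. X n om) ----> Z om"
shows "in_prob X Z"
unfolding in_prob_def
proof (intro conjI allI impI)
fix e :: real assume e: "e > 0"
let ?A = "%n. {om : space M. e < abs (X n om - Z om)}"
have "(%n. \<integral>om. indicator (?A n) om \<partial>M) ----> (LINT om|M. (0::real))"
proof (rule dominated_conv[where w = "%_. 1"])
 show "AE om in M. (%n. indicator (?A n) om :: real) ----> 0" using conv
 proof eventually_elim
  case (elim om)
  have "EVN n. dist (X n om) (Z om) < e" using tendstoD[OF elim e] .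
  then have "EVN n. (indicator (?A n) om :: real) = 0" by eventually_elim (auto simp: dist_real_def indicator_def)
  then show ?case by (rule tendsto_eventually)
 qed
qed (auto simp: indicator_def)
then show "(%n. prob (?A n)) ----> 0" by simp
qed auto

text \<open>Otherwise some deviation probability stays above a positive \<open>d\<close> along a
  subsequence, none of whose subsequences can converge almost surely. The criterion allows limits in
  probability to be handled path by path.\<close>

lemma in_prob_if_subseq:
assumes m: "!!n. X n : bmeas M" "Z : bmeas M"
 and sub: "!!r :: nat => nat. strict_mono r ==>
  EX s. strict_mono (s :: nat => nat) & (AE om in M. (%n. X (r (s n)) om) ----> Z om)"
shows "in_prob X Z"
unfolding in_prob_def
proof (intro conjI allI impI m)
fix e :: real assume e: "e > 0"
let ?p = "%n. prob {om : space M. e < abs (X n om - Z om)}"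
show "?p ----> 0"
proof (rule ccontr)
 assume "~ ?p ----> 0"
 then obtain d where d: "d > 0" "~ (EVN n. dist (?p n) 0 < d)" unfolding tendsto_iff by blast
 then have "infinite {n. ~ dist (?p n) 0 < d}" by (simp add: frequently_cofinite[symmetric] cofinite_eq_sequentially not_eventually)
 then obtain r :: "nat => nat" where r: "strict_mono r" "!!n. r n : {n. ~ dist (?p n) 0 < d}" using infinite_enumerate by blast
 obtain s where s: "strict_mono (s :: nat => nat)" "AE om in M. (%n. X (r (s n)) om) ----> Z om" using sub[OF r(1)] by blast
 have "in_prob (%n. X (r (s n))) Z" by (rule AE_in_prob[OF m s(2)])
 then have "(%n. ?p (r (s n))) ----> 0" using e by (simp add: in_prob_def)
 then have "EVN n. dist (?p (r (s n))) 0 < d" using d(1) by (rule tendstoD)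
 then obtain n where "dist (?p (r (s n))) 0 < d" by (auto simp: eventually_sequentially)
 then show False using r(2)[of "s n"] by simp
qed
qed

lemma in_prob_combine:
assumes X: "in_prob X Z" and Y: "in_prob Y V" and f: "continuous_on UNIV (%p. f (fst p) (snd p))"
shows "in_prob (%n om. f (X n om) (Y n om)) (%om. f (Z om) (V om))"
proof (rule in_prob_if_subseq)
note [measurable] = in_prob_measurable[OF X] in_prob_measurable[OF Y]
have m: "(%p. f (fst p) (snd p)) : bmeas (borel :: (real \<times> real) measure)" using f by (rule cont_bmeas)
show "(%om. f (X n om) (Y n om)) : bmeas M" for n using meas_comp[OF _ m, of "%om. (X n om, Y n om)" M] by simp
show "(%om. f (Z om) (V om)) : bmeas M" using meas_comp[OF _ m, of "%om. (Z om, V om)" M] by simp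
fix r :: "nat => nat" assume r: "strict_mono r"
obtain s where s: "strict_mono (s :: nat => nat)" "AE om in M. (%n. X (r (s n)) om) ----> Z om"
 using in_prob_AE_subseq[OF in_prob_subseq[OF X r]] .
have rs: "strict_mono (%n. r (s n))" using strict_mono_o[OF r s(1)] by (simp add: o_def)
obtain q where q: "strict_mono (q :: nat => nat)" "AE om in M. (%n. Y (r (s (q n))) om) ----> V om"
 using in_prob_AE_subseq[OF in_prob_subseq[OF Y rs]] .
have "AE om in M. (%n. f (X (r (s (q n))) om) (Y (r (s (q n))) om)) ----> f (Z om) (V om)" using s(2) q(2)
proof eventually_elim
 case (elim om)
 have "(%n. (X (r (s (q n))) om, Y (r (s (q n))) om)) ----> (Z om, V om)"
  using LIMSEQ_subseq_LIMSEQ[OF elim(1) q(1)] elim(2) by (intro tendsto_Pair) (simp_all add: o_def)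
 from cont_tendsto[OF f this] show ?case by simp
qed
then show "EX s. strict_mono s & (AE om in M. (%n. f (X (r (s n)) om) (Y (r (s n)) om)) ----> f (Z om) (V om))"
 using strict_mono_o[OF s(1) q(1)] by (intro exI[of _ "s \<circ> q"]) simp
qed

lemma in_prob_add: "in_prob X Z ==> in_prob Y V ==> in_prob (%n om. X n om + Y n om) (%om. Z om + V om)"
by (rule in_prob_combine) (auto intro!: continuous_intros)

lemma in_prob_diff: "in_prob X Z ==> in_prob Y V ==> in_prob (%n om. X n om - Y n om) (%om. Z om - V om)"
by (rule in_prob_combine) (auto intro!: continuous_intros)

lemma in_prob_const: "Z : bmeas M ==> in_prob (%n. Z) Z"
by (rule AE_in_prob) auto

lemma in_prob_sum:
assumes "!!i. i : I ==> in_prob (X i) (Z i)"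
shows "in_prob (%n om. SUM i:I. X i n om) (%om. SUM i:I. Z i om)"
using assms
proof (induction I rule: infinite_finite_induct)
case (insert x F)
then show ?case using in_prob_add[of "X x" "Z x"] by simp
qed (auto intro: in_prob_const)

lemma in_prob_scale:
assumes "in_prob X Z"
shows "in_prob (%n om. c * X n om) (%om. c * Z om)"
by (rule in_prob_combine[where f = "(*)" and X = "%_ _. c" and Z = "%_. c", OF in_prob_const assms])
 (auto intro!: continuous_intros)

lemma in_prob_unique:
assumes X: "in_prob X Z" "in_prob X Z'"
shows "AE om in M. Z om = Z' om"
proof -
obtain r where r: "strict_mono (r :: nat => nat)" "AE om in M. (%n. X (r n) om) ----> Z om" using in_prob_AE_subseq[OF X(1)] .
obtain s where s: "strict_mono (s :: nat => nat)" "AE om in M. (%n. X (r (s n)) om) ----> Z' om"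
 using in_prob_AE_subseq[OF in_prob_subseq[OF X(2) r(1)]] .
show ?thesis using r(2) s(2)
proof eventually_elim
 case (elim om)
 show ?case using LIMSEQ_unique[OF LIMSEQ_subseq_LIMSEQ[OF elim(1) s(1), unfolded o_def] elim(2)] .
qed
qed

lemma in_prob_cong_AE:
assumes X: "in_prob X Z" and m: "!!n. Y n : bmeas M" "V : bmeas M"
 and eq: "!!n. AE om in M. X n om = Y n om" "AE om in M. Z om = V om"
shows "in_prob Y V"
proof (rule in_prob_if_subseq[OF m])
fix r :: "nat => nat" assume r: "strict_mono r"
obtain s where s: "strict_mono (s :: nat => nat)" "AE om in M. (%n. X (r (s n)) om) ----> Z om"
 using in_prob_AE_subseq[OF in_prob_subseq[OF X r]] .
have "AE om in M. ALL n. X n om = Y n om" using eq(1) by (simp add: AE_all_countable)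
then have "AE om in M. (%n. Y (r (s n)) om) ----> V om" using s(2) eq(2) by eventually_elim simp
then show "EX s. strict_mono s & (AE om in M. (%n. Y (r (s n)) om) ----> V om)" using s(1) by blast
qed

section \<open>Second moments and Fatou's lemma\<close>

lemma prob_gt_le_second_moment:
assumes [measurable]: "X : bmeas M" and i: "integrable M (%om. (X om)^2)" and e: "e > 0"
shows "prob {om : space M. e < abs (X om)} <= (LINT om|M. (X om)^2) / e^2"
proof -
have "prob {om : space M. e < abs (X om)} <= prob {om : space M. (X om)^2 >= e^2}"
proof (rule finite_measure_mono)
 show "{om : space M. e < abs (X om)} <= {om : space M. (X om)^2 >= e^2}" using e by (auto simp flip: abs_le_square_iff)
qed measurable
also have "... <= (LINT om|M. (X om)^2) / e^2" using e i by (intro integral_Markov_inequality_measure[where A = "{}"]) auto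
finally show ?thesis .
qed

lemma in_prob_second_moment:
assumes [measurable]: "!!n. X n : bmeas M" "Z : bmeas M"
 and i: "!!n. integrable M (%om. (X n om - Z om)^2)"
 and c: "EVN n. (LINT om|M. (X n om - Z om)^2) <= c n" "c ----> 0"
shows "in_prob X Z"
unfolding in_prob_def
proof (intro conjI allI impI)
fix e :: real assume e: "e > 0"
show "(%n. prob {om : space M. e < abs (X n om - Z om)}) ----> 0"
proof (rule Lim_null_comparison)
 show "(%n. c n / e^2) ----> 0" using tendsto_divide[OF c(2) tendsto_const, of "e^2"] e by simp
 show "EVN n. norm (prob {om : space M. e < abs (X n om - Z om)}) <= c n / e^2" using c(1)
 proof eventually_elim
  case (elim n)
  have "prob {om : space M. e < abs (X n om - Z om)} <= (LINT om|M. (X n om - Z om)^2) / e^2"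
   by (rule prob_gt_le_second_moment[OF _ i e]) simp
  also have "... <= c n / e^2" using elim by (intro divide_right_mono) auto
  finally show ?case by simp
 qed
qed
qed auto

lemma fatou_AE:
fixes X :: "nat => 'a => real"
assumes [measurable]: "!!n. X n : bmeas M" "Z : bmeas M"
 and pos: "!!n. AE om in M. 0 <= X n om" and i: "!!n. integrable M (X n)"
 and conv: "AE om in M. (%n. X n om) ----> Z om"
 and c: "!!n. (LINT om|M. X n om) <= c n" "c ----> C"
shows "integrable M Z" "(LINT om|M. Z om) <= C"
proof -
have pos': "AE om in M. ALL n. 0 <= X n om" using pos by (simp add: AE_all_countable)
have Z0: "AE om in M. 0 <= Z om" using pos' conv
proof eventually_elim
 case (elim om)
 show ?case by (rule LIMSEQ_le_const[OF elim(2)]) (use elim(1) in auto)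
qed
have c0: "0 <= c n" for n using integral_nonneg_AE[OF pos[of n]] c(1)[of n] by linarith
have C0: "0 <= C" using c(2) c0 by (intro LIMSEQ_le_const) auto
have "(\<integral>\<^sup>+om. ennreal (Z om) \<partial>M) = (\<integral>\<^sup>+om. liminf (%n. ennreal (X n om)) \<partial>M)"
proof (rule nn_integral_cong_AE)
 show "AE om in M. ennreal (Z om) = liminf (%n. ennreal (X n om))" using conv
 proof eventually_elim
  case (elim om)
  then have "(%n. ennreal (X n om)) ----> ennreal (Z om)" by (rule tendsto_ennrealI)
  then show ?case using lim_imp_Liminf[OF sequentially_bot] by metis
 qed
qed
also have "... <= liminf (%n. \<integral>\<^sup>+om. ennreal (X n om) \<partial>M)" by (rule nn_integral_liminf) auto
also have "... <= liminf (%n. ennreal (c n))"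
proof (rule Liminf_mono, rule always_eventually, rule allI)
 show "(\<integral>\<^sup>+om. ennreal (X n om) \<partial>M) <= ennreal (c n)" for n
  using nn_integral_eq_integral[OF i pos, of n] c(1)[of n] by (simp add: ennreal_leI)
qed
also have "... = ennreal C" using lim_imp_Liminf[OF sequentially_bot tendsto_ennrealI[OF c(2)]] .
finally have le: "(\<integral>\<^sup>+om. ennreal (Z om) \<partial>M) <= ennreal C" .
then show iZ: "integrable M Z" using Z0 by (intro integrableI_nonneg) (auto intro: le_less_trans)
show "(LINT om|M. Z om) <= C" using le nn_integral_eq_integral[OF iZ Z0] C0 by (simp add: ennreal_le_iff)
qed

text \<open>Second moment bounds survive a limit in probability even if the moments themselves do
  not converge; the bound improves to the limit of the \<open>c n\<close>.\<close>

lemma in_prob_fatou: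
assumes X: "in_prob X Z" and i: "!!n. integrable M (%om. (X n om)^2)"
 and c: "!!n. (LINT om|M. (X n om)^2) <= c n" "c ----> C"
shows "integrable M (%om. (Z om)^2)" "(LINT om|M. (Z om)^2) <= C"
proof -
note [measurable] = in_prob_measurable[OF X]
obtain r where r: "strict_mono (r :: nat => nat)" "AE om in M. (%n. X (r n) om) ----> Z om" using in_prob_AE_subseq[OF X] .
have conv: "AE om in M. (%n. (X (r n) om)^2) ----> (Z om)^2" using r(2) by eventually_elim (rule tendsto_power)
have cr: "(%n. c (r n)) ----> C" using LIMSEQ_subseq_LIMSEQ[OF c(2) r(1)] by (simp add: o_def)
show "integrable M (%om. (Z om)^2)" "(LINT om|M. (Z om)^2) <= C"
 using fatou_AE[of "%n om. (X (r n) om)^2" "%om. (Z om)^2" "%n. c (r n)" C, OF _ _ _ i conv c(1) cr] by simp_all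
qed

lemma summable_expectation_tendsto_0:
fixes X :: "nat => 'a => real"
assumes [measurable]: "!!n. X n : bmeas M"
 and pos: "!!n om. 0 <= X n om" and i: "!!n. integrable M (X n)"
 and s: "summable (%n. \<integral>om. X n om \<partial>M)"
shows "AE om in M. (%n. X n om) ----> 0"
proof -
have "(\<integral>\<^sup>+om. (\<Sum>n. ennreal (X n om)) \<partial>M) = (\<Sum>n. \<integral>\<^sup>+om. ennreal (X n om) \<partial>M)"
 by (rule nn_integral_suminf) simp
also have "... = (\<Sum>n. ennreal (LINT om|M. X n om))" using i pos by (simp add: nn_integral_eq_integral)
also have "... = ennreal (\<Sum>n. \<integral>om. X n om \<partial>M)" using s pos by (intro suminf_ennreal2) auto
finally have "(\<integral>\<^sup>+om. (\<Sum>n. ennreal (X n om)) \<partial>M) ~= \<infinity>" by simp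
then have "AE om in M. (\<Sum>n. ennreal (X n om)) ~= \<infinity>" by (intro nn_integral_noteq_infinite) auto
then show ?thesis
proof eventually_elim
 case (elim om)
 then have "summable (%n. X n om)" using pos by (intro summable_suminf_not_top) auto
 then show ?case by (rule summable_LIMSEQ_zero)
qed
qed

end

section \<open>Increments of Brownian motion\<close>

locale bm =
fixes P :: "'w measure" and F :: "real => 'w measure" and W :: "real => 'w => real^'m"
assumes bm: "brownian_motion P F W"

sublocale bm \<subseteq> prob_space P
using bm by (simp add: brownian_motion_def)

context bm
begin

lemma space_F: "space (F t) = space P"
using bm by (simp add: brownian_motion_def filtration_def)

lemma sets_F_mono: "s <= t ==> sets (F s) <= sets (F t)"
using bm unfolding brownian_motion_def filtration_def by blast

lemma sets_F_P: "sets (F s) <= sets P"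
using bm unfolding brownian_motion_def by blast

lemma F_mono:
assumes "s <= t" "X : measurable (F s) N"
shows "X : measurable (F t) N"
proof (rule measurableI)
show "X x : space N" if "x : space (F t)" for x using measurable_space[OF assms(2), of x] that by (simp add: space_F)
show "X -` A Int space (F t) : sets (F t)" if "A : sets N" for A
 using measurable_sets[OF assms(2) that] sets_F_mono[OF assms(1)] unfolding space_F by blast
qed

lemma F_P:
assumes "X : measurable (F s) N"
shows "X : measurable P N"
proof (rule measurableI)
show "X x : space N" if "x : space P" for x using measurable_space[OF assms, of x] that by (simp add: space_F)
show "X -` A Int space P : sets P" if "A : sets N" for A using measurable_sets[OF assms that] sets_F_P[of s] unfolding space_F by blast
qed

lemma W_measurable: "0 <= t ==> W t : bmeas (F t)"
using bm by (simp add: brownian_motion_def adapted_continuous_def)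

lemma W_continuous: "om : space P ==> cont0 (%t. W t om)"
using bm by (simp add: brownian_motion_def adapted_continuous_def)

definition inc :: "real => real => 'w => real^'m" where
"inc s t om = W t om - W s om"

abbreviation dW where "dW tau i == inc (tau i) (tau (Suc i))"

lemma inc_measurable: "0 <= s ==> s <= t ==> inc s t : bmeas (F t)"
unfolding inc_def[abs_def] by (intro bmeas_diff W_measurable F_mono[OF _ W_measurable]) auto

lemma inc_measurable_P [measurable]: "0 <= s ==> s <= t ==> inc s t : bmeas P"
using inc_measurable by (rule F_P)

lemma inc_indep_sets:
assumes st: "0 <= s" "s < t" and "a : sets (F s)" "S : sets borel"
shows "prob (a Int (inc s t -` S Int space P)) = prob a * prob (inc s t -` S Int space P)"
proof (rule indep_setD)
show "indep_set (sets (F s)) {(%om. W t om - W s om) -` S Int space P | S. S : sets borel}" using bm st by (simp add: brownian_motion_def)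
qed (use assms in "auto simp: inc_def[abs_def]")

text \<open>Independence of the past as a product law. Since \<open>X\<close> may take values in any
  space, a whole state can be frozen while the increment is integrated out by Fubini.\<close>

lemma inc_joint_law:
assumes st: "0 <= s" "s < t" and X: "X : measurable (F s) N"
shows "distr P N X \<Otimes>\<^sub>M distr P borel (inc s t) = distr P (N \<Otimes>\<^sub>M borel) (%om. (X om, inc s t om))"
proof (rule pair_measure_eqI)
have m [measurable]: "X : measurable P N" "inc s t : bmeas P" using F_P[OF X] st by auto
interpret X: prob_space "distr P N X" by (rule prob_space_distr) simp
interpret I: prob_space "distr P borel (inc s t)" by (rule prob_space_distr) simp
show "sigma_finite_measure (distr P N X)" "sigma_finite_measure (distr P borel (inc s t))" by unfold_locales
fix A B assume A: "A : sets (distr P N X)" and B: "B : sets (distr P borel (inc s t))"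
have "X -` A Int space P : sets (F s)" using X A by (simp add: measurable_def space_F)
then have "prob ((X -` A Int space P) Int (inc s t -` B Int space P)) = prob (X -` A Int space P) * prob (inc s t -` B Int space P)"
 using B by (intro inc_indep_sets st) auto
moreover have "(%om. (X om, inc s t om)) -` (A \<times> B) Int space P = (X -` A Int space P) Int (inc s t -` B Int space P)" by auto
ultimately show "emeasure (distr P N X) A * emeasure (distr P borel (inc s t)) B
  = emeasure (distr P (N \<Otimes>\<^sub>M borel) (%om. (X om, inc s t om))) (A \<times> B)"
 using A B by (simp add: emeasure_distr emeasure_eq_measure ennreal_mult'')
qed simp

lemma expectation_mult_inc:
fixes X :: "'w => real" and g :: "real^'m => real"
assumes st: "0 <= s" "s < t" and X: "X : bmeas (F s)" "integrable P X"
 and g: "g : bmeas borel" "integrable P (%om. g (inc s t om))"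
shows "integrable P (%om. X om * g (inc s t om))"
 "(LINT om|P. X om * g (inc s t om)) = (LINT om|P. X om) * (LINT om|P. g (inc s t om))"
proof -
have mi: "(%om. g (inc s t om)) : bmeas P" using g(2) by simp
have "indep_var borel X borel (%om. g (inc s t om))" unfolding indep_var_eq
proof (intro conjI indep_setI F_P[OF X(1)] mi)
 let ?SX = "sigma_sets (space P) {X -` A Int space P |A. A : sets borel}"
 let ?SI = "sigma_sets (space P) {(%om. g (inc s t om)) -` A Int space P |A. A : sets borel}"
 have 1: "?SX <= sets (F s)" using sets.sigma_sets_subset[of "{X -` A Int space P |A. A : sets borel}" "F s"] X
  by (auto simp: space_F measurable_def)
 have 2: "?SI = {(%om. g (inc s t om)) -` A Int space P |A. A : sets borel}"
  unfolding sets_vimage_algebra[symmetric] by (rule sets_vimage_algebra2) auto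
 show "?SX <= events" using 1 bm by (auto simp: brownian_motion_def)
 show "?SI <= events" using mi unfolding 2 by (auto simp: measurable_def)
 fix a b assume a: "a : ?SX" and "b : ?SI"
 then obtain A where A: "b = (%om. g (inc s t om)) -` A Int space P" "A : sets borel" unfolding 2 by auto
 have "b = inc s t -` (g -` A) Int space P" "g -` A : sets borel" using A measurable_sets[OF g(1) A(2)] by auto
 then show "prob (a Int b) = prob a * prob b" using inc_indep_sets[OF st, of a "g -` A"] a 1 by auto
qed
from indep_var_integrable[OF this X(2) g(2)] indep_var_lebesgue_integral[OF this X(2) g(2)]
show "integrable P (%om. X om * g (inc s t om))"
 "(LINT om|P. X om * g (inc s t om)) = (LINT om|P. X om) * (LINT om|P. g (inc s t om))" by simp_all
qed

definition inc_law :: "real => (real^'m) measure" where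
"inc_law d = distr P borel (inc 0 d)"

text \<open>Every increment over a time \<open>t - s\<close> is the image of the same product of
  centred normal laws with variance \<open>t - s\<close>.\<close>

lemma inc_law:
assumes st: "0 <= s" "s < t"
shows "distr P borel (inc s t) = inc_law (t - s)"
proof -
let ?N = "%d. density lborel (normal_density 0 (sqrt d))"
let ?v = "%f. (\<chi> l. f l) :: real^'m"
have vm: "?v : measurable (Pi\<^sub>M UNIV (%_. borel)) borel" unfolding borel_measurable_euclidean_space[of ?v]
 by (auto simp: Basis_vec_def inner_axis intro!: measurable_component_singleton)
have "distr P borel (inc s t) = distr (Pi\<^sub>M UNIV (%_. ?N (t - s))) borel ?v" if "0 <= s" "s < t" for s t
proof -
 have ind: "indep_vars (%_. borel) (%l om. inc s t om $ l) UNIV"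
  and d: "!!l. distributed P lborel (%om. inc s t om $ l) (normal_density 0 (sqrt (t - s)))"
  using bm that by (simp_all add: brownian_motion_def inc_def)
 have rv: "!!l. (%om. inc s t om $ l) : bmeas P" using d by (auto simp: distributed_def)
 have dl: "distr P borel (%om. inc s t om $ l) = ?N (t - s)" for l
 proof -
  have "distr P borel (%om. inc s t om $ l) = distr P lborel (%om. inc s t om $ l)" by (rule distr_cong) simp_all
  then show ?thesis using distributed_distr_eq_density[OF d[of l]] by simp
 qed
 have "distr P (Pi\<^sub>M UNIV (%_. borel)) (%om. \<lambda>l\<in>UNIV. inc s t om $ l) = Pi\<^sub>M UNIV (%_. ?N (t - s))"
  using ind indep_vars_iff_distr_eq_PiM[where I = UNIV and M' = "%_. borel" and X = "%l om. inc s t om $ l"] rv by (simp add: dl)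
 then have "distr (Pi\<^sub>M UNIV (%_. ?N (t - s))) borel ?v = distr (distr P (Pi\<^sub>M UNIV (%_. borel)) (%om. \<lambda>l\<in>UNIV. inc s t om $ l)) borel ?v"
  by simp
 also have "... = distr P borel (inc s t)"
  using rv by (subst distr_distr[OF vm]) (auto intro!: measurable_PiM_single' distr_cong simp: vec_eq_iff)
 finally show ?thesis by simp
qed
from this[OF st] this[of 0 "t - s"] st show ?thesis by (simp add: inc_law_def)
qed

section \<open>Moments of Brownian increments\<close>

lemma inc_component_moment:
assumes st: "0 <= s" "s < t"
shows "integrable P (%om. (inc s t om $ l) ^ k)"
 "(LINT om|P. inc s t om $ l) = 0" "(LINT om|P. (inc s t om $ l)^2) = t - s"
 "(LINT om|P. (inc s t om $ l) ^ 4) = 3 * (t - s)^2"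
proof -
let ?d = "normal_density 0 (sqrt (t - s))"
have sg: "0 < sqrt (t - s)" using st by simp
have d: "distributed P lborel (%om. inc s t om $ l) ?d" using bm st by (simp add: brownian_motion_def inc_def)
have m: "(LINT om|P. (inc s t om $ l) ^ k) = (LINT x|lborel. ?d x * x ^ k)" for k using distributed_integral[OF d, of "%x. x ^ k"] by simp
show "integrable P (%om. (inc s t om $ l) ^ k)"
 using distributed_integrable[OF d, of "%x. x ^ k"] integrable_normal_moment[OF sg, of 0 k] by simp
show "(LINT om|P. inc s t om $ l) = 0" using m[of 1] integral_normal_moment_odd[OF sg, of 0 0] by simp
show "(LINT om|P. (inc s t om $ l)^2) = t - s" using m[of 2] integral_normal_moment_even[OF sg, of 0 1] st by (simp add: fact_numeral)
show "(LINT om|P. (inc s t om $ l) ^ 4) = 3 * (t - s)^2"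
 using m[of 4] integral_normal_moment_even[OF sg, of 0 2] st by (simp add: fact_numeral power_divide)
qed

lemma inc_inner_moment:
assumes st: "0 <= s" "s < t"
shows "integrable P (%om. c *. inc s t om)" "integrable P (%om. (c *. inc s t om)^2)"
 "(LINT om|P. c *. inc s t om) = 0" "(LINT om|P. (c *. inc s t om)^2) = (norm c)^2 * (t - s)"
proof -
note mom = inc_component_moment[OF st]
have int1: "integrable P (%om. inc s t om $ l)" for l using mom(1)[of l 1] by simp
have ind: "indep_vars (%_. borel) (%l om. inc s t om $ l) UNIV" using bm st by (simp add: brownian_motion_def inc_def)
have cross: "integrable P (%om. inc s t om $ j * inc s t om $ l)"
 "(LINT om|P. inc s t om $ j * inc s t om $ l) = (if j = l then t - s else 0)" for j l
proof -
 have "integrable P (%om. inc s t om $ j * inc s t om $ l) &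
   (LINT om|P. inc s t om $ j * inc s t om $ l) = (if j = l then t - s else 0)"
 proof (cases "j = l")
  case True
  then show ?thesis using mom(1)[of l 2] mom(3)[of l] by (simp add: power2_eq)
 next
  case False
  have "indep_vars (%_. borel) (%l om. inc s t om $ l) {j, l}" by (rule indep_vars_subset[OF ind]) auto
  from indep_vars_integrable[OF _ this int1] indep_vars_lebesgue_integral[OF _ this int1]
  show ?thesis using False mom(2) by simp
 qed
 then show "integrable P (%om. inc s t om $ j * inc s t om $ l)"
  "(LINT om|P. inc s t om $ j * inc s t om $ l) = (if j = l then t - s else 0)" by auto
qed
show "integrable P (%om. c *. inc s t om)" "(LINT om|P. c *. inc s t om) = 0" unfolding inner_vec_def using int1 mom(2) by simp_all
have eq: "(c *. inc s t om)^2 = (SUM j:UNIV. SUM l:UNIV. (c $ j * c $ l) * (inc s t om $ j * inc s t om $ l))" for om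
 by (simp add: inner_vec_def power2_eq sum_product mult_ac)
show "integrable P (%om. (c *. inc s t om)^2)" unfolding eq using cross(1) by (intro bi_integrable_sum integrable_mult_right) auto
have "(LINT om|P. (c *. inc s t om)^2) = (SUM j:UNIV. SUM l:UNIV. (c $ j * c $ l) * (if j = l then t - s else 0))"
 unfolding eq using cross by (simp add: bi_integral_sum bi_integrable_sum)
also have "... = (SUM j:UNIV. (c $ j)^2 * (t - s))" by (simp add: power2_eq if_distrib cong: if_cong)
also have "... = (norm c)^2 * (t - s)" unfolding power2_norm_eq_inner inner_vec_def by (simp add: sum_distrib_right power2_eq)
finally show "(LINT om|P. (c *. inc s t om)^2) = (norm c)^2 * (t - s)" .
qed

text \<open>The fourth moment rests on \<open>|x|^4 <= m \<Sum> x_l^4\<close>, by Cauchy-Schwarz,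
  which spares the mixed moments.\<close>

lemma inc_norm_moment:
assumes st: "0 <= s" "s < t"
shows "integrable P (%om. (norm (inc s t om))^2)" "(LINT om|P. (norm (inc s t om))^2) = real CARD('m) * (t - s)"
 "integrable P (%om. (norm (inc s t om)) ^ 4)" "(LINT om|P. (norm (inc s t om)) ^ 4) <= 3 * (real CARD('m))^2 * (t - s)^2"
proof -
note mom = inc_component_moment[OF st]
have m: "inc s t : bmeas P" using st by simp
have n2: "(norm x)^2 = (SUM l:UNIV. (x $ l)^2)" for x :: "real^'m" unfolding power2_norm_eq_inner inner_vec_def by (simp add: power2_eq)
show "integrable P (%om. (norm (inc s t om))^2)" unfolding n2 by (intro bi_integrable_sum mom(1))
show "(LINT om|P. (norm (inc s t om))^2) = real CARD('m) * (t - s)" unfolding n2 by (subst bi_integral_sum) (simp_all add: mom)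
have n4: "(norm x) ^ 4 <= real CARD('m) * (SUM l:UNIV. (x $ l) ^ 4)" for x :: "real^'m"
proof -
 have "(norm x) ^ 4 = (SUM l:UNIV. (x $ l)^2)^2" by (simp flip: n2)
 also have "... <= (SUM l:(UNIV::'m set). 1\<^sup>2) * (SUM l:UNIV. ((x $ l)^2)^2)"
  using Cauchy_Schwarz_ineq_sum[of "%_. 1" "%l. (x $ l)^2" UNIV] by simp
 finally show ?thesis by simp
qed
have i4: "integrable P (%om. real CARD('m) * (SUM l:UNIV. (inc s t om $ l) ^ 4))" by (intro integrable_mult_right bi_integrable_sum mom(1))
show i: "integrable P (%om. (norm (inc s t om)) ^ 4)"
 by (rule bi_integrable_bound[OF i4]) (use m n4 in "auto intro: order_trans[OF n4 abs_ge_self]")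
have "(LINT om|P. (norm (inc s t om)) ^ 4) <= (LINT om|P. real CARD('m) * (SUM l:UNIV. (inc s t om $ l) ^ 4))"
 by (rule integral_mono[OF i i4]) (rule n4)
also have "... = 3 * (real CARD('m))^2 * (t - s)^2" by (simp add: bi_integral_sum mom power2_eq)
finally show "(LINT om|P. (norm (inc s t om)) ^ 4) <= 3 * (real CARD('m))^2 * (t - s)^2" .
qed

end


section \<open>Martingale transforms and Riemann-Ito sums\<close>

context bm
begin

text \<open>Discrete Ito isometry: the weight \<open>G i\<close> and the sum before it belong to the
  past of the increment, so cross terms vanish. The function \<open>g\<close> is general in order to
  cover linear functionals of the increment as well as centred squares.\<close>

lemma mt_L2:
fixes tau :: "nat => real" and G :: "nat => 'w => real" and g :: "nat => real^'m => real"
assumes tau: "0 <= tau 0" "!!i. tau i < tau (Suc i)"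
 and G: "!!i. G i : bmeas (F (tau i))" "!!i om. om : space P ==> abs (G i om) <= C i"
 and g: "!!i. g i : bmeas borel" "!!i. integrable P (%om. (g i (dW tau i om))^2)"
  "!!i. (LINT om|P. g i (dW tau i om)) = 0"
  "!!i. (LINT om|P. (g i (dW tau i om))^2) = v i"
shows "(%om. SUM i<k. G i om * g i (dW tau i om)) : bmeas (F (tau k))" (is ?A)
 "integrable P (%om. (SUM i<k. G i om * g i (dW tau i om))^2)" (is ?B)
 "(LINT om|P. (SUM i<k. G i om * g i (dW tau i om))^2) = (SUM i<k. (LINT om|P. (G i om)^2) * v i)" (is ?C)
proof -
define S where "S k om = (SUM i<k. G i om * g i (dW tau i om))" for k om
have "S k : bmeas (F (tau k)) & integrable P (%om. (S k om)^2) &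
 (LINT om|P. (S k om)^2) = (SUM i<k. (LINT om|P. (G i om)^2) * v i) & 0 <= tau k"
proof (induction k)
 case 0
 show ?case using tau(1) by (simp add: S_def[abs_def])
next
 case (Suc k)
 let ?x = "%om. g k (dW tau k om)"
 have st: "0 <= tau k" "tau k < tau (Suc k)" using Suc tau(2) by auto
 have Sm: "S k : bmeas (F (tau k))" and Si: "integrable P (%om. (S k om)^2)" using Suc by auto
 have Sp [measurable]: "S k : bmeas P" and Gp [measurable]: "G k : bmeas P" using F_P Sm G(1) by auto
 have xm: "?x : bmeas (F (tau (Suc k)))" by (rule meas_comp[OF inc_measurable g(1)]) (use st in auto)
 have xp [measurable]: "?x : bmeas P" by (rule F_P[OF xm])
 have xi: "integrable P ?x" by (rule square_integrable_imp_integrable[OF xp g(2)])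
 have S1: "integrable P (S k)" by (rule square_integrable_imp_integrable[OF Sp Si])
 have C: "0 <= C k" using G(2) not_empty by (meson abs_ge_zero ex_in_conv order_trans)
 have SG: "integrable P (%om. 2 * S k om * G k om)"
 proof (rule bi_integrable_bound[OF integrable_mult_right[OF S1, of "2 * C k"]])
  show "AE om in P. norm (2 * S k om * G k om) <= norm (2 * C k * S k om)"
   using C by (intro AE_I2) (auto simp: abs_mult mult.commute intro!: mult_right_mono G(2))
 qed simp
 have G2: "integrable P (%om. (G k om)^2)"
 proof (rule integrable_const_bound[of _ "(C k)^2"])
  show "AE om in P. norm ((G k om)^2) <= (C k)^2" using C G(2) by (intro AE_I2) (auto simp: abs_le_square_iff[symmetric])
 qed simp
 have SGm: "(%om. 2 * S k om * G k om) : bmeas (F (tau k))" "(%om. (G k om)^2) : bmeas (F (tau k))" using Sm G(1) by auto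
 have g2m: "(%x. (g k x)^2) : bmeas borel" using g(1)[of k] by simp
 note e1 = expectation_mult_inc[OF st SGm(1) SG g(1) xi]
 note e2 = expectation_mult_inc[OF st SGm(2) G2 g2m g(2)]
 have eq: "(S (Suc k) om)^2 = (S k om)^2 + (2 * S k om * G k om) * ?x om + (G k om)^2 * (?x om)^2" for om
  by (simp add: S_def power2_eq algebra_simps)
 have "S (Suc k) = (%om. S k om + G k om * ?x om)" by (simp add: S_def[abs_def])
 then have "S (Suc k) : bmeas (F (tau (Suc k)))" using F_mono[OF less_imp_le[OF st(2)] Sm] F_mono[OF less_imp_le[OF st(2)] G(1)] xm by simp
 moreover have "integrable P (%om. (S (Suc k) om)^2)" unfolding eq using Si e1(1) e2(1) by simp
 moreover have "(LINT om|P. (S (Suc k) om)^2) = (LINT om|P. (S k om)^2) + (LINT om|P. (G k om)^2) * v k"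
  unfolding eq using Si e1 e2 g(3,4) by simp
 ultimately show ?case using Suc st by simp
qed
then show ?A ?B ?C by (simp_all add: S_def[abs_def])
qed

lemma mt_L2_inner:
fixes tau :: "nat => real" and G :: "nat => 'w => real"
assumes tau: "0 <= tau 0" "!!i. tau i < tau (Suc i)"
 and G: "!!i. G i : bmeas (F (tau i))" "!!i om. om : space P ==> abs (G i om) <= C i"
shows "(%om. SUM i<k. G i om * (c *. dW tau i om)) : bmeas (F (tau k))" (is ?A)
 "integrable P (%om. (SUM i<k. G i om * (c *. dW tau i om))^2)" (is ?B)
 "(LINT om|P. (SUM i<k. G i om * (c *. dW tau i om))^2)
  = (SUM i<k. (LINT om|P. (G i om)^2) * ((norm c)^2 * (tau (Suc i) - tau i)))" (is ?C)
proof -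
have "0 <= tau i" for i by (induction i) (use tau in "auto intro: order_trans less_imp_le")
then have m: "integrable P (%om. (c *. dW tau i om)^2)"
 "(LINT om|P. c *. dW tau i om) = 0"
 "(LINT om|P. (c *. dW tau i om)^2) = (norm c)^2 * (tau (Suc i) - tau i)" for i
 by (rule inc_inner_moment(2)[OF _ tau(2)], rule inc_inner_moment(3)[OF _ tau(2)], rule inc_inner_moment(4)[OF _ tau(2)])
have cm: "(%x. c *. x) : bmeas borel" by simp
show ?A by (rule mt_L2(1)[where g = "%i x. c *. x" and C = C, OF tau G cm m(1,2) refl])
show ?B by (rule mt_L2(2)[where g = "%i x. c *. x" and C = C, OF tau G cm m(1,2) refl])
show ?C by (rule mt_L2(3)[where g = "%i x. c *. x" and C = C, OF tau G cm m])
qed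

text \<open>An inequality of Lenglart type: weights are cut off as soon as the accumulated bracket
  \<open>A\<close> would exceed \<open>K\<close>. The bracket including the current step is known at
  the left end of that step, so the cut weights are adapted. They are bounded by
  \<open>sqrt (K / v i)\<close>, so that \<open>G\<close> itself may be unbounded.\<close>

lemma mt_truncation:
fixes tau :: "nat => real" and G :: "nat => 'w => real"
assumes tau: "0 <= tau 0" "!!i. tau i < tau (Suc i)" and c: "c ~= 0"
 and G: "!!i. G i : bmeas (F (tau i))" and e: "0 < e" and K: "0 <= K"
shows "prob {om : space P. e < abs (SUM i<n. G i om * (c *. dW tau i om))}
 <= K / e^2 + prob {om : space P. K < (SUM i<n. (G i om)^2 * ((norm c)^2 * (tau (Suc i) - tau i)))}"
proof -
define v where "v i = (norm c)^2 * (tau (Suc i) - tau i)" for i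
have v: "v i > 0" for i unfolding v_def using c tau(2)[of i] by simp
define A where "A i om = (SUM j<i. (G j om)^2 * v j)" for i om
define G' where "G' i om = (if A (Suc i) om <= K then G i om else 0)" for i om
have taum: "tau i <= tau j" if "i <= j" for i j using lift_Suc_mono_le[of tau i j] tau(2) that by (simp add: less_imp_le)
have tau0: "0 <= tau i" for i using taum[of 0 i] tau(1) by simp
have Am: "A i : bmeas (F (tau j))" if "i <= Suc j" for i j unfolding A_def[abs_def] using that
 by (intro bmeas_sum bmeas_times bmeas_power bmeas_const F_mono[OF taum G]) auto
have G'm: "G' i : bmeas (F (tau i))" for i unfolding G'_def[abs_def] using G[of i] Am[of "Suc i" i]
 by (intro measurable_If) (auto simp: measurable_def borel_measurable_le)
have Amono: "A i om <= A j om" if "i <= j" for i j om unfolding A_def using that v by (intro sum_mono2) (auto simp: less_imp_le)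
have bnd: "abs (G' i om) <= sqrt (K / v i)" for i om
proof (cases "A (Suc i) om <= K")
 case True
 have "0 <= A i om" using Amono[of 0 i om] by (simp add: A_def)
 then have "(G i om)^2 * v i <= K" using True by (simp add: A_def)
 then have "(G i om)^2 <= K / v i" using v[of i] by (simp add: field_simps)
 then show ?thesis using True by (simp add: G'_def real_le_rsqrt)
next
 case False
 then show ?thesis using K v[of i] by (simp add: G'_def less_imp_le)
qed
have sumG': "(SUM i<n. (G' i om)^2 * v i) <= K" for n om
proof (induction n)
 case (Suc n)
 show ?case
 proof (cases "A (Suc n) om <= K")
  case True
  have "G' i om = G i om" if "i < Suc n" for i using Amono[of "Suc i" "Suc n" om] that True by (simp add: G'_def)
  then show ?thesis using True by (simp add: A_def)
 next
  case False
  then show ?thesis using Suc by (simp add: G'_def)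
 qed
qed (use K in simp)
let ?xi = "%i om. c *. dW tau i om"
note L2 = mt_L2_inner[OF tau G'm bnd, where c = c, folded v_def]
have G'i: "integrable P (%om. (G' i om)^2)" for i
proof (rule integrable_const_bound[of _ "K / v i"])
 have Kv: "0 <= K / v i" using K v[of i] by simp
 show "AE om in P. norm ((G' i om)^2) <= K / v i"
 proof (rule AE_I2)
  show "norm ((G' i om)^2) <= K / v i" for om using power_mono[OF bnd[of i om], of 2] Kv by simp
 qed
qed (use F_P[OF G'm] in simp)
have "(LINT om|P. (SUM i<n. G' i om * ?xi i om)^2) = (LINT om|P. (SUM i<n. (G' i om)^2 * v i))"
 unfolding L2(3) using G'i by (subst bi_integral_sum) auto
also have "... <= (LINT om|P. K)" using G'i sumG' by (intro integral_mono) auto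
finally have E: "(LINT om|P. (SUM i<n. G' i om * ?xi i om)^2) <= K" by (simp add: prob_space)
have m: "(%om. SUM i<n. G' i om * ?xi i om) : bmeas P" by (rule F_P[OF L2(1)])
have mA: "A n : bmeas P" by (rule F_P[OF Am[of n n]]) simp
have "prob {om : space P. e < abs (SUM i<n. G i om * ?xi i om)}
 <= prob ({om : space P. e < abs (SUM i<n. G' i om * ?xi i om)} Un {om : space P. K < A n om})"
proof (rule finite_measure_mono)
 show "{om : space P. e < abs (SUM i<n. G i om * ?xi i om)} <= {om : space P. e < abs (SUM i<n. G' i om * ?xi i om)} Un {om : space P. K < A n om}"
 proof
  fix om assume om: "om : {om : space P. e < abs (SUM i<n. G i om * ?xi i om)}"
  show "om : {om : space P. e < abs (SUM i<n. G' i om * ?xi i om)} Un {om : space P. K < A n om}"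
  proof (cases "K < A n om")
   case False
   have "G' i om = G i om" if "i < n" for i using Amono[of "Suc i" n om] that False by (simp add: G'_def)
   then show ?thesis using om by simp
  qed (use om in simp)
 qed
qed (use m mA in measurable)
also have "... <= prob {om : space P. e < abs (SUM i<n. G' i om * ?xi i om)} + prob {om : space P. K < A n om}"
 by (rule measure_Un_le) (use m mA in measurable)
also have "prob {om : space P. e < abs (SUM i<n. G' i om * ?xi i om)} <= (LINT om|P. (SUM i<n. G' i om * ?xi i om)^2) / e^2"
 by (rule prob_gt_le_second_moment[OF m L2(2) e])
also have "... <= K / e^2" using E by (intro divide_right_mono) auto
finally show ?thesis by (simp add: A_def v_def)
qed

text \<open>Kolmogorov's argument: once a partial sum has exceeded \<open>e\<close>, all later
  weights are set to zero. The modified sum then stops at the first exceedance, so its terminal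
  value alone detects it.\<close>

lemma mt_maximal:
fixes tau :: "nat => real" and G :: "nat => 'w => real"
assumes tau: "0 <= tau 0" "!!i. tau i < tau (Suc i)"
 and G: "!!i. G i : bmeas (F (tau i))" "!!i om. om : space P ==> abs (G i om) <= C" and e: "0 < e"
shows "prob {om : space P. EX k<=n. e < abs (SUM i<k. G i om * (c *. dW tau i om))}
 <= C^2 * (norm c)^2 * (tau n - tau 0) / e^2"
proof -
let ?xi = "%i om. c *. dW tau i om"
define v where "v i = (norm c)^2 * (tau (Suc i) - tau i)" for i
have v: "v i >= 0" for i unfolding v_def using tau(2)[of i] by simp
define S where "S k om = (SUM i<k. G i om * ?xi i om)" for k om
define G' where "G' i om = (if ALL j:{..i}. abs (S j om) <= e then G i om else 0)" for i om
have taum: "tau i <= tau j" if "i <= j" for i j using lift_Suc_mono_le[of tau i j] tau(2) that by (simp add: less_imp_le)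
have tau0: "0 <= tau i" for i using taum[of 0 i] tau(1) by simp
have C0: "0 <= C" using G(2) not_empty by (meson abs_ge_zero ex_in_conv order_trans)
have Sm: "S j : bmeas (F (tau i))" if "j <= i" for i j unfolding S_def[abs_def] by (rule F_mono[OF taum[OF that] mt_L2_inner(1)[OF tau G]])
have G'm: "G' i : bmeas (F (tau i))" for i
proof -
 have "{om : space (F (tau i)). ALL j:{..i}. abs (S j om) <= e} : sets (F (tau i))"
  by (rule sets.sets_Collect_finite_All') (use Sm in "auto intro!: borel_measurable_le borel_measurable_abs")
 then show ?thesis unfolding G'_def[abs_def] using G(1)[of i] by (intro measurable_If) auto
qed
have bnd: "abs (G' i om) <= C" if "om : space P" for i om using G(2)[OF that, of i] C0 by (simp add: G'_def)
note L2 = mt_L2_inner[OF tau G'm bnd, where c = c, folded v_def]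
have "(LINT om|P. (SUM i<n. G' i om * ?xi i om)^2) = (SUM i<n. (LINT om|P. (G' i om)^2) * v i)" by (rule L2(3))
also have "... <= (SUM i<n. C^2 * v i)"
proof (intro sum_mono mult_right_mono v)
 fix i
 have "integrable P (%om. (G' i om)^2)"
  using power_mono[OF bnd, of _ i 2] F_P[OF G'm] by (intro integrable_const_bound[of _ "C^2"] AE_I2) auto
 then have "(LINT om|P. (G' i om)^2) <= (LINT om|P. C^2)" using power_mono[OF bnd, of _ i 2] by (intro integral_mono) auto
 then show "(LINT om|P. (G' i om)^2) <= C^2" by (simp add: prob_space)
qed
also have "... = C^2 * (norm c)^2 * (tau n - tau 0)"
 using sum_lessThan_telescope[of tau n] by (simp add: v_def mult.assoc flip: sum_distrib_left)
finally have E: "(LINT om|P. (SUM i<n. G' i om * ?xi i om)^2) <= C^2 * (norm c)^2 * (tau n - tau 0)" .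
have m: "(%om. SUM i<n. G' i om * ?xi i om) : bmeas P" by (rule F_P[OF L2(1)])
have "{om : space P. EX k<=n. e < abs (S k om)} <= {om : space P. e < abs (SUM i<n. G' i om * ?xi i om)}"
proof clarify
 fix om k assume om: "om : space P" and k: "k <= n" "e < abs (S k om)"
 define k0 where "k0 = (LEAST k. e < abs (S k om))"
 have k0: "e < abs (S k0 om)" "k0 <= k" using k LeastI[of "%k. e < abs (S k om)" k] Least_le[of "%k. e < abs (S k om)" k] by (auto simp: k0_def)
 have before: "abs (S j om) <= e" if "j < k0" for j using not_less_Least[of j "%k. e < abs (S k om)"] that by (auto simp: k0_def)
 have G'eq: "G' i om = (if i < k0 then G i om else 0)" for i
 proof (cases "i < k0")
  case True
  then have "ALL j:{..i}. abs (S j om) <= e" using before by simp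
  then show ?thesis using True by (simp add: G'_def)
 next
  case False
  then have "~ (ALL j:{..i}. abs (S j om) <= e)" using k0(1) by (auto simp: not_le)
  then show ?thesis using False unfolding G'_def by (simp only: if_False)
 qed
 have "(SUM i<n. G' i om * ?xi i om) = (SUM i:{..<n} Int {..<k0}. G i om * ?xi i om)"
  by (subst sum.inter_restrict) (auto simp: G'eq intro!: sum.cong)
 also have "{..<n} Int {..<k0} = {..<k0}" using k0(2) k(1) by auto
 finally have "(SUM i<n. G' i om * ?xi i om) = S k0 om" by (simp add: S_def)
 then show "e < abs (SUM i<n. G' i om * ?xi i om)" using k0(1) by simp
qed
then have "prob {om : space P. EX k<=n. e < abs (S k om)} <= prob {om : space P. e < abs (SUM i<n. G' i om * ?xi i om)}"
 by (rule finite_measure_mono) (use m in measurable)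
also have "... <= (LINT om|P. (SUM i<n. G' i om * ?xi i om)^2) / e^2" by (rule prob_gt_le_second_moment[OF m L2(2) e])
also have "... <= C^2 * (norm c)^2 * (tau n - tau 0) / e^2" using E by (intro divide_right_mono) auto
finally show ?thesis by (simp add: S_def)
qed

section \<open>Left-point sums on uniform grids\<close>

definition adapted :: "(real => 'w => 'e::topological_space) => bool" where
"adapted H \<longleftrightarrow> (ALL t>=0. H t : bmeas (F t))"

text \<open>Left-point sums for the Ito integral of \<open>H\<close> against
  \<open>c \<bullet> W\<close>: the time grid is that of \<open>[0, T]\<close> with \<open>n\<close>
  cells, and \<open>k = n\<close> gives the full sum, smaller \<open>k\<close> the partial sums
  needed for maximal inequalities.\<close>

definition RS :: "real^'m => (real => 'w => real) => real => nat => nat => 'w => real" where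
"RS c H T n k om = (SUM i<k. H (grid T n i) om * (c *. dW (grid T n) i om))"

lemma adaptedD: "adapted H ==> 0 <= t ==> H t : bmeas (F t)"
by (simp add: adapted_def)

lemma grid_less: "0 < T ==> 0 < n ==> grid T n i < grid T n (Suc i)"
using grid_step[of T n i] by (simp add: algebra_simps)

lemma RS_L2:
assumes H: "adapted H" "!!t om. 0 <= t ==> om : space P ==> abs (H t om) <= C" and T: "0 < T" and n: "0 < n"
shows "integrable P (%om. (RS c H T n k om)^2)"
 "(LINT om|P. (RS c H T n k om)^2) = (SUM i<k. (LINT om|P. (H (grid T n i) om)^2) * ((norm c)^2 * (T / n)))"
proof -
have g0: "0 <= grid T n i" for i using T by (intro grid_nonneg) simp
note L2 = mt_L2_inner[where tau = "grid T n" and G = "%i. H (grid T n i)" and C = "%_. C",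
  OF g0 grid_less[OF T n] adaptedD[OF H(1) g0] H(2)[OF g0]]
show "integrable P (%om. (RS c H T n k om)^2)"
 "(LINT om|P. (RS c H T n k om)^2) = (SUM i<k. (LINT om|P. (H (grid T n i) om)^2) * ((norm c)^2 * (T / n)))"
 using L2(2,3)[where k = k and c = c] by (simp_all add: RS_def grid_step)
qed

lemma RS_measurable [measurable]:
assumes H: "adapted H" and T: "0 <= T"
shows "RS c H T n k : bmeas P"
unfolding RS_def[abs_def] using T
by (intro bmeas_sum bmeas_times bmeas_inner bmeas_const
  inc_measurable_P grid_nonneg grid_mono F_P[OF adaptedD[OF H]]) auto

lemma RS_maximal:
assumes H: "adapted H" "!!t om. 0 <= t ==> om : space P ==> abs (H t om) <= C" and T: "0 < T" and n: "0 < n" and e: "0 < e"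
shows "prob {om : space P. EX k<=n. e < abs (RS c H T n k om)} <= C^2 * (norm c)^2 * T / e^2"
proof -
have g0: "0 <= grid T n i" for i using T by (intro grid_nonneg) simp
show ?thesis using mt_maximal[where tau = "grid T n" and G = "%i. H (grid T n i)" and C = C and c = c and n = n,
  OF g0 grid_less[OF T n] adaptedD[OF H(1) g0] H(2)[OF g0] e] n by (simp add: RS_def grid_n)
qed

lemma integral_measurable_F:
fixes f :: "real => 'w => 'e::euclidean_space"
assumes f: "!!s. 0 <= s ==> s <= t ==> f s : bmeas (F t)"
 and c: "!!om. om : space P ==> cont0 (%s. f s om)" and t: "0 <= t"
shows "(%om. itg t (%s. f s om)) : bmeas (F t)"
proof (rule bmeas_LIMSEQ)
show "(%om. SUM i<n. (t / n) *\<^sub>R f (grid t n i) om) : bmeas (F t)" for n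
 using t by (intro bmeas_sum bmeas_scaleR bmeas_const f grid_nonneg grid_le) auto
fix om assume "om : space (F t)"
then have "continuous_on {0..t} (%s. f s om)" using c[of om] by (auto simp: space_F intro: cont_subset)
then show "(%n. SUM i<n. (t / n) *\<^sub>R f (grid t n i) om) ----> itg t (%s. f s om)" by (rule riemann_sum_tendsto[OF _ t])
qed

text \<open>Each squared increment is its mean \<open>|c|^2 T / n\<close> plus a centred part. The
  means form a Riemann sum; the centred parts are orthogonal with second moments of order
  \<open>1 / n^2\<close>, so their sum vanishes in the limit.\<close>

lemma quadratic_variation:
assumes f: "adapted f" "!!t om. 0 <= t ==> om : space P ==> abs (f t om) <= C"
 and cont: "!!om. om : space P ==> cont0 (%t. f t om)" and T: "0 < T"
shows "in_prob (%n om. SUM i<n. f (grid T n i) om * (c *. dW (grid T n) i om)^2)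
 (%om. (norm c)^2 * itg T (%t. f t om))"
proof -
\<comment> \<open>\<open>K * (?D n)^2\<close> bounds the fourth moment of
  \<open>c \<bullet> dW\<close> over one step, by Cauchy-Schwarz and
  \<open>inc_norm_moment\<close>.\<close>
define K where "K = 3 * (real CARD('m))^2 * (norm c) ^ 4"
let ?D = "%n. T / real n"
let ?g = "%n x. (c *. x)^2 - (norm c)^2 * ?D n"
let ?I = "%n i. dW (grid T n) i"
let ?S = "%n om. SUM i<n. f (grid T n i) om * ?g n (?I n i om)"
 and ?c = "%n i om. c *. ?I n i om"
have g0: "0 <= grid T n i" for n i using T by (intro grid_nonneg) simp
have L2: "integrable P (%om. (?S n om)^2) &
  (LINT om|P. (?S n om)^2) <= C^2 * K * T^2 / n" if n: "0 < n" for n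
proof -
 note lt = grid_less[OF T n]
 have 4: "integrable P (%om. (?c n i om) ^ 4)" "(LINT om|P. (?c n i om) ^ 4) <= K * (?D n)^2" for i
 proof -
  have le: "(c *. x) ^ 4 <= (norm c) ^ 4 * (norm x) ^ 4" for x
  proof -
   have "abs (c *. x) ^ 4 <= (norm c * norm x) ^ 4" by (intro power_mono Cauchy_Schwarz_ineq2) simp
   then show ?thesis by (simp add: power_mult_distrib)
  qed
  have i4: "integrable P (%om. (norm c) ^ 4 * (norm (?I n i om)) ^ 4)" by (intro integrable_mult_right inc_norm_moment(3) g0 lt)
  show i: "integrable P (%om. (?c n i om) ^ 4)" by (rule bi_integrable_bound[OF i4]) (use le g0 lt in "auto simp: less_imp_le")
  have "(LINT om|P. (?c n i om) ^ 4) <= (LINT om|P. (norm c) ^ 4 * (norm (?I n i om)) ^ 4)" by (rule integral_mono[OF i i4 le])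
  also have "... = (norm c) ^ 4 * (LINT om|P. (norm (?I n i om)) ^ 4)" by simp
  also have "... <= (norm c) ^ 4 * (3 * (real CARD('m))^2 * (grid T n (Suc i) - grid T n i)^2)"
   by (intro mult_left_mono inc_norm_moment(4) g0 lt) simp
  finally show "(LINT om|P. (?c n i om) ^ 4) <= K * (?D n)^2" by (simp add: K_def grid_step mult_ac)
 qed
 have mean: "integrable P (%om. (?c n i om)^2)" "(LINT om|P. (?c n i om)^2) = (norm c)^2 * ?D n" for i
  using inc_inner_moment(2,4)[OF g0 lt, of c] by (simp_all add: grid_step)
 have sq: "(?g n x)^2 = (c *. x) ^ 4 - 2 * ((norm c)^2 * ?D n) * (c *. x)^2 + ((norm c)^2 * ?D n)^2" for x
  by (simp add: power2_diff power_mult[symmetric] mult_ac)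
 have gi: "integrable P (%om. (?g n (?I n i om))^2)" for i
  unfolding sq using 4(1) mean(1) by (intro bi_integrable_add bi_integrable_diff integrable_mult_right) auto
 have gE: "(LINT om|P. ?g n (?I n i om)) = 0" for i using mean[of i] by (simp add: prob_space)
 have g2: "(LINT om|P. (?g n (?I n i om))^2) <= K * (?D n)^2" for i
 proof -
  have "(LINT om|P. (?g n (?I n i om))^2) = (LINT om|P. (?c n i om) ^ 4) - 2 * ((norm c)^2 * ?D n) * ((norm c)^2 * ?D n) + ((norm c)^2 * ?D n)^2"
   unfolding sq using 4(1)[of i] mean[of i] by (simp add: prob_space)
  also have "... <= (LINT om|P. (?c n i om) ^ 4)"
  proof -
   have "x - 2 * q * q + q^2 <= x" for x q :: real by (simp add: power2_eq)
   then show ?thesis .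
  qed
  finally show ?thesis using 4(2)[of i] by linarith
 qed
 have gm: "?g n : bmeas borel" by measurable
 note L = mt_L2[where g = "%i. ?g n" and v = "%i. \<integral>om. (?g n (?I n i om))^2 \<partial>P" and tau = "grid T n"
  and G = "%i. f (grid T n i)" and C = "%_. C",
  OF g0 lt adaptedD[OF f(1) g0] f(2)[OF g0] gm gi gE refl]
 have f2: "(LINT om|P. (f (grid T n i) om)^2) <= C^2" for i
 proof -
  have "(abs (f (grid T n i) om))^2 <= C^2" if "om : space P" for om by (rule power_mono[OF f(2)[OF g0 that]]) simp
  then have b: "(f (grid T n i) om)^2 <= C^2" if "om : space P" for om using that by simp
  have "integrable P (%om. (f (grid T n i) om)^2)" by (rule integrable_const_bound[of _ "C^2"]) (use b F_P[OF adaptedD[OF f(1) g0]] in auto)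
  then have "(LINT om|P. (f (grid T n i) om)^2) <= (LINT om|P. C^2)" by (rule integral_mono) (use b in auto)
  then show ?thesis by (simp add: prob_space)
 qed
 have "(LINT om|P. (?S n om)^2)
  = (SUM i<n. (LINT om|P. (f (grid T n i) om)^2) * (LINT om|P. (?g n (?I n i om))^2))" by (rule L(3))
 also have "... <= (SUM i<n. C^2 * (K * (?D n)^2))" by (intro sum_mono mult_mono f2 g2) auto
 also have "... = C^2 * K * T^2 / n" using n by (simp add: power2_eq field_simps)
 finally show ?thesis using L(2) by blast
qed
have m: "(%om. SUM i<n. f (grid T n i) om * ?g n (?I n i om)) : bmeas P" for n
 using T by (intro bmeas_sum bmeas_times bmeas_diff bmeas_power bmeas_inner
  bmeas_const inc_measurable_P g0 grid_mono F_P[OF adaptedD[OF f(1) g0]]) auto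
have 1: "in_prob (%n om. SUM i<n. f (grid T n i) om * ?g n (?I n i om)) (%_. 0)"
proof (rule in_prob_second_moment[where c = "%n. C^2 * K * T^2 / n"])
 show "integrable P (%om. ((?S n om) - 0)^2)" for n using L2[of n] by (cases "n = 0") auto
 show "EVN n. (LINT om|P. ((?S n om) - 0)^2) <= C^2 * K * T^2 / n" using L2 by (intro eventually_mono[OF eventually_gt_at_top[of 0]]) auto
 show "(%n. C^2 * K * T^2 / real n) ----> 0" by (rule lim_const_over_n)
qed (use m in auto)
have im: "(%om. itg T (%t. f t om)) : bmeas P" by (rule F_P[OF integral_measurable_F]) (use T cont F_mono[OF _ adaptedD[OF f(1)]] in auto)
have 2: "in_prob (%n om. SUM i<n. ?D n *\<^sub>R f (grid T n i) om) (%om. itg T (%t. f t om))"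
proof (rule AE_in_prob[OF _ im])
 show "(%om. SUM i<n. ?D n *\<^sub>R f (grid T n i) om) : bmeas P" for n
  by (intro bmeas_sum bmeas_scaleR bmeas_const F_P[OF adaptedD[OF f(1) g0]])
 show "AE om in P. (%n. SUM i<n. ?D n *\<^sub>R f (grid T n i) om) ----> itg T (%t. f t om)"
  using T by (intro AE_I2 riemann_sum_tendsto cont_subset[OF cont]) auto
qed
have eq: "(?S n om) + (norm c)^2 * (SUM i<n. ?D n *\<^sub>R f (grid T n i) om)
 = (SUM i<n. f (grid T n i) om * (?c n i om)^2)" for n om
 unfolding sum_distrib_left sum.distrib[symmetric] by (rule sum.cong) (simp_all add: algebra_simps)
show ?thesis using in_prob_add[OF 1 in_prob_scale[OF 2, of "(norm c)^2"]] unfolding eq by simp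
qed

end


section \<open>Simple integrands sampled on grids\<close>

lemma (in prob_space) in_probD:
assumes "in_prob X Z" "0 < e" "0 < d"
shows "EVN n. prob {om : space M. e < abs (X n om - Z om)} < d"
proof -
have "(%n. prob {om : space M. e < abs (X n om - Z om)}) ----> 0" using assms(1,2) unfolding in_prob_def by blast
then show ?thesis using assms(3) by (rule order_tendstoD(2))
qed

text \<open>The terms past \<open>tau\<close> telescope from the first grid point beyond it, which
  lies within one mesh of \<open>min T tau\<close>. The strict inequality matches the left-open
  intervals of a simple integrand.\<close>

lemma grid_cut_tendsto:
fixes w :: "real => real"
assumes w: "continuous_on {0..T} w" and T: "0 < T" and tau: "0 <= tau"
shows "(%n. SUM k<n. if tau < grid T n k then w (grid T n (Suc k)) - w (grid T n k) else 0) ----> w T - w (min T tau)"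
proof -
\<comment> \<open>If no grid point lies beyond \<open>tau\<close>, the default \<open>n\<close>
  makes the sum empty and points to \<open>T\<close>.\<close>
define k0 where "k0 n = (LEAST k. tau < grid T n k | k = n)" for n
have k0: "tau < grid T n (k0 n) | k0 n = n" "k0 n <= n" for n unfolding k0_def by (rule LeastI[of _ n], simp) (rule Least_le, simp)
have before: "~ tau < grid T n k & k ~= n" if "k < k0 n" for n k using not_less_Least[OF that[unfolded k0_def]] by simp
have sum: "(SUM k<n. if tau < grid T n k then w (grid T n (Suc k)) - w (grid T n k) else 0) = w T - w (grid T n (k0 n))"
 if n: "n > 0" for n
proof -
 have cond: "tau < grid T n k \<longleftrightarrow> k0 n <= k" if "k < n" for k
 proof
  show "k0 n <= k" if "tau < grid T n k" using before[of k n] that by (meson not_le)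
  show "tau < grid T n k" if "k0 n <= k"
   using k0(1)[of n] \<open>k < n\<close> that grid_mono[of T "k0 n" k n] T by (auto intro: less_le_trans)
 qed
 have "(SUM k<n. if tau < grid T n k then w (grid T n (Suc k)) - w (grid T n k) else 0)
  = (SUM k<n. if k0 n <= k then w (grid T n (Suc k)) - w (grid T n k) else 0)" using cond by (intro sum.cong) auto
 also have "... = (SUM k:{k0 n..<n}. w (grid T n (Suc k)) - w (grid T n k))" by (intro sum.mono_neutral_cong_right) auto
 also have "... = w (grid T n n) - w (grid T n (k0 n))" using k0(2) by (rule sum_Suc_diff')
 finally show ?thesis using n by (simp add: grid_n)
qed
have g: "grid T n (k0 n) : {0..T}" for n using k0(2) T by (auto intro: grid_nonneg grid_le)
have close: "abs (grid T n (k0 n) - min T tau) <= T / n" if n: "n > 0" for n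
proof (cases "k0 n")
 case 0
 then show ?thesis using k0(1)[of n] tau n by simp
next
 case (Suc k)
 have "grid T n k <= tau" using before[of k n] Suc by simp
 moreover have "grid T n (k0 n) <= grid T n k + T / n" using grid_step[of T n k] Suc by simp
 moreover have "tau < grid T n (k0 n) | (grid T n (k0 n) = T & T <= tau)" using k0(1)[of n] grid_n[OF n, of T] by auto
 ultimately show ?thesis using g[of n] T n by (auto simp: min_def)
qed
have "(%n. grid T n (k0 n) - min T tau) ----> 0"
proof (rule Lim_null_comparison[OF _ lim_const_over_n[of T]])
 show "EVN n. norm (grid T n (k0 n) - min T tau) <= T / real n" using close by (auto intro: eventually_mono[OF eventually_gt_at_top[of 0]])
qed
then have "(%n. grid T n (k0 n)) ----> min T tau" by (rule LIM_zero_cancel)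
then have "(%n. w (grid T n (k0 n))) ----> w (min T tau)" using T tau g by (intro cont_tendsto[OF w]) (auto simp: min_def)
then have "(%n. w T - w (grid T n (k0 n))) ----> w T - w (min T tau)" by (intro tendsto_intros)
then show ?thesis by (rule Lim_transform_eventually) (use sum in "auto intro: eventually_mono[OF eventually_gt_at_top[of 0]]")
qed

lemma riemann_sum_ae_continuous:
fixes phi :: "real => real"
assumes T: "0 < T" and bnd: "!!s. s : {0..T} ==> abs (phi s) <= C"
 and m: "(%s. indicator {0..T} s * phi s) : bmeas borel"
 and D: "finite D" "!!s. s : {0<..<T} ==> s ~: D ==> continuous (at s) phi"
shows "(%n. SUM k<n. T / n * phi (grid T n k)) ----> (LINT s|lborel. indicator {0..T} s * phi s)"
 "integrable lborel (%s. indicator {0..T} s * phi s)"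
proof -
define f where "f n s = (SUM k<n. indicator {grid T n k..<grid T n (Suc k)} s * phi (grid T n k))" for n s
have C0: "0 <= C" using bnd[of 0] T by (auto intro: order_trans[OF abs_ge_zero])
have f_eq: "f n s = (if 0 <= s & s < T then phi (grid T n (nat \<lfloor>s * n / T\<rfloor>)) else 0)"
 "0 <= s ==> s < T ==> grid T n (nat \<lfloor>s * n / T\<rfloor>) : {0..T} & abs (grid T n (nat \<lfloor>s * n / T\<rfloor>) - s) <= T / n"
 if n: "n > 0" for n s
proof -
 let ?k = "nat \<lfloor>s * n / T\<rfloor>"
 have ind: "s : {grid T n k..<grid T n (Suc k)} \<longleftrightarrow> 0 <= s & k = ?k" for k
 proof -
  have "s : {grid T n k..<grid T n (Suc k)} \<longleftrightarrow> real k <= s * n / T & s * n / T < real k + 1"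
   using T n by (auto simp: grid_def field_simps)
  also have "... \<longleftrightarrow> \<lfloor>s * n / T\<rfloor> = int k" unfolding floor_eq_iff by simp
  also have "... \<longleftrightarrow> 0 <= s & k = ?k"
  proof
   assume a: "\<lfloor>s * n / T\<rfloor> = int k"
   then have "0 <= s * n / T" by linarith
   then show "0 <= s & k = ?k" using a T n by (simp add: zero_le_divide_iff zero_le_mult_iff)
  next
   assume "0 <= s & k = ?k"
   then show "\<lfloor>s * n / T\<rfloor> = int k" using T by simp
  qed
  finally show ?thesis .
 qed
 have kn: "?k < n \<longleftrightarrow> s < T" if "0 <= s"
 proof -
  have "?k < n \<longleftrightarrow> \<lfloor>s * n / T\<rfloor> < int n" using n by linarith
  also have "... \<longleftrightarrow> s * n / T < n" by (simp add: floor_less_iff)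
  also have "... \<longleftrightarrow> s < T" using T n by (simp add: field_simps)
  finally show ?thesis .
 qed
 have "f n s = (SUM k<n. if k = ?k then (if 0 <= s then phi (grid T n k) else 0) else 0)"
  unfolding f_def by (intro sum.cong) (auto simp: indicator_def ind simp del: atLeastLessThan_iff)
 also have "... = (if ?k < n then (if 0 <= s then phi (grid T n ?k) else 0) else 0)" by (simp add: sum.delta')
 finally show "f n s = (if 0 <= s & s < T then phi (grid T n ?k) else 0)" using kn by auto
 assume s: "0 <= s" "s < T"
 have "s : {grid T n ?k..<grid T n (Suc ?k)}" using ind s by blast
 then show "grid T n ?k : {0..T} & abs (grid T n ?k - s) <= T / n" using grid_step[of T n ?k] grid_nonneg[of T n ?k] T s by auto
qed
have int_f: "(LINT s|lborel. f n s) = (SUM k<n. T / n * phi (grid T n k))" for n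
proof -
 have "(LINT s|lborel. f n s) = (SUM k<n. (LINT s|lborel. indicator {grid T n k..<grid T n (Suc k)} s * phi (grid T n k)))"
  unfolding f_def by (rule bi_integral_sum)
   (use T grid_mono[of T] in "auto intro!: integrable_mult_left integrable_real_indicator simp: emeasure_lborel_Ico")
 also have "... = (SUM k<n. T / n * phi (grid T n k))" using T grid_mono[of T] by (intro sum.cong) (auto simp: grid_step)
 finally show ?thesis .
qed
have iw: "integrable lborel (%s. indicator {0..T} s * C)" using T by (intro integrable_mult_left integrable_real_indicator) (auto simp: emeasure_lborel_Icc)
have mf: "f n : bmeas lborel" for n unfolding f_def[abs_def] by (intro bmeas_sum bmeas_times) auto
have lim: "(%n. \<integral>s. f (Suc n) s \<partial>lborel) ----> (LINT s|lborel. indicator {0..T} s * phi s)"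
proof (rule dominated_conv[OF _ _ iw])
 have "AE s in lborel. s ~: insert 0 (insert T D)" using D(1) by (intro AE_not_in finite_imp_null_set_lborel) auto
 then show "AE s in lborel. (%n. f (Suc n) s) ----> indicator {0..T} s * phi s"
 proof eventually_elim
  case (elim s)
  show ?case
  proof (cases "0 < s & s < T")
   case True
   let ?g = "%n. grid T (Suc n) (nat \<lfloor>s * real (Suc n) / T\<rfloor>)"
   have "(%n. ?g n - s) ----> 0"
   proof (rule Lim_null_comparison[OF _ LIMSEQ_Suc[OF lim_const_over_n[of T]]])
    show "EVN n. norm (?g n - s) <= T / real (Suc n)" using f_eq(2)[of "Suc _" s] True by (intro always_eventually allI) auto
   qed
   then have "?g ----> s" by (rule LIM_zero_cancel)
   moreover have "isCont phi s" using D(2)[of s] True elim by auto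
   ultimately have "(%n. phi (?g n)) ----> phi s" by (rule isCont_tendsto_compose[rotated])
   then show ?thesis using True f_eq(1)[of "Suc _" s] by simp
  next
   case False
   then show ?thesis using elim f_eq(1)[of "Suc _" s] by auto
  qed
 qed
 show "AE s in lborel. norm (f (Suc n) s) <= indicator {0..T} s * C" for n
  using f_eq[of "Suc n"] bnd C0 by (intro AE_I2) (auto simp: indicator_def)
qed (use m mf in auto)
then show "(%n. SUM k<n. T / n * phi (grid T n k)) ----> (LINT s|lborel. indicator {0..T} s * phi s)"
 unfolding int_f by (rule LIMSEQ_imp_Suc)
show "integrable lborel (%s. indicator {0..T} s * phi s)" by (rule bi_integrable_bound[OF iw]) (use m bnd C0 in "auto simp: indicator_def")
qed

context bm
begin

lemma simple_value_measurable:
assumes S: "simple_integrand P F (n, tau, xi)" and s: "0 <= s"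
shows "simple_value (n, tau, xi) s : bmeas (F s)"
proof -
have "(%om. if tau i < s & s <= tau (Suc i) then xi i om else 0) : bmeas (F s)" if "i < n" for i
proof (cases "tau i < s & s <= tau (Suc i)")
 case True
 have "xi i : bmeas (F (tau i))" using S that by (simp add: simple_integrand_def)
 then have "xi i : bmeas (F s)" by (rule F_mono[rotated]) (use True in simp)
 then show ?thesis using True by simp
qed auto
then show ?thesis unfolding simple_value_def by simp
qed

lemma simple_integrand_mono:
assumes "simple_integrand P F (n, tau, xi)" "i <= j" "j <= n"
shows "0 <= tau i" "tau i <= tau j"
proof -
have step: "!!i. i < n ==> tau i <= tau (Suc i)" and 0: "0 <= tau 0" using assms(1) by (auto simp: simple_integrand_def less_imp_le)
have mono: "tau i <= tau j" if "i <= j" "j <= n" for i j using that by (induction rule: dec_induct) (auto intro: order_trans[OF _ step])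
show "tau i <= tau j" using mono assms by blast
show "0 <= tau i" using mono[of 0 i] 0 assms by auto
qed

text \<open>The indicator of \<open>(tau i, tau (Suc i)]\<close> is the difference of the indicators
  of two half lines, and \<open>grid_cut_tendsto\<close> treats each of them.\<close>

lemma simple_integral_grid:
fixes xi :: "nat => 'w => 'e::euclidean_space"
assumes S: "simple_integrand P F (n, tau, xi)" and T: "0 < T" and w: "cont0 (%t. w t om)"
shows "(%N. SUM k<N. (e *. simple_value (n, tau, xi) (grid T N k) om) * (w (grid T N (Suc k)) om - w (grid T N k) om))
 ----> e *. simple_integral w (n, tau, xi) T om"
proof -
have wT: "continuous_on {0..T} (%t. w t om)" by (rule cont_subset[OF w]) auto
let ?c = "%t N. SUM k<N. if t < grid T N k then w (grid T N (Suc k)) om - w (grid T N k) om else 0"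
have lim: "(%N. (e *. xi i om) * (?c (tau i) N - ?c (tau (Suc i)) N)) ---->
  (e *. xi i om) * ((w T om - w (min T (tau i)) om) - (w T om - w (min T (tau (Suc i))) om))" if "i < n" for i
 using simple_integrand_mono[OF S, of i n] simple_integrand_mono[OF S, of "Suc i" n] that
 by (intro tendsto_intros grid_cut_tendsto[OF wT T]) auto
have "(%N. SUM i<n. (e *. xi i om) * (?c (tau i) N - ?c (tau (Suc i)) N)) ---->
  (SUM i<n. (e *. xi i om) * ((w T om - w (min T (tau i)) om) - (w T om - w (min T (tau (Suc i))) om)))" by (intro tendsto_sum lim) auto
moreover have "(SUM i<n. (e *. xi i om) * ((w T om - w (min T (tau i)) om) - (w T om - w (min T (tau (Suc i))) om)))
  = e *. simple_integral w (n, tau, xi) T om" by (simp add: simple_integral_def inner_sum_right mult.commute)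
moreover have "(SUM i<n. (e *. xi i om) * (?c (tau i) N - ?c (tau (Suc i)) N))
  = (SUM k<N. (e *. simple_value (n, tau, xi) (grid T N k) om) * (w (grid T N (Suc k)) om - w (grid T N k) om))" for N
proof -
 have "(SUM i<n. (e *. xi i om) * (?c (tau i) N - ?c (tau (Suc i)) N))
  = (SUM i<n. SUM k<N. (e *. (if tau i < grid T N k & grid T N k <= tau (Suc i) then xi i om else 0)) * (w (grid T N (Suc k)) om - w (grid T N k) om))"
 proof -
  have "(e *. xi i om) * ((if tau i < t then x else 0) - (if tau (Suc i) < t then x else 0))
   = (e *. (if tau i < t & t <= tau (Suc i) then xi i om else 0)) * x" if "i < n" for i t x
   using simple_integrand_mono(2)[OF S, of i "Suc i"] that by auto
  then show ?thesis unfolding sum_subtractf[symmetric] sum_distrib_left by (intro sum.cong refl) simp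
 qed
 also have "... = (SUM k<N. SUM i<n. (e *. (if tau i < grid T N k & grid T N k <= tau (Suc i) then xi i om else 0)) * (w (grid T N (Suc k)) om - w (grid T N k) om))"
  by (rule sum.swap)
 finally show ?thesis by (simp add: simple_value_def inner_sum_right sum_distrib_right)
qed
ultimately show ?thesis by simp
qed

text \<open>Relates the extended nonnegative integral in the definition of
  \<open>ito_integral\<close> to real sums over the grid, in which \<open>mt_truncation\<close> is
  stated.\<close>

lemma simple_L2_grid:
fixes xi :: "nat => 'w => 'e::euclidean_space"
assumes S: "simple_integrand P F (n, tau, xi)" and T: "0 < T" and H: "cont0 (%t. H t om)"
obtains L where "0 <= L" "(%N. SUM k<N. T / N * (norm (simple_value (n, tau, xi) (grid T N k) om - H (grid T N k) om))^2) ----> L"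
 "(\<integral>\<^sup>+s\<in>{0..T}. ennreal ((norm (simple_value (n, tau, xi) s om - H s om))^2) \<partial>lborel) = ennreal L"
proof -
let ?S = "%s. simple_value (n, tau, xi) s om"
define phi where "phi s = (norm (?S s - H s om))^2" for s
have HT: "continuous_on {0..T} (%t. H t om)" by (rule cont_subset[OF H]) auto
have Sn: "norm (?S s) <= (SUM i<n. norm (xi i om))" for s unfolding simple_value_def by (auto intro!: order_trans[OF norm_sum] sum_mono)
obtain CH where "ALL x:(%t. H t om) ` {0..T}. norm x <= CH"
 using compact_imp_bounded[OF compact_continuous_image[OF HT compact_Icc]] unfolding bounded_iff by blast
then have CH: "!!s. s : {0..T} ==> norm (H s om) <= CH" by simp
define C where "C = (SUM i<n. norm (xi i om)) + CH"
have "norm (?S s - H s om) <= C" if "s : {0..T}" for s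
 using norm_triangle_ineq4[of "?S s" "H s om"] Sn[of s] CH[OF that] by (simp add: C_def)
then have bnd: "abs (phi s) <= C^2" if "s : {0..T}" for s unfolding phi_def using that by (simp add: power_mono)
have m: "(%s. indicator {0..T} s * phi s) : bmeas borel"
proof -
 have Sm: "?S : bmeas borel" unfolding simple_value_def prod.case by measurable
 have "(%s. indicator {0..T} s *\<^sub>R H s om) : bmeas borel" by (rule borel_measurable_continuous_on_indicator[OF _ HT]) simp
 then have "(%s. indicator {0..T} s * (norm (?S s - indicator {0..T} s *\<^sub>R H s om))^2) : bmeas borel" using Sm by simp
 also have "(%s. indicator {0..T} s * (norm (?S s - indicator {0..T} s *\<^sub>R H s om))^2) = (%s. indicator {0..T} s * phi s)"
  by (auto simp: phi_def indicator_def)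
 finally show ?thesis .
qed
have cont: "continuous (at s) phi" if "s : {0<..<T}" "s ~: tau ` {..n}" for s
proof -
 have "continuous (at s) (%s. if tau i < s & s <= tau (Suc i) then xi i om else 0)" if "i < n" for i
 proof -
  have ne: "s ~= tau i" "s ~= tau (Suc i)" using \<open>s ~: tau ` {..n}\<close> that by auto
  have "\<forall>\<^sub>F r in nhds s. (tau i < r \<longleftrightarrow> tau i < s) & (r <= tau (Suc i) \<longleftrightarrow> s <= tau (Suc i))"
  proof (intro eventually_conj)
   have ev: "\<forall>\<^sub>F r in nhds s. a < r" if "a < s" for a using order_tendstoD(1)[OF filterlim_ident that] .
   have ev': "\<forall>\<^sub>F r in nhds s. r < a" if "s < a" for a using order_tendstoD(2)[OF filterlim_ident that] .
   show "\<forall>\<^sub>F r in nhds s. tau i < r \<longleftrightarrow> tau i < s"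
    using ev[of "tau i"] ev'[of "tau i"] ne(1) by (cases "tau i < s") (auto elim!: eventually_mono)
   show "\<forall>\<^sub>F r in nhds s. r <= tau (Suc i) \<longleftrightarrow> s <= tau (Suc i)"
    using ev[of "tau (Suc i)"] ev'[of "tau (Suc i)"] ne(2) by (cases "s < tau (Suc i)") (auto elim!: eventually_mono)
  qed
  then have "\<forall>\<^sub>F r in nhds s. (if tau i < r & r <= tau (Suc i) then xi i om else 0) = (if tau i < s & s <= tau (Suc i) then xi i om else 0)"
   by eventually_elim simp
  then show ?thesis using isCont_cong[of "%r. if tau i < r & r <= tau (Suc i) then xi i om else 0" "%_. if tau i < s & s <= tau (Suc i) then xi i om else 0" s] by simp
 qed
 then have "continuous (at s) ?S" unfolding simple_value_def by (auto intro!: continuous_sum)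
 moreover have "continuous (at s) (%t. H t om)" using continuous_on_interior[OF HT] that(1) by (simp add: interior_atLeastAtMost_real)
 ultimately show ?thesis unfolding phi_def by (intro continuous_intros)
qed
have R1: "(%N. SUM k<N. T / N * phi (grid T N k)) ----> (LINT s|lborel. indicator {0..T} s * phi s)"
 and R2: "integrable lborel (%s. indicator {0..T} s * phi s)" using riemann_sum_ae_continuous[OF T bnd m, of "tau ` {..n}"] cont by auto
have "(\<integral>\<^sup>+s\<in>{0..T}. ennreal (phi s) \<partial>lborel) = (\<integral>\<^sup>+s. ennreal (indicator {0..T} s * phi s) \<partial>lborel)"
 by (intro nn_integral_cong) (auto simp: indicator_def)
also have "... = ennreal (LINT s|lborel. indicator {0..T} s * phi s)" using R2 by (intro nn_integral_eq_integral) (auto simp: phi_def)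
finally have "(\<integral>\<^sup>+s\<in>{0..T}. ennreal (phi s) \<partial>lborel) = ennreal (LINT s|lborel. indicator {0..T} s * phi s)" .
moreover have "0 <= (LINT s|lborel. indicator {0..T} s * phi s)" by (rule Bochner_Integration.integral_nonneg) (simp add: phi_def)
ultimately show ?thesis using R1 by (intro that) (simp_all add: phi_def)
qed

text \<open>The Ito integral of a continuous integrand is the limit in probability of its left-point
 Riemann sums: the sums of a simple integrand converge pathwise, and the error of replacing the
 integrand is controlled, uniformly in the mesh, by truncation.\<close>

lemma ito_integral_RS:
fixes H I :: "real => 'w => 'e::euclidean_space"
assumes ito: "ito_integral P F (%t om. W t om $ l) H I" and e: "norm e <= 1" and T: "0 < T"
shows "in_prob (%n. RS (axis l 1) (%t om. e *. H t om) T n n) (%om. e *. I T om)"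
proof -
let ?w = "%t om. W t om $ l"
let ?N = "%y om. \<integral>\<^sup>+s\<in>{0..T}. ennreal ((norm (simple_value y s om - H s om))^2) \<partial>lborel"
 and ?D = "%y om. simple_integral ?w y T om - I T om"
have Hm: "!!t. 0 <= t ==> H t : bmeas (F t)" and Hc: "!!om. om : space P ==> cont0 (%t. H t om)"
 and Im: "I T : bmeas P" using ito T by (auto simp: ito_integral_def adapted_continuous_def)
obtain S where S: "!!m. simple_integrand P F (S m)"
 and S1: "!!eps. 0 < eps ==> (%m. measure P {om : space P. ennreal eps < ?N (S m) om}) ----> 0"
 and S2: "!!eps. 0 < eps ==> (%m. measure P {om : space P. eps < norm (?D (S m) om)}) ----> 0"
 using ito T unfolding ito_integral_def by (meson less_imp_le)
have g0: "0 <= grid T n i" for n i using T by (intro grid_nonneg) simp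
have adH: "adapted (%t om. e *. H t om)" using Hm by (simp add: adapted_def)
have Sm: "simple_value (S m) s : bmeas (F s)" if "0 <= s" for m s
 using simple_value_measurable[of "fst (S m)" "fst (snd (S m))" "snd (snd (S m))" s] S[of m] that by simp
have adS: "adapted (%t om. e *. simple_value (S m) t om)" for m using Sm by (simp add: adapted_def)
have axis: "axis l 1 *. inc s t om = ?w t om - ?w s om" for s t om by (simp add: inner_axis' inc_def)
have nax: "norm (axis l (1::real) :: real^'m) = 1" by (simp add: norm_eq_1 inner_axis_axis)
let ?R = "%n om. RS (axis l 1) (%t om. e *. H t om) T n n om"
let ?RS = "%m n om. RS (axis l 1) (%t om. e *. simple_value (S m) t om) T n n om"
have Rm: "?R n : bmeas P" "?RS m n : bmeas P" for n m using RS_measurable[OF adH] RS_measurable[OF adS] T by auto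
let ?Q = "%m n om. SUM k<n. T / n * (norm (simple_value (S m) (grid T n k) om - H (grid T n k) om))^2"
have Qm: "?Q m n : bmeas P" for m n
proof -
 note [measurable] = F_P[OF Sm[OF g0]] F_P[OF Hm[OF g0]]
 show ?thesis by measurable
qed
have "EX L. 0 <= L & (%n. ?Q m n om) ----> L &
  ?N (S m) om = ennreal L"
 if om: "om : space P" for m om
proof -
 obtain N t x where Seq: "S m = (N, t, x)" by (cases "S m") auto
 show ?thesis using simple_L2_grid[of N t x T H om, OF _ T Hc[OF om]] S[of m] unfolding Seq by blast
qed
note ex = this
\<comment> \<open>The real limit is chosen path by path; its measurability follows afterwards from
  \<open>?Q\<close>, whose pointwise limit it is.\<close>
define L where "L m om = (SOME L. 0 <= L & (%n. ?Q m n om) ----> L &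
  ?N (S m) om = ennreal L)" for m om
have L: "0 <= L m om" "(%n. ?Q m n om) ----> L m om"
  "?N (S m) om = ennreal (L m om)"
 if "om : space P" for m om using someI_ex[OF ex[OF that, of m]] unfolding L_def by blast+
have Lm [measurable]: "L m : bmeas P" for m by (rule bmeas_LIMSEQ[OF Qm L(2)])
have inQ: "in_prob (?Q m) (L m)" for m by (rule AE_in_prob[OF Qm Lm]) (use L(2) in auto)
let ?SI = "%m om. e *. simple_integral ?w (S m) T om"
have limS: "(%n. ?RS m n om) ----> ?SI m om" if "om : space P" for m om
proof -
 have "cont0 (%t. ?w t om)" using W_continuous[OF that] by (intro continuous_intros)
 then show ?thesis using simple_integral_grid[of "fst (S m)" "fst (snd (S m))" "snd (snd (S m))" T ?w om e] S[of m] T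
  unfolding RS_def axis by simp
qed
have SIm [measurable]: "?SI m : bmeas P" for m by (rule bmeas_LIMSEQ[OF Rm(2) limS])
have inS: "in_prob (?RS m) (?SI m)" for m by (rule AE_in_prob[OF Rm(2) SIm]) (use limS in auto)
\<comment> \<open>Valid for all meshes and all simple integrands. Only \<open>?Q\<close> depends on
  them, and it is small for a good \<open>m\<close> and then all large \<open>n\<close>.\<close>
have trunc: "prob {om : space P. eps < abs (?R n om - ?RS m n om)} <= K / eps^2 + prob {om : space P. K < ?Q m n om}"
 if n: "n > 0" and "eps > 0" "0 <= K" for eps K n m
proof -
 let ?G = "%i om. e *. H (grid T n i) om - e *. simple_value (S m) (grid T n i) om"
 let ?d = "%i om. simple_value (S m) (grid T n i) om - H (grid T n i) om"
  and ?c = "%i. (norm (axis l (1::real) :: real^'m))^2 * (grid T n (Suc i) - grid T n i)"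
 have Gm: "?G i : bmeas (F (grid T n i))" for i using Hm[OF g0] Sm[OF g0] by simp
 have t1: "prob {om : space P. eps < abs (SUM i<n. ?G i om * (axis l 1 *. dW (grid T n) i om))}
  <= K / eps^2 + prob {om : space P. K < (SUM i<n. (?G i om)^2 * ?c i)}"
  by (rule mt_truncation[where tau = "grid T n" and G = ?G, OF g0 grid_less[OF T n] _ Gm that(2,3)]) (simp add: axis_eq_0_iff)
 have eq: "(SUM i<n. ?G i om * (axis l 1 *. dW (grid T n) i om)) = ?R n om - ?RS m n om" for om
  by (simp add: RS_def sum_subtractf left_diff_distrib)
 have t2: "prob {om : space P. K < (SUM i<n. (?G i om)^2 * ?c i)}
  <= prob {om : space P. K < ?Q m n om}"
 proof (rule finite_measure_mono)
  have "(?G i om)^2 * ?c i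
   <= T / n * (norm (?d i om))^2" for i om
  proof -
   have "abs (?G i om) = abs (e *. (?d i om))" by (simp add: inner_diff_right)
   also have "... <= norm e * norm (?d i om)" by (rule Cauchy_Schwarz_ineq2)
   also have "... <= 1 * norm (?d i om)" using e by (intro mult_right_mono) auto
   finally have "(abs (?G i om))^2 <= (norm (?d i om))^2" by (intro power_mono) auto
   then have "(?G i om)^2 <= (norm (?d i om))^2" by simp
   from mult_left_mono[OF this, of "T / n"] show ?thesis using T unfolding grid_step nax by (simp add: mult.commute)
  qed
  then have le: "(SUM i<n. (?G i om)^2 * ?c i) <= ?Q m n om" for om by (rule sum_mono)
  show "{om : space P. K < (SUM i<n. (?G i om)^2 * ?c i)} <= {om : space P. K < ?Q m n om}" using less_le_trans[OF _ le] by blast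
 qed (use Qm in measurable)
 show ?thesis using t1 t2 unfolding eq by linarith
qed
show ?thesis unfolding in_prob_def
proof (intro conjI allI impI)
 fix eps' :: real assume "eps' > 0"
 define eps where "eps = eps' / 3"
 have eps: "eps > 0" using \<open>eps' > 0\<close> by (simp add: eps_def)
 show "(%n. prob {om : space P. eps' < abs (?R n om - e *. I T om)}) ----> 0"
 proof (rule tendstoI)
  fix d' :: real assume "d' > 0"
  \<comment> \<open>Five shares: the truncation inequality costs one for \<open>K / eps^2\<close>
    and two for \<open>?Q\<close> above \<open>K\<close>; the other two differences in the triangle
    inequality cost one each.\<close>
  define d where "d = d' / 5"
  have d: "d > 0" using \<open>d' > 0\<close> by (simp add: d_def)
  define K where "K = d * eps^2"
  have K: "K > 0" using d eps by (simp add: K_def)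
  have "EVN m. measure P {om : space P. ennreal (K/2) < ?N (S m) om} < d
    & measure P {om : space P. eps < norm (?D (S m) om)} < d"
   using order_tendstoD(2)[OF S1, of "K/2" d] order_tendstoD(2)[OF S2 d, of eps] K d eps by (intro eventually_conj) auto
  then obtain m where m1: "measure P {om : space P. ennreal (K/2) < ?N (S m) om} < d"
   and m2: "measure P {om : space P. eps < norm (?D (S m) om)} < d" by (auto simp: eventually_sequentially)
  have "{om : space P. ennreal (K/2) < ?N (S m) om} = {om : space P. K/2 < L m om}" using L(3)[of _ m] K by (auto simp: ennreal_less_iff)
  with m1 have p1: "prob {om : space P. K/2 < L m om} < d" by simp
  have p2: "prob {om : space P. eps < abs (?SI m om - e *. I T om)} < d"
  proof -
   have SInm: "simple_integral ?w (S m) T : bmeas P"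
   proof -
    obtain N t x where Seq: "S m = (N, t, x)" by (cases "S m") auto
    have "t i >= 0 & t (Suc i) >= 0 & x i : bmeas P" if "i < N" for i
     using simple_integrand_mono[of N t x i N] simple_integrand_mono[of N t x "Suc i" N] S[of m] that F_P[of "x i" "t i"]
     by (auto simp: Seq simple_integrand_def)
    moreover have "?w u : bmeas P" if "0 <= u" for u using bmeas_inner[OF bmeas_const F_P[OF W_measurable[OF that]], of "axis l 1"]
     by (simp add: inner_axis')
    ultimately show ?thesis unfolding Seq simple_integral_def prod.case using T by (intro bmeas_sum bmeas_scaleR bmeas_diff) auto
   qed
   have "abs (?SI m om - e *. I T om) <= norm (?D (S m) om)" for om using Cauchy_Schwarz_ineq2[of e "?D (S m) om"]
     mult_right_mono[OF e norm_ge_zero[of "?D (S m) om"]] by (simp add: inner_diff_right)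
   then have "prob {om : space P. eps < abs (?SI m om - e *. I T om)} <= prob {om : space P. eps < norm (?D (S m) om)}"
    using SInm Im by (intro finite_measure_mono) (auto intro: less_le_trans)
   then show ?thesis using m2 by linarith
  qed
  have "EVN n. prob {om : space P. K/2 < abs (?Q m n om - L m om)} < d" by (rule in_probD[OF inQ half_gt_zero[OF K] d])
  moreover have "EVN n. prob {om : space P. eps < abs (?RS m n om - ?SI m om)} < d" by (rule in_probD[OF inS eps d])
  moreover have "EVN n. n > (0::nat)" by (rule eventually_gt_at_top)
  ultimately show "EVN n. dist (prob {om : space P. eps' < abs (?R n om - e *. I T om)}) 0 < d'"
  proof eventually_elim
   case (elim n)
   note [measurable] = Rm Qm Im
   have q: "prob {om : space P. K < ?Q m n om} <= prob {om : space P. K/2 < abs (?Q m n om - L m om)} + prob {om : space P. K/2 < L m om}"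
   proof -
    have "K/2 < abs (q - x) | K/2 < x" if "K < q" for q x :: real using that abs_ge_self[of "q - x"] by (cases "K/2 < x") auto
    then have "{om : space P. K < ?Q m n om} <= {om : space P. K/2 < abs (?Q m n om - L m om)} Un {om : space P. K/2 < L m om}" by blast
    then have "prob {om : space P. K < ?Q m n om} <= prob ({om : space P. K/2 < abs (?Q m n om - L m om)} Un {om : space P. K/2 < L m om})"
     by (rule finite_measure_mono) measurable
    also have "... <= prob {om : space P. K/2 < abs (?Q m n om - L m om)} + prob {om : space P. K/2 < L m om}"
     by (rule measure_Un_le) measurable
    finally show ?thesis .
   qed
   have t: "prob {om : space P. eps < abs (?R n om - ?RS m n om)} <= d + prob {om : space P. K < ?Q m n om}"
    using trunc[OF elim(3) eps less_imp_le[OF K], of m] eps by (simp add: K_def)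
   let ?A = "{om : space P. eps < abs (?R n om - ?RS m n om)}" and ?B = "{om : space P. eps < abs (?RS m n om - ?SI m om)}"
    and ?C = "{om : space P. eps < abs (?SI m om - e *. I T om)}"
   have tri: "eps < abs (x - y) | eps < abs (y - s) | eps < abs (s - i)" if "eps' < abs (x - i)" for x y s i :: real
   proof (rule ccontr)
    assume "~ ?thesis"
    then have "abs (x - y) <= eps" "abs (y - s) <= eps" "abs (s - i) <= eps" by auto
    then show False using that unfolding eps_def by linarith
   qed
   have "{om : space P. eps' < abs (?R n om - e *. I T om)} <= ?A Un ?B Un ?C" using tri by blast
   then have "prob {om : space P. eps' < abs (?R n om - e *. I T om)} <= prob (?A Un ?B Un ?C)" by (rule finite_measure_mono) measurable
   also have "... <= prob (?A Un ?B) + prob ?C" by (rule measure_Un_le) measurable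
   also have "prob (?A Un ?B) <= prob ?A + prob ?B" by (rule measure_Un_le) measurable
   finally have "prob {om : space P. eps' < abs (?R n om - e *. I T om)} < 5 * d" using t q elim(1,2) p1 p2 by linarith
   then show ?case by (simp add: d_def)
  qed
 qed
qed (use Rm Im in auto)
qed

end


section \<open>The oscillator along a fixed path\<close>

text \<open>Writing \<open>z = \<phi> + i \<phi>'\<close> and \<open>w = \<langle>\<gamma>, W\<rangle>\<close>, the shifted velocity \<open>u = z - i w \<phi>\<close> is continuously
 differentiable, since \<open>\<phi>\<close> is. This turns the stochastic equation into an integral equation that makes
 sense for every continuous path, and the Euler-Maruyama scheme of the former into an Euler scheme of
 the latter.\<close>

locale params =
fixes A :: "real^'d^'d" and B :: "real^'m^'d" and a :: "real^'d" and gamma :: "real^'m" and kappa zeta :: real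
begin

definition osc_drift :: "real^'d => complex => complex" where
"osc_drift v z = Complex (Im z) (- 2 * zeta * Im z - (kappa^2 - a *. v) * Re z)"

definition shear :: "real => complex => complex" where
"shear w u = Complex (Re u) (Im u + w * Re u)"

text \<open>The time derivative of the shifted variable, written in terms of \<open>z\<close>. In
  the product rule for \<open>\<phi>' - w \<phi>\<close> the term \<open>\<phi> dw\<close> cancels
  the noise and \<open>- w \<phi>' dt\<close> remains; there is no second-order term since
  \<open>\<phi>\<close> is differentiable.\<close>

definition rde_drift :: "real => real^'d => complex => complex" where
"rde_drift w v z = Complex (Im z) (- 2 * zeta * Im z - (kappa^2 - a *. v) * Re z - w * Im z)"

text \<open>Normalized to vanish at time 0, so that the equation takes the same form when restarted
  at a later time.\<close>

definition driver :: "(real => real^'m) => real => real" where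
"driver W t = gamma *. (W t - W 0)"

definition osc_path :: "(real => real^'m) => (real => real^'d) => (real => complex) => bool" where
"osc_path W v z \<longleftrightarrow> cont0 v & cont0 z &
  (ALL t>=0. v t = v 0 + itg t (%s. A *v v s) + B *v (W t - W 0)) &
  (ALL t>=0. shear (- driver W t) (z t) = z 0 + itg t (%s. rde_drift (driver W s) (v s) (z s)))"

definition drift_bound :: "real^'d => real" where
"drift_bound v = 1 + 2 * abs zeta + kappa^2 + norm a * norm v"

section \<open>Algebra and bounds for the shear and the drift\<close>

lemma complex_norm_le: "norm z <= abs (Re z) + abs (Im z)"
by (rule cmod_le)

lemma shear_shear: "shear w (shear w' u) = shear (w + w') u"
by (simp add: shear_def algebra_simps)

lemma shear_0 [simp]: "shear 0 u = u"
by (simp add: shear_def)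

lemma shear_diff: "shear w u - shear w u' = shear w (u - u')"
by (simp add: shear_def complex_eq_iff algebra_simps)

lemma norm_shear: "norm (shear w u) <= (1 + abs w) * norm u"
proof -
have "shear w u = u + Complex 0 (w * Re u)" by (simp add: shear_def complex_eq_iff)
then have "norm (shear w u) <= norm u + norm (Complex 0 (w * Re u))" by (simp add: norm_triangle_ineq)
also have "norm (Complex 0 (w * Re u)) <= abs w * norm u"
 using mult_left_mono[OF abs_Re_le_cmod[of u], of "abs w"] by (simp add: complex_norm abs_mult)
finally show ?thesis by (simp add: algebra_simps)
qed

lemma rde_drift_diff: "rde_drift w v z - rde_drift w v z' = rde_drift w v (z - z')"
by (simp add: rde_drift_def complex_eq_iff algebra_simps)

lemma norm_rde_drift: "norm (rde_drift w v z) <= (drift_bound v + abs w) * norm z"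
proof -
have "norm (rde_drift w v z) <= abs (Im z) + abs (- 2 * zeta * Im z - (kappa^2 - a *. v) * Re z - w * Im z)"
 using complex_norm_le[of "rde_drift w v z"] by (simp add: rde_drift_def)
also have "... <= abs (Im z) + (2 * abs zeta * abs (Im z) + abs (kappa^2 - a *. v) * abs (Re z) + abs w * abs (Im z))"
proof -
 have "abs (x - y - z) <= abs x + abs y + abs z" for x y z :: real by linarith
 from this[of "- 2 * zeta * Im z" "(kappa^2 - a *. v) * Re z" "w * Im z"] show ?thesis by (simp add: abs_mult)
qed
also have "... <= norm z + (2 * abs zeta * norm z + (kappa^2 + norm a * norm v) * norm z + abs w * norm z)"
proof -
 have "abs (kappa^2 - a *. v) <= kappa^2 + norm a * norm v"
  using Cauchy_Schwarz_ineq2[of a v] by (simp add: abs_le_iff) (smt (verit) zero_le_power2)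
 then show ?thesis by (intro add_mono mult_mono) (auto simp: abs_Im_le_cmod abs_Re_le_cmod)
qed
finally show ?thesis by (simp add: drift_bound_def algebra_simps)
qed

lemma norm_rde_drift_diff:
"norm (rde_drift w v z - rde_drift w' v' z') <=
  (drift_bound v + abs w) * norm (z - z') + norm a * norm (v - v') * norm z' + abs (w - w') * norm z'"
proof -
have "rde_drift w v z - rde_drift w' v' z' = rde_drift w v (z - z') + (Complex 0 ((a *. (v - v')) * Re z') + Complex 0 (- (w - w') * Im z'))"
 by (simp add: rde_drift_def complex_eq_iff algebra_simps)
also have "norm ... <= norm (rde_drift w v (z - z')) + (norm (Complex 0 ((a *. (v - v')) * Re z')) + norm (Complex 0 (- (w - w') * Im z')))"
 by (intro order_trans[OF norm_triangle_ineq] add_left_mono norm_triangle_ineq)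
also have "norm (Complex 0 ((a *. (v - v')) * Re z')) <= norm a * norm (v - v') * norm z'"
 using mult_mono[OF Cauchy_Schwarz_ineq2[of a "v - v'"] abs_Re_le_cmod[of z']] by (simp add: complex_norm abs_mult)
also have "norm (Complex 0 (- (w - w') * Im z')) <= abs (w - w') * norm z'"
 using mult_left_mono[OF abs_Im_le_cmod[of z'], of "abs (w - w')"] by (simp add: complex_norm abs_mult abs_minus_commute)
finally show ?thesis using norm_rde_drift[of w v "z - z'"] by simp
qed

lemma continuous_on_shear:
"continuous_on S w ==> continuous_on S u ==> continuous_on S (%t. shear (w t) (u t))"
unfolding shear_def Complex_eq by (intro continuous_intros)

lemma continuous_on_rde_drift:
"continuous_on S w ==> continuous_on S v ==> continuous_on S z ==> continuous_on S (%t. rde_drift (w t) (v t) (z t))"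
unfolding rde_drift_def Complex_eq by (intro continuous_intros)

lemma continuous_on_driver: "cont0 W ==> cont0 (driver W)"
unfolding driver_def[abs_def] by (intro continuous_intros)

lemma matrix_bound: "EX K>=0. ALL x. norm ((M :: real^'n^'k) *v x) <= K * norm x"
proof -
obtain K where "K > 0" "!!x. norm (M *v x) <= K * norm x" using linear_bounded_pos[OF matrix_vector_mul_linear[of M]] by blast
then show ?thesis by (intro exI[of _ K]) simp
qed

lemma continuous_on_mat:
assumes "continuous_on S v"
shows "continuous_on S (%t. (M :: real^'n^'k) *v v t)"
by (rule bounded_linear.continuous_on[OF matrix_vector_mul_bounded_linear assms])

lemma bounded_on_Icc:
assumes "cont0 (x :: real => 'b::real_normed_vector)"
obtains K where "K >= 0" "!!t. t : {0..T} ==> norm (x t) <= K"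
proof -
have "continuous_on {0..T} x" using assms by (rule cont_subset) auto
then have "bounded (x ` {0..T})" by (rule compact_imp_bounded[OF compact_continuous_image[OF _ compact_Icc]])
then obtain K where "K > 0" "ALL y:x ` {0..T}. norm y <= K" unfolding bounded_pos by blast
then show ?thesis by (intro that[of K]) auto
qed

section \<open>Existence, dependence on the initial value, restarts and zeros of the path\<close>

lemma osc_path_exists:
assumes W: "cont0 W"
obtains v z where "osc_path W v z" "v 0 = v0" "z 0 = z0"
proof -
obtain K where K: "K >= 0" "!!x. norm (A *v x) <= K * norm x" using matrix_bound by blast
let ?b = "%t. B *v (W t - W 0)"
have bc: "cont0 ?b" by (intro continuous_on_mat continuous_intros W)
\<comment> \<open>Subtracting the noise leaves an ordinary integral equation for
  \<open>y = v - B (W - W 0)\<close>.\<close>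
obtain y where yc: "cont0 y" and y: "!!t. t >= 0 ==> y t = v0 + itg t (%s. A *v (y s + ?b s))"
proof (rule picard_exists[where ?x0.0 = v0])
 show "EX L. ALL t:{0..T}. ALL x y. norm (A *v (x + ?b t) - A *v (y + ?b t)) <= L * norm (x - y)" for T
  using K(2) by (intro exI[of _ K]) (simp add: matrix_vector_mult_diff_distrib[symmetric])
 show "cont0 (%t. A *v (x t + ?b t))" if "cont0 x" for x by (intro continuous_on_mat continuous_on_add that bc)
 fix y assume "cont0 y" "!!t. t >= 0 ==> y t = v0 + itg t (%s. A *v (y s + ?b s))"
 then show thesis by (rule that)
qed
define v where "v t = y t + ?b t" for t
have vc: "cont0 v" unfolding v_def by (intro continuous_on_add yc bc)
have v: "v t = v 0 + itg t (%s. A *v v s) + ?b t" if "t >= 0" for t using y[OF that] y[of 0] by (simp add: v_def)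
have wc: "cont0 (driver W)" by (rule continuous_on_driver[OF W])
obtain u where uc: "cont0 u"
 and u: "!!t. t >= 0 ==> u t = z0 + itg t (%s. rde_drift (driver W s) (v s) (shear (driver W s) (u s)))"
proof (rule picard_exists[where ?x0.0 = z0])
 fix T :: real
 obtain V where V: "V >= 0" "!!t. t : {0..T} ==> norm (v t) <= V" using bounded_on_Icc[OF vc] by blast
 obtain w where w: "w >= 0" "!!t. t : {0..T} ==> norm (driver W t) <= w" using bounded_on_Icc[OF wc] by blast
 have "norm (rde_drift (driver W t) (v t) (shear (driver W t) x) - rde_drift (driver W t) (v t) (shear (driver W t) y))
   <= ((1 + 2 * abs zeta + kappa^2 + norm a * V) + w) * (1 + w) * norm (x - y)" if t: "t : {0..T}" for t x y
 proof -
  have "norm (rde_drift (driver W t) (v t) (shear (driver W t) (x - y)))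
   <= (drift_bound (v t) + abs (driver W t)) * ((1 + abs (driver W t)) * norm (x - y))"
   by (intro order_trans[OF norm_rde_drift] mult_left_mono norm_shear) (simp add: drift_bound_def)
  also have "... <= ((1 + 2 * abs zeta + kappa^2 + norm a * V) + w) * ((1 + w) * norm (x - y))"
   using V(2)[OF t] w(2)[OF t] V(1) w(1) unfolding drift_bound_def by (intro mult_mono add_mono mult_left_mono) auto
  finally show ?thesis by (simp add: rde_drift_diff shear_diff mult.assoc)
 qed
 then show "EX L. ALL t:{0..T}. ALL x y. norm (rde_drift (driver W t) (v t) (shear (driver W t) x) - rde_drift (driver W t) (v t) (shear (driver W t) y)) <= L * norm (x - y)"
  by blast
next
 show "cont0 (%t. rde_drift (driver W t) (v t) (shear (driver W t) (x t)))" if "cont0 x" for x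
  by (intro continuous_on_rde_drift continuous_on_shear that wc vc)
 fix u assume "cont0 u"
  "!!t. t >= 0 ==> u t = z0 + itg t (%s. rde_drift (driver W s) (v s) (shear (driver W s) (u s)))"
 then show thesis by (rule that)
qed
define z where "z t = shear (driver W t) (u t)" for t
have zc: "cont0 z" unfolding z_def by (intro continuous_on_shear wc uc)
have z0: "z 0 = z0" using u[of 0] by (simp add: z_def driver_def)
have "shear (- driver W t) (z t) = z 0 + itg t (%s. rde_drift (driver W s) (v s) (z s))" if "t >= 0" for t
 using u[OF that] z0 by (simp add: z_def shear_shear)
then have "osc_path W v z" using vc zc v unfolding osc_path_def by blast
moreover have "v 0 = v0" using y[of 0] by (simp add: v_def)
ultimately show ?thesis using z0 by (rule that)
qed

text \<open>The constant depends on the reference path alone: a competitor starting within distance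
  1 has \<open>v'\<close> within \<open>E\<close> of \<open>v\<close>, which bounds its drift. The
  component \<open>v\<close> can be treated first, as its equation does not involve
  \<open>z\<close>.\<close>

lemma osc_path_dependence:
assumes X: "osc_path W v z" and W: "cont0 W" and T: "0 <= T"
obtains C where "C >= 0"
 "!!v' z' t. osc_path W v' z' ==> norm (v' 0 - v 0) + norm (z' 0 - z 0) <= 1 ==> t : {0..T} ==>
   norm (v' t - v t) + norm (z' t - z t) <= C * (norm (v' 0 - v 0) + norm (z' 0 - z 0))"
proof -
have vc: "cont0 v" and zc: "cont0 z" using X by (auto simp: osc_path_def)
have wc: "cont0 (driver W)" by (rule continuous_on_driver[OF W])
obtain K where K: "K >= 0" "!!x. norm (A *v x) <= K * norm x" using matrix_bound by blast
obtain V where V: "V >= 0" "!!t. t : {0..T} ==> norm (v t) <= V" using bounded_on_Icc[OF vc] by blast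
obtain Z where Z: "Z >= 0" "!!t. t : {0..T} ==> norm (z t) <= Z" using bounded_on_Icc[OF zc] by blast
obtain w where w: "w >= 0" "!!t. t : {0..T} ==> norm (driver W t) <= w" using bounded_on_Icc[OF wc] by blast
define E where "E = exp (K * T)"
define L where "L = ((1 + 2 * abs zeta + kappa^2 + norm a * (V + E)) + w) * (1 + w)"
define C where "C = E + (1 + w) * ((1 + norm a * E * Z * T) * exp (L * T))"
have E0: "E > 0" by (simp add: E_def)
have L0: "L >= 0" using V(1) w(1) E0 by (simp add: L_def)
have sub: "{0..T} <= {0..}" by auto
show ?thesis
proof (rule that)
 show "C >= 0" using E0 w(1) Z(1) T by (simp add: C_def)
 fix v' z' t
 assume X': "osc_path W v' z'" and d1: "norm (v' 0 - v 0) + norm (z' 0 - z 0) <= 1" and t: "t : {0..T}"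
 define d where "d = norm (v' 0 - v 0) + norm (z' 0 - z 0)"
 have v'c: "cont0 v'" and z'c: "cont0 z'" using X' by (auto simp: osc_path_def)
 have d: "norm (v' 0 - v 0) <= d" "norm (z' 0 - z 0) <= d" "d <= 1" "0 <= d" using d1 by (auto simp: d_def)
 have dv: "norm (v' t - v t) <= E * d" if t: "t : {0..T}" for t
 proof -
  let ?b = "%t. B *v (W t - W 0)"
  have "norm ((v' t - ?b t) - (v t - ?b t)) <= (norm (v' 0 - v 0) + 0 * T) * exp (K * t)"
  proof (rule integral_eq_perturbation[OF _ _ _ _ K(1) order_refl _ t])
   show "continuous_on {0..T} (%s. A *v v' s)" "continuous_on {0..T} (%s. A *v v s)"
    by (intro continuous_on_mat cont_subset[OF v'c sub] cont_subset[OF vc sub])+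
   fix s assume s: "s : {0..T}"
   then have s0: "s >= 0" by simp
   have e1: "v' s = v' 0 + itg s (%s. A *v v' s) + ?b s" using X' s0 unfolding osc_path_def by blast
   show "v' s - ?b s = v' 0 + itg s (%s. A *v v' s)" by (subst e1) simp
   have e2: "v s = v 0 + itg s (%s. A *v v s) + ?b s" using X s0 unfolding osc_path_def by blast
   show "v s - ?b s = v 0 + itg s (%s. A *v v s)" by (subst e2) simp
   show "norm (A *v v' s - A *v v s) <= K * norm ((v' s - ?b s) - (v s - ?b s)) + 0"
    using K(2)[of "v' s - v s"] by (simp add: matrix_vector_mult_diff_distrib)
  qed
  also have "... <= d * exp (K * T)" using d t K(1) by (intro mult_mono) (auto intro: mult_left_mono)
  finally show ?thesis by (simp add: E_def mult.commute)
 qed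
 have V': "norm (v' s) <= V + E" if "s : {0..T}" for s
 proof -
  have "norm (v' s) <= norm (v s) + norm (v' s - v s)" using norm_triangle_ineq[of "v s" "v' s - v s"] by simp
  also have "... <= V + E * d" by (intro add_mono V dv that)
  also have "E * d <= E * 1" using d E0 by (intro mult_left_mono) auto
  finally show ?thesis by simp
 qed
 let ?u = "%t. shear (- driver W t) (z t)" and ?u' = "%t. shear (- driver W t) (z' t)"
 have zu: "norm (z' s - z s) <= (1 + w) * norm (?u' s - ?u s)" if s: "s : {0..T}" for s
 proof -
  have "z' s - z s = shear (driver W s) (?u' s - ?u s)" by (simp add: shear_diff shear_shear)
  then have "norm (z' s - z s) <= (1 + abs (driver W s)) * norm (?u' s - ?u s)" using norm_shear by metis
  also have "... <= (1 + w) * norm (?u' s - ?u s)" using w(2)[OF s] by (intro mult_right_mono) auto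
  finally show ?thesis .
 qed
 have du: "norm (?u' t - ?u t) <= (norm (z' 0 - z 0) + (norm a * (E * d) * Z) * T) * exp (L * t)"
 proof (rule integral_eq_perturbation[OF _ _ _ _ L0 _ _ t])
  show "continuous_on {0..T} (%s. rde_drift (driver W s) (v' s) (z' s))" "continuous_on {0..T} (%s. rde_drift (driver W s) (v s) (z s))"
   by (intro continuous_on_rde_drift cont_subset[OF _ sub] wc v'c z'c vc zc)+
  show "0 <= norm a * (E * d) * Z" using E0 d Z(1) by simp
  fix s assume s: "s : {0..T}"
  then have s0: "s >= 0" by simp
  show "?u' s = z' 0 + itg s (%s. rde_drift (driver W s) (v' s) (z' s))" using X' s0 unfolding osc_path_def by blast
  show "?u s = z 0 + itg s (%s. rde_drift (driver W s) (v s) (z s))" using X s0 unfolding osc_path_def by blast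
  have "norm (rde_drift (driver W s) (v' s) (z' s) - rde_drift (driver W s) (v s) (z s))
   <= (drift_bound (v' s) + abs (driver W s)) * norm (z' s - z s) + norm a * norm (v' s - v s) * norm (z s) + abs (driver W s - driver W s) * norm (z s)"
   by (rule norm_rde_drift_diff)
  also have "... <= ((1 + 2 * abs zeta + kappa^2 + norm a * (V + E)) + w) * ((1 + w) * norm (?u' s - ?u s)) + norm a * (E * d) * Z + 0 * norm (z s)"
   using V'[OF s] w(2)[OF s] V(1) E0 w(1) Z(2)[OF s] dv[OF s] d unfolding drift_bound_def
   by (intro add_mono mult_mono mult_left_mono zu[OF s]) auto
  finally show "norm (rde_drift (driver W s) (v' s) (z' s) - rde_drift (driver W s) (v s) (z s)) <= L * norm (?u' s - ?u s) + norm a * (E * d) * Z"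
   by (simp add: L_def mult.assoc)
 qed
 also have "... <= (d + (norm a * (E * d) * Z) * T) * exp (L * T)"
  using d t L0 T E0 Z(1) by (intro mult_mono add_mono) (auto intro: mult_left_mono)
 also have "... = d * ((1 + norm a * E * Z * T) * exp (L * T))"
 proof -
  have "(x + (n * (y * x) * q) * p) * r = x * ((1 + n * y * q * p) * r)" for x n y q p r :: real by (simp add: algebra_simps)
  then show ?thesis .
 qed
 finally have du2: "norm (?u' t - ?u t) <= d * ((1 + norm a * E * Z * T) * exp (L * T))" .
 have "norm (z' t - z t) <= (1 + w) * (d * ((1 + norm a * E * Z * T) * exp (L * T)))"
  by (rule order_trans[OF zu[OF t] mult_left_mono[OF du2]]) (use w(1) in simp)
 then show "norm (v' t - v t) + norm (z' t - z t) <= C * (norm (v' 0 - v 0) + norm (z' 0 - z 0))"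
  using dv[OF t] unfolding d_def[symmetric] C_def by (simp add: algebra_simps)
qed
qed

lemma osc_path_unique:
assumes "osc_path W v z" "osc_path W v' z'" "cont0 W" "v' 0 = v 0" "z' 0 = z 0" "0 <= t"
shows "v' t = v t" "z' t = z t"
proof -
obtain C where C: "!!v' z' s. osc_path W v' z' ==> norm (v' 0 - v 0) + norm (z' 0 - z 0) <= 1 ==> s : {0..t} ==>
   norm (v' s - v s) + norm (z' s - z s) <= C * (norm (v' 0 - v 0) + norm (z' 0 - z 0))" using osc_path_dependence[OF assms(1,3,6)] by metis
have "norm (v' t - v t) + norm (z' t - z t) <= 0" using C[OF assms(2), of t] assms(4-6) by simp
then show "v' t = v t" "z' t = z t"
 using norm_ge_zero[of "v' t - v t"] norm_ge_zero[of "z' t - z t"] by (smt (verit) norm_eq_zero right_minus_eq)+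
qed

lemma osc_path_Re:
assumes X: "osc_path W v z" and W: "cont0 W" and t: "0 <= t"
shows "Re (z t) = Re (z 0) + itg t (%s. Im (z s))"
proof -
have vc: "cont0 v" and zc: "cont0 z" using X by (auto simp: osc_path_def)
let ?r = "%s. rde_drift (driver W s) (v s) (z s)"
have i: "?r integrable_on {0..t}" by (intro cont_integrable continuous_on_rde_drift cont_subset[OF continuous_on_driver[OF W]]
  cont_subset[OF vc] cont_subset[OF zc]) auto
have "Re (z t) = Re (shear (- driver W t) (z t))" by (simp add: shear_def)
also have "... = Re (z 0) + Re (itg t ?r)" using X t by (simp add: osc_path_def)
also have "Re (itg t ?r) = itg t (%s. Re (?r s))" using integral_linear[OF i bounded_linear_Re] by (simp add: o_def)
finally show ?thesis by (simp add: rde_drift_def)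
qed

text \<open>Restarting at \<open>s\<close> subtracts the constant \<open>driver W s\<close> from the
  driver. This changes both the shear and the drift, and the changes cancel because
  \<open>Re z\<close> is the integral of \<open>Im z\<close>.\<close>

lemma osc_path_shift:
assumes X: "osc_path W v z" and W: "cont0 W" and s: "0 <= s"
shows "osc_path (%t. W (s + t)) (%t. v (s + t)) (%t. z (s + t))"
proof -
have vc: "cont0 v" and zc: "cont0 z" using X by (auto simp: osc_path_def)
have sc: "cont0 (%t. f (s + t))" if "cont0 f" for f :: "real => 'e::topological_space"
 by (rule cont_compose[OF that]) (use s in "auto intro!: continuous_intros")
have split: "itg (s + t) f = itg s f + itg t (%r. f (s + r))"
 if "cont0 f" "0 <= t" for f :: "real => 'e::euclidean_space" and t
proof -
 have c: "continuous_on {0..s + t} f" "continuous_on {s..s + t} f" using s by (auto intro: cont_subset[OF that(1)])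
 have "itg s f + integral {s..s + t} f = itg (s + t) f" using s that(2) by (intro hk_combine cont_integrable c) auto
 moreover have "itg t (%r. f (s + r)) = integral {s..s + t} f" using integral_shift[of 0 s t f] c(2) by (simp add: o_def add.commute)
 ultimately show ?thesis by simp
qed
have 1: "v (s + t) = v (s + 0) + itg t (%r. A *v v (s + r)) + B *v (W (s + t) - W (s + 0))" if t: "t >= 0" for t
proof -
 have e: "v t = v 0 + itg t (%s. A *v v s) + B *v (W t - W 0)" if "t >= 0" for t using X that unfolding osc_path_def by blast
 have "B *v (W (s + t) - W 0) = B *v (W s - W 0) + B *v (W (s + t) - W s)" by (simp add: matrix_vector_right_distrib[symmetric])
 then show ?thesis using e[of "s + t"] e[of s] split[OF continuous_on_mat[OF vc] t, of A] s t by simp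
qed
have 2: "shear (- driver (%t. W (s + t)) t) (z (s + t)) = z (s + 0) + itg t (%r. rde_drift (driver (%t. W (s + t)) r) (v (s + r)) (z (s + r)))"
 if t: "t >= 0" for t
proof -
 let ?w = "driver W" and ?w' = "driver (%t. W (s + t))"
 let ?r = "%s. rde_drift (?w s) (v s) (z s)"
 have w': "?w' r = ?w (s + r) - ?w s" for r by (simp add: driver_def inner_diff_right)
 have rc: "cont0 ?r" by (intro continuous_on_rde_drift continuous_on_driver W vc zc)
 have e: "shear (- ?w t) (z t) = z 0 + itg t ?r" if "t >= 0" for t using X that unfolding osc_path_def by blast
 have u: "shear (- ?w (s + t)) (z (s + t)) - shear (- ?w s) (z s) = itg t (%r. ?r (s + r))"
  using e[of "s + t"] e[of s] split[OF rc t] s t by simp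
 have Re': "Re (z (s + t)) - Re (z s) = itg t (%r. Im (z (s + r)))"
  using osc_path_Re[OF X W, of "s + t"] osc_path_Re[OF X W s] split[OF continuous_on_Im[OF zc] t] s t by simp
 have ii: "(%r. ?r (s + r)) integrable_on {0..t}" by (intro cont_integrable cont_subset[OF sc[OF rc]]) auto
 have ij: "(%r. Complex 0 (?w s * Im (z (s + r)))) integrable_on {0..t}"
  unfolding Complex_eq by (intro cont_integrable continuous_intros cont_subset[OF sc[OF zc]]) auto
 have ik: "(%r. Im (z (s + r))) integrable_on {0..t}" by (intro cont_integrable continuous_intros cont_subset[OF sc[OF zc]]) auto
 have J: "itg t (%r. Complex 0 (?w s * Im (z (s + r)))) = Complex 0 (?w s * (Re (z (s + t)) - Re (z s)))"
 proof -
  have "linear (%x. Complex 0 (?w s * x))" by (rule linearI) (simp_all add: complex_eq_iff algebra_simps)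
  then have "bounded_linear (%x. Complex 0 (?w s * x))" by (simp add: linear_conv_bounded_linear)
  from integral_linear[OF ik this] show ?thesis by (simp add: o_def Re')
 qed
 have "rde_drift (?w' r) (v (s + r)) (z (s + r)) = ?r (s + r) + Complex 0 (?w s * Im (z (s + r)))" for r
  unfolding w' by (simp add: rde_drift_def complex_eq_iff algebra_simps)
 then have "itg t (%r. rde_drift (?w' r) (v (s + r)) (z (s + r)))
  = itg t (%r. ?r (s + r)) + Complex 0 (?w s * (Re (z (s + t)) - Re (z s)))" using hk_add[OF ii ij] J by simp
 then show ?thesis unfolding u[symmetric] w' by (simp add: shear_def complex_eq_iff algebra_simps)
qed
show ?thesis unfolding osc_path_def using sc[OF vc] sc[OF zc] 1 2 by simp
qed

lemma osc_path_scale: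
assumes X: "osc_path W v z"
shows "osc_path W v (%t. c *\<^sub>R z t)"
proof -
have "shear x (c *\<^sub>R y) = c *\<^sub>R shear x y" "rde_drift x v (c *\<^sub>R y) = c *\<^sub>R rde_drift x v y" for x y v
 by (simp_all add: shear_def rde_drift_def complex_eq_iff algebra_simps)
note lin = this
have e: "shear (- driver W t) (z t) = z 0 + itg t (%s. rde_drift (driver W s) (v s) (z s))" if "t >= 0" for t
 using X that unfolding osc_path_def by blast
have "shear (- driver W t) (c *\<^sub>R z t) = c *\<^sub>R z 0 + itg t (%s. rde_drift (driver W s) (v s) (c *\<^sub>R z s))" if "t >= 0" for t
 unfolding lin e[OF that] scaleR_add_right Henstock_Kurzweil_Integration.integral_cmul ..
moreover have "cont0 (%t. c *\<^sub>R z t)" using X unfolding osc_path_def by (intro continuous_on_scaleR continuous_on_const) blast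
ultimately show ?thesis using X unfolding osc_path_def by blast
qed

text \<open>Gronwall backwards in time: seen from a zero at \<open>t1\<close>, the norm of the
  shifted variable is bounded by a multiple of its own integral, hence vanishes back to time
  0.\<close>

lemma osc_path_nonzero:
assumes X: "osc_path W v z" and W: "cont0 W" and z0: "z 0 ~= 0" and t1: "0 <= t1"
shows "z t1 ~= 0"
proof
assume zt: "z t1 = 0"
have vc: "cont0 v" and zc: "cont0 z" using X by (auto simp: osc_path_def)
let ?w = "driver W"
have wc: "cont0 ?w" by (rule continuous_on_driver[OF W])
obtain V where V: "V >= 0" "!!t. t : {0..t1} ==> norm (v t) <= V" using bounded_on_Icc[OF vc] by blast
obtain w where w: "w >= 0" "!!t. t : {0..t1} ==> norm (?w t) <= w" using bounded_on_Icc[OF wc] by blast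
define L where "L = ((1 + 2 * abs zeta + kappa^2 + norm a * V) + w) * (1 + w)"
have L0: "L >= 0" using V(1) w(1) by (simp add: L_def)
define u where "u t = shear (- ?w t) (z t)" for t
have uc: "cont0 u" unfolding u_def by (intro continuous_on_shear continuous_intros wc zc)
let ?r = "%s. rde_drift (?w s) (v s) (z s)"
have rc: "cont0 ?r" by (intro continuous_on_rde_drift wc vc zc)
have e: "u t = z 0 + itg t ?r" if "t >= 0" for t using X that unfolding osc_path_def u_def by blast
have rb: "norm (?r s) <= L * norm (u s)" if s: "s : {0..t1}" for s
proof -
 have "z s = shear (?w s) (u s)" by (simp add: u_def shear_shear)
 then have "norm (z s) <= (1 + abs (?w s)) * norm (u s)" using norm_shear by metis
 also have "... <= (1 + w) * norm (u s)" using w(2)[OF s] by (intro mult_right_mono) auto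
 finally have zu: "norm (z s) <= (1 + w) * norm (u s)" .
 have "norm (?r s) <= (drift_bound (v s) + abs (?w s)) * norm (z s)" by (rule norm_rde_drift)
 also have "... <= ((1 + 2 * abs zeta + kappa^2 + norm a * V) + w) * ((1 + w) * norm (u s))"
  using V(2)[OF s] w(2)[OF s] V(1) w(1) zu unfolding drift_bound_def by (intro mult_mono add_mono mult_left_mono) auto
 finally show ?thesis by (simp add: L_def mult.assoc)
qed
define g where "g s = norm (u (t1 - s))" for s
have gc: "continuous_on {0..t1} g" unfolding g_def by (intro continuous_on_norm cont_compose[OF uc]) (auto intro!: continuous_intros)
have "g t <= 0 + L * itg t g" if t: "t : {0..t1}" for t
proof -
 have sub: "{t1 - t..t1} <= {0..}" using t by auto
 have ri: "?r integrable_on {t1 - t..t1}" by (intro cont_integrable cont_subset[OF rc sub])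
 have nui: "(%s. norm (u s)) integrable_on {t1 - t..t1}" by (intro cont_integrable continuous_on_norm cont_subset[OF uc sub])
 have "?r integrable_on {0..t1}" by (intro cont_integrable cont_subset[OF rc]) auto
 then have "itg (t1 - t) ?r + integral {t1 - t..t1} ?r = itg t1 ?r" using t by (intro hk_combine) auto
 then have "u t1 = u (t1 - t) + integral {t1 - t..t1} ?r" using e[of t1] e[of "t1 - t"] t t1 by simp
 moreover have "u t1 = 0" using zt by (simp add: u_def shear_def complex_eq_iff)
 ultimately have "u (t1 - t) = - integral {t1 - t..t1} ?r" by (simp add: eq_neg_iff_add_eq_0)
 then have "norm (u (t1 - t)) = norm (integral {t1 - t..t1} ?r)" by simp
 also have "... <= integral {t1 - t..t1} (%s. L * norm (u s))"
  using rb t by (intro integral_norm_bound_integral ri integrable_on_mult_right nui) auto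
 also have "... = L * integral {t1 - t..t1} (%s. norm (u s))" by simp
 also have "integral {t1 - t..t1} (%s. norm (u s)) = integral {- t1..- (t1 - t)} (%s. norm (u (- s)))"
  using Henstock_Kurzweil_Integration.integral_reflect_real[of t1 "t1 - t" "%s. norm (u s)"] by simp
 also have "... = itg t g" using integral_shift_real_ivl[of "- t1" "- t1" "- (t1 - t)" "%s. norm (u (- s))"] by (simp add: g_def[abs_def])
 finally show ?thesis by (simp add: g_def)
qed
then have "g t1 <= 0 * exp (L * t1)" by (intro gronwall[OF gc L0]) (use t1 in auto)
then have "u 0 = 0" by (simp add: g_def)
then show False using z0 by (simp add: u_def driver_def)
qed

end


subsection \<open>The Euler-Maruyama scheme and the flow\<close>

context params
begin

text \<open>One Euler-Maruyama step of the Ito system for \<open>(v, z)\<close>;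
  \<open>rde_drift 0\<close> is the drift of the oscillator itself.\<close>

definition step :: "real => real^'m => (real^'d) * complex => (real^'d) * complex" where
"step D xi x = (fst x + D *\<^sub>R (A *v fst x) + B *v xi,
  snd x + D *\<^sub>R rde_drift 0 (fst x) (snd x) + Complex 0 ((gamma *. xi) * Re (snd x)))"

primrec scheme :: "(real => real^'m) => real => nat => (real^'d) * complex => nat => (real^'d) * complex" where
"scheme W T n x 0 = x"
| "scheme W T n x (Suc k) = step (T / n) (W (grid T n (Suc k)) - W (grid T n k)) (scheme W T n x k)"

text \<open>Sheared by the driver at the grid points, the stochastic scheme is exactly an Euler
  scheme for the random differential equation, with the driver taken at the right end of each cell.
  Therefore it converges along every continuous path, not merely in probability.\<close>

lemma scheme_tendsto:
assumes X: "osc_path W v z" and W: "cont0 W" and T: "0 < T"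
shows "(%n. scheme W T n (v 0, z 0) n) ----> (v T, z T)"
proof -
have vc: "cont0 v" and zc: "cont0 z" using X by (auto simp: osc_path_def)
let ?w = "driver W"
have wc: "cont0 ?w" by (rule continuous_on_driver[OF W])
have sub: "{0..T} <= {0..}" by auto
have T0: "0 <= T" using T by simp
obtain K where K: "K >= 0" "!!x. norm (A *v x) <= K * norm x" using matrix_bound by blast
obtain V where V: "V >= 0" "!!t. t : {0..T} ==> norm (v t) <= V" using bounded_on_Icc[OF vc] by blast
obtain Z where Z: "Z >= 0" "!!t. t : {0..T} ==> norm (z t) <= Z" using bounded_on_Icc[OF zc] by blast
obtain w where w: "w >= 0" "!!t. t : {0..T} ==> norm (?w t) <= w" using bounded_on_Icc[OF wc] by blast
have cont3: "continuous_on {0..T} (%t. (v t, z t, ?w t))" by (intro continuous_on_Pair cont_subset[OF _ sub] vc zc wc)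
obtain e where e: "e ----> 0" and em: "!!n i r r'. [|i < n; r : cell T n i; r' : cell T n i|]
   ==> dist (v r, z r, ?w r) (v r', z r', ?w r') <= e n" using grid_modulus[OF cont3 T0] by blast
have dst: "norm (v r - v r') <= dist (v r, z r, ?w r) (v r', z r', ?w r')" "norm (z r - z r') <= dist (v r, z r, ?w r) (v r', z r', ?w r')"
 "abs (?w r - ?w r') <= dist (v r, z r, ?w r) (v r', z r', ?w r')" for r r'
 using dist_fst_le[of "(v r, z r, ?w r)" "(v r', z r', ?w r')"] dist_snd_le[of "(v r, z r, ?w r)" "(v r', z r', ?w r')"]
  dist_fst_le[of "(z r, ?w r)" "(z r', ?w r')"] dist_snd_le[of "(z r, ?w r)" "(z r', ?w r')"] by (auto simp: dist_norm)
\<comment> \<open>\<open>delta\<close> is the error of \<open>v\<close> and \<open>eps\<close> the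
  resulting error in the drift of \<open>z\<close>. Once \<open>delta n <= 1\<close>, the numerical
  \<open>v\<close> is bounded by \<open>V + 1\<close>, which \<open>Cb\<close> takes into
  account.\<close>
define delta where "delta n = K * e n * T * exp (K * T)" for n
define Cb where "Cb = (1 + 2 * abs zeta + kappa^2 + norm a * (V + 1)) + w"
define L where "L = Cb * (1 + w)"
define eps where "eps n = Cb * e n + norm a * (delta n + e n) * Z + e n * Z" for n
have delta0: "delta ----> 0" unfolding delta_def using tendsto_mult_right_zero[OF e, of K] by (intro tendsto_mult_left_zero)
have eps0: "eps ----> 0" unfolding eps_def
 using tendsto_add[OF tendsto_add[OF tendsto_mult_right_zero[OF e, of Cb] tendsto_mult_left_zero[OF tendsto_mult_right_zero[OF tendsto_add_zero[OF delta0 e], of "norm a"], of Z]] tendsto_mult_left_zero[OF e, of Z]]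
 by simp
have Cb0: "Cb >= 0" using V(1) w(1) by (simp add: Cb_def)
have L0: "L >= 0" using Cb0 w(1) by (simp add: L_def)
have main: "norm (fst (scheme W T n (v 0, z 0) n) - v T) <= delta n &
  norm (snd (scheme W T n (v 0, z 0) n) - z T) <= (1 + w) * (eps n * T * exp (L * T))"
 if n: "n > 0" and delta1: "delta n <= 1" for n
proof -
 let ?g = "grid T n"
 define S where "S k = scheme W T n (v 0, z 0) k" for k
 define b where "b t = B *v (W t - W 0)" for t
 have S0: "S 0 = (v 0, z 0)" and SS: "S (Suc k) = step (T / n) (W (?g (Suc k)) - W (?g k)) (S k)" for k by (simp_all add: S_def)
 have g: "?g k : {0..T}" if "k <= n" for k using that T0 by (auto intro: grid_nonneg grid_le)
 have gs: "?g k : {?g k..?g (Suc k)}" "?g (Suc k) : {?g k..?g (Suc k)}" for k using grid_mono[OF T0] by auto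
 have gr: "r : {0..T}" if "k < n" "r : {?g k..?g (Suc k)}" for k r using that g[of k] g[of "Suc k"] by auto
 have e0: "e n >= 0" using em[OF n gs(1) gs(1)] by (simp add: zero_le_dist order_trans[OF zero_le_dist])
 have delta0': "delta n >= 0" using e0 K(1) T0 by (simp add: delta_def)
 have dV: "norm (fst (S k) - v (?g k)) <= delta n" if k: "k <= n" for k
 proof -
  let ?y = "%t. v t - b t" and ?Y = "%k. fst (S k) - b (?g k)"
  have "norm (?Y k - ?y (?g k)) <= (K * e n) * T * exp (K * T)"
  proof (rule euler_scheme_error[where a = "%s. A *v v s" and G = "%k. A *v fst (S k)", OF _ T0 _ _ K(1) _ _ k])
   show "continuous_on {0..T} (%s. A *v v s)" by (intro continuous_on_mat cont_subset[OF vc sub])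
   show "0 <= K * e n" using K(1) e0 by simp
   fix t assume t: "t : {0..T}"
   then have t0: "0 <= t" by simp
   have "v t = v 0 + itg t (%s. A *v v s) + b t" using X t0 unfolding osc_path_def b_def by blast
   then show "?y t = ?Y 0 + itg t (%s. A *v v s)" by (simp add: S0 b_def)
  next
   fix k assume "k < n"
   have "B *v (W (?g (Suc k)) - W (?g k)) = b (?g (Suc k)) - b (?g k)" by (simp add: b_def matrix_vector_mult_diff_distrib[symmetric])
   then show "?Y (Suc k) = ?Y k + (T / n) *\<^sub>R (A *v fst (S k))" by (simp add: SS step_def)
  next
   fix k r assume k: "k < n" and r: "r : {?g k..?g (Suc k)}"
   have "norm (A *v fst (S k) - A *v v r) <= K * norm ((fst (S k) - v (?g k)) + (v (?g k) - v r))"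
    using K(2)[of "fst (S k) - v r"] by (simp add: matrix_vector_mult_diff_distrib)
   also have "... <= K * (norm (fst (S k) - v (?g k)) + e n)"
    using order_trans[OF dst(1) em[OF k gs(1) r]] K(1) by (intro mult_left_mono order_trans[OF norm_triangle_ineq] add_left_mono) auto
   finally show "norm (A *v fst (S k) - A *v v r) <= K * norm (?Y k - ?y (?g k)) + K * e n" by (simp add: distrib_left)
  qed
  then show ?thesis by (simp add: delta_def mult.assoc)
 qed
 have V': "norm (fst (S k)) <= V + 1" if "k <= n" for k
  using norm_triangle_ineq[of "v (?g k)" "fst (S k) - v (?g k)"] V(2)[OF g[OF that]] dV[OF that] delta1 by simp
 let ?u = "%t. shear (- ?w t) (z t)" and ?U = "%k. shear (- ?w (?g k)) (snd (S k))"
 have ZU: "norm (snd (S k) - z (?g k)) <= (1 + w) * norm (?U k - ?u (?g k))" if k: "k <= n" for k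
 proof -
  have "snd (S k) - z (?g k) = shear (?w (?g k)) (?U k - ?u (?g k))" by (simp add: shear_diff shear_shear)
  then have "norm (snd (S k) - z (?g k)) <= (1 + abs (?w (?g k))) * norm (?U k - ?u (?g k))" using norm_shear by metis
  also have "... <= (1 + w) * norm (?U k - ?u (?g k))" using w(2)[OF g[OF k]] by (intro mult_right_mono) auto
  finally show ?thesis .
 qed
 have dU: "norm (?U k - ?u (?g k)) <= eps n * T * exp (L * T)" if k: "k <= n" for k
 proof (rule euler_scheme_error[where a = "%s. rde_drift (?w s) (v s) (z s)" and G = "%k. rde_drift (?w (?g (Suc k))) (fst (S k)) (snd (S k))", OF _ T0 _ _ L0 _ _ k])
  show "continuous_on {0..T} (%s. rde_drift (?w s) (v s) (z s))" by (intro continuous_on_rde_drift cont_subset[OF _ sub] wc vc zc)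
  show "0 <= eps n" using Cb0 e0 delta0' Z(1) by (simp add: eps_def)
  fix t assume t: "t : {0..T}"
  then have t0: "0 <= t" by simp
  have "?u t = z 0 + itg t (%s. rde_drift (?w s) (v s) (z s))" using X t0 unfolding osc_path_def by blast
  then show "?u t = ?U 0 + itg t (%s. rde_drift (?w s) (v s) (z s))" by (simp add: S0 driver_def)
 next
  fix k assume "k < n"
  have d: "gamma *. (W (?g (Suc k)) - W (?g k)) = ?w (?g (Suc k)) - ?w (?g k)" by (simp add: driver_def inner_diff_right)
  show "?U (Suc k) = ?U k + (T / n) *\<^sub>R rde_drift (?w (?g (Suc k))) (fst (S k)) (snd (S k))"
   unfolding SS step_def d by (simp add: shear_def rde_drift_def complex_eq_iff algebra_simps)
 next
  fix k r assume k: "k < n" and r: "r : {?g k..?g (Suc k)}"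
  have k': "k <= n" "Suc k <= n" using k by auto
  note m = em[OF k gs(1) r] em[OF k gs(2) r]
  have zr: "norm (z r) <= Z" by (rule Z(2)[OF gr[OF k r]])
  have "norm (snd (S k) - z r) <= norm (snd (S k) - z (?g k)) + norm (z (?g k) - z r)"
   using norm_triangle_ineq[of "snd (S k) - z (?g k)" "z (?g k) - z r"] by simp
  then have 1: "norm (snd (S k) - z r) <= (1 + w) * norm (?U k - ?u (?g k)) + e n"
   using ZU[OF k'(1)] order_trans[OF dst(2) m(1)] by linarith
  have "norm (fst (S k) - v r) <= norm (fst (S k) - v (?g k)) + norm (v (?g k) - v r)"
   using norm_triangle_ineq[of "fst (S k) - v (?g k)" "v (?g k) - v r"] by simp
  then have 2: "norm (fst (S k) - v r) <= delta n + e n" using dV[OF k'(1)] order_trans[OF dst(1) m(1)] by linarith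
  have 3: "abs (?w (?g (Suc k)) - ?w r) <= e n" by (rule order_trans[OF dst(3) m(2)])
  have 4: "drift_bound (fst (S k)) + abs (?w (?g (Suc k))) <= Cb"
   using mult_left_mono[OF V'[OF k'(1)] norm_ge_zero[of a]] w(2)[OF g[OF k'(2)]] by (simp add: drift_bound_def Cb_def)
  have "norm (rde_drift (?w (?g (Suc k))) (fst (S k)) (snd (S k)) - rde_drift (?w r) (v r) (z r))
   <= (drift_bound (fst (S k)) + abs (?w (?g (Suc k)))) * norm (snd (S k) - z r)
    + norm a * norm (fst (S k) - v r) * norm (z r) + abs (?w (?g (Suc k)) - ?w r) * norm (z r)" by (rule norm_rde_drift_diff)
  also have "... <= Cb * ((1 + w) * norm (?U k - ?u (?g k)) + e n) + norm a * (delta n + e n) * Z + e n * Z"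
   using Cb0 e0 delta0' by (intro add_mono mult_mono 1 2 3 4 zr) auto
  finally show "norm (rde_drift (?w (?g (Suc k))) (fst (S k)) (snd (S k)) - rde_drift (?w r) (v r) (z r)) <= L * norm (?U k - ?u (?g k)) + eps n"
   by (simp add: L_def eps_def algebra_simps)
 qed
 have "norm (snd (S n) - z T) <= (1 + w) * norm (?U n - ?u T)" using ZU[of n] n by (simp add: grid_n)
 also have "... <= (1 + w) * (eps n * T * exp (L * T))" using dU[of n] n w(1) by (intro mult_left_mono) (auto simp: grid_n)
 finally show ?thesis using dV[of n] n by (simp add: grid_n S_def)
qed
have ev: "EVN n. n > 0 & delta n <= 1"
 using eventually_conj[OF eventually_gt_at_top[of "0::nat"] order_tendstoD(2)[OF delta0 zero_less_one]] by (rule eventually_mono) auto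
have lv: "(%n. fst (scheme W T n (v 0, z 0) n) - v T) ----> 0"
 by (rule Lim_null_comparison[OF eventually_mono[OF ev] delta0]) (use main in blast)
have lz: "(%n. snd (scheme W T n (v 0, z 0) n) - z T) ----> 0"
proof (rule Lim_null_comparison[OF eventually_mono[OF ev]])
 show "(%n. (1 + w) * (eps n * T * exp (L * T))) ----> 0" by (intro tendsto_mult_right_zero tendsto_mult_left_zero eps0)
qed (use main in blast)
have "(%n. (fst (scheme W T n (v 0, z 0) n), snd (scheme W T n (v 0, z 0) n))) ----> (v T, z T)"
 by (rule tendsto_Pair[OF LIM_zero_cancel[OF lv] LIM_zero_cancel[OF lz]])
then show ?thesis by simp
qed

text \<open>One solution path is chosen for each driving path and starting point; by
  \<open>osc_path_unique\<close> its values at \<open>t >= 0\<close> do not depend on the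
  choice.\<close>

definition flow :: "(real => real^'m) => (real^'d) * complex => real => (real^'d) * complex" where
"flow W x t = (let p = SOME p. osc_path W (fst p) (snd p) & fst p 0 = fst x & snd p 0 = snd x in (fst p t, snd p t))"

context
fixes W :: "real => real^'m"
assumes W: "cont0 W"
begin

lemma flow_path: "osc_path W (%t. fst (flow W x t)) (%t. snd (flow W x t))" and flow_0 [simp]: "flow W x 0 = x"
proof -
let ?P = "%p. osc_path W (fst p) (snd p) & fst p 0 = fst x & snd p 0 = snd x"
obtain v z where "osc_path W v z" "v 0 = fst x" "z 0 = snd x" using osc_path_exists[OF W] by metis
then have "?P (v, z)" by simp
then have "?P (SOME p. ?P p)" by (rule someI)
then show "osc_path W (%t. fst (flow W x t)) (%t. snd (flow W x t))" "flow W x 0 = x" by (simp_all add: flow_def Let_def prod_eq_iff)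
qed

lemma flow_eq: "osc_path W v z ==> 0 <= t ==> flow W (v 0, z 0) t = (v t, z t)"
using osc_path_unique[OF _ flow_path[of "(v 0, z 0)"] W, of v z t] by (simp add: prod_eq_iff)

lemma flow_scheme: "0 < T ==> (%n. scheme W T n x n) ----> flow W x T"
using scheme_tendsto[OF flow_path[of x] W, of T] by simp

lemma flow_shift: "0 <= s ==> 0 <= t ==> flow W x (s + t) = flow (%r. W (s + r)) (flow W x s) t"
proof -
assume s: "0 <= s" and t: "0 <= t"
have "cont0 (%r. W (s + r))" by (rule cont_compose[OF W]) (use s in "auto intro!: continuous_intros")
note p = osc_path_shift[OF flow_path[of x] W s]
obtain v z where vz: "osc_path (%r. W (s + r)) v z" "v 0 = fst (flow W x s)" "z 0 = snd (flow W x s)"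
 using osc_path_exists[OF \<open>cont0 (%r. W (s + r))\<close>] by metis
have P: "osc_path (%r. W (s + r)) (fst q) (snd q) & fst q 0 = fst (flow W x s) & snd q 0 = snd (flow W x s)"
 if "q = (SOME p. osc_path (%r. W (s + r)) (fst p) (snd p) & fst p 0 = fst (flow W x s) & snd p 0 = snd (flow W x s))" for q
 unfolding that by (rule someI[of _ "(v, z)"]) (use vz in simp)
let ?q = "SOME p. osc_path (%r. W (s + r)) (fst p) (snd p) & fst p 0 = fst (flow W x s) & snd p 0 = snd (flow W x s)"
have "fst ?q t = fst (flow W x (s + t))" "snd ?q t = snd (flow W x (s + t))"
 using osc_path_unique[OF p _ \<open>cont0 (%r. W (s + r))\<close> _ _ t, of "fst ?q" "snd ?q"] P[OF refl] by auto
then show ?thesis by (simp add: flow_def[of "%r. W (s + r)"] Let_def prod_eq_iff)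
qed

lemma flow_scale:
assumes t: "0 <= t"
shows "flow W (v, c *\<^sub>R z) t = (fst (flow W (v, z) t), c *\<^sub>R snd (flow W (v, z) t))"
using flow_eq[OF osc_path_scale[OF flow_path[of "(v, z)"], of c] t] by simp

lemma flow_nonzero: "snd x ~= 0 ==> 0 <= t ==> snd (flow W x t) ~= 0"
using osc_path_nonzero[OF flow_path[of x] W] by simp

lemma flow_continuous_time: "cont0 (flow W x)"
proof -
have "cont0 (%t. (fst (flow W x t), snd (flow W x t)))" using flow_path[of x] unfolding osc_path_def by (intro continuous_on_Pair) auto
then show ?thesis by simp
qed

lemma flow_continuous_start:
assumes x: "xs ----> x" and t: "0 <= t"
shows "(%n. flow W (xs n) t) ----> flow W x t"
proof -
obtain C where C: "C >= 0" "!!v' z'. osc_path W v' z' ==> norm (v' 0 - fst x) + norm (z' 0 - snd x) <= 1 ==>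
   norm (v' t - fst (flow W x t)) + norm (z' t - snd (flow W x t)) <= C * (norm (v' 0 - fst x) + norm (z' 0 - snd x))"
 using osc_path_dependence[OF flow_path[of x] W t] t by (metis atLeastAtMost_iff flow_0 order_refl)
let ?d = "%n. norm (fst (xs n) - fst x) + norm (snd (xs n) - snd x)"
have d: "?d ----> 0"
 using tendsto_add[OF tendsto_norm[OF LIM_zero[OF tendsto_fst[OF x]]] tendsto_norm[OF LIM_zero[OF tendsto_snd[OF x]]]] by simp
then have ev: "EVN n. ?d n <= 1" using order_tendstoD(2)[OF d, of 1] by (auto elim: eventually_mono)
have le: "norm (flow W (xs n) t - flow W x t) <= C * ?d n" if "?d n <= 1" for n
proof -
 have "norm (flow W (xs n) t - flow W x t) <= norm (fst (flow W (xs n) t) - fst (flow W x t)) + norm (snd (flow W (xs n) t) - snd (flow W x t))"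
  using norm_Pair_le[of "fst (flow W (xs n) t) - fst (flow W x t)" "snd (flow W (xs n) t) - snd (flow W x t)"]
  by (metis fst_diff snd_diff prod.collapse)
 also have "... <= C * ?d n" using C(2)[OF flow_path[of "xs n"]] that by simp
 finally show ?thesis .
qed
have "(%n. flow W (xs n) t - flow W x t) ----> 0" by (rule Lim_null_comparison[OF eventually_mono[OF ev le] tendsto_mult_right_zero[OF d]])
then show ?thesis by (rule LIM_zero_cancel)
qed

end

lemma continuous_step: "continuous_on UNIV (%p. step D (fst p) (snd p))"
unfolding step_def
by (intro continuous_on_Pair continuous_on_add continuous_on_scaleR continuous_on_const continuous_on_mat
  continuous_on_fst continuous_on_snd continuous_on_id continuous_on_rde_drift)
  (auto simp: Complex_eq intro!: continuous_intros)

end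

section \<open>The transition operators\<close>

locale osc_bm = bm P F W + params A B a gamma kappa zeta
for P :: "'w measure" and F and W :: "real => 'w => real^'m"
 and A :: "real^'d^'d" and B :: "real^'m^'d" and a gamma kappa zeta
begin

text \<open>The flow driven by the noise after time \<open>s\<close> only, so that it is independent
  of the past when started from a fixed point.\<close>

definition Phi :: "real => (real^'d) * complex => real => 'w => (real^'d) * complex" where
"Phi s x t om = flow (%r. W (s + r) om) x t"

lemma path_continuous: "om : space P ==> 0 <= s ==> cont0 (%r. W (s + r) om)"
by (rule cont_compose[OF W_continuous]) (auto intro!: continuous_intros)

definition em :: "real => real => nat => (real^'d) * complex => nat => 'w => (real^'d) * complex" where
"em s T n x k om = scheme (%r. W (s + r) om) T n x k"

lemma em_Suc: "em s T n x (Suc k) om = step (T / n) (inc (s + grid T n k) (s + grid T n (Suc k)) om) (em s T n x k om)"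
by (simp add: em_def inc_def)

lemma measurable_step:
assumes "f : bmeas M" "g : bmeas M"
shows "(%om. step D (f om) (g om)) : bmeas M"
using meas_comp[OF bmeas_Pair[OF assms] cont_bmeas[OF continuous_step[of D]]] by simp

lemma em_measurable:
assumes X: "X : bmeas (F s)" and s: "0 <= s" and T: "0 <= T"
shows "(%om. em s T n (X om) k om) : bmeas (F (s + grid T n k))"
proof (induction k)
case 0
then show ?case using X by (simp add: em_def)
next
case (Suc k)
have g: "0 <= grid T n k" "grid T n k <= grid T n (Suc k)" using T by (auto intro: grid_nonneg grid_mono)
have "(%om. em s T n (X om) k om) : bmeas (F (s + grid T n (Suc k)))" by (rule F_mono[OF _ Suc]) (use g in simp)
moreover have "inc (s + grid T n k) (s + grid T n (Suc k)) : bmeas (F (s + grid T n (Suc k)))" by (rule inc_measurable) (use s g in auto)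
ultimately show ?case unfolding em_Suc by (intro measurable_step)
qed

lemma em_tendsto:
assumes "om : space P" "0 <= s" "0 < T"
shows "(%n. em s T n x n om) ----> Phi s x T om"
unfolding em_def Phi_def by (rule flow_scheme[OF path_continuous[OF assms(1,2)] assms(3)])

text \<open>Inherited from the schemes, which are finite compositions of continuous steps. Their
  convergence holds along every path, so no null sets have to be adjoined to
  \<open>F\<close>.\<close>

lemma Phi_measurable:
assumes X: "X : bmeas (F s)" and s: "0 <= s" and T: "0 <= T"
shows "(%om. Phi s (X om) T om) : bmeas (F (s + T))"
proof (cases "T = 0")
case True
have "Phi s (X om) 0 om = X om" if "om : space (F s)" for om using flow_0[OF path_continuous[OF _ s]] that by (simp add: Phi_def space_F)
then have "(%om. Phi s (X om) 0 om) : bmeas (F s) \<longleftrightarrow> X : bmeas (F s)" by (rule measurable_cong)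
then show ?thesis using X True by simp
next
case False
then have T': "T > 0" using T by simp
show ?thesis
proof (rule bmeas_LIMSEQ)
 show "(%om. em s T (Suc n) (X om) (Suc n) om) : bmeas (F (s + T))" for n
  using em_measurable[OF X s T, of "Suc n" "Suc n"] by (simp add: grid_n del: scheme.simps)
 fix om assume "om : space (F (s + T))"
 then show "(%n. em s T (Suc n) (X om) (Suc n) om) ----> Phi s (X om) T om"
  using LIMSEQ_Suc[OF em_tendsto[OF _ s T']] by (simp add: space_F)
qed
qed

lemma Phi_flow:
assumes "om : space P" "0 <= s" "0 <= t"
shows "Phi 0 x (s + t) om = Phi s (Phi 0 x s om) t om"
using flow_shift[OF W_continuous[OF assms(1)] assms(2,3)] by (simp add: Phi_def)

section \<open>One-step operators of the scheme and the Markov property of the flow\<close>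

definition Top :: "real => ((real^'d) * complex => real) => (real^'d) * complex => real" where
"Top D g x = (LINT xi|inc_law D. g (step D xi x))"

lemma prob_space_inc_law: "0 < D ==> prob_space (inc_law D)"
unfolding inc_law_def by (rule prob_space_distr) simp

lemma sets_inc_law [simp, measurable_cong]: "sets (inc_law D) = sets borel"
by (simp add: inc_law_def)

lemma Top_measurable:
assumes g [measurable]: "g : bmeas borel" and D: "0 < D"
shows "Top D g : bmeas borel"
proof -
interpret I: prob_space "inc_law D" by (rule prob_space_inc_law[OF D])
have "(%p. g (step D (snd p) (fst p))) : bmeas (borel \<Otimes>\<^sub>M inc_law D)" by (rule meas_comp[OF measurable_step g]) auto
then have "(%x. \<integral>xi. g (step D xi x) \<partial>inc_law D) : bmeas borel"
 by (intro I.borel_measurable_lebesgue_integral) (simp add: case_prod_beta)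
then show ?thesis by (simp add: Top_def[abs_def])
qed

lemma Top_bound:
assumes g [measurable]: "g : bmeas borel" and b: "!!x. abs (g x) <= C" and D: "0 < D"
shows "abs (Top D g x) <= C"
proof -
interpret I: prob_space "inc_law D" by (rule prob_space_inc_law[OF D])
have m: "(%xi. g (step D xi x)) : bmeas (inc_law D)" by (rule meas_comp[OF measurable_step g]) auto
have i: "integrable (inc_law D) (%xi. g (step D xi x))" by (rule I.integrable_const_bound[of _ C]) (use b m in auto)
have "abs (Top D g x) <= (LINT xi|inc_law D. abs (g (step D xi x)))" unfolding Top_def by (rule integral_abs_bound)
also have "... <= (LINT xi|inc_law D. C)" using i b by (intro integral_mono) auto
finally show ?thesis by (simp add: I.prob_space)
qed

text \<open>Conditional expectation given \<open>F s\<close>, expressed by testing against a bounded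
  weight \<open>c\<close> of the past: the pair of state and weight is frozen and the increment
  integrated out.\<close>

lemma Top_step:
assumes s: "0 <= s" and D: "0 < D" and X: "X : bmeas (F s)" and c: "c : bmeas (F s)" "!!om. abs (c om) <= Cc"
 and g [measurable]: "g : bmeas borel" and b: "!!x. abs (g x) <= C"
shows "(LINT om|P. g (step D (inc s (s + D) om) (X om)) * c om) = (LINT om|P. Top D g (X om) * c om)"
proof -
let ?N = "borel :: (((real^'d) * complex) \<times> real) measure"
let ?Y = "%om. (X om, c om)"
have Y: "?Y : measurable (F s) ?N" using X c(1) by simp
have st: "s < s + D" using D by simp
have Ym [measurable]: "?Y : measurable P ?N" by (rule F_P[OF Y])
have im [measurable]: "inc s (s + D) : bmeas P" using s D by simp
have law: "distr P borel (inc s (s + D)) = inc_law D" using inc_law[OF s st] by simp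
interpret I: prob_space "inc_law D" by (rule prob_space_inc_law[OF D])
interpret Yp: prob_space "distr P ?N ?Y" by (rule prob_space_distr) simp
interpret YI: pair_sigma_finite "distr P ?N ?Y" "inc_law D" ..
let ?f = "%p. g (step D (snd p) (fst (fst p))) * snd (fst p)"
have bf: "(fst :: ((real^'d) * complex) \<times> real => _) : bmeas borel" "(snd :: ((real^'d) * complex) \<times> real => _) : bmeas borel"
 by (auto intro!: cont_bmeas continuous_intros)
have fm: "?f : bmeas (?N \<Otimes>\<^sub>M borel)" by (intro bmeas_times meas_comp[OF measurable_step g] measurable_snd
   meas_comp[OF measurable_fst bf(1)] meas_comp[OF measurable_fst bf(2)])
have bnd: "abs (g y * c om) <= C * Cc" for y om unfolding abs_mult using b[of y] c(2)[of om] by (intro mult_mono) auto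
have J: "distr P ?N ?Y \<Otimes>\<^sub>M inc_law D = distr P (?N \<Otimes>\<^sub>M borel) (%om. (?Y om, inc s (s + D) om))"
 using inc_joint_law[OF s st Y] by (simp add: law)
have int: "integrable (distr P ?N ?Y \<Otimes>\<^sub>M inc_law D) ?f" unfolding J
proof (subst integrable_distr_eq)
 show "integrable P (%om. ?f (?Y om, inc s (s + D) om))"
 proof (rule integrable_const_bound[of _ "C * Cc"])
  show "(%om. ?f (?Y om, inc s (s + D) om)) : bmeas P" by (rule meas_comp[OF _ fm]) simp
 qed (use bnd in simp)
qed (use fm in auto)
have "(LINT om|P. g (step D (inc s (s + D) om) (X om)) * c om) = (\<integral>p. ?f p \<partial>(distr P ?N ?Y \<Otimes>\<^sub>M inc_law D))"
 unfolding J by (subst integral_distr) (use fm in auto)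
also have "... = (LINT y|distr P ?N ?Y. (LINT xi|inc_law D. ?f (y, xi)))" using YI.integral_fst'[OF int] by simp
also have "... = (LINT y|distr P ?N ?Y. Top D g (fst y) * snd y)" by (simp add: Top_def)
also have "... = (LINT om|P. Top D g (X om) * c om)"
proof (subst integral_distr[OF Ym])
 show "(%y. Top D g (fst y) * snd y) : bmeas ?N" by (intro bmeas_times meas_comp[OF bf(1) Top_measurable[OF g D]] bf(2))
qed simp
finally show ?thesis .
qed

lemma Top_iter:
assumes g: "g : bmeas borel" "!!x. abs (g x) <= C" and D: "0 < D"
shows "(Top D ^^ k) g : bmeas borel" "abs ((Top D ^^ k) g x) <= C"
proof -
have "(Top D ^^ k) g : bmeas borel & (ALL x. abs ((Top D ^^ k) g x) <= C)"
proof (induction k)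
 case 0
 then show ?case using g by simp
next
 case (Suc k)
 then show ?case using Top_measurable[OF _ D, of "(Top D ^^ k) g"] Top_bound[OF _ _ D, of "(Top D ^^ k) g"] by (simp del: split_paired_All)
qed
then show "(Top D ^^ k) g : bmeas borel" "abs ((Top D ^^ k) g x) <= C" by blast+
qed

text \<open>The last step is removed first, as its increment is independent of everything before it;
  this turns \<open>g\<close> into \<open>Top (T / n) g\<close>.\<close>

lemma em_expectation:
assumes s: "0 <= s" and T: "0 < T" and n: "0 < n" and X: "X : bmeas (F s)"
 and c: "c : bmeas (F s)" "!!om. abs (c om) <= Cc"
 and g: "g : bmeas borel" "!!x. abs (g x) <= C"
shows "(LINT om|P. g (em s T n (X om) k om) * c om) = (LINT om|P. (Top (T / n) ^^ k) g (X om) * c om)"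
using g
proof (induction k arbitrary: g)
case 0
then show ?case by (simp add: em_def)
next
case (Suc k)
have D: "0 < T / n" using T n by simp
let ?s = "s + grid T n k"
have s': "0 <= ?s" using s T by (simp add: grid_nonneg)
have eq: "s + grid T n (Suc k) = ?s + T / n" using grid_step[of T n k] by simp
have le: "s <= ?s" using T by (simp add: grid_nonneg)
have "(LINT om|P. g (em s T n (X om) (Suc k) om) * c om) = (LINT om|P. Top (T / n) g (em s T n (X om) k om) * c om)"
 unfolding em_Suc eq by (rule Top_step[OF s' D em_measurable[OF X s] F_mono[OF le c(1)] c(2) Suc.prems]) (use T in simp)
also have "... = (LINT om|P. (Top (T / n) ^^ k) (Top (T / n) g) (X om) * c om)"
 by (rule Suc.IH) (use Top_measurable[OF Suc.prems(1) D] Top_bound[OF Suc.prems D] in auto)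
finally show ?case by (simp add: funpow_swap1)
qed

text \<open>Continuity is asked only off the zero section, which the flow never meets: a nonconstant
  function of the angle alone cannot be continuous at \<open>z = 0\<close>.\<close>

definition nice :: "((real^'d) * complex => real) => bool" where
"nice f \<longleftrightarrow> f : bmeas borel & (EX C. ALL x. abs (f x) <= C) & (ALL x. snd x ~= 0 --> isCont f x)"

definition Kf :: "real => ((real^'d) * complex => real) => (real^'d) * complex => real" where
"Kf h f x = (LINT om|P. f (Phi 0 x h om))"

lemma Phi_nonzero: "om : space P ==> 0 <= s ==> 0 <= t ==> snd x ~= 0 ==> snd (Phi s x t om) ~= 0"
unfolding Phi_def by (rule flow_nonzero[OF path_continuous])

lemma Phi_const_measurable: "0 <= h ==> Phi 0 x h : bmeas P"
using F_P[OF Phi_measurable[of "%_. x" 0 h]] by simp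

lemma Kf_bound:
assumes f: "nice f" and b: "!!x. abs (f x) <= C" and h: "0 <= h"
shows "abs (Kf h f x) <= C"
proof -
have m: "(%om. f (Phi 0 x h om)) : bmeas P" by (rule meas_comp[OF Phi_const_measurable[OF h]]) (use f in "simp add: nice_def")
have i: "integrable P (%om. f (Phi 0 x h om))" by (rule integrable_const_bound[of _ C]) (use b m in auto)
have "abs (Kf h f x) <= (LINT om|P. abs (f (Phi 0 x h om)))" unfolding Kf_def by (rule integral_abs_bound)
also have "... <= (LINT om|P. C)" using i b by (intro integral_mono) auto
finally show ?thesis by (simp add: prob_space)
qed

lemma Kf_limit:
assumes f: "nice f" and x: "snd x ~= 0" and h: "0 < h"
shows "(%n. (Top (h / Suc n) ^^ Suc n) f x) ----> Kf h f x"
proof -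
obtain C where C: "!!x. abs (f x) <= C" using f by (auto simp: nice_def)
have fm: "f : bmeas borel" using f by (simp add: nice_def)
have em: "(%om. em 0 h n x k om) : bmeas P" for n k by (rule F_P[OF em_measurable[of "%_. x" 0]]) (use h in auto)
have "(LINT om|P. f (em 0 h (Suc n) x (Suc n) om)) = (Top (h / Suc n) ^^ Suc n) f x" for n
 using em_expectation[of 0 h "Suc n" "%_. x" "%_. 1" 1 f C "Suc n"] h C fm by (simp add: prob_space del: funpow.simps scheme.simps)
moreover have "(%n. \<integral>om. f (em 0 h (Suc n) x (Suc n) om) \<partial>P) ----> (LINT om|P. f (Phi 0 x h om))"
proof (rule dominated_conv[where w = "%_. C"])
 show "AE om in P. (%n. f (em 0 h (Suc n) x (Suc n) om)) ----> f (Phi 0 x h om)"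
 proof (rule AE_I2)
  fix om assume om: "om : space P"
  have "isCont f (Phi 0 x h om)" using f Phi_nonzero[OF om _ _ x, of 0 h] h unfolding nice_def by (auto simp del: split_paired_All)
  then show "(%n. f (em 0 h (Suc n) x (Suc n) om)) ----> f (Phi 0 x h om)"
   by (rule isCont_tendsto_compose) (rule LIMSEQ_Suc[OF em_tendsto[OF om order_refl h]])
 qed
qed (use C meas_comp[OF em fm] meas_comp[OF Phi_const_measurable fm] h in auto)
ultimately show ?thesis by (simp add: Kf_def del: funpow.simps)
qed

text \<open>Both sides are limits of the corresponding quantities for the Euler-Maruyama scheme,
  where the identity is a finite iteration. The measurability of \<open>Kf h f\<close> along
  \<open>X\<close> comes from the same limit.\<close>

theorem markov:
assumes f: "nice f" and X: "X : bmeas (F s)" "!!om. om : space P ==> snd (X om) ~= 0"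
 and c: "c : bmeas (F s)" "!!om. abs (c om) <= Cc" and s: "0 <= s" and h: "0 < h"
shows "(LINT om|P. f (Phi s (X om) h om) * c om) = (LINT om|P. Kf h f (X om) * c om)"
 "(%om. Kf h f (X om)) : bmeas (F s)"
proof -
obtain C where C: "!!x. abs (f x) <= C" using f by (auto simp: nice_def)
have fm: "f : bmeas borel" using f by (simp add: nice_def)
have h0: "0 <= h" using h by simp
have Dn: "0 < h / real (Suc n)" for n using h by simp
have Xp: "X : bmeas P" and cp: "c : bmeas P" using F_P X(1) c(1) by auto
note Ti = Top_iter[OF fm C Dn]
show KX: "(%om. Kf h f (X om)) : bmeas (F s)"
proof (rule bmeas_LIMSEQ)
 show "(%om. (Top (h / Suc n) ^^ Suc n) f (X om)) : bmeas (F s)" for n by (rule meas_comp[OF X(1) Ti(1)])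
 show "(%n. (Top (h / Suc n) ^^ Suc n) f (X om)) ----> Kf h f (X om)" if "om : space (F s)" for om
  using that by (intro Kf_limit[OF f X(2) h]) (simp add: space_F)
qed
have bnd: "abs (y * c om) <= C * Cc" if "abs y <= C" for y om unfolding abs_mult using that c(2)[of om] by (intro mult_mono) auto
have em: "(%om. em s h n (X om) k om) : bmeas P" for n k by (rule F_P[OF em_measurable[OF X(1) s h0]])
have eq: "(LINT om|P. f (em s h (Suc n) (X om) (Suc n) om) * c om) = (LINT om|P. (Top (h / Suc n) ^^ Suc n) f (X om) * c om)" for n
 by (rule em_expectation[OF s h _ X(1) c fm C]) simp
have "(%n. \<integral>om. f (em s h (Suc n) (X om) (Suc n) om) * c om \<partial>P) ----> (LINT om|P. f (Phi s (X om) h om) * c om)"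
proof (rule dominated_conv[where w = "%_. C * Cc"])
 show "AE om in P. (%n. f (em s h (Suc n) (X om) (Suc n) om) * c om) ----> f (Phi s (X om) h om) * c om"
 proof (rule AE_I2)
  fix om assume om: "om : space P"
  have "isCont f (Phi s (X om) h om)" using f Phi_nonzero[OF om s h0 X(2)[OF om]] unfolding nice_def by (auto simp del: split_paired_All)
  then have "(%n. f (em s h (Suc n) (X om) (Suc n) om)) ----> f (Phi s (X om) h om)"
   by (rule isCont_tendsto_compose) (rule LIMSEQ_Suc[OF em_tendsto[OF om s h]])
  then show "(%n. f (em s h (Suc n) (X om) (Suc n) om) * c om) ----> f (Phi s (X om) h om) * c om" by (intro tendsto_intros)
 qed
 show "AE om in P. norm (f (em s h (Suc n) (X om) (Suc n) om) * c om) <= C * Cc" for n using bnd[OF C] by simp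
qed (use cp meas_comp[OF em fm] meas_comp[OF F_P[OF Phi_measurable[OF X(1) s h0]] fm] in auto)
moreover have "(%n. \<integral>om. (Top (h / Suc n) ^^ Suc n) f (X om) * c om \<partial>P) ----> (LINT om|P. Kf h f (X om) * c om)"
proof (rule dominated_conv[where w = "%_. C * Cc"])
 show "AE om in P. (%n. (Top (h / Suc n) ^^ Suc n) f (X om) * c om) ----> Kf h f (X om) * c om"
  by (rule AE_I2) (intro tendsto_mult Kf_limit[OF f X(2) h] tendsto_const)
 show "AE om in P. norm ((Top (h / Suc n) ^^ Suc n) f (X om) * c om) <= C * Cc" for n using bnd[OF Ti(2)] by (simp del: funpow.simps)
qed (use cp meas_comp[OF Xp Ti(1)] F_P[OF KX] in "auto simp del: funpow.simps")
ultimately show "(LINT om|P. f (Phi s (X om) h om) * c om) = (LINT om|P. Kf h f (X om) * c om)" unfolding eq by (rule LIMSEQ_unique)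
qed

lemma Kf_tendsto:
assumes f: "nice f" and lim: "!!om. om : space P ==> (%n. Phi 0 (xs n) (hs n) om) ----> Phi 0 x h om"
 and x: "snd x ~= 0" and h: "0 <= h" "!!n. 0 <= hs n"
shows "(%n. Kf (hs n) f (xs n)) ----> Kf h f x"
proof -
obtain C where C: "!!x. abs (f x) <= C" using f by (auto simp: nice_def)
have fm: "f : bmeas borel" using f by (simp add: nice_def)
show ?thesis unfolding Kf_def
proof (rule dominated_conv[where w = "%_. C"])
 show "AE om in P. (%n. f (Phi 0 (xs n) (hs n) om)) ----> f (Phi 0 x h om)"
 proof (rule AE_I2)
  fix om assume om: "om : space P"
  have "isCont f (Phi 0 x h om)" using f Phi_nonzero[OF om order_refl h(1) x] unfolding nice_def by (auto simp del: split_paired_All)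
  then show "(%n. f (Phi 0 (xs n) (hs n) om)) ----> f (Phi 0 x h om)" by (rule isCont_tendsto_compose) (rule lim[OF om])
 qed
qed (use C meas_comp[OF Phi_const_measurable fm] h in auto)
qed

lemma Kf_feller:
assumes f: "nice f" and x: "snd x ~= 0" and h: "0 <= h"
shows "isCont (Kf h f) x"
unfolding continuous_at_sequentially
proof (intro allI impI)
fix xs assume xs: "xs ----> x"
have "(%n. Kf h f (xs n)) ----> Kf h f x"
proof (rule Kf_tendsto[OF f _ x h h])
 show "(%n. Phi 0 (xs n) h om) ----> Phi 0 x h om" if "om : space P" for om
  unfolding Phi_def by (rule flow_continuous_start[OF path_continuous[OF that order_refl] xs h])
qed
then show "(Kf h f \<circ> xs) ----> Kf h f x" by (simp add: o_def)
qed

lemma Kf_time: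
assumes f: "nice f" and x: "snd x ~= 0" and h: "0 <= h" "!!n. 0 <= hs n" "hs ----> h"
shows "(%n. Kf (hs n) f x) ----> Kf h f x"
proof (rule Kf_tendsto[OF f _ x h(1,2)])
show "(%n. Phi 0 x (hs n) om) ----> Phi 0 x h om" if "om : space P" for om unfolding Phi_def
 by (rule cont_tendsto[OF flow_continuous_time[OF path_continuous[OF that order_refl]] h(3)]) (use h in auto)
qed

lemma Kf_homogeneous:
assumes f: "!!v z r. r > 0 ==> f (v, r *\<^sub>R z) = f (v, z)" and h: "0 <= h" and r: "r > 0"
shows "Kf h f (v, r *\<^sub>R z) = Kf h f (v, z)"
unfolding Kf_def
proof (rule Bochner_Integration.integral_cong[OF refl])
fix om assume "om : space P"
from flow_scale[OF path_continuous[OF this order_refl] h, of v r z]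
have "Phi 0 (v, r *\<^sub>R z) h om = (fst (Phi 0 (v, z) h om), r *\<^sub>R snd (Phi 0 (v, z) h om))" by (simp add: Phi_def)
then show "f (Phi 0 (v, r *\<^sub>R z) h om) = f (Phi 0 (v, z) h om)" using f[OF r] by simp
qed

end


section \<open>The Ito formula for the complex logarithm\<close>

text \<open>A continuous logarithm along a path without zeros, equal to the principal value at time
  0; its imaginary part is a continuous angle.\<close>

definition clog :: "(real => complex) => real => complex" where
"clog z = (SOME l. cont0 l & (ALL t>=0. exp (l t) = z t) & l 0 = Ln (z 0))"

lemma clog:
assumes c: "cont0 z" and nz: "!!t. 0 <= t ==> z t ~= 0"
shows "cont0 (clog z)" "0 <= t ==> exp (clog z t) = z t" "clog z 0 = Ln (z 0)"
proof -
obtain g where g: "cont0 g" "!!x. x : {0..} ==> z x = exp (g x)"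
 using continuous_logarithm_on_contractible[OF c convex_imp_contractible[OF convex_real_interval(1)]] nz by auto
let ?l = "%t. g t + (Ln (z 0) - g 0)"
let ?P = "%l. cont0 l & (ALL t>=0. exp (l t) = z t) & l 0 = Ln (z 0)"
have "exp (?l t) = z t" if "t >= 0" for t using g(2)[of t] g(2)[of 0] that nz[of 0] by (simp add: exp_add exp_diff)
then have "?P ?l" using g(1) by (auto intro!: continuous_intros)
then have "?P (clog z)" unfolding clog_def by (rule someI[of ?P])
then show "cont0 (clog z)" "0 <= t ==> exp (clog z t) = z t" "clog z 0 = Ln (z 0)" by auto
qed

text \<open>The expansion \<open>d = eta - eta^2 / 2 + O(eta^3)\<close> for
  \<open>eta = exp d - 1\<close>, obtained from Taylor's formula for \<open>exp\<close>, so that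
  \<open>d\<close> can be the increment of any continuous logarithm. The 24 is
  \<open>3 * 2^3\<close>, from the error \<open>3 |d|^3\<close> and
  \<open>|d| <= 2 |eta|\<close>.\<close>

lemma exp_minus_one_bounds:
fixes d :: complex
assumes d: "norm d <= 1 / 8"
shows "norm (exp d - 1) <= 2 * norm d"
 "norm (d - ((exp d - 1) - (exp d - 1)^2 / 2)) <= 24 * norm (exp d - 1) ^ 3"
proof -
define R where "R = exp d - (1 + d + d^2 / 2)"
define eta where "eta = exp d - 1"
have "exp (abs (Re d)) <= exp 1" using abs_Re_le_cmod[of d] d by simp
then have "exp (abs (Re d)) <= 3" using exp_le by linarith
moreover have "norm (exp d - (SUM k<=2. d ^ k / fact k)) <= exp (abs (Re d)) * norm d ^ Suc 2 / fact 2" by (rule Taylor_exp)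
then have "norm R <= exp (abs (Re d)) * norm d ^ 3 / 2" by (simp add: R_def numeral_2_eq_2 numeral_3_eq_3)
ultimately have R: "norm R <= 3 / 2 * norm d ^ 3" using mult_right_mono[of "exp (abs (Re d))" 3 "norm d ^ 3"] by (simp add: mult.commute)
have d3: "norm d ^ 3 <= norm d ^ 2 * (1 / 8)" using mult_left_mono[OF d, of "norm d ^ 2"] by (simp add: power2_eq power3_eq_cube)
have d2: "norm d ^ 2 <= norm d * (1 / 8)" using mult_left_mono[OF d, of "norm d"] by (simp add: power2_eq)
have "eta - d = d^2 / 2 + R" by (simp add: eta_def R_def)
then have "norm (eta - d) <= norm d ^ 2 / 2 + norm R" using norm_triangle_ineq[of "d^2 / 2" R] by (simp add: norm_divide norm_power)
then have 1: "norm (eta - d) <= norm d ^ 2" using R d3 zero_le_power2[of "norm d"] by linarith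
have n0: "0 <= norm d" by simp
have "norm eta <= norm (eta - d) + norm d" using norm_triangle_ineq[of "eta - d" d] by simp
then show le: "norm (exp d - 1) <= 2 * norm d" using 1 d2 n0 unfolding eta_def by linarith
have "norm d <= norm eta + norm (eta - d)" using norm_triangle_ineq[of eta "d - eta"] by (simp add: norm_minus_commute)
then have ge: "norm d <= 2 * norm eta" using 1 d2 n0 by linarith
have "norm (eta^2 - d^2) = norm (eta - d) * norm (eta + d)" unfolding norm_mult[symmetric] by (simp add: power2_eq algebra_simps)
also have "... <= norm d ^ 2 * (3 * norm d)" using 1 norm_triangle_ineq[of eta d] le by (intro mult_mono) (auto simp: eta_def)
finally have 2: "norm (eta^2 - d^2) <= 3 * norm d ^ 3" by (simp add: power2_eq power3_eq_cube mult_ac)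
have "d - (eta - eta^2 / 2) = (eta^2 - d^2) / 2 - R" by (simp add: eta_def R_def field_simps)
then have "norm (d - (eta - eta^2 / 2)) <= norm (eta^2 - d^2) / 2 + norm R"
 using norm_triangle_ineq4[of "(eta^2 - d^2) / 2" R] by (simp add: norm_divide)
also have "... <= 3 * norm d ^ 3" using 2 R by simp
also have "norm d ^ 3 <= (2 * norm eta) ^ 3" by (rule power_mono[OF ge]) simp
finally show "norm (d - ((exp d - 1) - (exp d - 1)^2 / 2)) <= 24 * norm (exp d - 1) ^ 3" by (simp add: eta_def power_mult_distrib)
qed

context params
begin

text \<open>The noise term carries \<open>Re z\<close> at the left end, as in an Ito sum. The
  correction \<open>(w t - w r) * Im z\<close> is what remains when the driver is integrated by
  parts against \<open>Re z\<close>.\<close>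

lemma osc_path_increment:
assumes X: "osc_path W v z" and W: "cont0 W" and st: "0 <= s" "s <= t"
shows "z t - z s = of_real (driver W t - driver W s) * (\<i> * of_real (Re (z s)))
  + integral {s..t} (%r. osc_drift (v r) (z r) + of_real (driver W t - driver W r) * (\<i> * of_real (Im (z r))))"
 "(%r. osc_drift (v r) (z r) + of_real (driver W t - driver W r) * (\<i> * of_real (Im (z r)))) integrable_on {s..t}"
proof -
have vc: "cont0 v" and zc: "cont0 z" using X by (auto simp: osc_path_def)
let ?w = "driver W"
have wc: "cont0 ?w" by (rule continuous_on_driver[OF W])
let ?r = "%s. rde_drift (?w s) (v s) (z s)"
let ?H = "%r. osc_drift (v r) (z r) + of_real (?w t - ?w r) * (\<i> * of_real (Im (z r)))"
have sub: "{s..t} <= {0..}" "{0..t} <= {0..}" using st by auto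
have rc: "cont0 ?r" by (intro continuous_on_rde_drift wc vc zc)
have ri: "?r integrable_on {s..t}" "?r integrable_on {0..t}" by (intro cont_integrable cont_subset[OF rc] sub)+
have ii: "(%r. Im (z r)) integrable_on {s..t}" "(%r. Im (z r)) integrable_on {0..t}"
 by (intro cont_integrable continuous_intros cont_subset[OF zc] sub)+
have Heq: "?H = (%r. ?r r + (\<i> * of_real (?w t)) * of_real (Im (z r)))"
 by (simp add: fun_eq_iff osc_drift_def rde_drift_def complex_eq_iff algebra_simps)
have oi: "(%r. complex_of_real (Im (z r))) integrable_on {s..t}"
 "integral {s..t} (%r. complex_of_real (Im (z r))) = of_real (integral {s..t} (%r. Im (z r)))"
 using integrable_linear[OF ii(1) bounded_linear_of_real[where 'a = complex]] integral_linear[OF ii(1) bounded_linear_of_real[where 'a = complex]] by (simp_all add: o_def)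
have mi: "(%r. (\<i> * of_real (?w t)) * complex_of_real (Im (z r))) integrable_on {s..t}" by (rule integrable_on_mult_right[OF oi(1)])
show "?H integrable_on {s..t}" unfolding Heq by (rule integrable_add[OF ri(1) mi])
have H: "integral {s..t} ?H = integral {s..t} ?r + (\<i> * of_real (?w t)) * of_real (integral {s..t} (%r. Im (z r)))"
 unfolding Heq hk_add[OF ri(1) mi] Henstock_Kurzweil_Integration.integral_mult_right oi(2) ..
have sp: "itg s ?r + integral {s..t} ?r = itg t ?r"
 "itg s (%r. Im (z r)) + integral {s..t} (%r. Im (z r)) = itg t (%r. Im (z r))"
 by (rule hk_combine[OF st ri(2)], rule hk_combine[OF st ii(2)])
have sh: "shear (- ?w t) (z t) - shear (- ?w s) (z s) = integral {s..t} ?r"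
 using X st sp(1) unfolding osc_path_def by (simp add: algebra_simps)
have re: "Re (z t) - Re (z s) = integral {s..t} (%r. Im (z r))" using osc_path_Re[OF X W, of t] osc_path_Re[OF X W, of s] st sp(2) by simp
show "z t - z s = of_real (?w t - ?w s) * (\<i> * of_real (Re (z s))) + integral {s..t} ?H"
 unfolding H re[symmetric] sh[symmetric] by (simp add: shear_def complex_eq_iff algebra_simps)
qed

text \<open>The noise coefficient of \<open>dz / z\<close> with respect to
  \<open>\<langle>\<gamma>, W\<rangle>\<close>.\<close>

definition noise_coeff :: "complex => complex" where
"noise_coeff z = \<i> * of_real (Re z) / z"

lemma norm_noise_coeff: "norm (noise_coeff z) <= 1"
proof (cases "z = 0")
case False
then show ?thesis using abs_Re_le_cmod[of z] by (simp add: noise_coeff_def norm_divide norm_mult)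
qed (simp add: noise_coeff_def)

lemma norm_osc_drift: "norm (osc_drift v z) <= drift_bound v * norm z"
using norm_rde_drift[of 0 v z] by (simp add: rde_drift_def osc_drift_def)

lemma continuous_on_osc_drift:
"continuous_on S v ==> continuous_on S z ==> continuous_on S (%t. osc_drift (v t) (z t))"
unfolding osc_drift_def Complex_eq by (intro continuous_intros)

text \<open>Here \<open>c * y\<close> is the noise and \<open>b\<close> the drift part of the
  relative increment. Of the square only the noise part is kept: the cubic remainder yields
  \<open>24 * 2 e * 2 (y^2 + C^2)\<close>, the products with \<open>b\<close> the last term.\<close>

lemma log_increment_bound:
fixes d c b :: complex and y :: real
assumes d: "norm d <= e" "e <= 1 / 8" and eta: "exp d - 1 = c * of_real y + b"
 and c: "norm c <= 1" and y: "abs y <= e" and b: "norm b <= C"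
shows "norm (d - (c * of_real y - c^2 * of_real (y^2) / 2) - b) <= 96 * e * (y^2 + C^2) + C * (2 * e + C) / 2"
proof -
let ?eta = "exp d - 1"
have e0: "0 <= e" using d(1) norm_ge_zero[of d] by linarith
have C0: "0 <= C" using b norm_ge_zero[of b] by linarith
have cy: "norm (c * of_real y) <= abs y" using c mult_right_mono[of "norm c" 1 "abs y"] by (simp add: norm_mult)
have n: "norm ?eta <= abs y + C" unfolding eta using norm_triangle_ineq[of "c * of_real y" b] cy b by simp
have "norm ?eta ^ 2 <= (abs y + C)^2" by (rule power_mono[OF n]) simp
also have "... <= 2 * (y^2 + C^2)" using sum_squares_bound[of "abs y" C] by (simp add: power2_sum)
finally have n2: "norm ?eta ^ 2 <= 2 * (y^2 + C^2)" .
have d8: "norm d <= 1 / 8" using d by simp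
have "norm ?eta ^ 3 = norm ?eta * norm ?eta ^ 2" by (simp add: power2_eq power3_eq_cube)
also have "... <= (2 * e) * (2 * (y^2 + C^2))" using exp_minus_one_bounds(1)[OF d8] d(1) e0 by (intro mult_mono n2) auto
finally have 1: "norm (d - (?eta - ?eta^2 / 2)) <= 96 * e * (y^2 + C^2)" using exp_minus_one_bounds(2)[OF d8] by (simp add: algebra_simps)
have "norm (b * (2 * (c * of_real y) + b)) <= C * (2 * e + C)"
 unfolding norm_mult using b C0 cy y norm_triangle_ineq[of "2 * (c * of_real y)" b] by (intro mult_mono) (auto simp: norm_mult)
then have 2: "norm (b * (2 * (c * of_real y) + b) / 2) <= C * (2 * e + C) / 2" by (simp add: norm_divide)
have eq: "d - (c * of_real y - c^2 * of_real (y^2) / 2) - b = (d - (?eta - ?eta^2 / 2)) - b * (2 * (c * of_real y) + b) / 2"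
 unfolding eta by (simp add: power2_eq field_simps)
show ?thesis unfolding eq by (rule order_trans[OF norm_triangle_ineq4 add_mono[OF 1 2]])
qed

text \<open>For an arbitrary continuous path the sum of squared increments need not be bounded. It
  therefore stays in the error and is controlled by passing to a subsequence on which the quadratic
  variation converges almost surely.\<close>

lemma log_pathwise:
assumes X: "osc_path W v z" and W: "cont0 W" and z0: "z 0 ~= 0" and T: "0 < T"
obtains eps where "eps ----> 0"
 "EVN n. norm (clog z T - clog z 0
   - (SUM i<n. noise_coeff (z (grid T n i)) * of_real (driver W (grid T n (Suc i)) - driver W (grid T n i))
      - (noise_coeff (z (grid T n i)))^2 * of_real ((driver W (grid T n (Suc i)) - driver W (grid T n i))^2) / 2)
   - itg T (%t. osc_drift (v t) (z t) / z t))
  <= eps n * (1 + (SUM i<n. (driver W (grid T n (Suc i)) - driver W (grid T n i))^2))"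
proof -
have vc: "cont0 v" and zc: "cont0 z" using X by (auto simp: osc_path_def)
let ?w = "driver W" and ?l = "clog z" and ?g = "grid T"
have nz: "z t ~= 0" if "0 <= t" for t by (rule osc_path_nonzero[OF X W z0 that])
have l: "cont0 ?l" "!!t. 0 <= t ==> exp (?l t) = z t" using clog[OF zc nz] by auto
have wc: "cont0 ?w" by (rule continuous_on_driver[OF W])
have sub: "{0..T} <= {0..}" by auto
have T0: "0 <= T" using T by simp
obtain V where V: "V >= 0" "!!t. t : {0..T} ==> norm (v t) <= V" using bounded_on_Icc[OF vc] by blast
obtain Z where Z: "Z >= 0" "!!t. t : {0..T} ==> norm (z t) <= Z" using bounded_on_Icc[OF zc] by blast
obtain w where w: "w >= 0" "!!t. t : {0..T} ==> norm (?w t) <= w" using bounded_on_Icc[OF wc] by blast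
have ic: "cont0 (%t. inverse (z t))" using nz by (intro continuous_intros zc) auto
obtain c where c: "c >= 0" "!!t. t : {0..T} ==> norm (inverse (z t)) <= c" using bounded_on_Icc[OF ic] by blast
have cont: "continuous_on {0..T} (%t. (?l t, ?w t, inverse (z t)))" by (intro continuous_on_Pair cont_subset[OF _ sub] l(1) wc ic)
obtain e where e: "e ----> 0" and em: "!!n i r r'. [|i < n; r : {?g n i..?g n (Suc i)}; r' : {?g n i..?g n (Suc i)}|]
   ==> dist (?l r, ?w r, inverse (z r)) (?l r', ?w r', inverse (z r')) <= e n" using grid_modulus[OF cont T0] by blast
have dst: "norm (?l r - ?l r') <= dist (?l r, ?w r, inverse (z r)) (?l r', ?w r', inverse (z r'))"
 "abs (?w r - ?w r') <= dist (?l r, ?w r, inverse (z r)) (?l r', ?w r', inverse (z r'))"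
 "norm (inverse (z r) - inverse (z r')) <= dist (?l r, ?w r, inverse (z r)) (?l r', ?w r', inverse (z r'))" for r r'
 using dist_fst_le[of "(?l r, ?w r, inverse (z r))" "(?l r', ?w r', inverse (z r'))"] dist_snd_le[of "(?l r, ?w r, inverse (z r))" "(?l r', ?w r', inverse (z r'))"]
  dist_fst_le[of "(?w r, inverse (z r))" "(?w r', inverse (z r'))"] dist_snd_le[of "(?w r, inverse (z r))" "(?w r', inverse (z r'))"]
 by (auto simp: dist_norm)
define K where "K = (1 + 2 * abs zeta + kappa^2 + norm a * V) * Z"
define Cb where "Cb = (K + 2 * w * Z) * c"
have K0: "0 <= K" using V(1) Z(1) by (simp add: K_def)
have Cb0: "0 <= Cb" using K0 w(1) Z(1) c(1) by (simp add: Cb_def)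
\<comment> \<open>The summands are the cubic remainder from the noise, that from the drift part, the
  products with the drift part, and the cost of freezing \<open>1 / z\<close> and the driver in the
  integral.\<close>
define eps where "eps n = 96 * e n + 96 * e n * (Cb^2 * T * (T / n)) + Cb * T * (2 * e n + Cb * (T / n)) * (1 / 2) + (K * e n + e n * Z * c) * T" for n
have Tn: "(%n. T / real n) ----> 0" by (rule lim_const_over_n)
have eeps: "eps ----> 0"
proof -
 have "eps ----> 96 * 0 + 96 * 0 * (Cb^2 * T * 0) + Cb * T * (2 * 0 + Cb * 0) * (1 / 2) + (K * 0 + 0 * Z * c) * T"
  unfolding eps_def by (intro tendsto_add tendsto_mult tendsto_const e Tn)
 then show ?thesis by simp
qed
have ev: "EVN n. 0 < n & e n < 1 / 8" by (rule eventually_conj[OF eventually_gt_at_top order_tendstoD(2)[OF e]]) simp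
show thesis
proof (rule that[OF eeps], rule eventually_mono[OF ev])
 fix n assume n': "0 < n & e n < 1 / 8"
 then have n: "0 < n" and e8: "e n <= 1 / 8" by auto
 let ?D = "T / n"
 define dw where "dw i = ?w (?g n (Suc i)) - ?w (?g n i)" for i
 define d where "d i = ?l (?g n (Suc i)) - ?l (?g n i)" for i
 define ai where "ai i = noise_coeff (z (?g n i))" for i
 define H where "H i r = (osc_drift (v r) (z r) + of_real (?w (?g n (Suc i)) - ?w r) * (\<i> * of_real (Im (z r)))) / z (?g n i)" for i r
 define b where "b i = integral {?g n i..?g n (Suc i)} (H i)" for i
 have g: "?g n k : {0..T}" if "k <= n" for k using that T0 by (auto intro: grid_nonneg grid_le)
 have gs: "?g n k : {?g n k..?g n (Suc k)}" "?g n (Suc k) : {?g n k..?g n (Suc k)}" for k using grid_mono[OF T0] by auto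
 have gr: "r : {0..T}" if "k < n" "r : {?g n k..?g n (Suc k)}" for k r using that g[of k] g[of "Suc k"] by auto
 have e0: "0 <= e n" using em[OF n gs(1) gs(1)] by (simp add: order_trans[OF zero_le_dist])
 have oK: "norm (osc_drift (v r) (z r)) <= K" if "r : {0..T}" for r
 proof -
  have "drift_bound (v r) <= 1 + 2 * abs zeta + kappa^2 + norm a * V"
   unfolding drift_bound_def using mult_left_mono[OF V(2)[OF that] norm_ge_zero[of a]] by simp
  then show ?thesis unfolding K_def using Z(2)[OF that] V(1) by (intro order_trans[OF norm_osc_drift] mult_mono) auto
 qed
 have wz: "norm (of_real (?w (?g n (Suc i)) - ?w r) * (\<i> * complex_of_real (Im (z r)))) <= x * Z"
  if "r : {0..T}" "abs (?w (?g n (Suc i)) - ?w r) <= x" for i r x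
  unfolding norm_mult using that Z(2)[OF that(1)] abs_Im_le_cmod[of "z r"] Z(1) by (simp add: mult_mono del: of_real_diff)
 have Hi: "H i integrable_on {?g n i..?g n (Suc i)}" if "i < n" for i unfolding H_def divide_inverse
  by (rule integrable_on_mult_left[OF osc_path_increment(2)[OF X W]]) (use g[of i] gs[of i] that in auto)
 have Hb: "norm (H i r) <= Cb" if i: "i < n" "r : {?g n i..?g n (Suc i)}" for i r
 proof -
  have "abs (?w (?g n (Suc i)) - ?w r) <= 2 * w" using w(2)[of r] w(2)[of "?g n (Suc i)"] gr[OF i] g[of "Suc i"] i by fastforce
  then have "norm (osc_drift (v r) (z r) + of_real (?w (?g n (Suc i)) - ?w r) * (\<i> * of_real (Im (z r)))) <= K + 2 * w * Z"
   by (intro order_trans[OF norm_triangle_ineq] add_mono oK wz gr[OF i])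
  then show ?thesis unfolding H_def Cb_def divide_inverse norm_mult using c(2)[OF g[of i]] i K0 w(1) Z(1) by (intro mult_mono) auto
 qed
 have bb: "norm (b i) <= Cb * ?D" if i: "i < n" for i
  using integral_norm_le_const[OF _ Hi[OF i] Hb[OF i]] gs[of i] grid_step[of T n i] by (simp add: b_def)
 have eta: "exp (d i) - 1 = ai i * of_real (dw i) + b i" if i: "i < n" for i
 proof -
  have g0: "0 <= ?g n i" "0 <= ?g n (Suc i)" "?g n i <= ?g n (Suc i)" using g[of i] g[of "Suc i"] gs[of i] i by auto
  have bi: "b i = integral {?g n i..?g n (Suc i)}
    (%r. osc_drift (v r) (z r) + of_real (?w (?g n (Suc i)) - ?w r) * (\<i> * of_real (Im (z r)))) * inverse (z (?g n i))"
   unfolding b_def H_def[abs_def] divide_inverse by (rule Henstock_Kurzweil_Integration.integral_mult_left)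
  have "exp (d i) - 1 = (z (?g n (Suc i)) - z (?g n i)) * inverse (z (?g n i))"
   unfolding d_def exp_diff l(2)[OF g0(1)] l(2)[OF g0(2)] using nz[OF g0(1)] by (simp add: field_simps)
  also have "... = ai i * of_real (dw i) + b i"
   unfolding osc_path_increment(1)[OF X W g0(1,3)] bi distrib_right ai_def noise_coeff_def dw_def divide_inverse by (simp only: mult_ac)
  finally show ?thesis .
 qed
 have dw: "abs (dw i) <= e n" "norm (d i) <= e n" if i: "i < n" for i
  using order_trans[OF dst(2) em[OF i gs(2) gs(1)]] order_trans[OF dst(1) em[OF i gs(2) gs(1)]] by (simp_all add: dw_def d_def)
 have inc: "norm (d i - (ai i * of_real (dw i) - (ai i)^2 * of_real ((dw i)^2) / 2) - b i)
   <= 96 * e n * ((dw i)^2 + (Cb * ?D)^2) + (Cb * ?D) * (2 * e n + Cb * ?D) / 2" if i: "i < n" for i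
  by (rule log_increment_bound[OF dw(2)[OF i] e8 eta[OF i] _ dw(1)[OF i] bb[OF i]]) (simp add: ai_def norm_noise_coeff)
 have fc: "continuous_on {0..T} (%t. osc_drift (v t) (z t) / z t)"
  unfolding divide_inverse by (intro continuous_on_mult continuous_on_osc_drift cont_subset[OF _ sub] vc zc ic)
 have close: "norm (H i r - osc_drift (v r) (z r) / z r) <= K * e n + e n * Z * c"
  if i: "i < n" "r : {?g n i..?g n (Suc i)}" for i r
 proof -
  have "H i r - osc_drift (v r) (z r) / z r = osc_drift (v r) (z r) * (inverse (z (?g n i)) - inverse (z r))
    + of_real (?w (?g n (Suc i)) - ?w r) * (\<i> * of_real (Im (z r))) * inverse (z (?g n i))"
   by (simp add: H_def divide_inverse algebra_simps)
  also have "norm ... <= K * e n + e n * Z * c"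
  proof (intro order_trans[OF norm_triangle_ineq] add_mono)
   show "norm (osc_drift (v r) (z r) * (inverse (z (?g n i)) - inverse (z r))) <= K * e n"
    unfolding norm_mult using oK[OF gr[OF i]] order_trans[OF dst(3) em[OF i(1) gs(1) i(2)]] K0 by (intro mult_mono) auto
   show "norm (of_real (?w (?g n (Suc i)) - ?w r) * (\<i> * complex_of_real (Im (z r))) * inverse (z (?g n i))) <= e n * Z * c"
    unfolding norm_mult[of _ "inverse (z (?g n i))"]
    using wz[OF gr[OF i] order_trans[OF dst(2) em[OF i(1) gs(2) i(2)]]] c(2)[OF g[of i]] i e0 Z(1) by (intro mult_mono) auto
  qed
  finally show ?thesis .
 qed
 have I: "norm ((SUM i<n. b i) - itg T (%t. osc_drift (v t) (z t) / z t)) <= (K * e n + e n * Z * c) * T"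
  unfolding b_def by (rule sum_integral_close[OF fc T0 n Hi close])
 let ?S = "SUM i<n. ai i * of_real (dw i) - (ai i)^2 * of_real ((dw i)^2) / 2"
 have tel: "?l T - ?l 0 = (SUM i<n. d i)" using sum_lessThan_telescope[of "%i. ?l (?g n i)" n] n by (simp add: d_def grid_n)
 have tel': "?l T - ?l 0 - ?S - (SUM i<n. b i) = (SUM i<n. d i - (ai i * of_real (dw i) - (ai i)^2 * of_real ((dw i)^2) / 2) - b i)"
  unfolding tel by (simp add: sum_subtractf)
 have "norm (?l T - ?l 0 - ?S - (SUM i<n. b i)) <= (SUM i<n. 96 * e n * ((dw i)^2 + (Cb * ?D)^2) + (Cb * ?D) * (2 * e n + Cb * ?D) / 2)"
  unfolding tel' by (rule sum_norm_le) (use inc in auto)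
 also have "... = 96 * e n * (SUM i<n. (dw i)^2) + 96 * e n * (Cb^2 * T * ?D) + Cb * T * (2 * e n + Cb * ?D) / 2"
 proof -
  have alg: "N * (96 * e' * (C * D)^2 + C * D * (2 * e' + C * D) / 2) = 96 * e' * (C^2 * (N * D) * D) + C * (N * D) * (2 * e' + C * D) / 2"
   for N D C e' :: real
  proof -
   have "N * (96 * e' * (C * D)^2) = 96 * e' * (C^2 * (N * D) * D)" by (simp only: power2_eq mult_ac)
   moreover have "N * (C * D * X / 2) = C * (N * D) * X / 2" for X by (simp only: times_divide_eq_right mult_ac)
   ultimately show ?thesis by (simp only: distrib_left[of N])
  qed
  have nD: "real n * ?D = T" using n by simp
  have "(SUM i<n. 96 * e n * ((dw i)^2 + (Cb * ?D)^2) + (Cb * ?D) * (2 * e n + Cb * ?D) / 2)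
    = 96 * e n * (SUM i<n. (dw i)^2) + real n * (96 * e n * (Cb * ?D)^2 + (Cb * ?D) * (2 * e n + Cb * ?D) / 2)"
   unfolding distrib_left sum.distrib sum_distrib_left[symmetric] by simp
  then show ?thesis unfolding alg nD by simp
 qed
 finally have 1: "norm (?l T - ?l 0 - ?S - (SUM i<n. b i)) <= 96 * e n * (SUM i<n. (dw i)^2) + 96 * e n * (Cb^2 * T * ?D) + Cb * T * (2 * e n + Cb * ?D) / 2" .
 let ?q = "SUM i<n. (dw i)^2"
 have q0: "0 <= ?q" by (intro sum_nonneg) auto
 have "norm (?l T - ?l 0 - ?S - itg T (%t. osc_drift (v t) (z t) / z t))
   <= norm (?l T - ?l 0 - ?S - (SUM i<n. b i)) + norm ((SUM i<n. b i) - itg T (%t. osc_drift (v t) (z t) / z t))"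
 proof -
  have "norm (x - y) <= norm (x - u) + norm (u - y)" for x y u :: complex using norm_triangle_ineq[of "x - u" "u - y"] by simp
  then show ?thesis .
 qed
 also have "... <= 96 * e n * ?q + (eps n - 96 * e n)" using 1 I by (simp add: eps_def)
 also have "... <= eps n * (1 + ?q)"
 proof -
  have "0 <= eps n - 96 * e n" using e0 Cb0 T0 K0 Z(1) c(1) by (simp add: eps_def)
  from mult_right_mono[OF this q0] e0 show ?thesis by (simp add: algebra_simps)
 qed
 finally show "norm (?l T - ?l 0
   - (SUM i<n. noise_coeff (z (?g n i)) * of_real (?w (?g n (Suc i)) - ?w (?g n i))
      - (noise_coeff (z (?g n i)))^2 * of_real ((?w (?g n (Suc i)) - ?w (?g n i))^2) / 2)
   - itg T (%t. osc_drift (v t) (z t) / z t))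
  <= eps n * (1 + (SUM i<n. (?w (?g n (Suc i)) - ?w (?g n i))^2))" by (simp only: ai_def dw_def)
qed
qed


text \<open>The drift of \<open>log z\<close>, Ito correction included. In polar form its real part
  is \<open>Q\<close> and its imaginary part the angular drift, see
  \<open>Lam_polar\<close>.\<close>

definition Lam :: "(real^'d) * complex => complex" where
"Lam x = osc_drift (fst x) (snd x) / snd x - of_real ((norm gamma)^2 / 2) * (noise_coeff (snd x))^2"

end

lemma borel_fst_snd:
fixes X :: "'w => 'a::second_countable_topology \<times> 'b::second_countable_topology"
assumes "X : bmeas M"
shows "(%om. fst (X om)) : bmeas M" "(%om. snd (X om)) : bmeas M"
by (rule meas_comp[OF assms cont_bmeas], intro continuous_intros)+

context osc_bm
begin

section \<open>Measurability and Ito's formula along the flow\<close>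

lemma measurable_noise_coeff: "X : bmeas M ==> (%om. noise_coeff (X om)) : bmeas M"
unfolding noise_coeff_def by measurable

lemma measurable_osc_drift:
assumes [measurable]: "V : bmeas M" "Z : bmeas M"
shows "(%om. osc_drift (V om) (Z om)) : bmeas M"
unfolding osc_drift_def Complex_eq by measurable

lemma measurable_Lam:
assumes X: "X : bmeas M"
shows "(%om. Lam (X om)) : bmeas M"
unfolding Lam_def
by (intro bmeas_diff bmeas_divide bmeas_times bmeas_const bmeas_power
  measurable_noise_coeff measurable_osc_drift borel_fst_snd[OF X])

definition lg :: "(real^'d) * complex => real => 'w => complex" where
"lg x t om = clog (%s. snd (Phi 0 x s om)) t"

lemma Phi_path:
assumes "om : space P"
shows "osc_path (%t. W t om) (%t. fst (Phi 0 x t om)) (%t. snd (Phi 0 x t om))" "Phi 0 x 0 om = x"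
 "cont0 (%t. Phi 0 x t om)"
using flow_path[OF path_continuous[OF assms order_refl], of x] flow_0[OF path_continuous[OF assms order_refl], of x]
 flow_continuous_time[OF path_continuous[OF assms order_refl], of x]
by (simp_all add: Phi_def)

lemma Phi_adapted: "adapted (Phi 0 x)"
unfolding adapted_def using Phi_measurable[of "%_. x" 0] by simp

context
fixes x :: "(real^'d) * complex"
assumes x: "snd x ~= 0"
begin

lemma lg:
assumes om: "om : space P"
shows "cont0 (%t. lg x t om)" "0 <= t ==> exp (lg x t om) = snd (Phi 0 x t om)" "lg x 0 om = Ln (snd x)"
proof -
have c: "cont0 (%t. snd (Phi 0 x t om))" by (intro continuous_on_snd Phi_path(3)[OF om])
note l = clog[OF c Phi_nonzero[OF om order_refl _ x]]
show "cont0 (%t. lg x t om)" "0 <= t ==> exp (lg x t om) = snd (Phi 0 x t om)" "lg x 0 om = Ln (snd x)"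
 unfolding lg_def using l Phi_path(2)[OF om, of x] by auto
qed

text \<open>The logarithm is a choice made along the whole path, so its value at \<open>t\<close>
  has to be recovered from the past. On a fine grid the ratios of consecutive values lie in the
  right half plane, and their principal logarithms add up to the increment. Restriction to the half
  plane makes the summands Borel.\<close>

lemma lg_adapted: "adapted (lg x)"
unfolding adapted_def
proof (intro allI impI)
fix t :: real assume t: "0 <= t"
let ?z = "%t om. snd (Phi 0 x t om)" and ?H = "{zeta::complex. 0 < Re zeta}"
have zm: "?z s : bmeas (F t)" if "0 <= s" "s <= t" for s by (rule F_mono[OF that(2) borel_fst_snd(2)[OF adaptedD[OF Phi_adapted that(1)]]])
have Lm: "(%zeta. indicator ?H zeta *\<^sub>R Ln zeta) : bmeas borel"
proof (rule borel_measurable_continuous_on_indicator)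
 show "?H : sets borel" using open_halfspace_Re_gt[of 0] by simp
 show "continuous_on ?H Ln" by (rule continuous_on_Ln) (auto simp: complex_nonpos_Reals_iff)
qed
show "lg x t : bmeas (F t)"
proof (rule bmeas_LIMSEQ)
 let ?r = "%n i om. ?z (grid t n (Suc i)) om / ?z (grid t n i) om"
 let ?s = "%n i om. indicator ?H (?r n i om) *\<^sub>R Ln (?r n i om)"
 show "(%om. Ln (snd x) + (SUM i<n. ?s n i om)) : bmeas (F t)" for n
 proof (intro bmeas_add bmeas_const bmeas_sum)
  fix i assume "i : {..<n}"
  then have "?r n i : bmeas (F t)" using t by (intro bmeas_divide zm grid_nonneg grid_le) auto
  from meas_comp[OF this Lm] show "(%om. ?s n i om) : bmeas (F t)" .
 qed
 fix om assume "om : space (F t)"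
 then have om: "om : space P" by (simp add: space_F)
 note l = lg[OF om]
 have lc: "continuous_on {0..t} (%s. lg x s om)" by (rule cont_subset[OF l(1)]) auto
 obtain e where e: "e ----> 0" and em: "!!n i r r'. [|i < n; r : cell t n i; r' : cell t n i|]
   ==> dist (lg x r om) (lg x r' om) <= e n" using grid_modulus[OF lc t] by blast
 have "EVN n. 0 < n & e n < 1 / 8" by (rule eventually_conj[OF eventually_gt_at_top order_tendstoD(2)[OF e]]) simp
 then have "EVN n. Ln (snd x) + (SUM i<n. ?s n i om) = lg x t om"
 proof (rule eventually_mono)
  fix n assume n: "0 < n & e n < 1 / 8"
  have "?s n i om = lg x (grid t n (Suc i)) om - lg x (grid t n i) om" if i: "i < n" for i
  proof -
   define d where "d = lg x (grid t n (Suc i)) om - lg x (grid t n i) om"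
   have "norm d <= e n" using em[OF i, of "grid t n (Suc i)" "grid t n i"] grid_mono[OF t, of i "Suc i" n] by (simp add: d_def dist_norm)
   then have d: "norm d <= 1 / 8" using n by linarith
   have ed: "?r n i om = exp d" using l(2) grid_nonneg[OF t] by (simp add: d_def exp_diff)
   have "abs (Re (exp d - 1)) <= 1 / 4" using exp_minus_one_bounds(1)[OF d] d abs_Re_le_cmod[of "exp d - 1"] by linarith
   then have "abs (Re (exp d) - 1) <= 1 / 4" by simp
   then have "0 < Re (exp d)" by linarith
   then have "exp d : ?H" by simp
   moreover have "abs (Im d) <= 1 / 8" using abs_Im_le_cmod[of d] d by linarith
   then have "- pi < Im d" "Im d <= pi" using pi_gt3 by linarith+
   then have "Ln (exp d) = d" by (rule Ln_exp)
   ultimately show ?thesis unfolding ed by (simp add: d_def)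
  qed
  then have "(SUM i<n. ?s n i om) = (SUM i<n. lg x (grid t n (Suc i)) om - lg x (grid t n i) om)" by (intro sum.cong) auto
  also have "... = lg x t om - lg x 0 om" using sum_lessThan_telescope[of "%i. lg x (grid t n i) om" n] n by (simp add: grid_n)
  finally show "Ln (snd x) + (SUM i<n. ?s n i om) = lg x t om" by (simp add: l(3))
 qed
 then show "(%n. Ln (snd x) + (SUM i<n. ?s n i om)) ----> lg x t om" by (rule tendsto_eventually)
qed
qed

lemma noise_continuous: "om : space P ==> cont0 (%t. noise_coeff (snd (Phi 0 x t om)))"
unfolding noise_coeff_def by (intro continuous_intros Phi_path(3)) (simp_all add: Phi_nonzero[OF _ order_refl _ x])

lemma Lam_continuous: "om : space P ==> cont0 (%t. Lam (Phi 0 x t om))"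
unfolding Lam_def
by (intro continuous_on_diff continuous_on_divide continuous_on_mult continuous_on_const continuous_on_power noise_continuous
  continuous_on_osc_drift continuous_on_fst continuous_on_snd Phi_path(3)) (simp_all add: Phi_nonzero[OF _ order_refl _ x])

lemma noise_adapted: "adapted (%t om. noise_coeff (snd (Phi 0 x t om)))"
unfolding adapted_def by (intro allI impI measurable_noise_coeff borel_fst_snd(2) adaptedD[OF Phi_adapted])

lemma integral_Lam_measurable:
assumes t: "0 <= t"
shows "(%om. itg t (%s. Lam (Phi 0 x s om))) : bmeas (F t)"
by (rule integral_measurable_F[OF _ Lam_continuous t]) (auto intro!: measurable_Lam F_mono[OF _ adaptedD[OF Phi_adapted]])

text \<open>Testing against \<open>e\<close> yields real sums: \<open>e = 1\<close> gives the radius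
  and \<open>e = \<i>\<close> the angle. By \<open>log_pathwise\<close>, applied along subsequences,
  the left-point sums differ asymptotically from the increment of the logarithm by the drift
  integral and the sum of squared terms; the latter converges to the Ito correction by
  \<open>quadratic_variation\<close>.\<close>

theorem ito_log:
assumes e: "norm e <= 1" and T: "0 < T"
shows "in_prob (%n. RS gamma (%t om. e *. noise_coeff (snd (Phi 0 x t om))) T n n)
 (%om. e *. (lg x T om - lg x 0 om - itg T (%t. Lam (Phi 0 x t om))))"
proof -
 let ?M = "%om. lg x T om - lg x 0 om - itg T (%t. Lam (Phi 0 x t om))"
let ?a = "%t om. noise_coeff (snd (Phi 0 x t om))" and ?g = "grid T"
let ?f = "%t om. e *. (?a t om)^2 / 2"
let ?dr = "%t om. osc_drift (fst (Phi 0 x t om)) (snd (Phi 0 x t om)) / snd (Phi 0 x t om)"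
let ?dw = "%n i om. gamma *. dW (?g n) i om"
have T0: "0 <= T" using T by simp
have ab: "abs (e *. u) <= 1" if "norm u <= 1" for u :: complex using order_trans[OF Cauchy_Schwarz_ineq2 mult_mono[OF e that]] by simp
have fb: "abs (?f t om) <= 1 / 2" for t om using ab[of "(?a t om)^2"] norm_noise_coeff by (simp add: norm_power power_le_one)
have fa: "adapted ?f" unfolding adapted_def by (intro allI impI bmeas_divide bmeas_inner bmeas_const bmeas_power adaptedD[OF noise_adapted])
have fc: "cont0 (%t. ?f t om)" if "om : space P" for om by (intro continuous_intros noise_continuous[OF that]) simp
have Ra: "adapted (%t om. e *. ?a t om)" unfolding adapted_def by (intro allI impI bmeas_inner bmeas_const adaptedD[OF noise_adapted])
let ?Q = "%n om. SUM i<n. ?f (?g n i) om * (?dw n i om)^2" and ?q = "%n om. SUM i<n. 1 * (?dw n i om)^2"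
have Q: "in_prob ?Q (%om. (norm gamma)^2 * itg T (%t. ?f t om))" by (rule quadratic_variation[OF fa fb fc T])
have q: "in_prob ?q (%om. (norm gamma)^2 * itg T (%t. 1))" by (rule quadratic_variation[where C = 1]) (auto simp: adapted_def T)
let ?L = "%om. e *. (lg x T om - lg x 0 om - itg T (%t. ?dr t om))"
have drc: "cont0 (%t. ?dr t om)" if "om : space P" for om
 by (intro continuous_on_divide continuous_on_osc_drift continuous_on_fst continuous_on_snd Phi_path(3)[OF that])
  (simp_all add: Phi_nonzero[OF that order_refl _ x])
have drm: "(%om. itg T (%t. ?dr t om)) : bmeas (F T)" by (rule integral_measurable_F[OF _ drc T0])
  (auto intro!: bmeas_divide measurable_osc_drift borel_fst_snd F_mono[OF _ adaptedD[OF Phi_adapted]])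
have Lm: "?L : bmeas P" by (intro bmeas_inner bmeas_diff bmeas_const F_P[OF drm]
   F_P[OF adaptedD[OF lg_adapted T0]] F_P[OF adaptedD[OF lg_adapted order_refl]])
let ?R = "%n. RS gamma (%t om. e *. ?a t om) T n n"
have D: "in_prob (%n om. ?R n om - ?Q n om - ?L om) (%om. 0)"
proof (rule in_prob_if_subseq)
 show "(%om. ?R n om - ?Q n om - ?L om) : bmeas P" for n by (intro bmeas_diff RS_measurable[OF Ra T0] in_prob_measurable(1)[OF Q] Lm)
 fix r :: "nat => nat" assume r: "strict_mono r"
 obtain s where s: "strict_mono (s :: nat => nat)" "AE om in P. (%n. ?q (r (s n)) om) ----> (norm gamma)^2 * itg T (%t. 1)"
  using in_prob_AE_subseq[OF in_prob_subseq[OF q r]] .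
 have rs: "strict_mono (%n. r (s n))" using r s(1) by (simp add: strict_mono_def)
 from s(2) have "AE om in P. (%n. ?R (r (s n)) om - ?Q (r (s n)) om - ?L om) ----> 0"
 proof (rule AE_mp, intro AE_I2 impI)
  fix om assume om: "om : space P" and qc: "(%n. ?q (r (s n)) om) ----> (norm gamma)^2 * itg T (%t. 1)"
  let ?w = "driver (%t. W t om)"
  have dw: "?w (?g n (Suc i)) - ?w (?g n i) = ?dw n i om" for n i by (simp add: driver_def inc_def inner_diff_right)
  have z0: "snd (Phi 0 x 0 om) ~= 0" using Phi_path(2)[OF om] x by simp
  obtain eps where eps: "eps ----> 0" and le: "EVN n. norm (lg x T om - lg x 0 om
    - (SUM i<n. ?a (?g n i) om * of_real (?dw n i om) - (?a (?g n i) om)^2 * of_real ((?dw n i om)^2) / 2)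
    - itg T (%t. ?dr t om)) <= eps n * (1 + (SUM i<n. (?dw n i om)^2))"
   using log_pathwise[OF Phi_path(1)[OF om, of x] W_continuous[OF om] z0 T] unfolding dw lg_def by blast
  have le': "EVN n. norm (?R n om - ?Q n om - ?L om) <= eps n * (1 + ?q n om)"
  proof (rule eventually_mono[OF le])
   fix n
   let ?S = "SUM i<n. ?a (?g n i) om * of_real (?dw n i om) - (?a (?g n i) om)^2 * of_real ((?dw n i om)^2) / 2"
   assume le: "norm (lg x T om - lg x 0 om - ?S - itg T (%t. ?dr t om)) <= eps n * (1 + (SUM i<n. (?dw n i om)^2))"
   have mul: "e *. (u * of_real y) = (e *. u) * y" for u y by (simp add: inner_complex_def algebra_simps)
   have half: "e *. (u / 2) = (e *. u) / 2" for u by (simp add: inner_complex_def)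
   have "e *. ?S = ?R n om - ?Q n om" unfolding RS_def inner_sum_right inner_diff_right half mul sum_subtractf by simp
   then have "?R n om - ?Q n om - ?L om = - (e *. (lg x T om - lg x 0 om - ?S - itg T (%t. ?dr t om)))" by (simp add: inner_diff_right)
   then have "norm (?R n om - ?Q n om - ?L om) <= norm (lg x T om - lg x 0 om - ?S - itg T (%t. ?dr t om))"
    using order_trans[OF Cauchy_Schwarz_ineq2 mult_right_mono[OF e norm_ge_zero]] by simp
   then show "norm (?R n om - ?Q n om - ?L om) <= eps n * (1 + ?q n om)" using le by simp
  qed
  have lim0: "(%n. eps (r (s n)) * (1 + ?q (r (s n)) om)) ----> 0 * (1 + (norm gamma)^2 * itg T (%t. 1))"
   by (intro tendsto_mult tendsto_add tendsto_const qc LIMSEQ_subseq_LIMSEQ[OF eps rs, unfolded o_def])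
  show "(%n. ?R (r (s n)) om - ?Q (r (s n)) om - ?L om) ----> 0"
   by (rule Lim_null_comparison[OF eventually_subseq[OF rs le']]) (use lim0 in simp)
 qed
 with s(1) show "EX s. strict_mono (s :: nat => nat) & (AE om in P. (%n. ?R (r (s n)) om - ?Q (r (s n)) om - ?L om) ----> 0)" by blast
qed simp
have eqZ: "e *. ?M om
  = 0 + (norm gamma)^2 * itg T (%t. ?f t om) + ?L om" if om: "om : space P" for om
proof -
 have sub: "{0..T} <= {0..}" by auto
 have di: "(%t. ?dr t om) integrable_on {0..T}" by (rule cont_integrable[OF cont_subset[OF drc[OF om] sub]])
 have ac: "(%t. of_real ((norm gamma)^2 / 2) * (?a t om)^2) integrable_on {0..T}"
  by (intro cont_integrable continuous_intros cont_subset[OF noise_continuous[OF om] sub])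
 have "itg T (%t. Lam (Phi 0 x t om)) = itg T (%t. ?dr t om) - itg T (%t. of_real ((norm gamma)^2 / 2) * (?a t om)^2)"
  unfolding Lam_def by (rule hk_diff[OF di ac])
 moreover have "e *. itg T (%t. of_real ((norm gamma)^2 / 2) * (?a t om)^2) = itg T (%t. e *. (of_real ((norm gamma)^2 / 2) * (?a t om)^2))"
  using integral_linear[OF ac bounded_linear_inner_right[of e]] by (simp add: o_def)
 moreover have "(%t. e *. (of_real ((norm gamma)^2 / 2) * (?a t om)^2)) = (%t. (norm gamma)^2 * ?f t om)"
  by (simp add: fun_eq_iff inner_complex_def algebra_simps)
 ultimately show ?thesis by (simp add: inner_diff_right)
qed
have R: "in_prob (%n om. (?R n om - ?Q n om - ?L om) + ?Q n om + ?L om) (%om. 0 + (norm gamma)^2 * itg T (%t. ?f t om) + ?L om)"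
 by (rule in_prob_add[OF in_prob_add[OF D Q] in_prob_const[OF Lm]])
show ?thesis
proof (rule in_prob_cong_AE[OF R])
 show "(%om. e *. ?M om) : bmeas P" by (intro bmeas_inner bmeas_diff bmeas_const F_P[OF integral_Lam_measurable[OF T0]]
   F_P[OF adaptedD[OF lg_adapted T0]] F_P[OF adaptedD[OF lg_adapted order_refl]])
 show "AE om in P. 0 + (norm gamma)^2 * itg T (%t. ?f t om) + ?L om = e *. ?M om" by (rule AE_I2) (rule eqZ[symmetric])
qed (use RS_measurable[OF Ra T0] in simp_all)
qed

end

end


section \<open>Pathwise uniqueness for the angle\<close>

lemma square_mono_abs: "abs x <= y ==> x^2 <= y^2" for x y :: real
using power_mono[of "abs x" y 2] by simp

lemma square_le_norm: "x^2 <= y ==> norm (x^2) <= norm y" for x y :: real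
using zero_le_power2[of x] by (simp add: order_trans[OF _ abs_ge_self])

text \<open>The trigonometric terms are both Lipschitz and bounded. Keeping the minimum makes all
  second moments of differences finite, whatever the moments of the angles.\<close>

lemma min_one_mono_diff:
fixes a b d :: real
assumes "abs (a - b) <= abs d"
shows "abs ((cos a)^2 - (cos b)^2) <= 4 * min 1 (abs d)" "abs (sin a * cos a - sin b * cos b) <= 4 * min 1 (abs d)"
 "abs (sin a * (cos a)^3 - sin b * (cos b)^3) <= 8 * min 1 (abs d)"
proof -
have prod: "abs (x * y - x' * y') <= abs (x - x') + abs (y - y')" if "abs x <= 1" "abs y' <= 1" for x y x' y' :: real
proof -
 have "x * y - x' * y' = x * (y - y') + (x - x') * y'" by (simp add: algebra_simps)
 then have "abs (x * y - x' * y') <= abs x * abs (y - y') + abs (x - x') * abs y'" by (metis abs_mult abs_triangle_ineq)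
 moreover have "abs x * abs (y - y') <= abs (y - y')" "abs (x - x') * abs y' <= abs (x - x')"
  using that by (auto intro: mult_left_le_one_le mult_right_le_one_le)
 ultimately show ?thesis by linarith
qed
have sc: "abs (cos x) <= 1" "abs (sin x) <= 1" for x :: real by (rule abs_cos_le_one, rule abs_sin_le_one)
have p2: "abs (2 * x * y) <= abs (a - b)" "abs (2 * y * x) <= abs (a - b)" if "abs x <= abs (a - b) / 2" "abs y <= 1" for x y :: real
 using mult_mono[OF that] by (simp_all add: abs_mult mult.commute mult.left_commute)
have hs: "abs (sin ((a - b) / 2)) <= abs (a - b) / 2" "abs (sin ((b - a) / 2)) <= abs (a - b) / 2"
 using abs_sin_x_le_abs_x[of "(a - b) / 2"] abs_sin_x_le_abs_x[of "(b - a) / 2"] by simp_all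
have lip: "abs (sin a - sin b) <= abs (a - b)" "abs (cos a - cos b) <= abs (a - b)"
 unfolding sin_diff_sin cos_diff_cos by (rule p2(1)[OF hs(1) sc(1)], rule p2(2)[OF hs(2) sc(2)])
let ?m = "min 1 (abs d)"
have 1: "abs (sin a - sin b) <= 2 * ?m" "abs (cos a - cos b) <= 2 * ?m"
proof -
 have g: "u <= 2 * ?m" if "u <= abs (a - b)" "u <= 2" for u
 proof (cases "abs d <= 1")
  case True
  then have "?m = abs d" by (rule min_absorb2)
  then show ?thesis using that assms by linarith
 next
  case False
  then have "?m = 1" by simp
  then show ?thesis using that by linarith
 qed
 have "abs (sin a - sin b) <= 2" "abs (cos a - cos b) <= 2" using sc[of a] sc[of b] by linarith+
 then show "abs (sin a - sin b) <= 2 * ?m" "abs (cos a - cos b) <= 2 * ?m" using g lip by blast+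
qed
have 2: "abs (cos a * cos a - cos b * cos b) <= 4 * ?m" using prod[OF sc(1)[of a] sc(1)[of b], of "cos a" "cos b"] 1 by linarith
then show "abs ((cos a)^2 - (cos b)^2) <= 4 * ?m" by (simp add: power2_eq)
show 3: "abs (sin a * cos a - sin b * cos b) <= 4 * ?m" using prod[OF sc(2)[of a] sc(1)[of b], of "cos a" "sin b"] 1 by linarith
have p1: "abs (x * y) <= 1" if "abs x <= 1" "abs y <= 1" for x y :: real unfolding abs_mult using that by (intro mult_le_one) auto
have "abs (sin a * cos a) <= 1" "abs (cos b * cos b) <= 1" by (rule p1[OF sc(2) sc(1)], rule p1[OF sc(1) sc(1)])
from prod[OF this, of "cos a * cos a" "sin b * cos b"]
have "abs ((sin a * cos a) * (cos a * cos a) - (sin b * cos b) * (cos b * cos b)) <= 8 * ?m" using 2 3 by linarith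
then show "abs (sin a * (cos a)^3 - sin b * (cos b)^3) <= 8 * ?m" by (simp add: power3_eq_cube mult_ac)
qed

context osc_bm
begin

abbreviation ang :: "real^'d => real => real" where
"ang \<equiv> angular_drift a gamma kappa zeta"

lemma ang_diff:
assumes "abs (theta - theta') <= abs d" "norm v <= M"
shows "abs (ang v theta - ang v theta') <= (4 * (1 + kappa^2 + norm a * M) + 8 * abs zeta + 8 * (norm gamma)^2) * min 1 (abs d)"
proof -
note m = min_one_mono_diff[OF assms(1)]
let ?m = "min 1 (abs d)"
have "abs (1 - kappa^2 + a *. v) <= 1 + kappa^2 + norm a * M"
 using Cauchy_Schwarz_ineq2[of a v] mult_left_mono[OF assms(2) norm_ge_zero[of a]] zero_le_power2[of kappa] by linarith
then have 1: "abs ((1 - kappa^2 + a *. v) * ((cos theta)^2 - (cos theta')^2)) <= (1 + kappa^2 + norm a * M) * (4 * ?m)"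
 unfolding abs_mult by (intro mult_mono m) auto
have 2: "abs (2 * zeta * (sin theta * cos theta - sin theta' * cos theta')) <= 2 * abs zeta * (4 * ?m)"
 unfolding abs_mult by (intro mult_mono m) auto
have 3: "abs ((norm gamma)^2 * (sin theta * (cos theta)^3 - sin theta' * (cos theta')^3)) <= (norm gamma)^2 * (8 * ?m)"
 unfolding abs_mult by (intro mult_mono m) auto
have "ang v theta - ang v theta' = (1 - kappa^2 + a *. v) * ((cos theta)^2 - (cos theta')^2) - 2 * zeta * (sin theta * cos theta - sin theta' * cos theta')
  - (norm gamma)^2 * (sin theta * (cos theta)^3 - sin theta' * (cos theta')^3)" by (simp add: angular_drift_def algebra_simps)
moreover have "abs (x - y - z) <= X + Y + Z" if "abs x <= X" "abs y <= Y" "abs z <= Z" for x y z X Y Z :: real using that by linarith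
note this[OF 1 2 3]
ultimately have "abs (ang v theta - ang v theta') <= (1 + kappa^2 + norm a * M) * (4 * ?m) + 2 * abs zeta * (4 * ?m) + (norm gamma)^2 * (8 * ?m)"
 by (simp only:)
then show ?thesis by (simp add: algebra_simps)
qed

lemma continuous_on_ang: "continuous_on (S :: real set) v ==> continuous_on S theta ==> continuous_on S (%t. ang (v t) (theta t))"
unfolding angular_drift_def by (intro continuous_intros)

lemma measurable_ang:
assumes [measurable]: "V : bmeas M" "theta : bmeas M"
shows "(%om. ang (V om) (theta om)) : bmeas M"
unfolding angular_drift_def by measurable

lemma power_fact_integral:
fixes L t :: real
assumes t: "0 <= t"
shows "L * itg t (%s. (L * s) ^ k / fact k) = (L * t) ^ Suc k / fact (Suc k)"
proof -
have "((%s. L * ((L * s) ^ k / fact k)) has_integral ((L * t) ^ Suc k / fact (Suc k) - (L * 0) ^ Suc k / fact (Suc k))) {0..t}"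
proof (rule fundamental_theorem_of_calculus[OF t])
 fix s assume "s : {0..t}"
 have f: "fact (Suc k) = (1 + real k) * fact k" by (simp add: algebra_simps)
 have "((%s. (L * s) ^ Suc k / fact (Suc k)) has_real_derivative (real (Suc k) * (L * s) ^ k * L) / fact (Suc k)) (at s within {0..t})"
  by (auto intro!: derivative_eq_intros simp del: power_Suc fact_Suc)
 also have "(real (Suc k) * (L * s) ^ k * L) / fact (Suc k) = L * ((L * s) ^ k / fact k)" by (simp add: divide_simps)
 finally show "((%s. (L * s) ^ Suc k / fact (Suc k)) has_vector_derivative L * ((L * s) ^ k / fact k)) (at s within {0..t})"
  by (simp add: has_real_derivative_iff_has_vector_derivative)
qed
then have "itg t (%s. L * ((L * s) ^ k / fact k)) = (L * t) ^ Suc k / fact (Suc k) - (L * 0) ^ Suc k / fact (Suc k)"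
 by (rule integral_unique)
then show ?thesis unfolding Henstock_Kurzweil_Integration.integral_mult_right by simp
qed

context
fixes alpha beta :: "real => 'w => real" and v :: "real => 'w => real^'d"
assumes ad: "adapted alpha" "adapted beta" "adapted v"
 and co: "!!om. om : space P ==> cont0 (%t. alpha t om)" "!!om. om : space P ==> cont0 (%t. beta t om)"
  "!!om. om : space P ==> cont0 (%t. v t om)"
 and eqalpha: "!!T. 0 < T ==> in_prob (%n. RS gamma (%t om. (cos (alpha t om))^2) T n n)
   (%om. alpha T om - alpha 0 om - itg T (%t. ang (v t om) (alpha t om)))"
 and eqbeta: "!!T. 0 < T ==> in_prob (%n. RS gamma (%t om. (cos (beta t om))^2) T n n)
   (%om. beta T om - beta 0 om - itg T (%t. ang (v t om) (beta t om)))"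
 and init: "AE om in P. EX k::int. beta 0 om = alpha 0 om + 2 * pi * of_int k"
begin

text \<open>Only increments of the angles are compared, since the initial values may differ by a
  multiple of \<open>2 * pi\<close>.\<close>

private definition "dl t om = (alpha t om - alpha 0 om) - (beta t om - beta 0 om)"
private definition "md t om = min 1 (abs (dl t om))"
text \<open>Localization without stopping times: a countable condition on \<open>v\<close>, known at
  time \<open>t\<close>. It passes from \<open>t\<close> to each grid point of
  \<open>[0, t]\<close>, because a grid point of a grid is again of the form
  \<open>t * i / n\<close>.\<close>

private definition "ch M t om = (if ALL n i. i <= n --> norm (v (grid t n i) om) <= (M :: real) then 1 else 0 :: real)"

private lemma dl_measurable: "0 <= t ==> dl t : bmeas (F t)"
unfolding dl_def[abs_def] by (intro bmeas_diff adaptedD[OF ad(1)] adaptedD[OF ad(2)] F_mono[OF _ adaptedD[OF ad(1)]] F_mono[OF _ adaptedD[OF ad(2)]]) auto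

private lemma md_measurable: "0 <= t ==> md t : bmeas (F t)"
unfolding md_def[abs_def] by (intro borel_measurable_min borel_measurable_abs dl_measurable bmeas_const)

private lemma ch_measurable:
assumes t: "0 <= t"
shows "ch M t : bmeas (F t)"
proof -
have "v (grid t n i) : bmeas (F t)" if "i <= n" for n i
 by (rule F_mono[OF _ adaptedD[OF ad(3)]]) (use t that in "auto intro: grid_le grid_nonneg")
then have "Measurable.pred (F t) (%om. i <= n --> norm (v (grid t n i) om) <= M)" for n i by (cases "i <= n") auto
then have p: "Measurable.pred (F t) (%om. ALL n i. i <= n --> norm (v (grid t n i) om) <= M)"
 by (rule pred_intros_countable(1)[OF pred_intros_countable(1)])
show ?thesis unfolding ch_def[abs_def] by (rule measurable_If[OF measurable_const measurable_const p[unfolded pred_def]]) simp_all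
qed

private lemma ch_grid: "ch M t om = 1 ==> ch M (grid t n i) om = 1" if "i <= n"
proof -
assume "ch M t om = 1"
then have *: "ALL n i. i <= n --> norm (v (grid t n i) om) <= M" by (simp add: ch_def split: if_splits)
have "grid (grid t n i) n' i' = grid t (n * n') (i * i')" for n' i' by (simp add: grid_def)
then have "norm (v (grid (grid t n i) n' i') om) <= M" if "i' <= n'" for n' i' using * that \<open>i <= n\<close> by (simp add: mult_le_mono)
then show ?thesis by (simp add: ch_def)
qed

private lemma ch_bound: "ch M t om = 1 ==> i <= n ==> norm (v (grid t n i) om) <= M"
by (simp add: ch_def split: if_splits)

private lemma ch01: "ch M t om = 0 | ch M t om = 1" "0 <= md t om" "md t om <= 1"
by (auto simp: ch_def md_def)

private definition "er M t = (LINT om|P. ch M t om * (md t om)^2)"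

private lemma bounded_integrable: "f : bmeas P ==> (!!om. abs (f om) <= C) ==> integrable P f" for f :: "'w => real"
by (rule integrable_const_bound[of _ C]) auto

private lemma cmd: "abs (ch M t om * (md t om)^2) <= 1"
using ch01(1)[of M t om] ch01(2,3)[of t om] by (auto simp: power_le_one)

private lemma cmd_integrable: "0 <= t ==> integrable P (%om. ch M t om * (md t om)^2)"
by (rule bounded_integrable[OF _ cmd]) (intro bmeas_times bmeas_power F_P[OF ch_measurable] F_P[OF md_measurable])

private lemma shift_2pi:
assumes "beta 0 om = alpha 0 om + 2 * pi * of_int k"
shows "abs ((cos (alpha t om))^2 - (cos (beta t om))^2) <= 4 * md t om"
 "norm (v t om) <= M ==> abs (ang (v t om) (alpha t om) - ang (v t om) (beta t om)) <= (4 * (1 + kappa^2 + norm a * M) + 8 * abs zeta + 8 * (norm gamma)^2) * md t om"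
proof -
let ?b = "beta t om - 2 * pi * of_int k"
have sc: "cos ?b = cos (beta t om)" "sin ?b = sin (beta t om)" by (simp_all add: sin_diff cos_diff)
have d: "abs (alpha t om - ?b) <= abs (dl t om)" using assms by (simp add: dl_def)
have h: "ang (v t om) ?b = ang (v t om) (beta t om)" by (simp add: angular_drift_def sc)
show "abs ((cos (alpha t om))^2 - (cos (beta t om))^2) <= 4 * md t om" using min_one_mono_diff(1)[OF d] by (simp add: sc md_def)
show "abs (ang (v t om) (alpha t om) - ang (v t om) (beta t om)) <= (4 * (1 + kappa^2 + norm a * M) + 8 * abs zeta + 8 * (norm gamma)^2) * md t om" if "norm (v t om) <= M"
 using ang_diff[OF d that] unfolding h md_def by simp
qed

text \<open>An iteration replaces Gronwall's inequality, since no regularity of \<open>er M\<close>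
  in \<open>t\<close> is at hand, while the bounds \<open>(L * t) ^ k / fact k\<close> are
  continuous and their Riemann sums converge. On each grid the isometry controls the noise,
  Cauchy-Schwarz the drift, and Fatou passes to the limit.\<close>

private lemma er_step:
assumes M: "0 <= M" and T0: "0 < T0"
obtains L where "0 <= L" "!!k t. t : {0..T0} ==> er M t <= (L * t) ^ k / fact k"
proof -
define Ch where "Ch = 4 * (1 + kappa^2 + norm a * M) + 8 * abs zeta + 8 * (norm gamma)^2"
\<comment> \<open>\<open>32 = 2 * 4^2\<close>: a factor 2 from the square of a sum and the constant
  4 of \<open>shift_2pi\<close> squared. The drift contributes \<open>Ch^2\<close> in the same way,
  times the length of the interval.\<close>
define L where "L = 32 * (norm gamma)^2 + 2 * T0 * Ch^2"
have L0: "0 <= L" using T0 by (simp add: L_def)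
have "er M t <= (L * t) ^ k / fact k" if "t : {0..T0}" for k t using that
proof (induction k arbitrary: t)
 case 0
 then have "er M t <= (LINT om|P. 1)" unfolding er_def by (intro integral_mono cmd_integrable integrable_const abs_le_D1[OF cmd]) auto
 then show ?case by (simp add: prob_space)
next
 case (Suc k)
 let ?f = "%s. (L * s) ^ k / fact k"
 show ?case
 proof (cases "t = 0")
  case True
  then show ?thesis by (simp add: er_def md_def dl_def)
 next
  case False
  then have t: "0 < t" "0 <= t" "t <= T0" using Suc.prems by auto
  let ?g = "grid t"
  let ?H = "%s om. (cos (alpha s om))^2 - (cos (beta s om))^2"
  let ?cH = "%s om. ch M s om * ?H s om"
  let ?Ralpha = "%n. RS gamma (%t om. (cos (alpha t om))^2) t n n" and ?Rbeta = "%n. RS gamma (%t om. (cos (beta t om))^2) t n n"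
  let ?S = "%n om. SUM i<n. (t / n) *\<^sub>R (ang (v (?g n i) om) (alpha (?g n i) om) - ang (v (?g n i) om) (beta (?g n i) om))"
  let ?I = "%om. itg t (%s. ang (v s om) (alpha s om) - ang (v s om) (beta s om))"
  \<comment> \<open>Multiplying by the indicator at the final time \<open>t\<close> allows the
    adapted indicators \<open>ch M s\<close> to be inserted in all summands, as they equal 1
    whenever it does.\<close>
  define X where "X n om = ch M t om * (?Ralpha n om - ?Rbeta n om + ?S n om)" for n om
  have am: "(%om. ang (v s om) (alpha s om)) : bmeas (F t)" "(%om. ang (v s om) (beta s om)) : bmeas (F t)" if "0 <= s" "s <= t" for s
   using that by (intro measurable_ang F_mono[OF that(2)] adaptedD[OF ad(1)] adaptedD[OF ad(2)] adaptedD[OF ad(3)]; simp)+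
  have ac: "cont0 (%s. ang (v s om) (alpha s om))" "cont0 (%s. ang (v s om) (beta s om))" if "om : space P" for om
   by (intro continuous_on_ang co that)+
  have sub: "{0..t} <= {0..}" by auto
  have Im: "?I : bmeas P" by (rule F_P[OF integral_measurable_F[OF _ _ t(2)]]) (intro bmeas_diff am continuous_on_diff ac; simp)+
  have Sm: "?S n : bmeas P" for n by (intro bmeas_sum bmeas_scaleR bmeas_const bmeas_diff F_P[OF am(1)] F_P[OF am(2)] grid_nonneg grid_le)
    (use t in auto)
  have S: "in_prob ?S ?I"
  proof (rule AE_in_prob[OF Sm Im], rule AE_I2)
   fix om assume om: "om : space P"
   have dc: "continuous_on {0..t} (%s. ang (v s om) (alpha s om) - ang (v s om) (beta s om))"
    by (rule continuous_on_diff) (rule cont_subset[OF _ sub], rule ac[OF om])+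
   show "(%n. ?S n om) ----> ?I om" by (rule riemann_sum_tendsto[OF dc t(2)])
  qed
  have c1: "in_prob (%n. ch M t) (ch M t)" by (rule in_prob_const[OF F_P[OF ch_measurable[OF t(2)]]])
  have X0: "in_prob X (%om. ch M t om * ((alpha t om - alpha 0 om - itg t (%s. ang (v s om) (alpha s om)))
    - (beta t om - beta 0 om - itg t (%s. ang (v s om) (beta s om))) + ?I om))" unfolding X_def[abs_def]
   by (rule in_prob_combine[where f = "(*)", OF c1 in_prob_add[OF in_prob_diff[OF eqalpha[OF t(1)] eqbeta[OF t(1)]] S]])
    (auto intro!: continuous_intros)
  have X: "in_prob X (%om. ch M t om * dl t om)"
  proof (rule in_prob_cong_AE[OF X0 in_prob_measurable(1)[OF X0]])
   show "(%om. ch M t om * dl t om) : bmeas P" by (intro bmeas_times F_P[OF ch_measurable] F_P[OF dl_measurable] t)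
   show "AE om in P. ch M t om * ((alpha t om - alpha 0 om - itg t (%s. ang (v s om) (alpha s om)))
    - (beta t om - beta 0 om - itg t (%s. ang (v s om) (beta s om))) + ?I om) = ch M t om * dl t om"
   proof (rule AE_I2)
    fix om assume om: "om : space P"
    have "?I om = itg t (%s. ang (v s om) (alpha s om)) - itg t (%s. ang (v s om) (beta s om))"
     by (intro hk_diff cont_integrable cont_subset[OF _ sub] ac[OF om])
    then show "ch M t om * ((alpha t om - alpha 0 om - itg t (%s. ang (v s om) (alpha s om)))
    - (beta t om - beta 0 om - itg t (%s. ang (v s om) (beta s om))) + ?I om) = ch M t om * dl t om" by (simp add: dl_def)
   qed
  qed simp
  have cm: "(%om. (cos (f om))^2) : bmeas N" if "f : bmeas N" for f :: "'w => real" and N using that by measurable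
  have Ha: "adapted ?cH" unfolding adapted_def
   by (intro allI impI bmeas_times ch_measurable bmeas_diff cm adaptedD[OF ad(1)] adaptedD[OF ad(2)])
  have c2: "0 <= (cos y)^2 & (cos y)^2 <= 1" for y :: real by (simp add: abs_square_le_1)
  have Hb: "abs (?cH s om) <= 1" for s om
  proof -
   have "abs (?H s om) <= 1" using c2[of "alpha s om"] c2[of "beta s om"] by linarith
   moreover have "abs (ch M s om) <= 1" by (simp add: ch_def)
   ultimately show ?thesis unfolding abs_mult by (intro mult_le_one abs_ge_zero)
  qed
  have RSi: "integrable P (%om. (RS gamma ?cH t n n om)^2)" if n: "0 < n" for n by (rule RS_L2(1)[OF Ha Hb t(1) n])
  let ?B = "%n om. 2 * (RS gamma ?cH t n n om)^2 + 2 * T0 * Ch^2 * (SUM i<n. (t / n) * (ch M (?g n i) om * (md (?g n i) om)^2))"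
  have Bi: "integrable P (?B n)" if n: "0 < n" for n
   using t by (intro bi_integrable_add integrable_mult_right RSi[OF n] bi_integrable_sum cmd_integrable grid_nonneg) auto
  have XB: "AE om in P. (X n om)^2 <= ?B n om" if n: "0 < n" for n
  proof (rule AE_mp[OF init], intro AE_I2 impI)
   fix om assume "EX k::int. beta 0 om = alpha 0 om + 2 * pi * of_int k"
   then obtain k :: int where k: "beta 0 om = alpha 0 om + 2 * pi * of_int k" by blast
   have pos: "0 <= (SUM i<n. (t / n) * (ch M (?g n i) om * (md (?g n i) om)^2))"
    using t by (intro sum_nonneg mult_nonneg_nonneg) (auto simp: ch_def)
   show "(X n om)^2 <= ?B n om"
   proof (cases "ch M t om = 1")
    case False
    then have "X n om = 0" using ch01(1)[of M t om] by (simp add: X_def)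
    then show ?thesis using pos T0 by simp
   next
    case True
    have cg: "ch M (?g n i) om = 1" if "i < n" for i by (rule ch_grid[OF _ True]) (use that in simp)
    have R: "?Ralpha n om - ?Rbeta n om = RS gamma ?cH t n n om"
     unfolding RS_def sum_subtractf[symmetric] using cg by (intro sum.cong) (auto simp: algebra_simps)
    have tn: "0 <= t / n" using t by simp
    let ?u = "%i. (t / n) * (Ch * md (?g n i) om)"
    have "abs (?S n om) <= (SUM i<n. ?u i)"
    proof (rule order_trans[OF sum_abs], rule sum_mono)
     fix i assume "i : {..<n}"
     then have "norm (v (?g n i) om) <= M" by (intro ch_bound[OF True]) auto
     from shift_2pi(2)[OF k this] show "abs ((t / n) *\<^sub>R (ang (v (?g n i) om) (alpha (?g n i) om) - ang (v (?g n i) om) (beta (?g n i) om))) <= ?u i"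
      unfolding real_scaleR_def abs_mult abs_of_nonneg[OF tn] Ch_def[symmetric] by (rule mult_left_mono[OF _ tn])
    qed
    then have "(?S n om)^2 <= (SUM i<n. ?u i)^2" by (rule square_mono_abs)
    also have "... <= (SUM i<n. (?u i)^2) * n" using sum_squared_le_sum_of_squares[of ?u "{..<n}"] by simp
    also have "... = (t * Ch^2) * (SUM i<n. (t / n) * (md (?g n i) om)^2)"
     unfolding sum_distrib_left sum_distrib_right using n by (intro sum.cong) (auto simp: power_mult_distrib power2_eq)
    also have "... <= (T0 * Ch^2) * (SUM i<n. (t / n) * (md (?g n i) om)^2)" using t by (intro mult_right_mono sum_nonneg) auto
    finally have S2: "(?S n om)^2 <= (T0 * Ch^2) * (SUM i<n. (t / n) * (ch M (?g n i) om * (md (?g n i) om)^2))" using cg by simp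
    have S3: "2 * (?S n om)^2 <= 2 * T0 * Ch^2 * (SUM i<n. (t / n) * (ch M (?g n i) om * (md (?g n i) om)^2))"
     using mult_left_mono[OF S2, of 2] by (simp only: mult.assoc)
    have Xeq: "X n om = RS gamma ?cH t n n om + ?S n om" unfolding X_def True R by simp
    have "(x + y)^2 <= 2 * x^2 + 2 * y^2" for x y :: real using sum_squares_bound[of x y] by (simp add: power2_sum)
    from order_trans[OF this add_left_mono[OF S3]] show ?thesis unfolding Xeq .
   qed
  qed
  have Xm: "X n : bmeas P" for n by (rule in_prob_measurable(1)[OF X])
  have X_0: "X 0 = (%_. 0)" by (simp add: X_def RS_def fun_eq_iff)
  have Xi: "integrable P (%om. (X n om)^2)" for n
  proof (cases "n = 0")
   case False
   then have n: "0 < n" by simp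
   show ?thesis
   proof (rule bi_integrable_bound[OF Bi[OF n]])
    show "(%om. (X n om)^2) : bmeas P" by (intro bmeas_power Xm)
    show "AE om in P. norm ((X n om)^2) <= norm (?B n om)" by (rule eventually_mono[OF XB[OF n]]) (rule square_le_norm)
   qed
  qed (simp add: X_0)
  have EX: "(LINT om|P. (X n om)^2) <= L * (SUM i<n. (t / n) *\<^sub>R ?f (?g n i))" for n
  proof (cases "n = 0")
   case False
   then have n: "0 < n" by simp
   have g: "0 <= ?g n i" for i using t by (simp add: grid_nonneg)
   have ge: "?g n i : {0..T0}" if "i < n" for i using grid_le[of t i n] t that g[of i] by simp
   have H2: "(LINT om|P. (?cH (?g n i) om)^2) <= 16 * er M (?g n i)" for i unfolding er_def integral_mult_right_zero[symmetric]
   proof (rule integral_mono_AE)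
    show "integrable P (%om. (?cH (?g n i) om)^2)"
    proof (rule bounded_integrable[of _ 1])
     show "(%om. (?cH (?g n i) om)^2) : bmeas P" by (intro bmeas_power F_P[OF adaptedD[OF Ha g]])
     show "abs ((?cH (?g n i) om)^2) <= 1" for om using Hb[of "?g n i" om] by (simp add: abs_square_le_1)
    qed
    show "integrable P (%om. 16 * (ch M (?g n i) om * (md (?g n i) om)^2))" by (intro integrable_mult_right cmd_integrable[OF g])
    show "AE om in P. (?cH (?g n i) om)^2 <= 16 * (ch M (?g n i) om * (md (?g n i) om)^2)"
    proof (rule AE_mp[OF init], intro AE_I2 impI)
     fix om assume "EX k::int. beta 0 om = alpha 0 om + 2 * pi * of_int k"
     then obtain k :: int where k: "beta 0 om = alpha 0 om + 2 * pi * of_int k" by blast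
     have "(?H (?g n i) om)^2 <= (4 * md (?g n i) om)^2" by (rule square_mono_abs[OF shift_2pi(1)[OF k]])
     then show "(?cH (?g n i) om)^2 <= 16 * (ch M (?g n i) om * (md (?g n i) om)^2)" by (simp add: ch_def power_mult_distrib)
    qed
   qed
   have "(LINT om|P. (X n om)^2) <= (LINT om|P. ?B n om)" by (rule integral_mono_AE[OF Xi Bi[OF n] XB[OF n]])
   also have "... = 2 * (LINT om|P. (RS gamma ?cH t n n om)^2) + 2 * T0 * Ch^2 * (SUM i<n. (t / n) * er M (?g n i))"
    unfolding er_def using RSi[OF n] cmd_integrable[OF g] by (subst Bochner_Integration.integral_add) (auto simp: bi_integral_sum)
   also have "(LINT om|P. (RS gamma ?cH t n n om)^2) = (SUM i<n. (LINT om|P. (?cH (?g n i) om)^2) * ((norm gamma)^2 * (t / n)))"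
    by (rule RS_L2(2)[OF Ha Hb t(1) n])
   also have "... <= (SUM i<n. 16 * er M (?g n i) * ((norm gamma)^2 * (t / n)))" using t by (intro sum_mono mult_right_mono H2) auto
   also have "2 * (SUM i<n. 16 * er M (?g n i) * ((norm gamma)^2 * (t / n))) + 2 * T0 * Ch^2 * (SUM i<n. (t / n) * er M (?g n i))
     = L * (SUM i<n. (t / n) * er M (?g n i))" unfolding L_def distrib_right sum_distrib_left by (simp add: mult_ac sum.distrib)
   also have "... <= L * (SUM i<n. (t / n) *\<^sub>R ?f (?g n i))"
    unfolding real_scaleR_def using t by (intro mult_left_mono sum_mono L0 Suc.IH ge) auto
   finally show ?thesis by simp
  qed (simp add: X_0)
  have lim: "(%n. L * (SUM i<n. (t / n) *\<^sub>R ?f (?g n i))) ----> L * itg t ?f"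
   by (intro tendsto_mult tendsto_const riemann_sum_tendsto t(2) continuous_intros) simp
  note I = in_prob_fatou[OF X Xi EX lim]
  have "er M t <= (LINT om|P. (ch M t om * dl t om)^2)" unfolding er_def
  proof (rule integral_mono[OF cmd_integrable[OF t(2)] I(1)])
   fix om
   have "(md t om)^2 <= (abs (dl t om))^2" by (rule power_mono) (auto simp: md_def)
   then show "ch M t om * (md t om)^2 <= (ch M t om * dl t om)^2" by (simp add: ch_def power_mult_distrib)
  qed
  then show ?thesis using I(2) unfolding power_fact_integral[OF t(2)] by linarith
 qed
qed
with L0 show thesis by (rule that)
qed

text \<open>Since \<open>(L * T) ^ k / fact k\<close> tends to zero, the difference vanishes on the
  event that \<open>v\<close> stays below \<open>N\<close>; every path lies in this event for some
  \<open>N\<close>.\<close>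

lemma angle_unique:
assumes T: "0 < T"
shows "AE om in P. alpha T om - alpha 0 om = beta T om - beta 0 om"
proof -
have T0: "0 <= T" using T by simp
have "AE om in P. ch (real N) T om * (md T om)^2 = 0" for N :: nat
proof -
 obtain L where L: "0 <= L" "!!k t. t : {0..T} ==> er (real N) t <= (L * t) ^ k / fact k" using er_step[of "real N" T] T by auto
 have "(%k. (L * T) ^ k / fact k) ----> 0"
  using summable_LIMSEQ_zero[OF summable_exp_generic[of "L * T"]] by (simp add: divide_inverse mult.commute)
 then have "er (real N) T <= 0" by (rule LIMSEQ_le_const) (use L(2)[of T] T0 in auto)
 moreover have pos: "0 <= ch (real N) T om * (md T om)^2" for om using ch01(1)[of "real N" T om] by auto
 then have "0 <= er (real N) T" unfolding er_def by (intro Bochner_Integration.integral_nonneg)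
 ultimately have "(LINT om|P. ch (real N) T om * (md T om)^2) = 0" by (simp add: er_def)
 then show ?thesis using integral_nonneg_eq_0_iff_AE[OF cmd_integrable[OF T0]] pos by auto
qed
then have "AE om in P. ALL N. ch (real N) T om * (md T om)^2 = 0" unfolding AE_all_countable by (rule allI)
then show ?thesis
proof (rule AE_mp, intro AE_I2 impI)
 fix om assume om: "om : space P" and 0: "ALL N. ch (real N) T om * (md T om)^2 = 0"
 obtain K where K: "!!t. t : {0..T} ==> norm (v t om) <= K" using bounded_on_Icc[OF co(3)[OF om]] by blast
 obtain N :: nat where N: "K <= real N" using real_arch_simple by blast
 have "norm (v (grid T n i) om) <= real N" if "i <= n" for n i
  by (rule order_trans[OF K N]) (use grid_le[OF T0 that] grid_nonneg[OF T0] in auto)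
 then have "ch (real N) T om = 1" by (simp add: ch_def)
 then have "md T om = 0" using 0 by (metis mult_1 power_eq_0_iff)
 then show "alpha T om - alpha 0 om = beta T om - beta 0 om" by (simp add: md_def dl_def min_def split: if_splits)
qed
qed

end


section \<open>The law of the angular diffusion\<close>

lemma noise_polar: "r ~= 0 ==> noise_coeff (of_real r * cis theta) = Complex (sin theta * cos theta) ((cos theta)^2)"
proof -
assume "r ~= 0"
then have "noise_coeff (of_real r * cis theta) = \<i> * of_real (cos theta) * inverse (cis theta)"
 by (simp add: noise_coeff_def field_simps)
then show ?thesis unfolding cis_inverse by (simp add: complex_eq_iff power2_eq)
qed

lemma Lam_polar:
assumes r: "r ~= 0"
shows "Lam (v, of_real r * cis theta) = Complex (Q a gamma kappa zeta v (to_circle theta)) (ang v theta)"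
proof -
have "osc_drift v (of_real r * cis theta) = of_real r * osc_drift v (cis theta)" by (simp add: osc_drift_def complex_eq_iff algebra_simps)
then have "osc_drift v (of_real r * cis theta) / (of_real r * cis theta) = osc_drift v (cis theta) * inverse (cis theta)"
 using r by (simp add: field_simps)
then have d: "osc_drift v (of_real r * cis theta) / (of_real r * cis theta)
 = Complex (sin theta * cos theta + (- 2 * zeta * sin theta - (kappa^2 - a *. v) * cos theta) * sin theta)
   ((- 2 * zeta * sin theta - (kappa^2 - a *. v) * cos theta) * cos theta - sin theta * sin theta)"
 unfolding cis_inverse by (simp add: osc_drift_def complex_eq_iff)
have n: "(noise_coeff (of_real r * cis theta))^2
 = Complex ((sin theta * cos theta)^2 - ((cos theta)^2)^2) (2 * (sin theta * cos theta) * (cos theta)^2)"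
 unfolding noise_polar[OF r] by (simp add: complex_eq_iff power2_eq)
have s2: "(sin theta)^2 = 1 - (cos theta)^2" by (rule sin_squared_eq)
have "Re (Lam (v, of_real r * cis theta)) = Q a gamma kappa zeta v (to_circle theta)"
 unfolding Lam_def fst_conv snd_conv d n Q.abs_eq cos_double by (simp add: power2_eq field_simps)
moreover have "Im (Lam (v, of_real r * cis theta)) = ang v theta" unfolding Lam_def fst_conv snd_conv d n angular_drift_def
 using s2 by (simp add: power2_eq power3_eq_cube algebra_simps)
ultimately show ?thesis by (simp add: complex_eq_iff)
qed

text \<open>Quotients of successors are never 0, so that statements available at positive times
  apply along the sequence.\<close>

lemma positive_rationals_tendsto:
fixes t :: real
assumes t: "0 <= t"
obtains s where "s ----> t" "!!n. EX i k. s n = real (Suc i) / real (Suc k)"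
proof
define s where "s n = real (Suc (nat \<lfloor>t * real (Suc n)\<rfloor>)) / real (Suc n)" for n
show "EX i k. s n = real (Suc i) / real (Suc k)" for n unfolding s_def by blast
have "abs (s n - t) <= 1 / real (Suc n)" for n
proof -
 have "real (nat \<lfloor>t * real (Suc n)\<rfloor>) = of_int \<lfloor>t * real (Suc n)\<rfloor>" using t by simp
 then have "abs (real (Suc (nat \<lfloor>t * real (Suc n)\<rfloor>)) - t * real (Suc n)) <= 1" by linarith
 then have "abs (real (Suc (nat \<lfloor>t * real (Suc n)\<rfloor>)) - t * real (Suc n)) / real (Suc n) <= 1 / real (Suc n)"
  by (rule divide_right_mono) simp
 moreover have "s n - t = (real (Suc (nat \<lfloor>t * real (Suc n)\<rfloor>)) - t * real (Suc n)) / real (Suc n)"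
  unfolding s_def diff_divide_distrib by simp
 ultimately show ?thesis by simp
qed
then have "(%n. s n - t) ----> 0" by (intro Lim_null_comparison[OF _ LIMSEQ_Suc[OF lim_const_over_n[of 1]]]) auto
then show "s ----> t" by (rule LIM_zero_cancel)
qed

section \<open>From limits in probability to identities of paths\<close>

lemma AE_all_times:
fixes f g :: "real => 'w => 'e::t2_space"
assumes eq: "!!t. 0 < t ==> AE om in P. f t om = g t om"
 and c: "!!om. om : space P ==> cont0 (%t. f t om)" "!!om. om : space P ==> cont0 (%t. g t om)"
shows "AE om in P. ALL t>=0. f t om = g t om"
proof -
have "AE om in P. ALL i n. f (real (Suc i) / real (Suc n)) om = g (real (Suc i) / real (Suc n)) om"
 unfolding AE_all_countable by (intro allI eq) simp
then show ?thesis
proof (rule AE_mp, intro AE_I2 impI allI)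
 fix om and t :: real
 assume om: "om : space P" and e: "ALL i n. f (real (Suc i) / real (Suc n)) om = g (real (Suc i) / real (Suc n)) om" and t: "0 <= t"
 obtain s where st: "s ----> t" and s: "!!n. EX i k. s n = real (Suc i) / real (Suc k)" using positive_rationals_tendsto[OF t] by blast
 have s0: "0 <= s n & f (s n) om = g (s n) om" for n
 proof -
  obtain i k where "s n = real (Suc i) / real (Suc k)" using s by blast
  then show ?thesis using e by simp
 qed
 have l: "(%n. f (s n) om) ----> f t om" by (rule cont_tendsto[OF c(1)[OF om] st]) (use t s0 in auto)
 have r: "(%n. g (s n) om) ----> g t om" by (rule cont_tendsto[OF c(2)[OF om] st]) (use t s0 in auto)
 have eq: "f (s n) om = g (s n) om" for n using s0 by blast
 show "f t om = g t om" using LIMSEQ_unique[OF l r[folded eq]] .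
qed
qed

text \<open>In a direction \<open>e\<close> where all noise coefficients are multiples
  \<open>c $ l\<close> of one scalar \<open>H\<close>, the Ito integrals merge into one left-point
  sum against \<open>c \<bullet> W\<close>. The components of \<open>v\<close>, the angle and the
  oscillator are all of this kind.\<close>

lemma sde_component:
fixes X :: "real => 'w => 'e::euclidean_space" and b :: "'e => 'e"
assumes X: "sde_solution P F W b \<sigma> X" and b: "continuous_on UNIV b" and e: "norm e <= 1" and T: "0 < T"
 and c: "!!l x. e *. \<sigma> l x = c $ l * H x"
shows "in_prob (%n. RS c (%t om. H (X t om)) T n n) (%om. e *. (X T om - X 0 om - itg T (%s. b (X s om))))"
proof -
let ?Y = "%T om. X T om - X 0 om - itg T (%s. b (X s om))"
have T0: "0 <= T" using T by simp
have ad: "!!t. 0 <= t ==> X t : bmeas (F t)" and co: "!!om. om : space P ==> cont0 (%t. X t om)"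
 using X by (auto simp: sde_solution_def adapted_continuous_def)
obtain I where I: "!!l. ito_integral P F (%t om. W t om $ l) (%t om. \<sigma> l (X t om)) (I l)"
 and eq: "AE om in P. ALL t>=0. X t om = X 0 om + itg t (%s. b (X s om)) + (SUM l:UNIV. I l t om)"
 using X unfolding sde_solution_def by blast
have bm: "(%om. itg T (%s. b (X s om))) : bmeas (F T)"
proof (rule integral_measurable_F[OF _ _ T0])
 show "(%om. b (X s om)) : bmeas (F T)" if "0 <= s" "s <= T" for s
  by (rule F_mono[OF that(2) meas_comp[OF ad[OF that(1)] cont_bmeas[OF b]]])
 show "cont0 (%s. b (X s om))" if "om : space P" for om by (rule cont_compose[OF b co[OF that]]) simp
qed
have S: "in_prob (%n om. SUM l:UNIV. RS (axis l 1) (%t om. e *. \<sigma> l (X t om)) T n n om) (%om. SUM l:UNIV. e *. I l T om)"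
 by (rule in_prob_sum) (rule ito_integral_RS[OF I e T])
have cx: "(SUM l:UNIV. c $ l * (axis l 1 *. x)) = c *. x" for x unfolding inner_axis' by (simp add: inner_vec_def)
have RSeq: "(SUM l:UNIV. RS (axis l 1) (%t om. e *. \<sigma> l (X t om)) T n n om) = RS c (%t om. H (X t om)) T n n om" for n om
proof -
 have "(SUM l:UNIV. RS (axis l 1) (%t om. e *. \<sigma> l (X t om)) T n n om)
   = (SUM i<n. SUM l:UNIV. H (X (grid T n i) om) * (c $ l * (axis l 1 *. dW (grid T n) i om)))"
  unfolding RS_def c by (subst sum.swap) (simp add: mult_ac)
 then show ?thesis unfolding sum_distrib_left[symmetric] cx RS_def .
qed
show ?thesis
proof (rule in_prob_cong_AE[OF S])
 show "RS c (%t om. H (X t om)) T n n : bmeas P" for n using in_prob_measurable(1)[OF S, of n] unfolding RSeq .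
 show "(%om. e *. ?Y T om) : bmeas P" by (intro bmeas_inner bmeas_diff bmeas_const F_P[OF bm] F_P[OF ad[OF T0]] F_P[OF ad[OF order_refl]])
 show "AE om in P. (SUM l:UNIV. RS (axis l 1) (%t om. e *. \<sigma> l (X t om)) T n n om) = RS c (%t om. H (X t om)) T n n om" for n
  by (rule AE_I2) (rule RSeq)
 show "AE om in P. (SUM l:UNIV. e *. I l T om) = e *. ?Y T om"
 proof (rule AE_mp[OF eq], intro AE_I2 impI)
  fix om assume "ALL t>=0. X t om = X 0 om + itg t (%s. b (X s om)) + (SUM l:UNIV. I l t om)"
  with T0 have "X T om = X 0 om + itg T (%s. b (X s om)) + (SUM l:UNIV. I l T om)" by blast
  then show "(SUM l:UNIV. e *. I l T om) = e *. ?Y T om" by (simp add: inner_sum_right[symmetric])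
 qed
qed
qed

lemma RS_constant_limit:
assumes Z: "in_prob (%n. RS c (%t om. 1) T n n) Z" and T: "0 <= T"
shows "AE om in P. Z om = c *. (W T om - W 0 om)"
proof -
have "RS c (%t om. 1) T (Suc n) (Suc n) om = c *. inc 0 T om" for n om
 using sum_lessThan_telescope[of "%i. W (grid T (Suc n) i) om" "Suc n"]
 unfolding RS_def inner_sum_right[symmetric] mult_1 inc_def by (simp add: grid_n del: sum.lessThan_Suc)
then have "(%n. RS c (%t om. 1) T (Suc n) (Suc n)) = (%n om. c *. inc 0 T om)" by (intro ext)
then have "in_prob (%n om. c *. inc 0 T om) Z" using in_prob_subseq[OF Z, of Suc] by (simp add: strict_mono_Suc_iff)
moreover have "(%om. c *. inc 0 T om) : bmeas P" by (intro bmeas_inner bmeas_const inc_measurable_P T order_refl)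
ultimately have "AE om in P. Z om = c *. inc 0 T om" by (intro in_prob_unique[OF _ in_prob_const])
then show ?thesis by (simp add: inc_def)
qed

text \<open>With constant noise coefficients the left-point sums telescope, so \<open>v\<close>
  satisfies its integral equation for almost every path, and pathwise uniqueness identifies
  it.\<close>

lemma sde_linear_part:
fixes X :: "real => 'w => (real^'d) \<times> 'f::euclidean_space"
assumes X: "sde_solution P F W b \<sigma> X" and b: "continuous_on UNIV b" "!!x. fst (b x) = A *v fst x"
 and \<sigma>: "!!l x. fst (\<sigma> l x) = column l B" and x: "AE om in P. fst (X 0 om) = fst x"
shows "AE om in P. ALL t>=0. fst (X t om) = fst (Phi 0 x t om)"
proof -
let ?Y = "%T om. X T om - X 0 om - itg T (%s. b (X s om))"
have co: "!!om. om : space P ==> cont0 (%t. X t om)" using X by (auto simp: sde_solution_def adapted_continuous_def)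
have fb: "fst (itg T (%s. b (X s om))) = itg T (%s. A *v fst (X s om))" if "om : space P" for T om
proof -
 have "(%s. b (X s om)) integrable_on {0..T}" by (intro cont_integrable cont_compose[OF b(1) cont_subset[OF co[OF that]]]) auto
 from integral_linear[OF this bounded_linear_fst] show ?thesis by (simp add: o_def b(2))
qed
have "AE om in P. fst (X T om) = fst (X 0 om) + itg T (%s. A *v fst (X s om)) + B *v (W T om - W 0 om)" if T: "0 < T" for T
proof -
 have T0: "0 <= T" using T by simp
 have "AE om in P. (u, 0) *. ?Y T om = u *. (B *v (W T om - W 0 om))" if u: "u : Basis" for u
 proof -
  let ?c = "(\<chi> l. u *. column l B) :: real^'m"
  have "in_prob (%n. RS ?c (%t om. (%_. 1) (X t om)) T n n) (%om. (u, 0) *. ?Y T om)"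
   by (rule sde_component[OF X b(1) _ T]) (use u in "simp_all add: norm_Pair inner_prod_def \<sigma>")
  from RS_constant_limit[OF this T0] have "AE om in P. (u, 0) *. ?Y T om = ?c *. (W T om - W 0 om)" .
  moreover have "?c *. y = u *. (B *v y)" for y
   unfolding matrix_mult_sum by (simp add: inner_vec_def[of ?c] inner_sum_right scalar_mult_eq_scaleR mult.commute)
  ultimately show ?thesis by simp
 qed
 then have "AE om in P. ALL u:Basis. (u, 0) *. ?Y T om = u *. (B *v (W T om - W 0 om))" by (simp add: AE_finite_all)
 then show ?thesis
 proof (rule AE_mp, intro AE_I2 impI)
  fix om assume om: "om : space P" and *: "ALL u:Basis. (u, 0) *. ?Y T om = u *. (B *v (W T om - W 0 om))"
  have "fst (X T om) - fst (X 0 om) - itg T (%s. A *v fst (X s om)) = B *v (W T om - W 0 om)"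
   by (rule euclidean_eqI) (use * in "simp add: inner_prod_def fb[OF om] inner_commute")
  then show "fst (X T om) = fst (X 0 om) + itg T (%s. A *v fst (X s om)) + B *v (W T om - W 0 om)" by (simp add: algebra_simps)
 qed
qed
then have "AE om in P. ALL t>=0. fst (X t om) = fst (X 0 om) + itg t (%s. A *v fst (X s om)) + B *v (W t om - W 0 om)"
proof (rule AE_all_times)
 fix om assume om: "om : space P"
 show "cont0 (%t. fst (X t om))" by (intro continuous_on_fst co om)
 then show "cont0 (%t. fst (X 0 om) + itg t (%s. A *v fst (X s om)) + B *v (W t om - W 0 om))"
  by (intro continuous_on_add continuous_on_const continuous_on_indefinite_integral continuous_on_mat continuous_on_diff W_continuous[OF om])
qed
with x AE_space show ?thesis
proof eventually_elim
 case (elim om)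
 have vc: "cont0 (%t. fst (X t om))" by (intro continuous_on_fst co elim(2))
 \<comment> \<open>Padding with \<open>z = 0\<close> extracts uniqueness of \<open>v\<close> from
   uniqueness of the pair.\<close>
 have 1: "osc_path (%t. W t om) (%t. fst (X t om)) (%t. 0)"
  unfolding osc_path_def by (intro conjI vc elim(3) continuous_on_const) (simp add: shear_def rde_drift_def Complex_eq)
 have 2: "osc_path (%t. W t om) (%t. fst (Phi 0 x t om)) (%t. 0)" using osc_path_scale[OF Phi_path(1)[OF elim(2), of x], of 0] by simp
 have 0: "fst (X 0 om) = fst (Phi 0 x 0 om)" using elim(1) Phi_path(2)[OF elim(2)] by simp
 show ?case
 proof (intro allI impI)
  fix t :: real assume t: "0 <= t"
  show "fst (X t om) = fst (Phi 0 x t om)" by (rule osc_path_unique(1)[OF 2 1 W_continuous[OF elim(2)] 0 refl t])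
 qed
qed
qed

lemma cyl_proj_exp: "cyl_proj (u, exp l) = (u, to_circle (Im l))"
unfolding exp_eq_polar by (rule cyl_proj_polar) simp

text \<open>The lift \<open>?beta\<close> of the given diffusion and the angle \<open>?alpha\<close>
  of the flow satisfy the same equation, the latter by \<open>ito_log\<close> with
  \<open>e = \<i>\<close>. \<open>angle_unique\<close> equates their increments, and the initial
  condition their classes.\<close>

lemma angular_diffusion_eq_flow:
assumes Y: "angular_diffusion P F W A B a gamma kappa zeta Y" and Y0: "AE om in P. Y 0 om = p" and T: "0 <= T"
shows "AE om in P. Y T om = cyl_proj (Phi 0 (cyl_embed p) T om)" "Y T : bmeas P"
proof -
let ?b = "%x :: (real^'d) \<times> real. (A *v fst x, ang (fst x) (snd x))"
let ?\<sigma> = "%l (x :: (real^'d) \<times> real). (column l B, gamma $ l * (cos (snd x))^2)"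
have eqs: "(%(v, psi). (A *v v, ang v psi)) = ?b" "(%l (v, psi). (column l B, gamma $ l * (cos psi)^2)) = ?\<sigma>"
 by (simp_all add: fun_eq_iff)
obtain X where X: "sde_solution P F W ?b ?\<sigma> X" and YX: "Y = (%t om. (fst (X t om), to_circle (snd (X t om))))"
 using Y unfolding angular_diffusion_def eqs by blast
have ad: "!!t. 0 <= t ==> X t : bmeas (F t)" and co: "!!om. om : space P ==> cont0 (%t. X t om)"
 using X by (auto simp: sde_solution_def adapted_continuous_def)
have bc: "continuous_on UNIV ?b" unfolding angular_drift_def by (intro continuous_on_Pair continuous_on_mat continuous_intros)
define x where "x = cyl_embed p"
have x: "snd x ~= 0" "fst x = fst p" "snd x = cis (rep_circle (snd p))" by (simp_all add: x_def cyl_embed_def)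
let ?v = "%t om. fst (X t om)" and ?beta = "%t om. snd (X t om)" and ?alpha = "%t om. Im (lg x t om)"
have X0: "AE om in P. fst (X 0 om) = fst x" "AE om in P. to_circle (?beta 0 om) = snd p"
 using Y0 by (auto elim!: eventually_mono simp: YX x(2))
have vf: "AE om in P. ALL t>=0. ?v t om = fst (Phi 0 x t om)" by (rule sde_linear_part[OF X bc _ _ X0(1)]) simp_all
have z: "snd (Phi 0 x t om) = of_real (exp (Re (lg x t om))) * cis (?alpha t om)" if "om : space P" "0 <= t" for t om
 using lg(2)[OF x(1) that] by (simp add: exp_eq_polar)
have vm: "adapted ?v" "adapted ?beta" "adapted ?alpha" unfolding adapted_def
 using borel_fst_snd[OF ad] adaptedD[OF lg_adapted[OF x(1)]] by (auto intro: meas_comp[OF _ borel_measurable_Im])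
have vc: "cont0 (%t. ?v t om)" "cont0 (%t. ?beta t om)" "cont0 (%t. ?alpha t om)" if "om : space P" for om
 by (intro continuous_on_fst continuous_on_snd continuous_on_Im co lg(1)[OF x(1)] that)+
have im: "(%om. itg T (%t. ang (?v t om) (theta t om))) : bmeas P"
 if theta: "adapted theta" "!!om. om : space P ==> cont0 (%t. theta t om)" and T: "0 <= T" for theta T
proof (rule F_P[OF integral_measurable_F[OF _ _ T]])
 show "(%om. ang (?v s om) (theta s om)) : bmeas (F T)" if "0 <= s" "s <= T" for s
  using that by (intro measurable_ang F_mono[OF that(2)] adaptedD[OF vm(1)] adaptedD[OF theta(1)])
 show "cont0 (%s. ang (?v s om) (theta s om))" if "om : space P" for om by (intro continuous_on_ang vc theta(2) that)
qed
have Zm: "(%om. theta T om - theta 0 om - itg T (%t. ang (?v t om) (theta t om))) : bmeas P"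
 if theta: "adapted theta" "!!om. om : space P ==> cont0 (%t. theta t om)" and T: "0 < T" for theta T
 using T by (intro bmeas_diff F_P[OF adaptedD[OF theta(1)]] im[OF theta]) auto
have cm: "adapted (%t om. (cos (theta t om))^2)" if theta: "adapted theta" for theta :: "real => 'w => real" unfolding adapted_def
proof (intro allI impI)
 fix t :: real assume "0 <= t"
 from adaptedD[OF theta this] have [measurable]: "theta t : bmeas (F t)" .
 show "(%om. (cos (theta t om))^2) : bmeas (F t)" by measurable
qed
have eqbeta: "in_prob (%n. RS gamma (%t om. (cos (?beta t om))^2) T n n) (%om. ?beta T om - ?beta 0 om - itg T (%t. ang (?v t om) (?beta t om)))"
 if T: "0 < T" for T
proof -
 have S: "in_prob (%n. RS gamma (%t om. (%x. (cos (snd x))^2) (X t om)) T n n) (%om. (0, 1) *. (X T om - X 0 om - itg T (%s. ?b (X s om))))"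
  by (rule sde_component[OF X bc _ T]) (simp_all add: norm_Pair inner_prod_def)
 show ?thesis
 proof (rule in_prob_cong_AE[OF S in_prob_measurable(1)[OF S] Zm[OF vm(2) vc(2) T]])
  show "AE om in P. (0, 1) *. (X T om - X 0 om - itg T (%s. ?b (X s om))) = ?beta T om - ?beta 0 om - itg T (%t. ang (?v t om) (?beta t om))"
  proof (rule AE_I2)
   fix om assume om: "om : space P"
   have "(%s. ?b (X s om)) integrable_on {0..T}" by (intro cont_integrable cont_compose[OF bc cont_subset[OF co[OF om]]]) auto
   from integral_linear[OF this bounded_linear_snd] show "(0, 1) *. (X T om - X 0 om - itg T (%s. ?b (X s om))) = ?beta T om - ?beta 0 om - itg T (%t. ang (?v t om) (?beta t om))"
    by (simp add: o_def inner_prod_def)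
  qed
 qed simp_all
qed
have eqalpha: "in_prob (%n. RS gamma (%t om. (cos (?alpha t om))^2) T n n) (%om. ?alpha T om - ?alpha 0 om - itg T (%t. ang (?v t om) (?alpha t om)))"
 if T: "0 < T" for T
proof -
 have T0: "0 <= T" using T by simp
 show ?thesis
 proof (rule in_prob_cong_AE[OF ito_log[OF x(1) _ T, of \<i>] _ Zm[OF vm(3) vc(3) T]])
  show "AE om in P. RS gamma (%t om. \<i> *. noise_coeff (snd (Phi 0 x t om))) T n n om = RS gamma (%t om. (cos (?alpha t om))^2) T n n om" for n
  proof (rule AE_I2)
   fix om assume om: "om : space P"
   have "\<i> *. noise_coeff (snd (Phi 0 x t om)) = (cos (?alpha t om))^2" if "0 <= t" for t
    unfolding z[OF om that] by (subst noise_polar) (simp_all add: inner_complex_def)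
   then show "RS gamma (%t om. \<i> *. noise_coeff (snd (Phi 0 x t om))) T n n om = RS gamma (%t om. (cos (?alpha t om))^2) T n n om"
    unfolding RS_def by (simp add: grid_nonneg[OF T0])
  qed
  show "AE om in P. \<i> *. (lg x T om - lg x 0 om - itg T (%t. Lam (Phi 0 x t om))) = ?alpha T om - ?alpha 0 om - itg T (%t. ang (?v t om) (?alpha t om))"
  proof (rule AE_mp[OF vf], intro AE_I2 impI)
   fix om assume om: "om : space P" and v: "ALL t>=0. ?v t om = fst (Phi 0 x t om)"
   have L: "Im (Lam (Phi 0 x t om)) = ang (?v t om) (?alpha t om)" if t: "0 <= t" for t
   proof -
    have "Phi 0 x t om = (?v t om, of_real (exp (Re (lg x t om))) * cis (?alpha t om))" using v t z[OF om t] by (simp add: prod_eq_iff)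
    then show ?thesis by (simp add: Lam_polar)
   qed
   have "(%t. Lam (Phi 0 x t om)) integrable_on {0..T}" by (intro cont_integrable cont_subset[OF Lam_continuous[OF x(1) om]]) auto
   from integral_linear[OF this bounded_linear_Im] have "Im (itg T (%t. Lam (Phi 0 x t om))) = itg T (%t. Im (Lam (Phi 0 x t om)))"
    by (simp add: o_def)
   also have "... = itg T (%t. ang (?v t om) (?alpha t om))" by (rule integral_cong) (simp add: L)
   finally show "\<i> *. (lg x T om - lg x 0 om - itg T (%t. Lam (Phi 0 x t om))) = ?alpha T om - ?alpha 0 om - itg T (%t. ang (?v t om) (?alpha t om))"
    by (simp add: inner_complex_def)
  qed
  show "RS gamma (%t om. (cos (?alpha t om))^2) T n n : bmeas P" for n by (rule RS_measurable[OF cm[OF vm(3)] T0])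
 qed simp_all
qed
have alpha0: "to_circle (?alpha 0 om) = snd p" if om: "om : space P" for om
proof -
 have "cyl_proj x = (fst x, to_circle (?alpha 0 om))"
  using cyl_proj_exp[of "fst x" "lg x 0 om"] lg(2)[OF x(1) om order_refl] Phi_path(2)[OF om, of x] by simp
 then show ?thesis using cyl_proj_embed[of p] by (simp add: x_def prod_eq_iff)
qed
have init: "AE om in P. EX k::int. ?beta 0 om = ?alpha 0 om + 2 * pi * of_int k"
proof (rule AE_mp[OF X0(2)], intro AE_I2 impI)
 fix om assume "om : space P" "to_circle (?beta 0 om) = snd p"
 then have "to_circle (?alpha 0 om) = to_circle (?beta 0 om)" using alpha0 by simp
 then show "EX k::int. ?beta 0 om = ?alpha 0 om + 2 * pi * of_int k" by (simp only: circle.abs_eq_iff)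
qed
have AB: "AE om in P. ?alpha T om - ?alpha 0 om = ?beta T om - ?beta 0 om"
proof (cases "T = 0")
 case False
 then have T': "0 < T" using T by simp
 show ?thesis by (rule angle_unique[where v = ?v, OF vm(3,2,1) vc(3,2,1) eqalpha eqbeta init T'])
qed simp
show "AE om in P. Y T om = cyl_proj (Phi 0 (cyl_embed p) T om)" using AB init vf AE_space
proof eventually_elim
 case (elim om)
 obtain k :: int where "?beta 0 om = ?alpha 0 om + 2 * pi * of_int k" using elim(2) by blast
 then have "?beta T om = ?alpha T om + 2 * pi * of_int k" using elim(1) by linarith
 then have c: "to_circle (?alpha T om) = to_circle (?beta T om)" unfolding circle.abs_eq_iff by blast
 have "Phi 0 x T om = (?v T om, exp (lg x T om))" using elim(3) T lg(2)[OF x(1) elim(4) T] by (simp add: prod_eq_iff)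
 then show ?case unfolding x_def[symmetric] YX by (simp add: cyl_proj_exp c)
qed
have "Y T = (%om. cyl_proj (?v T om, cis (?beta T om)))" unfolding YX by (simp add: fun_eq_iff cyl_proj_polar[of 1, simplified])
moreover have "(%om. (?v T om, cis (?beta T om))) : bmeas P" by (intro bmeas_Pair F_P[OF adaptedD[OF vm(1) T]]
   meas_comp[OF F_P[OF adaptedD[OF vm(2) T]] cont_bmeas[OF continuous_on_cis]] continuous_on_id)
ultimately show "Y T : bmeas P" using meas_comp[OF _ measurable_cyl_proj] by simp
qed

lemma transition_law:
assumes K: "transition_function P F W A B a gamma kappa zeta K" and t: "0 <= t"
shows "K t p = distr P borel (%om. cyl_proj (Phi 0 (cyl_embed p) t om))"
proof -
obtain Y where Y: "angular_diffusion P F W A B a gamma kappa zeta Y" "AE om in P. Y 0 om = p" "distr P borel (Y t) = K t p"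
 using K t unfolding transition_function_def by blast
have "distr P borel (Y t) = distr P borel (%om. cyl_proj (Phi 0 (cyl_embed p) t om))"
 by (intro distr_cong_AE refl angular_diffusion_eq_flow[OF Y(1,2) t] meas_comp[OF Phi_const_measurable[OF t] measurable_cyl_proj])
with Y(3) show ?thesis by simp
qed

end


section \<open>Laws of large numbers\<close>

context prob_space
begin

text \<open>Along squares the second moments of the averages are of order \<open>1 / n^2\<close>,
  hence summable.\<close>

lemma second_moment_squares:
assumes m: "!!n. S n : bmeas M" and i: "!!n. integrable M (%om. (S n om)^2)"
 and le: "!!n. (LINT om|M. (S n om)^2) <= C * real n"
shows "AE om in M. (%n. S ((Suc n)^2) om / (real (Suc n))^2) ----> 0"
proof -
let ?X = "%n om. (S ((Suc n)^2) om / (real (Suc n))^2)^2"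
have Xi: "integrable M (?X n)" for n unfolding power_divide by (intro integrable_divide i)
have le': "(LINT om|M. ?X n om) <= C * inverse ((real (Suc n))^2)" for n
proof -
 have "(LINT om|M. ?X n om) = (LINT om|M. (S ((Suc n)^2) om)^2) / ((real (Suc n))^2)^2"
  unfolding power_divide by (rule integral_divide_zero)
 also have "... <= (C * (real (Suc n))^2) / ((real (Suc n))^2)^2" using le[of "(Suc n)^2"] by (intro divide_right_mono) auto
 also have "... = C * inverse ((real (Suc n))^2)"
 proof -
  have "(C * y) / y^2 = C * inverse y" if "y ~= 0" for y :: real using that by (simp add: power2_eq field_simps)
  from this[of "(real (Suc n))^2"] show ?thesis by (simp only: power_eq_0_iff of_nat_eq_0_iff) simp
 qed
 finally show ?thesis .
qed
have sq: "summable (%n. inverse ((real (Suc n))^2))" using sums_summable[OF inverse_squares_sums] by (simp add: inverse_eq_divide)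
have "AE om in M. (%n. ?X n om) ----> 0"
proof (rule summable_expectation_tendsto_0[OF _ _ Xi])
 show "?X n : bmeas M" for n by (intro bmeas_power bmeas_divide m bmeas_const)
 show "summable (%n. \<integral>om. ?X n om \<partial>M)"
  by (rule summable_comparison_test'[OF summable_mult[OF sq, of C], of 0]) (use le' in simp)
qed simp
then show ?thesis
proof (rule eventually_mono)
 fix om assume "(%n. ?X n om) ----> 0"
 from tendsto_real_sqrt[OF this] have "(%n. abs (S ((Suc n)^2) om / (real (Suc n))^2)) ----> 0" by (simp only: real_sqrt_abs real_sqrt_zero)
 then show "(%n. S ((Suc n)^2) om / (real (Suc n))^2) ----> 0" by (rule tendsto_rabs_zero_cancel)
qed
qed

text \<open>Orthogonality is asked only from lag 2 on, because the block integrals to which it is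
  applied are correlated with their neighbours. Second moments still grow linearly, and between
  consecutive squares bounded summands cannot move the average.\<close>

lemma lln_bounded:
fixes U :: "nat => 'a => real"
assumes m: "!!k. U k : bmeas M" and b: "!!k om. om : space M ==> abs (U k om) <= c"
 and orth: "!!j k. j + 2 <= k ==> (LINT om|M. U j om * U k om) = 0"
shows "AE om in M. (%n. (SUM k<n. U k om) / n) ----> 0"
proof -
let ?S = "%n om. SUM k<n. U k om"
obtain om0 where om0: "om0 : space M" using not_empty by blast
have c0: "0 <= c" using b[OF om0, of 0] by linarith
have bi: "integrable M f" if "f : bmeas M" "!!om. om : space M ==> abs (f om) <= K" for f :: "'a => real" and K
 by (rule integrable_const_bound[of _ K]) (use that in "auto intro: AE_I2")
have Sm: "?S n : bmeas M" for n by (intro bmeas_sum m)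
have Sb: "abs (?S n om) <= n * c" if "om : space M" for n om
 using order_trans[OF sum_abs sum_bounded_above[of "{..<n}" "%k. abs (U k om)" c, OF b[OF that]]] by simp
have pi: "integrable M (%om. f om * g om)" "(LINT om|M. f om * g om) <= K * L"
 if "f : bmeas M" "g : bmeas M" "!!om. om : space M ==> abs (f om) <= K" "!!om. om : space M ==> abs (g om) <= L" for f g :: "'a => real" and K L
proof -
 have fg: "abs (f om * g om) <= K * L" if "om : space M" for om
  unfolding abs_mult by (rule mult_mono[OF _ _ order_trans[OF abs_ge_zero]]) (use \<open>om : space M\<close> \<open>!!om. om : space M ==> \<bar>f om\<bar> <= K\<close> \<open>!!om. om : space M ==> \<bar>g om\<bar> <= L\<close> in auto)
 show i: "integrable M (%om. f om * g om)" by (rule bi[OF _ fg]) (intro bmeas_times that(1,2))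
 have "(LINT om|M. f om * g om) <= (LINT om|M. K * L)" by (rule integral_mono[OF i]) (use fg abs_le_D1 in auto)
 then show "(LINT om|M. f om * g om) <= K * L" by (simp add: prob_space)
qed
have Si: "integrable M (%om. (?S n om)^2)" for n unfolding power2_eq by (rule pi(1)[OF Sm Sm Sb Sb])
have SU: "(LINT om|M. ?S n om * U n om) <= c * c" for n
proof (cases n)
 case (Suc k)
 have "(LINT om|M. ?S n om * U n om) = (SUM j<n. \<integral>om. U j om * U n om \<partial>M)"
  unfolding sum_distrib_right by (rule bi_integral_sum) (rule pi(1)[OF m m b b])
 also have "... = (LINT om|M. U k om * U n om)" using orth by (simp add: Suc)
 finally show ?thesis using pi(2)[OF m m b b, of k n] by simp
qed (simp add: c0)
\<comment> \<open>A new summand adds its own square and twice its product with its predecessor, each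
  at most \<open>c * c\<close>; hence the 3.\<close>
have le: "(LINT om|M. (?S n om)^2) <= (3 * (c * c)) * real n" for n
proof (induction n)
 case (Suc n)
 have "(LINT om|M. (?S (Suc n) om)^2) = (LINT om|M. (?S n om)^2 + 2 * (?S n om * U n om) + U n om * U n om)"
  by (intro Bochner_Integration.integral_cong refl) (simp add: power2_eq algebra_simps)
 also have "... = (LINT om|M. (?S n om)^2) + 2 * (LINT om|M. ?S n om * U n om) + (LINT om|M. U n om * U n om)"
  using Si[of n] pi(1)[OF Sm m Sb b, of n n] pi(1)[OF m m b b, of n n] by simp
 also have "... <= (3 * (c * c)) * real n + 2 * (c * c) + c * c" using Suc SU[of n] pi(2)[OF m m b b, of n n] by linarith
 finally show ?case by (simp add: algebra_simps)
qed simp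
from second_moment_squares[OF Sm Si le] AE_space show ?thesis
proof eventually_elim
 case (elim om)
 have d: "abs (?S n om - ?S k om) <= real (n - k) * c" if "k <= n" for n k
 proof -
  have "?S n om - ?S k om = (SUM i=k..<n. U i om)" using sum_diff_nat_ivl[of 0 k n "%i. U i om"] that by (simp add: atLeast0LessThan)
  then show ?thesis using order_trans[OF sum_abs sum_bounded_above[of "{k..<n}" "%k. abs (U k om)" c, OF b[OF elim(2)]]] by simp
 qed
 let ?r = "%m. abs (?S ((Suc m)^2) om / (real (Suc m))^2) + 3 * c / real (Suc m)"
 have r0: "?r ----> 0" using tendsto_add[OF tendsto_rabs[OF elim(1)] LIMSEQ_Suc[OF lim_const_over_n[of "3 * c"]]] by simp
 show ?case unfolding LIMSEQ_iff
 proof (intro allI impI)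
  fix e :: real assume "0 < e"
  then obtain m0 where m0: "!!m. m0 <= m ==> norm (?r m - 0) < e" using r0 unfolding LIMSEQ_iff by blast
  have "norm (?S n om / real n - 0) < e" if n: "(Suc m0)^2 <= n" for n
  proof -
   \<comment> \<open>Thus \<open>(m + 1)^2 <= n < (m + 2)^2\<close>, and \<open>n\<close> exceeds
     the square below it by at most \<open>3 * (m + 1)\<close>.\<close>
   define m where "m = (LEAST m. n < (Suc (Suc m))^2)"
   have ex: "n < (Suc (Suc n))^2" by (simp add: power2_eq)
   have up: "n < (Suc (Suc m))^2" unfolding m_def by (rule LeastI[of _ n]) (rule ex)
   have m0m: "m0 <= m"
   proof (rule ccontr)
    assume "~ m0 <= m"
    then have "Suc (Suc m) <= Suc m0" by simp
    then have "(Suc (Suc m))^2 <= (Suc m0)^2" by (rule power_mono) simp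
    then show False using up n by linarith
   qed
   have lo: "(Suc m)^2 <= n"
   proof (cases m)
    case 0
    have "1 <= n" using n by (metis One_nat_def Suc_leI le_trans zero_less_Suc zero_less_power)
    then show ?thesis using 0 by simp
   next
    case (Suc k)
    then have "~ n < (Suc (Suc k))^2" using not_less_Least[of k "%m. n < (Suc (Suc m))^2"] unfolding m_def by simp
    then show ?thesis using Suc by simp
   qed
   have "n - (Suc m)^2 <= 3 * Suc m" using up by (simp add: power2_eq)
   then have "real (n - (Suc m)^2) <= 3 * real (Suc m)" by linarith
   then have "abs (?S n om - ?S ((Suc m)^2) om) <= 3 * real (Suc m) * c" by (rule order_trans[OF d[OF lo] mult_right_mono[OF _ c0]])
   then have "abs (?S n om) <= abs (?S ((Suc m)^2) om) + 3 * real (Suc m) * c" by linarith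
   moreover have "real ((Suc m)^2) <= real n" using lo by (simp only: of_nat_le_iff)
   then have m2: "0 < (real (Suc m))^2" "(real (Suc m))^2 <= real n" by (simp, simp only: of_nat_power)
   ultimately have "abs (?S n om) / real n <= (abs (?S ((Suc m)^2) om) + 3 * real (Suc m) * c) / (real (Suc m))^2"
    using c0 by (intro frac_le) auto
   also have "... = ?r m" unfolding add_divide_distrib by (simp add: power2_eq del: of_nat_Suc)
   also have "... < e" using m0[OF m0m] c0 by simp
   finally show ?thesis by simp
  qed
  then show "EX no. ALL n>=no. norm (?S n om / real n - 0) < e" by blast
 qed
qed
qed

end

context osc_bm
begin

section \<open>Time averages of martingale differences\<close>

lemma nice_compose_continuous:
assumes f: "nice f" and x: "snd x ~= 0" and om: "om : space P"
shows "cont0 (%t. f (Phi 0 x t om))"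
proof -
have "continuous_on {y. snd y ~= 0} f" using f unfolding nice_def by (intro continuous_at_imp_continuous_on) blast
then show ?thesis by (rule cont_compose[OF _ Phi_path(3)[OF om]]) (use Phi_nonzero[OF om order_refl _ x] in auto)
qed

context
fixes x :: "(real^'d) * complex" and f :: "(real^'d) * complex => real" and h C :: real
assumes x: "snd x ~= 0" and f: "nice f" and C: "!!x. abs (f x) <= C" and h: "0 < h"
begin

text \<open>The deviation of \<open>f\<close> at time \<open>s + h\<close> from its conditional
  expectation given \<open>F s\<close>, so it is orthogonal to everything known at time
  \<open>s\<close>.\<close>

private definition "Ds s om = f (Phi 0 x (s + h) om) - Kf h f (Phi 0 x s om)"

private lemma Ds_facts:
shows "abs (Ds s om) <= 2 * C" and "om : space P ==> cont0 (%s. Ds s om)"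
 and "0 <= s ==> Ds s : bmeas (F (s + h))"
 and "0 <= s ==> c : bmeas (F s) ==> (!!om. abs (c om) <= Cc) ==> (LINT om|P. Ds s om * c om) = 0"
proof -
have h0: "0 <= h" using h by simp
have Kb: "abs (Kf h f y) <= C" for y by (rule Kf_bound[OF f C h0])
show D2: "abs (Ds s om) <= 2 * C" for s om unfolding Ds_def using C[of "Phi 0 x (s + h) om"] Kb[of "Phi 0 x s om"] by linarith
show "cont0 (%s. Ds s om)" if om: "om : space P"
proof -
 have "continuous_on {y. snd y ~= 0} (Kf h f)" using Kf_feller[OF f _ h0] by (intro continuous_at_imp_continuous_on) blast
 then have 1: "cont0 (%t. Kf h f (Phi 0 x t om))"
  by (rule cont_compose[OF _ Phi_path(3)[OF om]]) (use Phi_nonzero[OF om order_refl _ x] in auto)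
 have 2: "cont0 (%t. f (Phi 0 x (t + h) om))"
  by (rule cont_compose[OF nice_compose_continuous[OF f x om]]) (use h in "auto intro!: continuous_intros")
 show ?thesis unfolding Ds_def by (rule continuous_on_diff[OF 2 1])
qed
have fm: "f : bmeas borel" using f by (simp add: nice_def)
fix s :: real assume s: "0 <= s"
have X: "Phi 0 x s : bmeas (F s)" by (rule adaptedD[OF Phi_adapted s])
have nz: "snd (Phi 0 x s om) ~= 0" if "om : space P" for om by (rule Phi_nonzero[OF that order_refl s x])
have f1: "(%om. f (Phi 0 x (s + h) om)) : bmeas (F (s + h))" by (rule meas_comp[OF adaptedD[OF Phi_adapted] fm]) (use s h in simp)
have K1: "(%om. Kf h f (Phi 0 x s om)) : bmeas (F s)" by (rule markov(2)[OF f X nz _ _ s h, of "%_. 0" 0]) simp_all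
show Dm: "Ds s : bmeas (F (s + h))" unfolding Ds_def[abs_def] by (intro bmeas_diff f1 F_mono[OF _ K1]) (use h in simp)
assume c: "c : bmeas (F s)" "!!om. abs (c om) <= Cc"
have bi: "integrable P (%om. g om * c om)" if "g : bmeas P" "!!om. abs (g om) <= C" for g :: "'w => real"
proof (rule integrable_const_bound[of _ "C * Cc"])
 show "(%om. g om * c om) : bmeas P" by (intro bmeas_times that F_P[OF c(1)])
 show "AE om in P. norm (g om * c om) <= C * Cc"
  by (rule AE_I2, unfold norm_mult, rule mult_mono) (use that(2) c(2) order_trans[OF abs_ge_zero that(2)] in auto)
qed
have "(LINT om|P. Ds s om * c om) = (LINT om|P. f (Phi 0 x (s + h) om) * c om - Kf h f (Phi 0 x s om) * c om)"
 unfolding Ds_def left_diff_distrib ..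
also have "... = (LINT om|P. f (Phi 0 x (s + h) om) * c om) - (LINT om|P. Kf h f (Phi 0 x s om) * c om)"
 by (intro Bochner_Integration.integral_diff bi F_P[OF f1] F_P[OF K1] C Kb)
also have "(LINT om|P. f (Phi 0 x (s + h) om) * c om) = (LINT om|P. f (Phi s (Phi 0 x s om) h om) * c om)"
 by (rule Bochner_Integration.integral_cong[OF refl]) (simp add: Phi_flow[OF _ s h0])
also have "... = (LINT om|P. Kf h f (Phi 0 x s om) * c om)" by (rule markov(1)[OF f X nz c s h])
finally show "(LINT om|P. Ds s om * c om) = 0" by simp
qed

text \<open>The integral of \<open>Ds\<close> over a block of length \<open>h\<close> is known two
  blocks after its start and orthogonal to the past of its start, so blocks two apart are
  orthogonal. Riemann sums transfer measurability and orthogonality from \<open>Ds\<close> to the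
  block integrals.\<close>

lemma ergodic_increment:
"AE om in P. ((%T. itg T (%s. f (Phi 0 x (s + h) om) - Kf h f (Phi 0 x s om)) / T) ---> 0) at_top"
proof -
define U where "U k om = integral {real k * h..real k * h + h} (%s. Ds s om)" for k om
define R where "R k N om = (SUM i<N. (h / N) *\<^sub>R Ds (real k * h + grid h N i) om)" for k N om
have h0: "0 <= h" using h by simp
have kh: "0 <= real k * h" for k using h by simp
have C0: "0 <= C" by (rule order_trans[OF abs_ge_zero C])
have cs: "continuous_on {a..b} (%s. Ds s om)" if "om : space P" "0 <= a" for a b om
 by (rule cont_subset[OF Ds_facts(2)[OF that(1)]]) (use that in auto)
have RU: "(%N. R k N om) ----> U k om" if "om : space P" for k om
 unfolding R_def U_def by (rule riemann_sum_tendsto_shift[OF cs[OF that kh] h0])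
have Rm: "R k N : bmeas (F (real k * h + 2 * h))" for k N unfolding R_def
proof (intro bmeas_sum bmeas_scaleR bmeas_const)
 fix i assume "i : {..<N}"
 then show "Ds (real k * h + grid h N i) : bmeas (F (real k * h + 2 * h))"
  using kh[of k] grid_nonneg[OF h0, of N i] grid_le[OF h0, of i N] by (intro F_mono[OF _ Ds_facts(3)]) auto
qed
have Um: "U k : bmeas (F (real k * h + 2 * h))" for k by (rule bmeas_LIMSEQ[OF Rm]) (use RU in "simp add: space_F")
have Rb: "abs (R k N om) <= 2 * C * h" for k N om
proof -
 have "abs (R k N om) <= (SUM i<N. (h / N) * (2 * C))"
 proof (unfold R_def, rule order_trans[OF sum_abs sum_mono])
  fix i
  have hN: "0 <= h / N" using h0 by simp
  show "abs ((h / N) *\<^sub>R Ds (real k * h + grid h N i) om) <= (h / N) * (2 * C)"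
   unfolding real_scaleR_def abs_mult abs_of_nonneg[OF hN] by (rule mult_left_mono[OF Ds_facts(1) hN])
 qed
 also have "... <= 2 * C * h" using C0 h0 by (cases "N = 0") auto
 finally show ?thesis .
qed
have ib: "abs (integral {a..b} (%s. Ds s om)) <= 2 * C * (b - a)" if "om : space P" "0 <= a" "a <= b" for a b om
 using integral_norm_le_const[OF that(3) cont_integrable[OF cs[OF that(1,2)]], of "2 * C"] Ds_facts(1) by simp
have Ub: "abs (U k om) <= 2 * C * h" if "om : space P" for k om using ib[OF that kh, of k "real k * h + h"] h0 by (simp add: U_def)
have "AE om in P. (%n. (SUM k<n. U k om) / n) ----> 0"
proof (rule lln_bounded[OF F_P[OF Um] Ub])
 fix j k :: nat assume jk: "j + 2 <= k"
 \<comment> \<open>\<open>U j\<close> is bounded on \<open>space P\<close> only; the value 0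
   elsewhere makes it an admissible weight.\<close>
 define c where "c om = (if om : space P then U j om else 0)" for om
 have "real (j + 2) * h <= real k * h" using jk h0 by (intro mult_right_mono) auto
 then have t: "real j * h + 2 * h <= real k * h" by (simp add: algebra_simps)
 have "c : bmeas (F (real k * h)) \<longleftrightarrow> U j : bmeas (F (real k * h))" by (rule measurable_cong) (simp add: c_def space_F)
 with F_mono[OF t Um] have cm: "c : bmeas (F (real k * h))" by simp
 have cb: "abs (c om) <= 2 * C * h" for om using Ub[of om j] C0 h0 by (simp add: c_def)
 have Rc0: "(LINT om|P. c om * R k N om) = 0" for N
 proof -
  have g: "0 <= real k * h + grid h N i" for i using kh[of k] grid_nonneg[OF h0, of N i] by linarith
  have z: "(LINT om|P. Ds (real k * h + grid h N i) om * c om) = 0" for i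
   by (rule Ds_facts(4)[OF g F_mono[OF _ cm] cb]) (simp add: grid_nonneg[OF h0])
  have i: "integrable P (%om. Ds (real k * h + grid h N i) om * c om)" for i
  proof (rule integrable_const_bound[of _ "2 * C * (2 * C * h)"])
   show "AE om in P. norm (Ds (real k * h + grid h N i) om * c om) <= 2 * C * (2 * C * h)"
    by (rule AE_I2, unfold norm_mult, rule mult_mono) (use Ds_facts(1) cb C0 in auto)
  qed (intro bmeas_times F_P[OF Ds_facts(3)[OF g]] F_P[OF cm])
  have "(LINT om|P. c om * R k N om) = (LINT om|P. (SUM i<N. (h / N) * (Ds (real k * h + grid h N i) om * c om)))"
   unfolding R_def sum_distrib_left by (simp add: mult_ac)
  also have "... = 0" using i by (subst bi_integral_sum) (auto simp: z)
  finally show ?thesis .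
 qed
 have "(%N. \<integral>om. c om * R k N om \<partial>P) ----> (LINT om|P. U j om * U k om)"
 proof (rule dominated_conv[where w = "%_. (2 * C * h) * (2 * C * h)"])
  show "AE om in P. (%N. c om * R k N om) ----> U j om * U k om" by (rule AE_I2) (simp add: c_def tendsto_mult RU)
  show "AE om in P. norm (c om * R k N om) <= (2 * C * h) * (2 * C * h)" for N
   by (rule AE_I2, unfold norm_mult, rule mult_mono) (use Rb cb C0 h0 in auto)
  show "(%om. U j om * U k om) : bmeas P" by (intro bmeas_times F_P[OF Um])
  show "(%om. c om * R k N om) : bmeas P" for N by (intro bmeas_times F_P[OF cm] F_P[OF Rm])
 qed simp
 then show "(LINT om|P. U j om * U k om) = 0" unfolding Rc0 by (simp add: LIMSEQ_const_iff)
qed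
with AE_space show ?thesis
proof eventually_elim
 case (elim om)
 let ?I = "%T. itg T (%s. Ds s om)"
 have SU: "(SUM k<n. U k om) = ?I (real n * h)" for n
 proof (induction n)
  case (Suc n)
  have "?I (real n * h) + integral {real n * h..real n * h + h} (%s. Ds s om) = ?I (real n * h + h)"
   using kh[of n] h0 by (intro hk_combine cont_integrable cs[OF elim(1)]) auto
  then show ?case using Suc by (simp add: U_def distrib_right add.commute)
 qed simp
 let ?n = "%T. nat \<lfloor>T / h\<rfloor>"
 have nT: "filterlim ?n sequentially at_top" unfolding filterlim_at_top
 proof (intro allI eventually_mono[OF eventually_ge_at_top])
  fix N :: nat and T assume "real N * h <= T"
  then have "real N <= T / h" using h by (simp add: field_simps)
  then show "N <= ?n T" by (rule le_nat_floor)
 qed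
 let ?S = "%n. SUM k<n. U k om"
 have b0: "((%T. abs (?S (?n T) / real (?n T)) * (1 / h) + 2 * C * h * (1 / T)) ---> abs 0 * (1 / h) + 2 * C * h * 0) at_top"
  by (intro tendsto_add tendsto_mult tendsto_rabs tendsto_const filterlim_compose[OF elim(2) nT] tendsto_divide_0[OF tendsto_const]
    filterlim_at_top_imp_at_infinity filterlim_ident)
 have "((%T. ?I T / T) ---> 0) at_top"
 proof (rule Lim_null_comparison[OF eventually_mono[OF eventually_gt_at_top[of 0]]])
  fix T :: real assume T: "0 < T"
  have T0: "0 <= T / h" using T h by simp
  have n: "real (?n T) * h <= T" "T <= real (?n T) * h + h"
  proof -
   have "real (?n T) <= T / h" using T0 by linarith
   then show "real (?n T) * h <= T" using h by (simp add: field_simps)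
   have "T / h <= real (?n T) + 1" using T0 by linarith
   then show "T <= real (?n T) * h + h" using h by (simp add: field_simps)
  qed
  have "?I (real (?n T) * h) + integral {real (?n T) * h..T} (%s. Ds s om) = ?I T"
   using kh[of "?n T"] n by (intro hk_combine cont_integrable cs[OF elim(1)]) auto
  moreover have "abs (integral {real (?n T) * h..T} (%s. Ds s om)) <= 2 * C * h"
   by (rule order_trans[OF ib[OF elim(1) kh n(1)] mult_left_mono]) (use n C0 in auto)
  ultimately have "abs (?I T) <= abs (?S (?n T)) + 2 * C * h" unfolding SU by linarith
  then have "abs (?I T) / T <= (abs (?S (?n T)) + 2 * C * h) / T" using T by (intro divide_right_mono) auto
  moreover have "abs (?S (?n T)) / T <= abs (?S (?n T) / real (?n T)) * (1 / h)"
  proof (cases "?n T = 0")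
   case False
   then have "abs (?S (?n T)) / T <= abs (?S (?n T)) / (real (?n T) * h)" using n(1) h by (intro divide_left_mono) auto
   then show ?thesis by simp
  qed simp
  ultimately show "norm (?I T / T) <= abs (?S (?n T) / real (?n T)) * (1 / h) + 2 * C * h * (1 / T)"
   using T by (simp add: add_divide_distrib)
 qed (use b0 in simp)
 then show ?case unfolding Ds_def .
qed
qed

end

end


section \<open>The velocity process has bounded mean square along time\<close>

context bm
begin

text \<open>The two quantities through which the noise enters a unit step of \<open>v\<close>: its
  mean square over the interval and its final increment.\<close>

definition noise_energy :: "nat => 'w => real" where
"noise_energy k om = itg 1 (%r. (norm (inc (real k) (real k + r) om))^2) + (norm (inc (real k) (real k + 1) om))^2"

lemma inc_path_continuous: "om : space P ==> 0 <= s ==> continuous_on {0..1} (%r. inc s (s + r) om)"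
unfolding inc_def
by (intro continuous_on_diff continuous_on_const cont_compose[OF W_continuous]) (auto intro!: continuous_intros)

text \<open>For fixed \<open>u\<close> the centred squares summed over \<open>n\<close> blocks have
  second moment of order \<open>n\<close>; Cauchy-Schwarz on Riemann sums and Fatou give the same
  for their integral over \<open>u\<close>. This controls the average along squares, and since
  energies are nonnegative, monotonicity bounds it for all \<open>n\<close>.\<close>

lemma noise_average: "AE om in P. EX C. ALL n. (SUM k<n. noise_energy k om) <= C * real n"
proof -
define m where "m = real CARD('m)"
have m0: "0 <= m" by (simp add: m_def)
define g where "g u x = (norm (x :: real^'m))^2 - m * u" for u x
define J where "J u k = inc (real k) (real k + u)" for u and k :: nat
define R where "R n u om = (SUM k<n. g u (J u k om))" for n u om
have gm: "g u : bmeas borel" for u unfolding g_def[abs_def] by simp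
have Jm: "J u k : bmeas (F (real k + u))" "J u k : bmeas P" if "0 <= u" for u k
 unfolding J_def using that by (auto intro!: inc_measurable F_P[OF inc_measurable])
have gi: "integrable P (%om. g u (J u k om))" "(LINT om|P. g u (J u k om)) = 0"
 "integrable P (%om. (g u (J u k om))^2)" "(LINT om|P. (g u (J u k om))^2) <= 3 * m^2" if u: "0 < u" "u <= 1" for u k
proof -
 have k: "0 <= real k" "real k < real k + u" using u by auto
 note mom = inc_norm_moment[OF k, folded J_def m_def]
 show "integrable P (%om. g u (J u k om))" unfolding g_def by (intro bi_integrable_diff mom(1) integrable_const)
 show "(LINT om|P. g u (J u k om)) = 0" unfolding g_def using mom(1,2) by (simp add: prob_space)
 have eq: "(g u x)^2 = norm x ^ 4 - 2 * (m * u) * (norm x)^2 + (m * u)^2" for x :: "real^'m"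
  unfolding g_def power2_diff by (simp add: power_mult[symmetric])
 show "integrable P (%om. (g u (J u k om))^2)" unfolding eq
  by (intro bi_integrable_add bi_integrable_diff integrable_mult_right mom(1,3) integrable_const)
 have "(LINT om|P. (g u (J u k om))^2) = (LINT om|P. norm (J u k om) ^ 4) - (m * u)^2"
  unfolding eq using mom(1,2,3) by (simp add: prob_space power2_eq)
 also have "... <= 3 * m^2 * u^2"
 proof -
  have "e - y <= b" if "e <= b" "0 <= y" for e y b :: real using that by linarith
  from this[OF _ zero_le_power2] show ?thesis using mom(4) by simp
 qed
 also have "... <= 3 * m^2 * 1" using u by (intro mult_left_mono) (auto simp: power_le_one)
 finally show "(LINT om|P. (g u (J u k om))^2) <= 3 * m^2" by simp
qed
have Rm: "R n u : bmeas (F (real n))" if u: "0 <= u" "u <= 1" for n u unfolding R_def[abs_def]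
 by (intro bmeas_sum meas_comp[OF _ gm] F_mono[OF _ Jm(1)]) (use u in auto)
have RL: "integrable P (%om. (R n u om)^2) & (LINT om|P. (R n u om)^2) <= 3 * m^2 * real n" if u: "0 < u" "u <= 1" for n u
proof (induction n)
 case (Suc n)
 have k: "0 <= real n" "real n < real n + u" using u by auto
 have Ri: "integrable P (R n u)" unfolding R_def[abs_def] by (intro bi_integrable_sum gi(1)[OF u])
 have Rm': "R n u : bmeas (F (real n))" using Rm[of u n] u by simp
 note ei = expectation_mult_inc[OF k Rm' Ri gm[of u] gi(1)[OF u, of n, unfolded J_def], folded J_def]
 have eq: "(R (Suc n) u om)^2 = (R n u om)^2 + 2 * (R n u om * g u (J u n om)) + (g u (J u n om))^2" for om by (simp add: R_def power2_sum)
 have "(LINT om|P. (R (Suc n) u om)^2) = (LINT om|P. (R n u om)^2) + 2 * (LINT om|P. R n u om * g u (J u n om)) + (LINT om|P. (g u (J u n om))^2)"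
  unfolding eq using Suc ei(1) gi(3)[OF u, of n] by simp
 moreover have "integrable P (%om. (R (Suc n) u om)^2)" unfolding eq
  using Suc ei(1) gi(3)[OF u, of n] by (intro bi_integrable_add integrable_mult_right) auto
 ultimately show ?case using Suc ei(2) gi(2,4)[OF u, of n] by (simp add: algebra_simps)
qed (simp add: R_def)
have R0: "R n 0 om = 0" for n om by (simp add: R_def g_def J_def inc_def)
have RL': "integrable P (%om. (R n u om)^2)" "(LINT om|P. (R n u om)^2) <= 3 * m^2 * real n" if "0 <= u" "u <= 1" for n u
 using RL[of u n] R0 that m0 by (cases "u = 0"; simp)+
have Rc: "continuous_on {0..1} (%u. R n u om)" if "om : space P" for n om
 unfolding R_def g_def J_def by (intro continuous_intros inc_path_continuous that) simp
define S where "S n om = itg 1 (%u. R n u om) + R n 1 om" for n om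
define SN where "SN n N om = (SUM i<N. (1 / real N) *\<^sub>R R n (grid 1 N i) om) + R n 1 om" for n N om
have gr: "0 <= grid 1 N i" "i < N ==> grid 1 N i <= 1" for N i by (auto intro: grid_nonneg grid_le)
have SNm: "SN n N : bmeas P" for n N unfolding SN_def[abs_def] by (intro bmeas_add bmeas_sum bmeas_scaleR bmeas_const F_P[OF Rm] gr) auto
have lim: "(%N. SN n N om) ----> S n om" if "om : space P" for n om
 unfolding SN_def S_def by (intro tendsto_add tendsto_const riemann_sum_tendsto Rc that) simp
have Sm: "S n : bmeas P" for n by (rule bmeas_LIMSEQ[OF SNm lim])
have SN2: "integrable P (%om. (SN n N om)^2)" "(LINT om|P. (SN n N om)^2) <= (12 * m^2) * real n" for n N
proof -
 let ?B = "%om. 2 * (SUM i<N. (1 / real N) * (R n (grid 1 N i) om)^2) + 2 * (R n 1 om)^2"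
 have le: "(SN n N om)^2 <= ?B om" for om
 proof -
  let ?a = "%i. R n (grid 1 N i) om"
  have "(SUM i<N. (1 / real N) *\<^sub>R ?a i)^2 = (1 / real N)^2 * (SUM i<N. ?a i)^2"
   unfolding real_scaleR_def sum_distrib_left[symmetric] power_mult_distrib ..
  also have "... <= (1 / real N)^2 * ((SUM i<N. (?a i)^2) * N)"
   using sum_squared_le_sum_of_squares[of ?a "{..<N}"] by (intro mult_left_mono) auto
  also have "... = (SUM i<N. (1 / real N) * (?a i)^2)" unfolding sum_distrib_left[symmetric] by (cases "N = 0") (simp_all add: power2_eq)
  finally have 1: "(SUM i<N. (1 / real N) *\<^sub>R ?a i)^2 <= (SUM i<N. (1 / real N) * (?a i)^2)" .
  have "(x + y)^2 <= 2 * x^2 + 2 * y^2" for x y :: real using sum_squares_bound[of x y] by (simp add: power2_sum)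
  from order_trans[OF this add_right_mono[OF mult_left_mono[OF 1]]] show ?thesis unfolding SN_def by simp
 qed
 have Bi: "integrable P ?B" by (intro bi_integrable_add integrable_mult_right bi_integrable_sum RL'(1) gr) auto
 show i: "integrable P (%om. (SN n N om)^2)"
 proof (rule bi_integrable_bound[OF Bi])
  show "(%om. (SN n N om)^2) : bmeas P" by (intro bmeas_power SNm)
  show "AE om in P. norm ((SN n N om)^2) <= norm (?B om)" by (rule AE_I2) (rule square_le_norm[OF le])
 qed
 have "(LINT om|P. (SN n N om)^2) <= (LINT om|P. ?B om)" by (rule integral_mono[OF i Bi le])
 also have "... = 2 * (SUM i<N. (1 / real N) * (LINT om|P. (R n (grid 1 N i) om)^2)) + 2 * (LINT om|P. (R n 1 om)^2)"
  using RL'(1)[of 1 n] RL'(1)[OF gr] by (subst Bochner_Integration.integral_add) (auto simp: bi_integral_sum)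
 also have "... <= 2 * (SUM i<N. (1 / real N) * (3 * m^2 * real n)) + 2 * (3 * m^2 * real n)"
  by (intro add_mono mult_left_mono sum_mono RL'(2) gr) auto
 also have "... <= (12 * m^2) * real n" using m0 by (cases "N = 0") auto
 finally show "(LINT om|P. (SN n N om)^2) <= (12 * m^2) * real n" .
qed
have ip: "in_prob (SN n) (S n)" for n by (rule AE_in_prob[OF SNm Sm AE_I2[OF lim]])
note S2 = in_prob_fatou[OF ip SN2 tendsto_const]
from second_moment_squares[OF Sm S2] AE_space show ?thesis
proof eventually_elim
 case (elim om)
 define c where "c = itg 1 (%u. m * u) + m"
 have nc: "(%u. (norm (inc (real k) (real k + u) om))^2) integrable_on {0..1}" for k :: nat
  by (intro cont_integrable continuous_intros inc_path_continuous elim) simp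
 have mi: "(%u. m * u) integrable_on {0..1}" by (intro cont_integrable continuous_intros)
 have sum: "(SUM k<n. noise_energy k om) = S n om + c * real n" for n
 proof -
  have "itg 1 (%u. R n u om) = (SUM k<n. itg 1 (%u. (norm (inc (real k) (real k + u) om))^2) - itg 1 (%u. m * u))"
   unfolding R_def g_def J_def
   by (subst Henstock_Kurzweil_Integration.integral_sum) (use nc mi in "auto intro: integrable_diff simp: hk_diff[OF nc mi]")
  then show ?thesis unfolding S_def noise_energy_def c_def by (simp add: R_def g_def J_def sum.distrib sum_subtractf algebra_simps)
 qed
 have e0: "0 <= noise_energy k om" for k unfolding noise_energy_def by (intro add_nonneg_nonneg hk_nonneg nc) auto
 have "Bseq (%n. S ((Suc n)^2) om / (real (Suc n))^2)" using elim(1) by (intro convergent_imp_Bseq convergentI)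
 then obtain K where K: "0 < K" "!!n. abs (S ((Suc n)^2) om / (real (Suc n))^2) <= K" unfolding Bseq_def by auto
 have c0: "0 <= c" unfolding c_def using m0 by (intro add_nonneg_nonneg hk_nonneg mi) auto
 have "(SUM k<n. noise_energy k om) <= (4 * (K + c)) * real n" for n
 proof (cases "n = 0")
  case False
  \<comment> \<open>The square \<open>(j + 1)^2\<close> lies between \<open>n\<close> and
    \<open>4 * n\<close>.\<close>
  define j where "j = nat \<lfloor>sqrt n\<rfloor>"
  have s1: "1 <= sqrt n" using False by simp
  have j: "sqrt n <= real (Suc j)" "real (Suc j) <= 2 * sqrt n" unfolding j_def using s1 by linarith+
  have "real n <= (real (Suc j))^2" using power_mono[OF j(1), of 2] by simp
  then have nj: "n <= (Suc j)^2" by (simp only: of_nat_power[symmetric] of_nat_le_iff)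
  have j4: "(real (Suc j))^2 <= 4 * real n" using power_mono[OF j(2), of 2] by (simp add: power_mult_distrib)
  have "(SUM k<n. noise_energy k om) <= (SUM k<(Suc j)^2. noise_energy k om)" by (rule sum_mono2) (use nj e0 in auto)
  also have "... = S ((Suc j)^2) om + c * (real (Suc j))^2" unfolding sum by simp
  also have "S ((Suc j)^2) om <= K * (real (Suc j))^2" using abs_le_D1[OF K(2)[of j]] by (simp add: pos_divide_le_eq del: of_nat_Suc)
  also have "K * (real (Suc j))^2 + c * (real (Suc j))^2 = (K + c) * (real (Suc j))^2" by (simp add: distrib_right)
  also have "... <= (K + c) * (4 * real n)" using K(1) c0 by (intro mult_left_mono j4) auto
  finally show ?thesis by (simp add: algebra_simps)
 qed simp
 then show ?case by blast
qed
qed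

end


context params
begin

text \<open>The variable \<open>y = v - B (W - W 0)\<close> is differentiable, so
  \<open>exp (nu * t) * s y y\<close> can be differentiated; the noise enters through
  \<open>A *v beta\<close>. The resulting inequality yields both the contraction at time 1 and the
  bound on the mean square.\<close>

lemma lyapunov_step:
assumes A: "hurwitz A"
obtains V rho C where "0 <= rho" "rho < 1" "0 <= C" "!!v. (norm v)^2 <= V v"
 "!!W v z N. osc_path W v z ==> cont0 W ==>
   N = itg 1 (%r. (norm (W r - W 0))^2) + (norm (W 1 - W 0))^2 ==>
   V (v 1) <= rho * V (v 0) + C * N & itg 1 (%t. (norm (v t))^2) <= C * (V (v 0) + N)"
proof -
obtain s c where s: "bounded_bilinear s" "!!x y. s x y = s y x" "!!x. (norm x)^2 <= s x x"
 and c: "c > 0" "!!x. 2 * s x (A *v x) <= - c * (norm x)^2" using hurwitz_lyapunov[OF A] by blast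
interpret s: bounded_bilinear s by (rule s(1))
obtain S where S: "S > 0" "!!x y. norm (s x y) <= norm x * norm y * S" using s.pos_bounded by blast
obtain K where K: "K >= 0" "!!x. norm (A *v x) <= K * norm x" using matrix_bound by blast
obtain Kb where Kb: "Kb >= 0" "!!x. norm (B *v x) <= Kb * norm x" using matrix_bound by blast
have sp: "0 <= s x x" for x using s(3)[of x] zero_le_power2[of "norm x"] by linarith
\<comment> \<open>\<open>nu\<close> makes \<open>nu * s y y\<close> cost at most a quarter of the
  dissipation \<open>c |y|^2\<close>. \<open>D\<close> is the constant of Young's inequality that
  spends half of it on the cross term. \<open>delta\<close> solves
  \<open>(1 + delta) * exp (- nu) = exp (- nu / 2)\<close>, so that a contraction is left after the
  final increment is added back.\<close>
define nu where "nu = c / (4 * S)"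
define D where "D = 2 * S^2 * K^2 / c"
define delta where "delta = exp (nu / 2) - 1"
have nu0: "0 < nu" using c S by (simp add: nu_def)
have D0: "0 <= D" using c by (simp add: D_def)
have delta0: "0 < delta" using nu0 by (simp add: delta_def)
define c1 c2 c3 c4 where "c1 = (1 + delta) * (D * Kb^2)" and "c2 = (1 + 1 / delta) * (S * Kb^2)" and "c3 = 8 / c"
 and "c4 = 8 / c * (D * exp nu * Kb^2) + 2 * Kb^2"
have cc: "0 <= c1" "0 <= c2" "0 <= c3" "0 <= c4" using delta0 D0 S(1) c(1) by (simp_all add: c1_def c2_def c3_def c4_def)
show thesis
proof (rule that[of "exp (- nu / 2)" "c1 + c2 + c3 + c4" "%v. s v v"])
 fix W v z N assume X: "osc_path W v z" and W: "cont0 W"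
  and N: "N = itg 1 (%r. (norm (W r - W 0))^2) + (norm (W 1 - W 0))^2"
 have vc: "continuous_on {0..1} v" using X unfolding osc_path_def by (auto intro: cont_subset)
 have Wc: "continuous_on {0..1} W" by (rule cont_subset[OF W]) auto
 let ?N1 = "itg 1 (%r. (norm (W r - W 0))^2)"
 define beta where "beta t = B *v (W t - W 0)" for t
 define y where "y t = v t - beta t" for t
 have betac: "continuous_on {0..1} beta" unfolding beta_def[abs_def] by (intro continuous_on_mat continuous_intros Wc)
 have yc: "continuous_on {0..1} y" unfolding y_def[abs_def] by (intro continuous_intros vc betac)
 have Avc: "continuous_on {0..1} (%t. A *v v t)" by (rule continuous_on_mat[OF vc])
 have yI: "y t = v 0 + itg t (%r. A *v v r)" if "t : {0..1}" for t
 proof -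
  have "0 <= t" using that by simp
  then have "v t = v 0 + itg t (%r. A *v v r) + B *v (W t - W 0)" using X unfolding osc_path_def by blast
  then show ?thesis by (simp add: y_def beta_def)
 qed
 have yd: "(y has_vector_derivative A *v v t) (at t within {0..1})" if t: "t : {0..1}" for t
 proof (rule has_vector_derivative_transform[OF t yI])
  have "((%t. v 0 + itg t (%r. A *v v r)) has_vector_derivative (0 + A *v v t)) (at t within {0..1})"
   by (rule has_vector_derivative_add[OF has_vector_derivative_const integral_has_vector_derivative[OF Avc t]])
  then show "((%t. v 0 + itg t (%r. A *v v r)) has_vector_derivative A *v v t) (at t within {0..1})" by simp
 qed
 define phi' where "phi' t = exp (nu * t) * (s (y t) (A *v v t) + s (A *v v t) (y t)) + (nu * exp (nu * t)) * s (y t) (y t)" for t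
 have "(phi' has_integral (exp (nu * 1) * s (y 1) (y 1) - exp (nu * 0) * s (y 0) (y 0))) {0..1}"
 proof (rule fundamental_theorem_of_calculus)
  fix t :: real assume t: "t : {0..1}"
  have e: "((%t. exp (nu * t)) has_vector_derivative nu * exp (nu * t)) (at t within {0..1})"
   by (auto intro!: derivative_eq_intros simp: has_real_derivative_iff_has_vector_derivative[symmetric])
  show "((%t. exp (nu * t) * s (y t) (y t)) has_vector_derivative phi' t) (at t within {0..1})"
   unfolding phi'_def by (rule has_vector_derivative_mult[OF e s.has_vector_derivative[OF yd[OF t] yd[OF t]]])
 qed simp
 then have I: "(phi' has_integral (exp nu * s (y 1) (y 1) - s (v 0) (v 0))) {0..1}" by (simp add: y_def beta_def)
 have Wn: "(%r. (norm (W r - W 0))^2) integrable_on {0..1}" by (intro cont_integrable continuous_intros Wc)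
 have yn: "(%r. (norm (y r))^2) integrable_on {0..1}" by (intro cont_integrable continuous_intros yc)
 have bound: "phi' t <= D * exp nu * Kb^2 * (norm (W t - W 0))^2 - c / 4 * (norm (y t))^2" if t: "t : {0..1}" for t
 proof -
  let ?Y = "norm (y t)" and ?b = "norm (beta t)"
  have "v t = y t + beta t" by (simp add: y_def)
  then have "2 * s (y t) (A *v v t) = 2 * s (y t) (A *v y t) + 2 * s (y t) (A *v beta t)"
   by (simp add: matrix_vector_right_distrib s.add_right)
  also have "... <= - c * ?Y^2 + 2 * (?Y * (K * ?b) * S)"
   using c(2)[of "y t"] abs_le_D1[OF S(2)[of "y t" "A *v beta t", unfolded real_norm_def]] mult_right_mono[OF mult_left_mono[OF K(2)[of "beta t"] norm_ge_zero[of "y t"]], of S] S(1) by linarith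
  also have "2 * (?Y * (K * ?b) * S) <= c / 2 * ?Y^2 + D * ?b^2"
  proof -
   have "0 <= (c * ?Y - 2 * S * K * ?b)^2 / (2 * c)" using c(1) by simp
   also have "... = c / 2 * ?Y^2 + D * ?b^2 - 2 * (?Y * (K * ?b) * S)" using c(1) unfolding D_def by (simp add: power2_eq field_simps)
   finally show ?thesis by simp
  qed
  finally have 1: "2 * s (y t) (A *v v t) <= - (c / 2) * ?Y^2 + D * ?b^2" by simp
  have "nu * s (y t) (y t) <= nu * (?Y * ?Y * S)" using nu0 abs_le_D1[OF S(2)[of "y t" "y t", unfolded real_norm_def]] by (intro mult_left_mono) auto
  also have "... = c / 4 * ?Y^2" using S(1) by (simp add: nu_def power2_eq)
  finally have 2: "2 * s (y t) (A *v v t) + nu * s (y t) (y t) <= D * ?b^2 - c / 4 * ?Y^2" using 1 by simp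
  have "phi' t = exp (nu * t) * (2 * s (y t) (A *v v t) + nu * s (y t) (y t))"
   unfolding phi'_def s(2)[of "A *v v t"] by (simp add: algebra_simps)
  also have "... <= exp (nu * t) * (D * ?b^2 - c / 4 * ?Y^2)" by (rule mult_left_mono[OF 2]) simp
  also have "... = exp (nu * t) * (D * ?b^2) - exp (nu * t) * (c / 4 * ?Y^2)" by (rule right_diff_distrib)
  also have "... <= exp nu * (D * (Kb * norm (W t - W 0))^2) - 1 * (c / 4 * ?Y^2)"
   using t nu0 D0 c(1) Kb(2)[of "W t - W 0"] unfolding beta_def
   by (intro diff_mono mult_mono mult_left_mono power_mono) (auto intro: mult_left_le)
  finally show ?thesis by (simp add: power_mult_distrib mult_ac)
 qed
 have RI: "((%t. D * exp nu * Kb^2 * (norm (W t - W 0))^2 - c / 4 * (norm (y t))^2) has_integral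
   (D * exp nu * Kb^2 * ?N1 - c / 4 * itg 1 (%r. (norm (y r))^2))) {0..1}"
  by (intro has_integral_diff has_integral_mult_right integrable_integral Wn yn)
 have main: "exp nu * s (y 1) (y 1) - s (v 0) (v 0) <= D * exp nu * Kb^2 * ?N1 - c / 4 * itg 1 (%r. (norm (y r))^2)"
  by (rule has_integral_le[OF I RI bound])
 have Y0: "0 <= itg 1 (%r. (norm (y r))^2)" by (rule hk_nonneg[OF yn]) simp
 have N1: "0 <= ?N1" by (rule hk_nonneg[OF Wn]) simp
 have N1N: "?N1 <= N" "(norm (W 1 - W 0))^2 <= N" "0 <= N" using N1 by (simp_all add: N)
 have i: "s (y 1) (y 1) <= exp (- nu) * s (v 0) (v 0) + D * Kb^2 * ?N1"
 proof -
  have "exp nu * s (y 1) (y 1) <= s (v 0) (v 0) + D * exp nu * Kb^2 * ?N1"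
   using main mult_nonneg_nonneg[of "c / 4", OF _ Y0] c(1) by linarith
  from mult_left_mono[OF this, of "exp (- nu)"] show ?thesis by (simp add: exp_minus field_simps)
 qed
 have ii: "itg 1 (%r. (norm (y r))^2) <= 4 / c * (s (v 0) (v 0) + D * exp nu * Kb^2 * ?N1)"
 proof -
  have "c / 4 * itg 1 (%r. (norm (y r))^2) <= s (v 0) (v 0) + D * exp nu * Kb^2 * ?N1"
   using main mult_nonneg_nonneg[OF exp_ge_zero[of nu] sp[of "y 1"]] by linarith
  then show ?thesis using c(1) by (simp add: field_simps)
 qed
 let ?b = "beta 1"
 have sb: "s ?b ?b <= S * Kb^2 * (norm (W 1 - W 0))^2"
 proof -
  have "s ?b ?b <= norm ?b * norm ?b * S" using abs_le_D1[OF S(2)[of ?b ?b, unfolded real_norm_def]] .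
  also have "... <= (Kb * norm (W 1 - W 0)) * (Kb * norm (W 1 - W 0)) * S"
   using S(1) Kb(1) Kb(2)[of "W 1 - W 0"] unfolding beta_def by (intro mult_right_mono mult_mono) auto
  finally show ?thesis by (simp add: power2_eq mult_ac)
 qed
 have "2 * s (y 1) ?b <= delta * s (y 1) (y 1) + 1 / delta * s ?b ?b"
 proof -
  have "0 <= s (delta *\<^sub>R y 1 - ?b) (delta *\<^sub>R y 1 - ?b) / delta" using sp delta0 by simp
  also have "... = delta * s (y 1) (y 1) + 1 / delta * s ?b ?b - 2 * s (y 1) ?b"
   using delta0 by (simp add: s.diff_left s.diff_right s.scaleR_left s.scaleR_right s(2)[of ?b "y 1"] field_simps)
  finally show ?thesis by simp
 qed
 moreover have "s (v 1) (v 1) = s (y 1) (y 1) + 2 * s (y 1) ?b + s ?b ?b"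
 proof -
  have v1: "v 1 = y 1 + ?b" by (simp add: y_def)
  show ?thesis unfolding v1 s.add_left s.add_right s(2)[of ?b "y 1"] by simp
 qed
 ultimately have "s (v 1) (v 1) <= (1 + delta) * s (y 1) (y 1) + (1 + 1 / delta) * s ?b ?b" by (simp add: distrib_right)
 also have "... <= (1 + delta) * (exp (- nu) * s (v 0) (v 0) + D * Kb^2 * ?N1) + (1 + 1 / delta) * (S * Kb^2 * (norm (W 1 - W 0))^2)"
  using delta0 by (intro add_mono mult_left_mono i sb) auto
 also have "... = exp (- nu / 2) * s (v 0) (v 0) + (c1 * ?N1 + c2 * (norm (W 1 - W 0))^2)"
 proof -
  have "(1 + delta) * exp (- nu) = exp (- nu / 2)" unfolding delta_def by (simp flip: exp_add)
  then show ?thesis unfolding c1_def c2_def by (simp add: distrib_left mult.assoc[symmetric])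
 qed
 also have "c1 * ?N1 + c2 * (norm (W 1 - W 0))^2 <= c1 * N + c2 * N" using cc by (intro add_mono mult_left_mono N1N)
 also have "... <= (c1 + c2 + c3 + c4) * N" using mult_nonneg_nonneg[OF cc(3) N1N(3)] mult_nonneg_nonneg[OF cc(4) N1N(3)] by (simp add: distrib_right)
 finally have a: "s (v 1) (v 1) <= exp (- nu / 2) * s (v 0) (v 0) + (c1 + c2 + c3 + c4) * N" by simp
 have vn: "(%r. (norm (v r))^2) integrable_on {0..1}" by (intro cont_integrable continuous_intros vc)
 have RI2: "((%t. 2 * (norm (y t))^2 + 2 * Kb^2 * (norm (W t - W 0))^2) has_integral
   (2 * itg 1 (%r. (norm (y r))^2) + 2 * Kb^2 * ?N1)) {0..1}" by (intro has_integral_add has_integral_mult_right integrable_integral Wn yn)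
 have "itg 1 (%r. (norm (v r))^2) <= 2 * itg 1 (%r. (norm (y r))^2) + 2 * Kb^2 * ?N1"
 proof (rule has_integral_le[OF integrable_integral[OF vn] RI2])
  fix t :: real
  have "norm (v t) <= norm (y t) + Kb * norm (W t - W 0)"
   using norm_triangle_ineq[of "y t" "beta t"] Kb(2)[of "W t - W 0"] by (simp add: y_def beta_def)
  then have "(norm (v t))^2 <= (norm (y t) + Kb * norm (W t - W 0))^2" by (rule power_mono) simp
  also have "... <= 2 * (norm (y t))^2 + 2 * (Kb * norm (W t - W 0))^2"
   using sum_squares_bound[of "norm (y t)" "Kb * norm (W t - W 0)"] by (simp add: power2_sum)
  finally show "(norm (v t))^2 <= 2 * (norm (y t))^2 + 2 * Kb^2 * (norm (W t - W 0))^2" by (simp add: power_mult_distrib)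
 qed
 also have "... <= 2 * (4 / c * (s (v 0) (v 0) + D * exp nu * Kb^2 * ?N1)) + 2 * Kb^2 * ?N1"
  by (intro add_right_mono mult_left_mono ii) simp
 also have "... = c3 * s (v 0) (v 0) + c4 * ?N1" unfolding c3_def c4_def by (simp add: algebra_simps)
 also have "... <= (c1 + c2 + c3 + c4) * s (v 0) (v 0) + (c1 + c2 + c3 + c4) * N" using cc N1N N1 sp by (intro add_mono mult_mono) auto
 finally have b: "itg 1 (%r. (norm (v r))^2) <= (c1 + c2 + c3 + c4) * (s (v 0) (v 0) + N)" by (simp add: distrib_left)
 show "s (v 1) (v 1) <= exp (- nu / 2) * s (v 0) (v 0) + (c1 + c2 + c3 + c4) * N &
  itg 1 (%t. (norm (v t))^2) <= (c1 + c2 + c3 + c4) * (s (v 0) (v 0) + N)" using a b by blast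
qed (use nu0 cc s(3) in auto)
qed

end

text \<open>Summing the contraction over unit steps bounds the sum of \<open>V\<close> by the
  initial value and the noise energies, which grow at most linearly by
  \<open>noise_average\<close>.\<close>

lemma (in osc_bm) velocity_mean_square:
assumes A: "hurwitz A"
shows "AE om in P. EX C. ALL T>=1. itg T (%t. (norm (fst (Phi 0 x t om)))^2) <= C * T"
proof -
obtain V rho C where VC: "0 <= rho" "rho < 1" "0 <= C" "!!v. (norm v)^2 <= V v"
 "!!W v z N. osc_path W v z ==> cont0 W ==>
   N = itg 1 (%r. (norm (W r - W 0))^2) + (norm (W 1 - W 0))^2 ==>
   V (v 1) <= rho * V (v 0) + C * N & itg 1 (%t. (norm (v t))^2) <= C * (V (v 0) + N)" using lyapunov_step[OF A] by metis
have V0: "0 <= V v" for v using VC(4)[of v] zero_le_power2[of "norm v"] by linarith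
from noise_average AE_space show ?thesis
proof eventually_elim
 case (elim om)
 obtain Cn where Cn: "!!n. (SUM k<n. noise_energy k om) <= Cn * real n" using elim(1) by blast
 let ?v = "%t. fst (Phi 0 x t om)" and ?E = "%k. noise_energy k om"
 let ?n = "%t. (norm (?v t))^2"
 have vc: "cont0 ?n" by (intro continuous_intros Phi_path(3)[OF elim(2)])
 have vi: "?n integrable_on {a..b}" if "0 <= a" for a b by (intro cont_integrable cont_subset[OF vc]) (use that in auto)
 define S where "S n = (SUM k<n. V (?v (real k)))" for n
 have step: "V (?v (real k + 1)) <= rho * V (?v (real k)) + C * ?E k"
  "integral {real k..real k + 1} ?n <= C * (V (?v (real k)) + ?E k)" for k
 proof -
  have p: "osc_path (%t. W (real k + t) om) (%t. ?v (real k + t)) (%t. snd (Phi 0 x (real k + t) om))"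
   by (rule osc_path_shift[OF Phi_path(1)[OF elim(2)] W_continuous[OF elim(2)]]) simp
  have sh: "itg 1 (%t. (norm (?v (real k + t)))^2) = integral {real k..real k + 1} ?n"
   using integral_shift[of 0 "real k" 1 ?n] cont_subset[OF vc, of "{real k..real k + 1}"] by (simp add: o_def add.commute)
  from VC(5)[OF p path_continuous[OF elim(2)], of "?E k"]
  show "V (?v (real k + 1)) <= rho * V (?v (real k)) + C * ?E k"
   "integral {real k..real k + 1} ?n <= C * (V (?v (real k)) + ?E k)" unfolding sh by (simp_all add: noise_energy_def inc_def)
 qed
 have tel: "(1 - rho) * S n + V (?v (real n)) <= V (?v 0) + C * (SUM k<n. ?E k)" for n
 proof (induction n)
  case (Suc n)
  have "(1 - rho) * S (Suc n) + V (?v (real (Suc n))) <= ((1 - rho) * S n + V (?v (real n))) + C * ?E n"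
   using step(1)[of n] by (simp add: S_def algebra_simps)
  then show ?case using Suc by (simp add: distrib_left)
 qed (simp add: S_def)
 have Sb: "S n <= (V (?v 0) + C * (SUM k<n. ?E k)) / (1 - rho)" for n
  using tel[of n] V0[of "?v (real n)"] VC(2) by (simp add: pos_le_divide_eq mult.commute)
 have In: "itg (real n) ?n <= C * (S n + (SUM k<n. ?E k))" for n
 proof (induction n)
  case (Suc n)
  have "itg (real n) ?n + integral {real n..real n + 1} ?n = itg (real n + 1) ?n" by (intro hk_combine vi) auto
  then show ?case using Suc step(2)[of n] by (simp add: S_def algebra_simps)
 qed (simp add: S_def)
 define M where "M = C * ((V (?v 0) + C * abs Cn) / (1 - rho) + abs Cn)"
 have M0: "0 <= M" unfolding M_def using VC(2,3) V0[of "?v 0"] by simp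
 have IM: "itg (real n) ?n <= M * real n" if n: "1 <= n" for n :: nat
 proof -
  have E: "(SUM k<n. ?E k) <= abs Cn * real n" using Cn[of n] mult_right_mono[OF abs_ge_self[of Cn], of "real n"] by linarith
  have "V (?v 0) <= V (?v 0) * real n" using mult_left_mono[of 1 "real n" "V (?v 0)"] V0[of "?v 0"] n by simp
  then have "V (?v 0) + C * (SUM k<n. ?E k) <= V (?v 0) * real n + C * (abs Cn * real n)" using mult_left_mono[OF E VC(3)] by linarith
  then have "(V (?v 0) + C * (SUM k<n. ?E k)) / (1 - rho) <= (V (?v 0) * real n + C * (abs Cn * real n)) / (1 - rho)"
   using VC(2) by (intro divide_right_mono) auto
  then have "S n + (SUM k<n. ?E k) <= (V (?v 0) * real n + C * (abs Cn * real n)) / (1 - rho) + abs Cn * real n" using Sb[of n] E by linarith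
  from order_trans[OF In[of n] mult_left_mono[OF this VC(3)]] show ?thesis unfolding M_def by (simp add: algebra_simps add_divide_distrib)
 qed
 have "itg T ?n <= (2 * M) * T" if T: "1 <= T" for T
 proof -
  define n where "n = nat \<lceil>T\<rceil>"
  have n: "1 <= n" "T <= real n" "real n <= 2 * T" unfolding n_def using T by linarith+
  have "itg T ?n <= itg (real n) ?n" by (rule integral_subset_le) (use n T vi in auto)
  also have "... <= M * real n" by (rule IM[OF n(1)])
  also have "... <= M * (2 * T)" by (rule mult_left_mono[OF n(3) M0])
  finally show ?thesis by simp
 qed
 then show ?case by blast
qed
qed


section \<open>Time averages\<close>

lemma at_top_limit_if_subseq:
fixes f :: "real => real"
assumes sub: "!!T :: nat => real. filterlim T at_top sequentially ==> (!!n. 1 <= T n) ==>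
  EX r. strict_mono (r :: nat => nat) & (%n. f (T (r n))) ----> L"
shows "(f ---> L) at_top"
proof (rule ccontr)
assume "~ (f ---> L) at_top"
then obtain e where e: "0 < e" "~ (\<forall>\<^sub>F t in at_top. dist (f t) L < e)" unfolding tendsto_iff by blast
then have "EX t. real n + 1 <= t & ~ dist (f t) L < e" for n :: nat unfolding eventually_at_top_linorder by blast
then obtain T where T: "!!n :: nat. real n + 1 <= T n" "!!n. ~ dist (f (T n)) L < e" by metis
have "filterlim T at_top sequentially"
 by (rule filterlim_at_top_mono[OF filterlim_real_sequentially]) (use T(1) in "auto intro!: always_eventually order_trans[OF _ T(1)]")
moreover have "1 <= T n" for n using T(1)[of n] by simp
ultimately obtain r where "(%n. f (T (r n))) ----> L" using sub by blast
then have "EVN n. dist (f (T (r n))) L < e" using e(1) by (rule tendstoD)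
then show False using T(2) by (auto simp: eventually_sequentially)
qed

text \<open>The uniform law on \<open>[0, T]\<close> transported by the path; \<open>max 0 t\<close>
  extends the path continuously to negative times, where the density vanishes.\<close>

definition occupation :: "(real => 'a::euclidean_space) => real => 'a measure" where
"occupation y T = distr (density lborel (%t. ennreal (indicator {0..T} t / T))) borel (%t. y (max 0 t))"

lemma occupation:
assumes y: "cont0 y" and T: "0 < T"
shows "prob_space (occupation y T)" "sets (occupation y T) = sets borel"
 "!!g :: 'a::euclidean_space => real. continuous_on UNIV g ==>
  integrable (occupation y T) g & (LINT x|occupation y T. g x) = itg T (%t. g (y t)) / T"
proof -
let ?d = "%t :: real. indicator {0..T} t / T"
let ?D = "density lborel (%t. ennreal (?d t))" and ?y = "%t. y (max 0 t)"
have "continuous_on UNIV ?y" by (rule cont_compose[OF y]) (auto intro!: continuous_intros)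
then have ym: "?y : bmeas borel" by (rule cont_bmeas)
then have yD: "?y : ?D \<rightarrow>\<^sub>M borel" by simp
have "emeasure ?D (space ?D) = (\<integral>\<^sup>+t. ennreal (1 / T) * indicator {0..T} t \<partial>lborel)"
 by (subst emeasure_density) (auto intro!: nn_integral_cong simp: indicator_def)
also have "... = ennreal (1 / T) * ennreal T" using T by (subst nn_integral_cmult_indicator) auto
also have "... = 1" using T by (simp flip: ennreal_mult)
finally have "prob_space ?D" by (rule prob_spaceI)
then show "prob_space (occupation y T)" unfolding occupation_def by (rule prob_space.prob_space_distr[OF _ yD])
show "sets (occupation y T) = sets borel" by (simp add: occupation_def)
fix g :: "'a => real" assume g: "continuous_on UNIV g"
have gm: "g : bmeas borel" by (rule cont_bmeas[OF g])
have gy: "(%t. g (?y t)) : bmeas lborel" using meas_comp[OF ym gm] by simp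
have gc: "continuous_on {0..T} (%t. g (y t))" by (rule cont_compose[OF g cont_subset[OF y]]) auto
note si = borel_integrable_atLeastAtMost'[OF gc]
have eq: "?d t *\<^sub>R g (?y t) = (1 / T) *\<^sub>R (indicator {0..T} t *\<^sub>R g (y t))" for t by (simp add: indicator_def max_def)
have dn: "AE t in lborel. 0 <= ?d t" using T by (auto intro!: AE_I2)
have dm: "?d : bmeas lborel" by measurable
have "integrable lborel (%t. (1 / T) *\<^sub>R (indicator {0..T} t *\<^sub>R g (y t)))"
 using si unfolding set_integrable_def by (rule integrable_scaleR_right)
then have "integrable ?D (%t. g (?y t))" unfolding integrable_density[OF gy dm dn] eq .
then have 1: "integrable (occupation y T) g" unfolding occupation_def by (subst integrable_distr_eq[OF yD gm])
have "(LINT x|occupation y T. g x) = (LINT t|?D. g (?y t))" unfolding occupation_def by (rule integral_distr[OF yD gm])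
also have "... = (LINT t|lborel. (1 / T) *\<^sub>R (indicator {0..T} t *\<^sub>R g (y t)))" unfolding integral_density[OF gy dm dn] eq ..
also have "... = (1 / T) *\<^sub>R (LINT t:{0..T}|lborel. g (y t))" unfolding set_lebesgue_integral_def by (rule integral_scaleR_right)
also have "... = itg T (%t. g (y t)) / T" unfolding set_borel_integral_eq_integral(2)[OF si] by simp
finally show "integrable (occupation y T) g & (LINT x|occupation y T. g x) = itg T (%t. g (y t)) / T" using 1 by blast
qed

section \<open>Observables that depend on the ray of \<open>z\<close>\<close>

definition pol :: "(real^'d) * complex => (real^'d) * complex" where
"pol x = (fst x, sgn (snd x))"

text \<open>Makes a test function of the ambient space constant along rays, so that the determining
  class can be used for the projective process.\<close>

definition rad :: "((real^'d) * complex => real) => (real^'d) * complex => real" where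
"rad g x = g (pol x)"

definition clip :: "((real^'d) * complex => real) => (real^'d) * complex => real" where
"clip f x = min 1 (norm (snd x)) * f x"

text \<open>Observables of the projective process: bounded, continuous off the zero section, and constant
 along rays. Multiplication by \<open>min 1 \<bar>z\<bar>\<close> makes them continuous without changing them on \<open>\<bar>z\<bar> = 1\<close>.\<close>

definition projective :: "((real^'d) * complex => real) => bool" where
"projective f \<longleftrightarrow> (EX C. ALL x. abs (f x) <= C) & (ALL x. snd x ~= 0 --> isCont f x) & (ALL v r z. 0 < r --> f (v, r *\<^sub>R z) = f (v, z))"

lemma projectiveD:
assumes "projective f"
obtains C where "!!x. abs (f x) <= C" "!!x. snd x ~= 0 ==> isCont f x" "!!v r z. 0 < r ==> f (v, r *\<^sub>R z) = f (v, z)"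
using assms unfolding projective_def by blast

lemma projective_pol:
assumes f: "projective f" and x: "snd x ~= 0"
shows "f (pol x) = f x" "clip f (pol x) = f x"
proof -
have "f (fst x, (1 / norm (snd x)) *\<^sub>R snd x) = f (fst x, snd x)" using f x unfolding projective_def by simp
then show 1: "f (pol x) = f x" by (simp add: pol_def sgn_div_norm divide_inverse)
show "clip f (pol x) = f x" unfolding clip_def 1 using x by (simp add: pol_def norm_sgn)
qed

lemma clip_continuous:
assumes f: "projective f"
shows "continuous_on UNIV (clip f)" "EX C. ALL x. abs (clip f x) <= C"
proof -
obtain C where C: "!!x. abs (f x) <= C" and c: "!!x. snd x ~= 0 ==> isCont f x" using projectiveD[OF f] by metis
have C0: "0 <= C" by (rule order_trans[OF abs_ge_zero C])
have b: "abs (clip f x) <= min 1 (norm (snd x)) * C" for x unfolding clip_def abs_mult by (intro mult_mono C) auto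
then have "abs (clip f x) <= C" for x using b[of x] mult_right_mono[OF min.cobounded1[of 1 "norm (snd x)"] C0] by linarith
then show "EX C. ALL x. abs (clip f x) <= C" by blast
have "isCont (clip f) x" for x
proof (cases "snd x = 0")
 case False
 show ?thesis unfolding clip_def by (intro continuous_intros c[OF False])
next
 case True
 have "((%y. min 1 (norm (snd y)) * C) ---> min 1 (norm (snd x)) * C) (at x)" by (intro tendsto_intros)
 then have z: "((%y. min 1 (norm (snd y)) * C) ---> 0) (at x)" by (simp add: True)
 have "((%y. clip f y) ---> 0) (at x)"
 proof (rule Lim_null_comparison[OF always_eventually z])
  show "ALL y. norm (clip f y) <= min 1 (norm (snd y)) * C" unfolding real_norm_def by (rule allI) (rule b)
 qed
 moreover have "clip f x = 0" using True by (simp add: clip_def)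
 ultimately show ?thesis unfolding isCont_def by (simp only:)
qed
then show "continuous_on UNIV (clip f)" by (intro continuous_at_imp_continuous_on) blast
qed

lemma cyl_embed_cyl_proj: "snd x ~= 0 ==> cyl_embed (cyl_proj x) = pol x"
using cyl_embed_proj[of "snd x" "fst x"] by (simp add: pol_def)

context osc_bm
begin

lemma projective_Kf:
assumes f: "projective f" "nice f" and h: "0 <= h"
shows "projective (Kf h f)"
proof -
obtain C where C: "!!x. abs (f x) <= C" and hm: "!!v r z. 0 < r ==> f (v, r *\<^sub>R z) = f (v, z)" using projectiveD[OF f(1)] by metis
show ?thesis unfolding projective_def
proof (intro conjI allI impI)
 show "EX C. ALL x. abs (Kf h f x) <= C" using Kf_bound[OF f(2) C h] by blast
 show "isCont (Kf h f) x" if "snd x ~= 0" for x by (rule Kf_feller[OF f(2) that h])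
 show "Kf h f (v, r *\<^sub>R z) = Kf h f (v, z)" if "0 < r" for v r z by (rule Kf_homogeneous[OF hm h that])
qed
qed

context
fixes K and G :: "nat => (real^'d) * complex => real" and m :: "((real^'d) * complex) measure"
assumes K: "transition_function P F W A B a gamma kappa zeta K"
 and G: "!!i. continuous_on UNIV (G i)" "!!i x. 0 <= G i x & G i x <= 1"
  "!!mu nu. prob_space mu ==> prob_space nu ==> sets mu = sets borel ==> sets nu = sets borel ==>
    (!!n. (LINT x|mu. G n x) = (LINT x|nu. G n x)) ==> mu = nu"
begin

lemma rad_projective: "projective (rad (G i))" "nice (rad (G i))"
proof -
have Gc: "isCont (G i) x" for x using G(1)[of i] unfolding continuous_on_eq_continuous_at[OF open_UNIV] by blast
have b: "abs (rad (G i) x) <= 1" for x using G(2)[of i "pol x"] by (simp add: rad_def)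
have c: "isCont (rad (G i)) x" if "snd x ~= 0" for x unfolding rad_def pol_def
 by (rule isCont_o2[OF _ Gc]) (intro continuous_intros; use that in simp)
have "pol : bmeas (borel :: ((real^'d) * complex) measure)"
 unfolding pol_def[abs_def] by (intro bmeas_Pair borel_fst_snd meas_comp[OF _ borel_measurable_sgn]) simp_all
then have "rad (G i) : bmeas borel" unfolding rad_def[abs_def] by (rule meas_comp) (rule cont_bmeas[OF G(1)])
with b c show "nice (rad (G i))" unfolding nice_def by blast
show "projective (rad (G i))" unfolding projective_def
proof (intro conjI allI impI)
 show "EX C. ALL x. abs (rad (G i) x) <= C" using b by blast
 show "isCont (rad (G i)) x" if "snd x ~= 0" for x using c[OF that] .
 show "rad (G i) (v, r *\<^sub>R z) = rad (G i) (v, z)" if "0 < r" for v r z using that by (simp add: rad_def pol_def sgn_scaleR)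
qed
qed

text \<open>Invariance is assumed for the countable family \<open>rad (G i)\<close> and positive
  rational times only. Continuity of \<open>Kf\<close> in time extends it to all \<open>t\<close>.
  On \<open>|z| = 1\<close> neither clipping nor the passage through the cylinder changes an
  observable, so the determining class applies to the images of the two measures.\<close>

lemma invariant_projection:
assumes m: "prob_space m" "sets m = sets borel" and on: "AE x in m. norm (snd x) = 1" and t: "0 <= t"
 and inv: "!!i j k. (LINT x|m. clip (Kf (real (Suc j) / real (Suc k)) (rad (G i))) x) = (LINT x|m. clip (rad (G i)) x)"
shows "distr m borel cyl_proj \<bind> K t = distr m borel cyl_proj"
proof (rule cyl_measure_eqI)
interpret m: prob_space m by (rule m(1))
have pm: "cyl_proj : m \<rightarrow>\<^sub>M borel" using measurable_cyl_proj m(2) by (simp cong: measurable_cong_sets)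
have em: "cyl_embed : borel \<rightarrow>\<^sub>M borel" by (rule measurable_cyl_embed)
let ?nu = "distr m borel cyl_proj"
interpret nu: prob_space ?nu by (rule m.prob_space_distr[OF pm])
have Kp: "K t : borel \<rightarrow>\<^sub>M prob_algebra borel" using K t unfolding transition_function_def by blast
then have Km: "K t : ?nu \<rightarrow>\<^sub>M subprob_algebra borel" by (simp add: measurable_prob_algebraD)
show sb: "sets (?nu \<bind> K t) = sets borel" by (rule sets_bind) (use Km in "auto simp: subprob_measurableD")
have pb: "prob_space (?nu \<bind> K t)"
 by (rule prob_space_bind'[of _ borel]) (use Kp nu.prob_space_axioms in "auto simp: space_prob_algebra")
show "sets ?nu = sets borel" by simp
have eb: "cyl_embed : (?nu \<bind> K t) \<rightarrow>\<^sub>M borel" using em sb by (simp cong: measurable_cong_sets)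
show "distr (?nu \<bind> K t) borel cyl_embed = distr ?nu borel cyl_embed"
proof (rule G(3))
 show "prob_space (distr (?nu \<bind> K t) borel cyl_embed)" by (rule prob_space.prob_space_distr[OF pb eb])
 show "prob_space (distr ?nu borel cyl_embed)" by (rule nu.prob_space_distr) (use em in simp)
 fix i
 have Gm: "G i : bmeas borel" by (rule cont_bmeas[OF G(1)])
 let ?g = "%p. G i (cyl_embed p)"
 have gm: "?g : bmeas borel" by (rule meas_comp[OF em Gm])
 have inner: "(LINT q|K t p. ?g q) = Kf t (rad (G i)) (cyl_embed p)" for p
 proof -
  have nz: "snd (cyl_embed p) ~= 0" by (simp add: cyl_embed_def)
  have "(LINT q|K t p. ?g q) = (LINT om|P. ?g (cyl_proj (Phi 0 (cyl_embed p) t om)))"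
   unfolding transition_law[OF K t] by (rule integral_distr[OF meas_comp[OF Phi_const_measurable[OF t] measurable_cyl_proj] gm])
  also have "... = Kf t (rad (G i)) (cyl_embed p)" unfolding Kf_def rad_def
   by (rule Bochner_Integration.integral_cong[OF refl]) (simp add: cyl_embed_cyl_proj Phi_nonzero[OF _ order_refl t nz])
  finally show ?thesis .
 qed
 have Kfm: "(%p. Kf t (rad (G i)) (cyl_embed p)) : bmeas borel"
  unfolding inner[symmetric] by (rule meas_comp[OF measurable_prob_algebraD[OF Kp] integral_measurable_subprob_algebra[OF gm]])
 have clipm: "clip f : bmeas m" if "projective f" for f
  using cont_bmeas[OF clip_continuous(1)[OF that]] m(2) by (simp cong: measurable_cong_sets)
 have AEeq: "(LINT x|m. f (cyl_embed (cyl_proj x))) = (LINT x|m. clip f x)"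
  if f: "projective f" and fm: "(%p. f (cyl_embed p)) : bmeas borel" for f
 proof (rule integral_cong_AE)
  show "(%x. f (cyl_embed (cyl_proj x))) : bmeas m" by (rule meas_comp[OF pm fm])
  show "AE x in m. f (cyl_embed (cyl_proj x)) = clip f x"
  proof (rule eventually_mono[OF on])
   fix x :: "(real^'d) * complex" assume n: "norm (snd x) = 1"
   then have nz: "snd x ~= 0" by auto
   show "f (cyl_embed (cyl_proj x)) = clip f x" unfolding cyl_embed_cyl_proj[OF nz] projective_pol(1)[OF f nz] by (simp add: clip_def n)
  qed
 qed (rule clipm[OF f])
 have "(LINT x|distr (?nu \<bind> K t) borel cyl_embed. G i x) = (LINT p|(?nu \<bind> K t). ?g p)" by (rule integral_distr[OF eb Gm])
 also have "... = (LINT p|?nu. (LINT q|K t p. ?g q))"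
 proof (rule integral_bind[where B = 1 and B' = 1, OF gm _ Km])
  have "prob_space (K t p)" for p unfolding transition_law[OF K t]
   by (rule prob_space_distr) (rule meas_comp[OF Phi_const_measurable[OF t] measurable_cyl_proj])
  then show "AE p in ?nu. emeasure (K t p) (space (K t p)) <= ennreal 1" by (simp add: prob_space.emeasure_space_1)
  show "abs (?g p) <= 1" for p using G(2)[of i "cyl_embed p"] by simp
 qed (rule nu.finite_measure_axioms)
 also have "... = (LINT p|?nu. Kf t (rad (G i)) (cyl_embed p))" unfolding inner ..
 also have "... = (LINT x|m. Kf t (rad (G i)) (cyl_embed (cyl_proj x)))" by (rule integral_distr[OF pm Kfm])
 also have "... = (LINT x|m. clip (Kf t (rad (G i))) x)" by (rule AEeq[OF projective_Kf[OF rad_projective t] Kfm])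
 also have "... = (LINT x|m. clip (rad (G i)) x)"
 proof -
  obtain s where st: "s ----> t" and s: "!!n. EX i k. s n = real (Suc i) / real (Suc k)" using positive_rationals_tendsto[OF t] by blast
  have s0: "0 <= s n" "(LINT x|m. clip (Kf (s n) (rad (G i))) x) = (LINT x|m. clip (rad (G i)) x)" for n
  proof -
   obtain i' k where "s n = real (Suc i') / real (Suc k)" using s by blast
   then show "0 <= s n" "(LINT x|m. clip (Kf (s n) (rad (G i))) x) = (LINT x|m. clip (rad (G i)) x)" using inv by simp_all
  qed
  have "(%n. \<integral>x. clip (Kf (s n) (rad (G i))) x \<partial>m) ----> (LINT x|m. clip (Kf t (rad (G i))) x)"
  proof (rule dominated_conv[where w = "%_. 1"])
   show "AE x in m. (%n. clip (Kf (s n) (rad (G i))) x) ----> clip (Kf t (rad (G i))) x"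
   proof (rule AE_I2)
    fix x :: "(real^'d) * complex"
    show "(%n. clip (Kf (s n) (rad (G i))) x) ----> clip (Kf t (rad (G i))) x"
    proof (cases "snd x = 0")
     case False
     then show ?thesis unfolding clip_def by (intro tendsto_intros Kf_time[OF rad_projective(2) False t s0(1) st])
    qed (simp add: clip_def)
   qed
   have g1: "abs (rad (G i) x) <= 1" for x using G(2)[of i "pol x"] by (simp add: rad_def)
   show "AE x in m. norm (clip (Kf (s n) (rad (G i))) x) <= 1" for n
   proof (rule AE_I2)
    fix x :: "(real^'d) * complex"
    show "norm (clip (Kf (s n) (rad (G i))) x) <= 1" unfolding clip_def norm_mult
     by (rule mult_le_one) (use Kf_bound[OF rad_projective(2) g1 s0(1)] in auto)
   qed
  qed (auto intro!: clipm projective_Kf[OF rad_projective] t s0(1))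
  then show ?thesis unfolding s0(2) by (simp add: LIMSEQ_const_iff)
 qed
 also have "... = (LINT x|m. rad (G i) (cyl_embed (cyl_proj x)))"
  by (rule AEeq[OF rad_projective(1) meas_comp[OF em], symmetric]) (use rad_projective(2) in "simp add: nice_def")
 also have "... = (LINT x|m. ?g (cyl_proj x))"
 proof -
  have "rad (G i) (cyl_embed p) = ?g p" for p by (simp add: rad_def pol_def cyl_embed_def sgn_div_norm)
  then show ?thesis by simp
 qed
 also have "... = (LINT p|?nu. ?g p)" by (rule integral_distr[OF pm gm, symmetric])
 also have "... = (LINT x|distr ?nu borel cyl_embed. G i x)" by (rule integral_distr[symmetric]) (use em Gm in auto)
 finally show "(LINT x|distr (?nu \<bind> K t) borel cyl_embed. G i x) = (LINT x|distr ?nu borel cyl_embed. G i x)" .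
qed simp_all
qed

end


context
fixes K and mu :: "((real^'d) \<times> circle) measure" and x :: "(real^'d) * complex"
assumes A: "hurwitz A" and K: "transition_function P F W A B a gamma kappa zeta K"
 and mu: "prob_space mu" "sets mu = sets borel"
 and uniq: "!!nu. prob_space nu ==> sets nu = sets borel ==> (ALL t>=0. nu \<bind> K t = nu) ==> nu = mu"
 and x: "snd x ~= 0"
begin

lemma projective_path_continuous:
assumes f: "!!y. snd y ~= 0 ==> isCont f y" and om: "om : space P"
shows "cont0 (%t. f (Phi 0 x t om))"
proof -
have "continuous_on {y. snd y ~= 0} f" using f by (intro continuous_at_imp_continuous_on) blast
then show ?thesis by (rule cont_compose[OF _ Phi_path(3)[OF om]]) (use Phi_nonzero[OF om order_refl _ x] in auto)
qed

text \<open>The exceptional null set is common to all \<open>f\<close>: only countably many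
  statements on \<open>rad (G i)\<close> at rational times and the velocity bound enter. On a good
  path every sequence of times has a subsequence of convergent occupation measures, whose limit is
  identified with \<open>mu\<close>.\<close>

theorem time_average:
"AE om in P. (EX C. ALL T>=1. itg T (%t. (norm (fst (Phi 0 x t om)))^2) <= C * T) &
  (ALL f. projective f --> ((%T. itg T (%t. f (Phi 0 x t om)) / T) ---> (LINT p|mu. f (cyl_embed p))) at_top)"
proof -
obtain G :: "nat => (real^'d) * complex => real" where G: "!!i. continuous_on UNIV (G i)" "!!i x. 0 <= G i x & G i x <= 1"
  "!!mu nu. prob_space mu ==> prob_space nu ==> sets mu = sets borel ==> sets nu = sets borel ==>
    (!!n. (LINT x|mu. G n x) = (LINT x|nu. G n x)) ==> mu = nu" using countable_determining_class[where 'a = "(real^'d) * complex"] by metis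
let ?g = "%i. rad (G i)" and ?q = "%j k. real (Suc j) / real (Suc k)"
have gp1: "projective (rad (G i))" for i by (rule rad_projective(1)[of K G i]) (rule K G(1) G(2) G(3), assumption?)+
have gp2: "nice (rad (G i))" for i by (rule rad_projective(2)[of K G i]) (rule K G(1) G(2) G(3), assumption?)+
note gp = gp1 gp2
have g1: "abs (?g i y) <= 1" for i y using G(2)[of i "pol y"] by (simp add: rad_def)
have erg: "AE om in P. ALL i j k. ((%T. itg T (%s. ?g i (Phi 0 x (s + ?q j k) om) - Kf (?q j k) (?g i) (Phi 0 x s om)) / T) ---> 0) at_top"
 unfolding AE_all_countable by (intro allI ergodic_increment[OF x gp(2) g1] divide_pos_pos) simp_all
from erg velocity_mean_square[OF A, of x] AE_space show ?thesis
proof eventually_elim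
 case (elim om)
 let ?X = "%t. Phi 0 x t om"
 have nz: "snd (?X t) ~= 0" if "0 <= t" for t by (rule Phi_nonzero[OF elim(3) order_refl that x])
 obtain C where C: "!!T. 1 <= T ==> itg T (%t. (norm (fst (?X t)))^2) <= C * T" using elim(2) by blast
 define y where "y t = pol (?X t)" for t
 have yc: "cont0 y"
  unfolding y_def pol_def by (intro continuous_on_Pair continuous_on_fst continuous_on_sgn continuous_on_snd Phi_path(3)[OF elim(3)]) (use nz in auto)
 have clipy: "clip f (y t) = f (?X t)" if "projective f" "0 <= t" for f t
  unfolding y_def by (rule projective_pol(2)[OF that(1) nz[OF that(2)]])
 have "((%T. itg T (%t. f (?X t)) / T) ---> (LINT p|mu. f (cyl_embed p))) at_top" if f: "projective f" for f
 proof (rule at_top_limit_if_subseq)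
  fix T :: "nat => real" assume T: "filterlim T at_top sequentially" "!!n. 1 <= T n"
  have T0: "0 < T n" for n using T(2)[of n] by linarith
  let ?M = "%n. occupation y (T n)"
  note occ = occupation[OF yc T0]
  have tight: "EX R. ALL n. measure (?M n) (cball 0 R) > 1 - e" if e: "0 < e" for e
  proof (intro exI allI)
   fix n
   interpret o: prob_space "?M n" by (rule occ(1))
   \<comment> \<open>By Chebyshev the mass outside the ball of radius \<open>R\<close> is at most
     \<open>(1 + C) / R^2\<close>, the 1 coming from \<open>|z|^2\<close>. With this
     \<open>R\<close> it is below \<open>e\<close>, whatever the sign of \<open>C\<close>.\<close>
   define R where "R = sqrt ((abs C + 2) / e)"
   have R2: "R^2 = (abs C + 2) / e" "0 < R" using e by (simp_all add: R_def)
   have gc: "continuous_on UNIV (%z :: (real^'d) * complex. 1 - (norm z)^2 / R^2)" by (intro continuous_intros) (use R2(2) in simp)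
   have vi: "(%t. (norm (fst (?X t)))^2) integrable_on {0..T n}"
    by (intro cont_integrable continuous_intros cont_subset[OF Phi_path(3)[OF elim(3)]]) auto
   have ny: "(norm (y t))^2 = (norm (fst (?X t)))^2 + 1" if "0 <= t" for t using nz[OF that] by (simp add: y_def pol_def norm_Pair norm_sgn)
   have "itg (T n) (%t. 1 - (norm (y t))^2 / R^2) = itg (T n) (%t. (1 - 1 / R^2) - (norm (fst (?X t)))^2 / R^2)"
    by (rule integral_cong) (simp add: ny add_divide_distrib)
   also have "... = (1 - 1 / R^2) * T n - itg (T n) (%t. (norm (fst (?X t)))^2) / R^2"
    using T0[of n] by (subst hk_diff) (use vi in "auto intro: integrable_on_divide")
   also have "... >= (1 - 1 / R^2) * T n - C * T n / R^2" by (intro diff_left_mono divide_right_mono C T(2)) simp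
   finally have "((1 - 1 / R^2) * T n - C * T n / R^2) / T n <= itg (T n) (%t. 1 - (norm (y t))^2 / R^2) / T n"
    using T0[of n] by (intro divide_right_mono) auto
   moreover have "((1 - 1 / R^2) * T n - C * T n / R^2) / T n = 1 - (1 + C) / R^2"
    using T0[of n] by (simp add: diff_divide_distrib add_divide_distrib)
   ultimately have "1 - (1 + C) / R^2 <= (LINT z|?M n. 1 - (norm z)^2 / R^2)" using occ(3)[OF gc] by simp
   also have "... <= (LINT z|?M n. indicator (cball 0 R) z)"
   proof (rule integral_mono[OF conjunct1[OF occ(3)[OF gc]]])
    have "cball 0 R : sets (?M n)" unfolding occ(2) by simp
    then show "integrable (?M n) (indicat_real (cball 0 R))"
     by (intro o.integrable_const_bound[of _ 1] borel_measurable_indicator AE_I2) (simp_all add: indicator_def)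
    show "1 - (norm z)^2 / R^2 <= indicat_real (cball 0 R) z" for z using R2(2) power_mono[of R "norm z" 2] by (auto simp: indicator_def)
   qed
   also have "... = measure (?M n) (cball 0 R)" using occ(2) by simp
   finally have "1 - (1 + C) / R^2 <= measure (?M n) (cball 0 R)" .
   moreover have "(1 + C) / R^2 < e"
   proof -
    have "(1 + C) * e < (abs C + 2) * e" using e by (intro mult_strict_right_mono) auto
    then show ?thesis unfolding R2(1) using e by (simp add: field_simps)
   qed
   ultimately show "measure (?M n) (cball 0 R) > 1 - e" by linarith
  qed
  obtain r m where r: "strict_mono (r :: nat => nat)" and m: "prob_space m" "sets m = sets borel"
   and lim: "!!(g :: (real^'d) * complex => real) c. continuous_on UNIV g ==> (!!x. abs (g x) <= c) ==>
     (%n. \<integral>x. g x \<partial>?M (r n)) ----> (LINT x|m. g x)" using prokhorov_euclidean[of ?M, OF occ(1,2) tight] by metis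
  interpret m: prob_space m by (rule m(1))
  let ?T = "%n. T (r n)"
  have Tr: "filterlim ?T at_top sequentially" by (rule filterlim_compose[OF T(1) filterlim_subseq[OF r]])
  have conv: "(%n. itg (?T n) (%t. f (?X t)) / ?T n) ----> (LINT z|m. clip f z)" if f: "projective f" for f
  proof -
   obtain c where c: "!!x. abs (clip f x) <= c" using clip_continuous(2)[OF f] by blast
   have "(LINT z|?M (r n). clip f z) = itg (?T n) (%t. f (?X t)) / ?T n" for n
    using occ(3)[OF clip_continuous(1)[OF f]] integral_cong[of "{0..?T n}" "%t. clip f (y t)" "%t. f (?X t)"] clipy[OF f] by simp
   with lim[OF clip_continuous(1)[OF f] c] show ?thesis by simp
  qed
  \<comment> \<open>A bounded continuous function vanishing exactly on \<open>|z| = 1\<close>; it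
    integrates to 0 under every occupation measure, hence under \<open>m\<close>.\<close>
  let ?h = "%z :: (real^'d) * complex. min 1 (abs (norm (snd z) - 1))"
  have hc: "continuous_on UNIV ?h" by (intro continuous_intros)
  have h1: "abs (?h z) <= 1" for z by simp
  have "(LINT z|?M (r n). ?h z) = 0" for n
  proof -
   have "itg (?T n) (%t. ?h (y t)) = itg (?T n) (%t. 0)" by (rule integral_cong) (simp add: y_def pol_def norm_sgn nz)
   then show ?thesis using occ(3)[OF hc] by simp
  qed
  with lim[OF hc h1] have "(LINT z|m. ?h z) = 0" by (simp add: LIMSEQ_const_iff)
  moreover have hm: "?h : bmeas m" using cont_bmeas[OF hc] m(2) by (simp cong: measurable_cong_sets)
  then have "integrable m ?h" by (intro m.integrable_const_bound[of _ 1]) auto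
  ultimately have "AE z in m. ?h z = 0" using integral_nonneg_eq_0_iff_AE[of m ?h] by simp
  then have on: "AE z in m. norm (snd z) = 1" by (rule eventually_mono) (auto simp: min_def split: if_splits)
  \<comment> \<open>Shifting the time integral by \<open>?s\<close> costs two boundary pieces of
    length \<open>?s\<close>, negligible after division by the time; the rest is
    \<open>ergodic_increment\<close>.\<close>
  have inv: "(LINT z|m. clip (Kf (?q j k) (?g i)) z) = (LINT z|m. clip (?g i) z)" for i j k
  proof -
   let ?s = "?q j k" and ?f = "?g i"
   have s0: "0 <= ?s" by simp
   have fc: "cont0 (%t. ?f (?X t))" by (rule nice_compose_continuous[OF gp(2) x elim(3)])
   have Kc: "cont0 (%t. Kf ?s ?f (?X t))" by (rule projective_path_continuous[OF Kf_feller[OF gp(2) _ s0] elim(3)])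
   have ii: "(%t. ?f (?X t)) integrable_on {c..d}" if "0 <= c" for c d by (intro cont_integrable cont_subset[OF fc]) (use that in auto)
   have ib: "abs (integral {c..c + ?s} (%t. ?f (?X t))) <= ?s" if "0 <= c" for c
    using integral_norm_le_const[OF _ ii[OF that], of "c + ?s" 1] g1 s0 by simp
   have split: "itg (?T n) (%t. ?f (?X (t + ?s)) - Kf ?s ?f (?X t)) / ?T n
     = (integral {?T n..?T n + ?s} (%t. ?f (?X t)) - itg (0 + ?s) (%t. ?f (?X t))) / ?T n
      + itg (?T n) (%t. ?f (?X t)) / ?T n - itg (?T n) (%t. Kf ?s ?f (?X t)) / ?T n" for n
   proof -
    have Tn: "0 <= ?T n" using T0[of "r n"] by simp
    have c1: "continuous_on {0..?T n} (%t. ?f (?X (t + ?s)))" by (rule cont_compose[OF fc]) (auto intro!: continuous_intros)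
    have i1: "itg (?T n) (%t. ?f (?X (t + ?s)) - Kf ?s ?f (?X t)) = itg (?T n) (%t. ?f (?X (t + ?s))) - itg (?T n) (%t. Kf ?s ?f (?X t))"
     by (intro hk_diff cont_integrable c1 cont_subset[OF Kc]) auto
    have "itg (?T n) (%t. ?f (?X (t + ?s))) = integral {?s..?s + ?T n} (%t. ?f (?X t))"
     using integral_shift[of 0 ?s "?T n" "%t. ?f (?X t)"] cont_subset[OF fc, of "{?s..?s + ?T n}"] s0 by (simp add: o_def add.commute)
    moreover have "itg ?s (%t. ?f (?X t)) + integral {?s..?s + ?T n} (%t. ?f (?X t)) = itg (?s + ?T n) (%t. ?f (?X t))"
     by (rule hk_combine) (use s0 Tn ii in auto)
    moreover have "itg (?T n) (%t. ?f (?X t)) + integral {?T n..?T n + ?s} (%t. ?f (?X t)) = itg (?T n + ?s) (%t. ?f (?X t))"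
     by (rule hk_combine) (use s0 Tn ii in auto)
    ultimately have "itg (?T n) (%t. ?f (?X (t + ?s))) = integral {?T n..?T n + ?s} (%t. ?f (?X t)) - itg (0 + ?s) (%t. ?f (?X t)) + itg (?T n) (%t. ?f (?X t))"
     by (simp add: add.commute)
    then show ?thesis unfolding i1 by (simp add: diff_divide_distrib add_divide_distrib)
   qed
   have "(%n. 2 * ?s * (1 / ?T n)) ----> 2 * ?s * 0"
    by (intro tendsto_mult tendsto_const tendsto_divide_0[OF tendsto_const] filterlim_at_top_imp_at_infinity Tr)
   then have z: "(%n. 2 * ?s * (1 / ?T n)) ----> 0" by simp
   have "(%n. (integral {?T n..?T n + ?s} (%t. ?f (?X t)) - itg (0 + ?s) (%t. ?f (?X t))) / ?T n) ----> 0"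
   proof (rule Lim_null_comparison[OF always_eventually z], intro allI)
    fix n
    have Tn: "0 < ?T n" by (rule T0)
    have g: "norm (u / t) <= b * (1 / t)" if "abs u <= b" "0 < t" for u b t :: real using that by (simp add: divide_right_mono)
    have "abs (integral {?T n..?T n + ?s} (%t. ?f (?X t)) - itg (0 + ?s) (%t. ?f (?X t))) <= 2 * ?s"
     using ib[of "?T n"] ib[of 0] Tn by linarith
    then show "norm ((integral {?T n..?T n + ?s} (%t. ?f (?X t)) - itg (0 + ?s) (%t. ?f (?X t))) / ?T n) <= 2 * ?s * (1 / ?T n)"
     by (rule g[OF _ Tn])
   qed
   from tendsto_diff[OF tendsto_add[OF this conv[OF gp(1)[of i]]] conv[OF projective_Kf[OF gp(1)[of i] gp(2)[of i] s0]]]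
   have "(%n. itg (?T n) (%t. ?f (?X (t + ?s)) - Kf ?s ?f (?X t)) / ?T n) ----> 0 + (LINT z|m. clip ?f z) - (LINT z|m. clip (Kf ?s ?f) z)"
    unfolding split .
   moreover have "(%n. itg (?T n) (%t. ?f (?X (t + ?s)) - Kf ?s ?f (?X t)) / ?T n) ----> 0"
    by (rule filterlim_compose[OF elim(1)[rule_format] Tr])
   ultimately have "0 + (LINT z|m. clip ?f z) - (LINT z|m. clip (Kf ?s ?f) z) = 0" by (rule LIMSEQ_unique)
   then show ?thesis by simp
  qed
  have pm: "cyl_proj : m \<rightarrow>\<^sub>M borel" using measurable_cyl_proj m(2) by (simp cong: measurable_cong_sets)
  have numu: "distr m borel cyl_proj = mu" by (rule uniq) (auto intro!: m.prob_space_distr[OF pm] invariant_projection[OF K G m on _ inv])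
  have "(LINT p|mu. f (cyl_embed p)) = (LINT p|mu. clip f (cyl_embed p))" by (simp add: clip_def cyl_embed_def)
  also have "... = (LINT z|m. clip f (cyl_embed (cyl_proj z)))" unfolding numu[symmetric]
   by (rule integral_distr[OF pm meas_comp[OF measurable_cyl_embed cont_bmeas[OF clip_continuous(1)[OF f]]]])
  also have "... = (LINT z|m. clip f z)"
  proof (rule integral_cong_AE)
   have cm: "clip f : bmeas borel" by (rule cont_bmeas[OF clip_continuous(1)[OF f]])
   show "(%z. clip f (cyl_embed (cyl_proj z))) : bmeas m" by (rule meas_comp[OF meas_comp[OF pm measurable_cyl_embed] cm])
   show "clip f : bmeas m" using cm m(2) by (simp cong: measurable_cong_sets)
   show "AE z in m. clip f (cyl_embed (cyl_proj z)) = clip f z"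
   proof (rule eventually_mono[OF on])
    fix z :: "(real^'d) * complex" assume n: "norm (snd z) = 1"
    then have z: "snd z ~= 0" by auto
    show "clip f (cyl_embed (cyl_proj z)) = clip f z" unfolding cyl_embed_cyl_proj[OF z] projective_pol(2)[OF f z] by (simp add: clip_def n)
   qed
  qed
  finally show "EX r. strict_mono (r :: nat => nat) & (%n. itg (T (r n)) (%t. f (?X t)) / T (r n)) ----> (LINT p|mu. f (cyl_embed p))"
   using conv[OF f] r by auto
 qed
 with elim(2) show ?case by blast
qed
qed


text \<open>Truncation at height \<open>n\<close> changes \<open>q\<close> by at most
  \<open>q^2 / n\<close>, and \<open>q^2\<close> is bounded by a multiple of
  \<open>1 + |v|^2\<close>, whose time averages are bounded. So the error is uniform in the time.
  The same averages and Fatou give integrability under \<open>mu\<close>.\<close>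

theorem time_average_linear_growth:
fixes q :: "(real^'d) * complex => real"
assumes q: "!!y. snd y ~= 0 ==> isCont q y" "!!v r z. 0 < r ==> q (v, r *\<^sub>R z) = q (v, z)"
 and gr: "!!y. snd y ~= 0 ==> abs (q y) <= c * (1 + norm (fst y))" and c: "0 <= c"
shows "integrable mu (%p. q (cyl_embed p))"
 "AE om in P. ((%T. itg T (%t. q (Phi 0 x t om)) / T) ---> (LINT p|mu. q (cyl_embed p))) at_top"
proof -
interpret mu: prob_space mu by (rule mu(1))
let ?e = "%p. q (cyl_embed p)"
let ?n = "%t om. norm (fst (Phi 0 x t om))"
have "continuous_on {y. snd y ~= 0} q" using q(1) by (intro continuous_at_imp_continuous_on) blast
then have "continuous_on UNIV ?e" by (rule cont_compose[OF _ continuous_cyl_embed]) (auto simp: cyl_embed_def)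
then have em: "?e : bmeas mu" using cont_bmeas[of ?e] mu(2) by (simp cong: measurable_cong_sets)
define tr where "tr n y = max (- real n) (min (real n) (q y))" for n y
have trp: "projective (tr n)" "projective (%y. abs (tr n y))" for n
proof -
 have b: "abs (tr n y) <= real n" for y by (simp add: tr_def)
 have cc: "isCont (tr n) y" if "snd y ~= 0" for y unfolding tr_def by (intro continuous_intros q(1)[OF that])
 have h: "tr n (v, r *\<^sub>R z) = tr n (v, z)" if "0 < r" for v r z using q(2)[OF that] by (simp add: tr_def)
 show "projective (tr n)" unfolding projective_def using b cc h by blast
 show "projective (%y. abs (tr n y))" unfolding projective_def
 proof (intro conjI allI impI)
  show "EX C. ALL x. abs (abs (tr n x)) <= C" using b by (intro exI[of _ "real n"]) simp
  show "isCont (%y. abs (tr n y)) y" if "snd y ~= 0" for y by (intro continuous_intros cc[OF that])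
  show "abs (tr n (v, r *\<^sub>R z)) = abs (tr n (v, z))" if "0 < r" for v r z using h[OF that] by simp
 qed
qed
have path: "((%t. (?n t om)^2) integrable_on {0..T})" "(%t. q (Phi 0 x t om)) integrable_on {0..T}"
 "(%t. tr n (Phi 0 x t om)) integrable_on {0..T}" "(%t. abs (tr n (Phi 0 x t om))) integrable_on {0..T}" if "om : space P" for om n T
proof -
 have sub: "{0..T} <= {0..}" by auto
 have tc: "isCont (tr n) y" "isCont (%y. abs (tr n y)) y" if "snd y ~= 0" for y using trp that unfolding projective_def by blast+
 show "(%t. (?n t om)^2) integrable_on {0..T}" by (intro cont_integrable continuous_intros cont_subset[OF Phi_path(3)[OF that] sub])
 show "(%t. q (Phi 0 x t om)) integrable_on {0..T}" "(%t. tr n (Phi 0 x t om)) integrable_on {0..T}" "(%t. abs (tr n (Phi 0 x t om))) integrable_on {0..T}"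
  by (rule cont_integrable[OF cont_subset[OF projective_path_continuous[OF _ that] sub]], rule q(1) tc, assumption)+
qed
have avg: "itg T g / T <= alpha + beta * C"
 if om: "om : space P" and T: "1 <= T" and gi: "g integrable_on {0..T}" and beta: "0 <= beta"
  and le: "!!t. t : {0..T} ==> g t <= alpha + beta * (?n t om)^2"
  and C: "itg T (%t. (?n t om)^2) <= C * T" for om g alpha beta C and T :: real
proof -
 have "((%t. alpha + beta * (?n t om)^2) has_integral (T * alpha + beta * itg T (%t. (?n t om)^2))) {0..T}"
  using has_integral_const_real[of alpha 0 T] T by (intro has_integral_add has_integral_mult_right integrable_integral path(1)[OF om]) simp
 from has_integral_le[OF integrable_integral[OF gi] this le] have "itg T g <= T * alpha + beta * (C * T)"
  using mult_left_mono[OF C beta] by linarith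
 then have "itg T g / T <= (T * alpha + beta * (C * T)) / T" using T by (intro divide_right_mono) auto
 then show ?thesis using T by (simp add: add_divide_distrib)
qed
\<comment> \<open>The limits are deterministic, so a single good path suffices to bound integrals
  under \<open>mu\<close>.\<close>
have good: "EX om:space P. (EX C. ALL T>=1. itg T (%t. (?n t om)^2) <= C * T) &
  (ALL f. projective f --> ((%T. itg T (%t. f (Phi 0 x t om)) / T) ---> (LINT p|mu. f (cyl_embed p))) at_top)"
proof (rule ccontr)
 assume n: "~ ?thesis"
 have "AE om in P. False" using time_average AE_space by eventually_elim (use n in blast)
 then show False by simp
qed
show ei: "integrable mu ?e"
proof -
 obtain om C where om: "om : space P" and C: "!!T. 1 <= T ==> itg T (%t. (?n t om)^2) <= C * T"
  and lim: "!!f. projective f ==> ((%T. itg T (%t. f (Phi 0 x t om)) / T) ---> (LINT p|mu. f (cyl_embed p))) at_top" using good by blast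
 have nz: "snd (Phi 0 x t om) ~= 0" if "0 <= t" for t by (rule Phi_nonzero[OF om order_refl that x])
 have tm: "(%p. abs (tr n (cyl_embed p))) : bmeas mu" for n
  unfolding tr_def by (intro borel_measurable_abs borel_measurable_max borel_measurable_min bmeas_const em)
 have "integrable mu (%p. abs (?e p))"
 proof (rule mu.fatou_AE(1)[where X = "%n p. abs (tr n (cyl_embed p))" and c = "%_. 2 * c + c * C", OF tm _ _ _ _ _ tendsto_const])
  show "(%p. abs (?e p)) : bmeas mu" by (rule borel_measurable_abs[OF em])
  show "integrable mu (%p. abs (tr n (cyl_embed p)))" for n by (rule mu.integrable_const_bound[of _ "real n", OF _ tm]) (simp add: tr_def)
  show "AE p in mu. (%n. abs (tr n (cyl_embed p))) ----> abs (?e p)"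
  proof (rule AE_I2)
   fix p
   obtain N :: nat where "abs (?e p) <= real N" using real_arch_simple by blast
   then have "EVN n. abs (tr n (cyl_embed p)) = abs (?e p)" unfolding eventually_sequentially tr_def by (intro exI[of _ N]) auto
   then show "(%n. abs (tr n (cyl_embed p))) ----> abs (?e p)" by (rule tendsto_eventually)
  qed
  show "(LINT p|mu. abs (tr n (cyl_embed p))) <= 2 * c + c * C" for n
  proof (rule tendsto_upperbound[OF lim[OF trp(2)] eventually_mono[OF eventually_ge_at_top[of 1]]])
   fix T :: real assume T: "1 <= T"
   show "itg T (%t. abs (tr n (Phi 0 x t om))) / T <= 2 * c + c * C"
   proof (rule avg[OF om T path(4)[OF om] c _ C[OF T]])
    fix t assume "t : {0..T}"
    then have z: "snd (Phi 0 x t om) ~= 0" using nz by simp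
    let ?v = "?n t om"
    have "2 * ?v <= ?v^2 + 1" using zero_le_power2[of "?v - 1"] by (simp add: power2_diff)
    then have "1 + ?v <= 2 + ?v^2" using norm_ge_zero[of "fst (Phi 0 x t om)"] by linarith
    from mult_left_mono[OF this c] have "c * (1 + ?v) <= 2 * c + c * ?v^2" by (simp add: distrib_left)
    moreover have "abs (tr n (Phi 0 x t om)) <= abs (q (Phi 0 x t om))" by (auto simp: tr_def)
    ultimately show "abs (tr n (Phi 0 x t om)) <= 2 * c + c * ?v^2" using gr[OF z] by linarith
   qed
  qed simp
 qed simp
 then show ?thesis using em by (simp add: integrable_abs_iff)
qed
let ?L = "\<integral>p. ?e p \<partial>mu"
have Ln: "(%n. \<integral>p. tr n (cyl_embed p) \<partial>mu) ----> ?L"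
proof (rule dominated_conv[where w = "%p. abs (?e p)"])
 show "(%p. tr n (cyl_embed p)) : bmeas mu" for n unfolding tr_def by (intro borel_measurable_max borel_measurable_min bmeas_const em)
 show "AE p in mu. (%n. tr n (cyl_embed p)) ----> ?e p"
 proof (rule AE_I2)
  fix p
  obtain N :: nat where "abs (?e p) <= real N" using real_arch_simple by blast
  then have "EVN n. tr n (cyl_embed p) = ?e p" unfolding eventually_sequentially tr_def by (intro exI[of _ N]) auto
  then show "(%n. tr n (cyl_embed p)) ----> ?e p" by (rule tendsto_eventually)
 qed
 show "AE p in mu. norm (tr n (cyl_embed p)) <= abs (?e p)" for n by (rule AE_I2) (auto simp: tr_def)
qed (use em ei in auto)
show "AE om in P. ((%T. itg T (%t. q (Phi 0 x t om)) / T) ---> ?L) at_top" using time_average AE_space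
proof eventually_elim
 case (elim om)
 obtain C where C: "!!T. 1 <= T ==> itg T (%t. (?n t om)^2) <= C * T" using elim(1) by blast
 have lim: "((%T. itg T (%t. tr n (Phi 0 x t om)) / T) ---> (LINT p|mu. tr n (cyl_embed p))) at_top" for n using elim(1) trp(1) by blast
 have nz: "snd (Phi 0 x t om) ~= 0" if "0 <= t" for t by (rule Phi_nonzero[OF elim(2) order_refl that x])
 define B where "B = abs (2 * c^2 + 2 * c^2 * C) + 1"
 have close: "abs (itg T (%t. q (Phi 0 x t om)) / T - itg T (%t. tr n (Phi 0 x t om)) / T) <= B / real n"
  if T: "1 <= T" and n: "0 < n" for T and n :: nat
 proof -
  have pw: "abs (q (Phi 0 x t om) - tr n (Phi 0 x t om)) <= 2 * c^2 / real n + 2 * c^2 / real n * (?n t om)^2" if t: "t : {0..T}" for t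
  proof -
   have z: "snd (Phi 0 x t om) ~= 0" using nz t by simp
   let ?v = "?n t om" and ?u = "q (Phi 0 x t om)"
   have "abs (?u - tr n (Phi 0 x t om)) * real n <= ?u^2"
   proof (cases "abs ?u <= real n")
    case True
    then have "tr n (Phi 0 x t om) = ?u" by (simp add: tr_def)
    then show ?thesis by simp
   next
    case False
    have "abs (?u - tr n (Phi 0 x t om)) <= abs ?u" by (auto simp: tr_def)
    then have "abs (?u - tr n (Phi 0 x t om)) * real n <= abs ?u * abs ?u" using False by (intro mult_mono) auto
    then show ?thesis by (simp add: power2_eq)
   qed
   also have "?u^2 <= (c * (1 + ?v))^2" by (rule square_mono_abs[OF gr[OF z]])
   also have "... <= 2 * c^2 + 2 * c^2 * ?v^2"
   proof -
    have "(1 + ?v)^2 <= 2 + 2 * ?v^2" using sum_squares_bound[of 1 ?v] by (simp add: power2_sum)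
    from mult_left_mono[OF this, of "c^2"] show ?thesis unfolding power_mult_distrib by (simp add: distrib_left)
   qed
   finally have "abs (?u - tr n (Phi 0 x t om)) <= (2 * c^2 + 2 * c^2 * ?v^2) / real n" using n by (simp add: pos_le_divide_eq)
   then show ?thesis by (simp add: add_divide_distrib)
  qed
  have k: "2 * c^2 / real n + 2 * c^2 / real n * C <= B / real n"
  proof -
   have "(2 * c^2 + 2 * c^2 * C) / real n <= B / real n" unfolding B_def by (rule divide_right_mono) auto
   then show ?thesis by (simp add: add_divide_distrib)
  qed
  have beta: "0 <= 2 * c^2 / real n" by simp
  let ?d = "%t. q (Phi 0 x t om) - tr n (Phi 0 x t om)"
  have di: "?d integrable_on {0..T}" by (rule integrable_diff[OF path(2)[OF elim(2)] path(3)[OF elim(2)]])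
  have d2: "(%t. - ?d t) integrable_on {0..T}" by (rule integrable_neg[OF di])
  have "itg T ?d / T <= B / real n" by (rule order_trans[OF avg[OF elim(2) T di beta order_trans[OF abs_ge_self pw] C[OF T]] k])
  moreover have "itg T (%t. - ?d t) / T <= B / real n"
   by (rule order_trans[OF avg[OF elim(2) T d2 beta order_trans[OF abs_ge_minus_self pw] C[OF T]] k])
  moreover have "itg T ?d = itg T (%t. q (Phi 0 x t om)) - itg T (%t. tr n (Phi 0 x t om))"
   by (rule hk_diff[OF path(2)[OF elim(2)] path(3)[OF elim(2)]])
  ultimately show ?thesis unfolding Henstock_Kurzweil_Integration.integral_neg by (simp add: diff_divide_distrib abs_le_iff)
 qed
 show ?case unfolding tendsto_iff
 proof (intro allI impI)
  fix e :: real assume e: "0 < e"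
  then have e3: "0 < e / 3" by simp
  have "(%n. B / real n) ----> 0" by (rule lim_const_over_n)
  from eventually_conj[OF eventually_conj[OF order_tendstoD(2)[OF this e3] tendstoD[OF Ln e3]] eventually_gt_at_top[of 0]]
  obtain n where n: "B / real n < e / 3" "dist (LINT p|mu. tr n (cyl_embed p)) ?L < e / 3" "0 < n" by (auto simp: eventually_sequentially)
  from eventually_conj[OF tendstoD[OF lim[of n] e3] eventually_ge_at_top[of 1]]
  show "\<forall>\<^sub>F T in at_top. dist (itg T (%t. q (Phi 0 x t om)) / T) ?L < e"
  proof (rule eventually_mono)
   fix T assume T: "dist (itg T (%t. tr n (Phi 0 x t om)) / T) (LINT p|mu. tr n (cyl_embed p)) < e / 3 & 1 <= T"
   then show "dist (itg T (%t. q (Phi 0 x t om)) / T) ?L < e" using n(1,2) close[of T n] n(3) unfolding dist_real_def by linarith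
  qed
 qed
qed
qed

end

end


section \<open>The growth rate\<close>

text \<open>Summation by parts moves the increments onto \<open>p\<close>, which is continuously
  differentiable; the left-point sums then converge for any continuous \<open>w\<close>.\<close>

lemma riemann_sum_by_parts:
fixes w u p :: "real => real"
assumes w: "cont0 w" and u: "cont0 u"
 and p: "!!t. 0 <= t ==> p t = p 0 + itg t u" and T: "0 < T"
shows "(%n. SUM i<n. p (grid T n i) * (w (grid T n (Suc i)) - w (grid T n i)))
 ----> p T * w T - p 0 * w 0 - itg T (%s. w s * u s)"
proof -
have T0: "0 <= T" using T by simp
have sub: "{0..T} <= {0..}" by auto
obtain e where e: "e ----> 0" and em: "!!n i r r'. i < n ==> r : cell T n i ==>
  r' : cell T n i ==> dist (w r) (w r') <= e n" using grid_modulus[OF cont_subset[OF w sub] T0] by metis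
have "bounded (u ` {0..T})" by (intro compact_imp_bounded compact_continuous_image cont_subset[OF u sub]) simp
then obtain C where "ALL y:u ` {0..T}. norm y <= C" unfolding bounded_iff by blast
then have C: "abs (u s) <= C" if "s : {0..T}" for s using that by simp
let ?S = "%n. SUM i<n. integral (cell T n i) (%s. w (grid T n (Suc i)) * u s)"
have inG: "(cell T n i) <= {0..T}" if "i < n" for n i using that grid_nonneg[OF T0, of n i] grid_le[OF T0, of "Suc i" n] by auto
have ui: "u integrable_on (cell T n i)" if "i < n" for n i by (intro cont_integrable cont_subset[OF u] order_trans[OF inG[OF that] sub])
have le: "norm (?S n - itg T (%s. w s * u s)) <= e n * C * T" if n: "0 < n" for n
proof (rule sum_integral_close[OF cont_subset[OF continuous_on_mult[OF w u] sub] T0 n])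
 fix i assume i: "i < n"
 show "(%s. w (grid T n (Suc i)) * u s) integrable_on (cell T n i)" by (rule integrable_on_mult_right[OF ui[OF i]])
 fix r assume r: "r : cell T n i"
 have "grid T n (Suc i) : cell T n i" using grid_mono[OF T0, of i "Suc i" n] by simp
 from em[OF i this r] have d: "abs (w (grid T n (Suc i)) - w r) <= e n" by (simp add: dist_real_def)
 have "abs (w (grid T n (Suc i)) - w r) * abs (u r) <= e n * C"
  using inG[OF i] r by (intro mult_mono d C order_trans[OF abs_ge_zero d]) auto
 then show "norm (w (grid T n (Suc i)) * u r - w r * u r) <= e n * C" by (simp add: abs_mult[symmetric] left_diff_distrib)
qed
have eq: "(SUM i<n. p (grid T n i) * (w (grid T n (Suc i)) - w (grid T n i))) = p T * w T - p 0 * w 0 - ?S n" if n: "0 < n" for n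
proof -
 let ?g = "grid T n"
 have pd: "p (?g (Suc i)) - p (?g i) = integral {?g i..?g (Suc i)} u" if i: "i < n" for i
 proof -
  have "itg (?g i) u + integral {?g i..?g (Suc i)} u = itg (?g (Suc i)) u" using grid_nonneg[OF T0, of n i] grid_mono[OF T0, of i "Suc i" n]
   by (intro hk_combine cont_integrable cont_subset[OF u]) auto
  then show ?thesis using p[OF grid_nonneg[OF T0]] by simp
 qed
 have "(SUM i<n. p (?g i) * (w (?g (Suc i)) - w (?g i)))
  = (SUM i<n. (p (?g (Suc i)) * w (?g (Suc i)) - p (?g i) * w (?g i)) - w (?g (Suc i)) * (p (?g (Suc i)) - p (?g i)))"
  by (rule sum.cong) (simp_all add: algebra_simps)
 also have "... = (p (?g n) * w (?g n) - p (?g 0) * w (?g 0)) - (SUM i<n. w (?g (Suc i)) * (p (?g (Suc i)) - p (?g i)))"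
  unfolding sum_lessThan_telescope[of "%i. p (?g i) * w (?g i)", symmetric] by (rule sum_subtractf)
 also have "(SUM i<n. w (?g (Suc i)) * (p (?g (Suc i)) - p (?g i))) = ?S n" by (rule sum.cong) (simp_all add: pd)
 finally show ?thesis using n by (simp add: grid_n)
qed
have "(%n. ?S n - itg T (%s. w s * u s)) ----> 0"
proof (rule Lim_null_comparison)
 show "EVN n. norm (?S n - itg T (%s. w s * u s)) <= e n * C * T" using eventually_gt_at_top[of 0] by eventually_elim (rule le)
 show "(%n. e n * C * T) ----> 0" using tendsto_mult_right[OF tendsto_mult_right[OF e, of C], of T] by simp
qed
then have "(%n. p T * w T - p 0 * w 0 - ?S n) ----> p T * w T - p 0 * w 0 - itg T (%s. w s * u s)"
 by (intro tendsto_diff tendsto_const) (simp add: LIM_zero_iff)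
then show ?thesis by (rule Lim_transform_eventually) (use eventually_gt_at_top[of 0] in eventually_elim, simp only: eq)
qed

context osc_bm
begin

text \<open>As \<open>\<phi>\<close> is differentiable, the limit in probability of its left-point
  sums is also a pathwise limit, by summation by parts. Almost every path thus satisfies the
  equation of the flow, and uniqueness is a statement about a single path.\<close>

theorem oscillator_eq_flow:
assumes X: "oscillator_solution P F W A B a gamma kappa zeta X" and X0: "AE om in P. X 0 om = (v\<^sub>0, p\<^sub>0, u\<^sub>0)"
shows "AE om in P. ALL t>=0. Complex (fst (snd (X t om))) (snd (snd (X t om))) = snd (Phi 0 (v\<^sub>0, Complex p\<^sub>0 u\<^sub>0) t om)"
proof -
let ?x = "(v\<^sub>0, Complex p\<^sub>0 u\<^sub>0)"
let ?p = "%t om. fst (snd (X t om))" and ?u = "%t om. snd (snd (X t om))"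
let ?c = "%y :: (real^'d) \<times> real \<times> real. - 2 * zeta * snd (snd y) - (kappa^2 - a *. fst y) * fst (snd y)"
define b where "b y = (A *v fst y, snd (snd y), ?c y)" for y
define \<sigma> where "\<sigma> l y = (column l B, 0 :: real, gamma $ l * fst (snd y))" for l and y :: "(real^'d) \<times> real \<times> real"
let ?Y = "%T om. X T om - X 0 om - itg T (%s. b (X s om))"
have beq: "b = (%(v, phi, phi'). (A *v v, phi', - 2 * zeta * phi' - (kappa^2 - a *. v) * phi))" by (simp add: b_def fun_eq_iff)
have seq: "\<sigma> = (%l (v, phi, phi'). (column l B, 0, gamma $ l * phi))" by (simp add: \<sigma>_def fun_eq_iff)
have S: "sde_solution P F W b \<sigma> X" using X unfolding oscillator_solution_def beq seq .
have co: "cont0 (%t. X t om)" if "om : space P" for om using S that by (auto simp: sde_solution_def adapted_continuous_def)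
have bc: "continuous_on UNIV b" unfolding b_def by (intro continuous_on_Pair continuous_on_mat continuous_intros)
have pc: "cont0 (%t. ?p t om)" and uc: "cont0 (%t. ?u t om)" if "om : space P" for om
 by (intro continuous_on_fst continuous_on_snd co that)+
have cc: "cont0 (%t. ?c (X t om))" if "om : space P" for om by (intro continuous_intros co that)
have bi: "(0, 1, 0) *. itg T (%s. b (X s om)) = itg T (%s. ?u s om)"
 "(0, 0, 1) *. itg T (%s. b (X s om)) = itg T (%s. ?c (X s om))" if om: "om : space P" for T om
proof -
 have i: "(%s. b (X s om)) integrable_on {0..T}" by (intro cont_integrable cont_compose[OF bc cont_subset[OF co[OF om]]]) auto
 show "(0, 1, 0) *. itg T (%s. b (X s om)) = itg T (%s. ?u s om)"
  "(0, 0, 1) *. itg T (%s. b (X s om)) = itg T (%s. ?c (X s om))"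
  using integral_linear[OF i bounded_linear_inner_right[of "(0, 1, 0)"]] integral_linear[OF i bounded_linear_inner_right[of "(0, 0, 1)"]]
  by (simp_all add: o_def b_def inner_prod_def)
qed
have "AE om in P. ?p T om = ?p 0 om + itg T (%s. ?u s om)" if T: "0 < T" for T
proof -
 have "in_prob (%n. RS 0 (%t om. (%_. 1) (X t om)) T n n) (%om. (0, 1, 0) *. ?Y T om)"
  by (rule sde_component[OF S bc _ T]) (simp_all add: norm_Pair inner_prod_def \<sigma>_def)
 from RS_constant_limit[OF this] T
 have "AE om in P. (0, 1, 0) *. ?Y T om = 0" by simp
 with AE_space show ?thesis
 proof eventually_elim
  case (elim om)
  then show ?case unfolding inner_diff_right bi(1)[OF elim(1)] by (simp add: inner_prod_def)
 qed
qed
then have P: "AE om in P. ALL t>=0. ?p t om = ?p 0 om + itg t (%s. ?u s om)"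
proof (rule AE_all_times)
 show "cont0 (%t. ?p 0 om + itg t (%s. ?u s om))" if "om : space P" for om
  by (intro continuous_on_add continuous_on_const continuous_on_indefinite_integral uc that)
qed (simp, rule pc)
let ?w = "%om. driver (%t. W t om)"
let ?R = "%t om. ?u 0 om + itg t (%s. ?c (X s om)) + ?p t om * ?w om t - itg t (%s. ?w om s * ?u s om)"
have wc: "cont0 (?w om)" if "om : space P" for om by (rule continuous_on_driver[OF W_continuous[OF that]])
have "AE om in P. ?u T om = ?R T om" if T: "0 < T" for T
proof -
 have R: "in_prob (%n. RS gamma (%t om. ?p t om) T n n) (%om. (0, 0, 1) *. ?Y T om)"
  by (rule sde_component[OF S bc _ T, where H = "%y. fst (snd y)"]) (simp_all add: norm_Pair inner_prod_def \<sigma>_def)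
 obtain r :: "nat => nat" where r: "strict_mono r" and lim: "AE om in P. (%n. RS gamma (%t om. ?p t om) T (r n) (r n) om)
   ----> (0, 0, 1) *. ?Y T om" using in_prob_AE_subseq[OF R] .
 from lim P AE_space show ?thesis
 proof eventually_elim
  case (elim om)
  have "(%n. RS gamma (%t om. ?p t om) T n n om) ----> ?p T om * ?w om T - ?p 0 om * ?w om 0 - itg T (%s. ?w om s * ?u s om)"
   using riemann_sum_by_parts[OF wc[OF elim(3)] uc[OF elim(3)] elim(2)[rule_format] T]
   by (simp add: RS_def inc_def driver_def inner_diff_right)
  from LIMSEQ_unique[OF LIMSEQ_subseq_LIMSEQ[OF this r, unfolded o_def] elim(1)]
  have "?p T om * ?w om T - ?p 0 om * ?w om 0 - itg T (%s. ?w om s * ?u s om)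
   = ?u T om - ?u 0 om - itg T (%s. ?c (X s om))" unfolding inner_diff_right bi(2)[OF elim(3)] by (simp add: inner_prod_def)
  moreover have "?w om 0 = 0" by (simp add: driver_def)
  ultimately show ?case by simp
 qed
qed
then have U: "AE om in P. ALL t>=0. ?u t om = ?R t om"
proof (rule AE_all_times)
 show "cont0 (%t. ?R t om)" if "om : space P" for om
  by (intro continuous_on_add continuous_on_diff continuous_on_mult continuous_on_const continuous_on_indefinite_integral uc pc wc cc that)
qed (simp, rule uc)
have fb: "fst (b y) = A *v fst y" "fst (\<sigma> l y) = column l B" for l y by (simp_all add: b_def \<sigma>_def)
have fx: "AE om in P. fst (X 0 om) = fst ?x" using X0 by eventually_elim simp
from P U sde_linear_part[OF S bc fb fx] X0 AE_space show ?thesis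
proof eventually_elim
 case (elim om)
 let ?z = "%t. Complex (?p t om) (?u t om)" and ?v = "%t. fst (Phi 0 ?x t om)"
 note path = Phi_path[OF elim(5), of ?x]
 have zc: "cont0 ?z" unfolding Complex_eq by (intro continuous_intros uc pc elim(5))
 have vc: "cont0 ?v" by (intro continuous_on_fst path(3))
 have "shear (- ?w om t) (?z t) = ?z 0 + itg t (%s. rde_drift (?w om s) (?v s) (?z s))" if t: "0 <= t" for t
 proof -
  have sub: "{0..t} <= {0..}" by auto
  let ?r = "%s. rde_drift (?w om s) (?v s) (?z s)"
  have i: "?r integrable_on {0..t}" by (intro cont_integrable continuous_on_rde_drift cont_subset[OF _ sub] wc elim(5) vc zc)
  have ci: "(%s. ?c (X s om)) integrable_on {0..t}" "(%s. ?w om s * ?u s om) integrable_on {0..t}"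
   by (intro cont_integrable cont_subset[OF _ sub] continuous_on_mult wc uc cc elim(5))+
  have "Re (itg t ?r) = itg t (%s. ?u s om)" using integral_linear[OF i bounded_linear_Re] by (simp add: o_def rde_drift_def)
  moreover have "Im (itg t ?r) = itg t (%s. ?c (X s om) - ?w om s * ?u s om)"
  proof -
   have "Im (itg t ?r) = itg t (%s. Im (?r s))" using integral_linear[OF i bounded_linear_Im] by (simp add: o_def)
   also have "... = itg t (%s. ?c (X s om) - ?w om s * ?u s om)" using elim(3) by (intro integral_cong) (simp add: rde_drift_def)
   finally show ?thesis .
  qed
  moreover have "itg t (%s. ?c (X s om) - ?w om s * ?u s om) = itg t (%s. ?c (X s om)) - itg t (%s. ?w om s * ?u s om)"
   by (rule hk_diff[OF ci])
  moreover have "?p t om = ?p 0 om + itg t (%s. ?u s om)" "?u t om = ?R t om" using elim(1,2) t by blast+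
  ultimately show ?thesis by (simp add: complex_eq_iff shear_def mult.commute)
 qed
 then have 1: "osc_path (%t. W t om) ?v ?z" using path(1) vc zc unfolding osc_path_def by blast
 have 0: "?v 0 = fst (Phi 0 ?x 0 om)" "?z 0 = snd (Phi 0 ?x 0 om)" using elim(4) path(2) by simp_all
 show ?case
 proof (intro allI impI)
  fix t :: real assume t: "0 <= t"
  show "?z t = snd (Phi 0 ?x t om)" by (rule osc_path_unique(2)[OF path(1) 1 W_continuous[OF elim(5)] 0 t])
 qed
qed
qed

context
fixes x :: "(real^'d) * complex"
assumes x: "snd x ~= 0"
begin

text \<open>The martingale part of \<open>log |z|\<close>; the inner product with 1 is the real
  part, in the form delivered by \<open>ito_log\<close>.\<close>

definition growth_noise :: "real => 'w => real" where
"growth_noise t om = 1 *. (lg x t om - lg x 0 om - itg t (%s. Lam (Phi 0 x s om)))"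

abbreviation Hn :: "real => 'w => real" where
"Hn t om \<equiv> 1 *. noise_coeff (snd (Phi 0 x t om))"

lemma Hn: "adapted Hn" "abs (Hn t om) <= 1"
proof -
show "adapted Hn" unfolding adapted_def by (intro allI impI bmeas_inner bmeas_const adaptedD[OF noise_adapted[OF x]])
show "abs (Hn t om) <= 1" using order_trans[OF abs_Re_le_cmod norm_noise_coeff] by simp
qed

lemma growth_noise_RS: "0 < T ==> in_prob (%n. RS gamma Hn T n n) (growth_noise T)"
using ito_log[OF x, of 1 T] by (simp add: growth_noise_def[abs_def])

lemma growth_noise_0: "growth_noise 0 om = 0"
by (simp add: growth_noise_def)

lemma growth_noise_measurable:
assumes t: "0 <= t"
shows "growth_noise t : bmeas P"
proof (cases "t = 0")
case True
then show ?thesis using growth_noise_0 by (simp cong: measurable_cong)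
next
case False
then show ?thesis using in_prob_measurable(2)[OF growth_noise_RS] t by simp
qed

lemma growth_noise_continuous:
assumes om: "om : space P"
shows "cont0 (%t. growth_noise t om)"
unfolding growth_noise_def
by (intro continuous_on_inner continuous_on_const continuous_on_diff lg(1)[OF x om] continuous_on_indefinite_integral Lam_continuous[OF x om])

text \<open>The inequality is inherited from Riemann sums on refinements with
  \<open>Suc n * K\<close> cells, which contain the coarse grid points. Half of the level
  \<open>e\<close> is spent on the approximation, hence the factor 4.\<close>

lemma growth_noise_maximal_grid:
assumes T: "0 < T" and e: "0 < e" and K: "0 < K"
shows "prob {om : space P. EX k<=K. e < abs (growth_noise (grid T K k) om)} <= 4 * (norm gamma)^2 * T / e^2"
proof -
let ?M = growth_noise and ?R = "%n k. RS gamma Hn T (Suc n * K) (Suc n * k)"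
let ?E = "%n. {om : space P. EX k<=Suc n * K. e / 2 < abs (RS gamma Hn T (Suc n * K) k om)}"
let ?D = "%k n. {om : space P. e / 2 < abs (?R n k om - ?M (grid T K k) om)}"
let ?S = "{om : space P. EX k<=K. e < abs (?M (grid T K k) om)}"
have T0: "0 <= T" using T by simp
note [measurable] = RS_measurable[OF Hn(1) T0] growth_noise_measurable[OF grid_nonneg[OF T0]]
have D: "(%n. prob (?D k n)) ----> 0" if k: "k : {1..K}" for k
proof -
 have g: "0 < grid T K k" using k T K by (simp add: grid_def)
 have sm: "strict_mono (%n. Suc n * k)" using k by (auto intro!: strict_monoI mult_strict_right_mono)
 have ge: "grid (grid T K k) (Suc n * k) i = grid T (Suc n * K) i" for n i
 proof -
  have "T * K' / K'' * I / (N * K') = T * I / (N * K'')" if "K' ~= 0" for K' K'' I N :: real using that by (simp add: field_simps)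
  then show ?thesis unfolding grid_def of_nat_mult using k by simp
 qed
 have "(%n. RS gamma Hn (grid T K k) (Suc n * k) (Suc n * k)) = (%n. ?R n k)" unfolding RS_def ge ..
 with in_prob_subseq[OF growth_noise_RS[OF g] sm] have "in_prob (%n. ?R n k) (?M (grid T K k))" by simp
 then show ?thesis using half_gt_zero[OF e] unfolding in_prob_def by blast
qed
have le: "prob ?S <= 4 * (norm gamma)^2 * T / e^2 + (SUM k:{1..K}. prob (?D k n))" for n
proof -
 have "?S <= ?E n Un (UN k:{1..K}. ?D k n)"
 proof
  fix om assume "om : ?S"
  then obtain k where om: "om : space P" and k: "k <= K" "e < abs (?M (grid T K k) om)" by blast
  have "k ~= 0"
  proof
   assume "k = 0"
   then show False using k(2) e growth_noise_0[of om] by simp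
  qed
  then have k1: "k : {1..K}" using k(1) by simp
  have "e / 2 < abs (?R n k om) | e / 2 < abs (?R n k om - ?M (grid T K k) om)" using k(2) by linarith
  then show "om : ?E n Un (UN k:{1..K}. ?D k n)"
  proof
   assume "e / 2 < abs (?R n k om)"
   moreover have "Suc n * k <= Suc n * K" using k(1) by (rule mult_le_mono2)
   ultimately show ?thesis using om by blast
  next
   assume "e / 2 < abs (?R n k om - ?M (grid T K k) om)"
   then show ?thesis using om k1 by blast
  qed
 qed
 then have "prob ?S <= prob (?E n Un (UN k:{1..K}. ?D k n))" by (rule finite_measure_mono) measurable
 also have "... <= prob (?E n) + prob (UN k:{1..K}. ?D k n)" by (rule measure_Un_le) measurable
 also have "prob (UN k:{1..K}. ?D k n) <= (SUM k:{1..K}. prob (?D k n))" by (rule measure_UNION_le) (simp, measurable)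
 also have "prob (?E n) <= 4 * (norm gamma)^2 * T / e^2"
  using RS_maximal[OF Hn T, of "Suc n * K" "e / 2" gamma] e K by (simp add: power_divide field_simps del: mult_Suc)
 finally show ?thesis by simp
qed
have "(%n. 4 * (norm gamma)^2 * T / e^2 + (SUM k:{1..K}. prob (?D k n))) ----> 4 * (norm gamma)^2 * T / e^2 + (SUM k:{1..K}. 0)"
 by (intro tendsto_add tendsto_const tendsto_sum D)
then have "prob ?S <= 4 * (norm gamma)^2 * T / e^2 + (SUM k:{1..K}. 0)" by (rule LIMSEQ_le_const) (intro exI[of _ 0] allI impI le)
then show ?thesis by simp
qed

text \<open>Successive uniform grids are not nested, so the events \<open>E K\<close> need not be
  monotone; their lower limit is an increasing union and keeps the bound. By continuity, an
  exceedance at any time shows on all sufficiently fine grids and so belongs to it.\<close>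

lemma growth_noise_maximal:
assumes T: "0 < T" and e: "0 < e"
obtains L where "L : sets P" "prob L <= 4 * (norm gamma)^2 * T / e^2"
 "!!om t. om : space P - L ==> 0 <= t ==> t <= T ==> abs (growth_noise t om) <= e"
proof -
let ?M = growth_noise
have T0: "0 <= T" using T by simp
note [measurable] = growth_noise_measurable[OF grid_nonneg[OF T0]]
define E where "E K = {om : space P. EX k<=Suc K. e < abs (?M (grid T (Suc K) k) om)}" for K
define L where "L n = (INT K:{n..}. E K)" for n
have Em: "E K : sets P" for K unfolding E_def by measurable
have Lm: "L n : sets P" for n unfolding L_def by (intro sets.countable_INT') (use Em in auto)
have "incseq L" unfolding incseq_def L_def by (intro allI impI INF_superset_mono) auto
then have lim: "(%n. prob (L n)) ----> prob (\<Union>n. L n)" by (intro finite_Lim_measure_incseq) (use Lm in auto)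
have le: "prob (L n) <= 4 * (norm gamma)^2 * T / e^2" for n
proof -
 have "prob (L n) <= prob (E n)" by (rule finite_measure_mono) (use Em in "auto simp: L_def")
 also have "... <= 4 * (norm gamma)^2 * T / e^2" unfolding E_def by (rule growth_noise_maximal_grid[OF T e]) simp
 finally show ?thesis .
qed
show ?thesis
proof (rule that[of "\<Union>n. L n"])
 show "(\<Union>n. L n) \<in> sets P" using Lm by blast
 show "prob (\<Union>n. L n) <= 4 * (norm gamma)^2 * T / e^2" by (rule LIMSEQ_le_const2[OF lim]) (use le in blast)
 fix om t assume om: "om : space P - (\<Union>n. L n)" and t: "0 <= t" "t <= T"
 define k where "k K = nat \<lfloor>t * real (Suc K) / T\<rfloor>" for K
 let ?t = "%K. grid T (Suc K) (k K)"
 have kK: "k K <= Suc K" "abs (?t K - t) <= T / real (Suc K)" for K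
 proof -
  have r0: "0 <= t * real (Suc K) / T" using t T by simp
  have r1: "t * real (Suc K) / T <= real (Suc K)" using t T by (simp add: divide_le_eq mult.commute mult_right_mono)
  have kr: "real (k K) = of_int \<lfloor>t * real (Suc K) / T\<rfloor>" unfolding k_def using r0 by simp
  then have k: "real (k K) <= t * real (Suc K) / T" "t * real (Suc K) / T < real (k K) + 1" by linarith+
  then show "k K <= Suc K" using r1 by linarith
  have N: "0 < T / real (Suc K)" using T by simp
  have teq: "t * real (Suc K) / T * (T / real (Suc K)) = t" using T by (simp del: of_nat_Suc)
  have geq: "?t K = real (k K) * (T / real (Suc K))" by (simp add: grid_def mult.commute)
  have "real (k K) * (T / real (Suc K)) <= t" using mult_right_mono[OF k(1) less_imp_le[OF N]] unfolding teq .
  moreover have "t <= (real (k K) + 1) * (T / real (Suc K))" using mult_right_mono[OF less_imp_le[OF k(2)] less_imp_le[OF N]] unfolding teq .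
  ultimately have "?t K <= t" "t <= ?t K + T / real (Suc K)" unfolding geq distrib_right by simp_all
  then show "abs (?t K - t) <= T / real (Suc K)" using N by (intro abs_leI) simp_all
 qed
 show "abs (?M t om) <= e"
 proof (rule ccontr)
  assume "~ abs (?M t om) <= e"
  then have gt: "e < abs (?M t om)" by simp
  have "(%K. ?t K - t) ----> 0"
   by (rule Lim_null_comparison[OF always_eventually LIMSEQ_Suc[OF lim_const_over_n[of T]]]) (use kK(2) in simp)
  then have tl: "?t ----> t" by (simp add: LIM_zero_iff)
  have "(%K. ?M (?t K) om) ----> ?M t om" by (rule cont_tendsto[OF growth_noise_continuous tl]) (use om t grid_nonneg[OF T0] in auto)
  from order_tendstoD(1)[OF tendsto_rabs[OF this] gt]
  obtain n where n: "!!K. n <= K ==> e < abs (?M (?t K) om)" by (auto simp: eventually_sequentially)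
  have "om : L n" unfolding L_def E_def using n kK(1) om by blast
  then show False using om by blast
 qed
qed
qed

text \<open>Up to time \<open>4^j\<close> the level \<open>3^j\<close> is exceeded with probability
  of order \<open>(4/9)^j\<close>, which is summable, while \<open>3^j\<close> is negligible against
  \<open>4^j\<close>. Any base strictly between 2 and 4 would serve for the level.\<close>

lemma growth_noise_sublinear: "AE om in P. ((%t. growth_noise t om / t) ---> 0) at_top"
proof -
have "EX L. L : sets P & prob L <= 4 * (norm gamma)^2 * 4 ^ j / (3 ^ j)^2 &
  (ALL om t. om : space P - L --> 0 <= t --> t <= 4 ^ j --> abs (growth_noise t om) <= 3 ^ j)" for j :: nat
proof -
 have "(0::real) < 4 ^ j" "(0::real) < 3 ^ j" by simp_all
 from growth_noise_maximal[OF this] show ?thesis by metis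
qed
then obtain L where L: "!!j. L j : sets P" "!!j. prob (L j) <= 4 * (norm gamma)^2 * 4 ^ j / (3 ^ j)^2"
 "!!j om t. om : space P - L j ==> 0 <= t ==> t <= 4 ^ j ==> abs (growth_noise t om) <= 3 ^ j" for j :: nat by metis
have e: "4 * (norm gamma)^2 * 4 ^ j / (3 ^ j)^2 = 4 * (norm gamma)^2 * (4 / 9 :: real) ^ j" for j :: nat
 by (simp add: power_divide power_mult[symmetric] mult.commute[of j 2] power_mult)
have "summable (%j. 4 * (norm gamma)^2 * (4 / 9 :: real) ^ j)" by (intro summable_mult summable_geometric) simp
then have "summable (%j. prob (L j))" by (rule summable_comparison_test'[where N = 0]) (use L(2) e in simp)
then have "AE om in P. eventually (%j. om : space P - L j) sequentially"
 by (intro borel_cantelli_AE1 L(1)) (simp_all add: emeasure_eq_measure)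
then show ?thesis
proof eventually_elim
 case (elim om)
 then obtain J where J: "!!j. J <= j ==> om : space P - L j" by (auto simp: eventually_sequentially)
 show ?case unfolding tendsto_iff
 proof (intro allI impI)
  fix eps :: real assume eps: "0 < eps"
  have "(%j. 4 * (3 / 4 :: real) ^ j) ----> 4 * 0" by (intro tendsto_mult tendsto_const LIMSEQ_power_zero) simp
  then have "EVN j. 4 * (3 / 4 :: real) ^ j < eps" using eps by (intro order_tendstoD(2)[where y = 0]) simp_all
  then obtain N where N: "!!j. N <= j ==> 4 * (3 / 4 :: real) ^ j < eps" by (auto simp: eventually_sequentially)
  show "\<forall>\<^sub>F t in at_top. dist (growth_noise t om / t) 0 < eps"
  proof (rule eventually_mono[OF eventually_ge_at_top[of "4 ^ max J N"]])
   fix t :: real assume t: "4 ^ max J N <= t"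
   have t1: "1 <= t" using order_trans[OF one_le_power[of "4::real"] t] by simp
   \<comment> \<open>The block with \<open>4^j / 4 <= t <= 4^j\<close>; since \<open>t >= 1\<close>,
     the lower bound holds for \<open>j = 0\<close> too.\<close>
   define j where "j = (LEAST j. t <= 4 ^ j)"
   have ex: "EX j. t <= 4 ^ j" using real_arch_pow[of 4 t] by (auto intro: less_imp_le)
   have tj: "t <= 4 ^ j" unfolding j_def by (rule LeastI_ex[OF ex])
   have jl: "max J N <= j" using order_trans[OF t tj] by simp
   have lo: "4 ^ j / 4 <= t"
   proof (cases j)
    case (Suc i)
    then have "~ t <= 4 ^ i" using not_less_Least[of i "%j. t <= 4 ^ j"] by (simp add: j_def)
    then show ?thesis using Suc by simp
   qed (use t1 in simp)
   have "abs (growth_noise t om) <= 3 ^ j" using L(3)[OF J] jl tj t1 by simp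
   then have "abs (growth_noise t om / t) <= 3 ^ j / (4 ^ j / 4)" using lo t1 unfolding abs_divide by (intro frac_le) simp_all
   also have "... = 4 * (3 / 4) ^ j" by (simp add: power_divide)
   also have "... < eps" using N jl by simp
   finally show "dist (growth_noise t om / t) 0 < eps" by (simp add: dist_real_def)
  qed
 qed
qed
qed

end

section \<open>Regularity of the logarithmic drift, and the conclusion\<close>

lemma Lam_isCont:
assumes y: "snd y ~= 0"
shows "isCont Lam y"
unfolding Lam_def[abs_def] osc_drift_def noise_coeff_def Complex_eq by (intro continuous_intros) (use y in simp_all)

lemma Lam_homogeneous: "0 < r ==> Lam (v, r *\<^sub>R z) = Lam (v, z)"
proof -
assume r: "0 < r"
have "osc_drift v (r *\<^sub>R z) = of_real r * osc_drift v z" by (simp add: osc_drift_def complex_eq_iff algebra_simps)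
with r show ?thesis by (simp add: Lam_def noise_coeff_def scaleR_conv_of_real)
qed

lemma Lam_linear_growth:
assumes y: "snd y ~= 0"
shows "norm (Lam y) <= (1 + 2 * abs zeta + kappa^2 + norm a + (norm gamma)^2) * (1 + norm (fst y))"
proof -
have n2: "(norm (noise_coeff (snd y)))^2 <= 1" using norm_noise_coeff by (simp add: power_le_one)
have "norm (Lam y) <= norm (osc_drift (fst y) (snd y) / snd y) + norm (of_real ((norm gamma)^2 / 2) * (noise_coeff (snd y))^2)"
 unfolding Lam_def by (rule norm_triangle_ineq4)
moreover have "norm (osc_drift (fst y) (snd y) / snd y) <= drift_bound (fst y)"
 using norm_osc_drift[of "fst y" "snd y"] y by (simp add: norm_divide divide_le_eq)
moreover have "norm (of_real ((norm gamma)^2 / 2) * (noise_coeff (snd y))^2) <= (norm gamma)^2"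
proof -
 have "(norm gamma)^2 / 2 * (norm (noise_coeff (snd y)))^2 <= (norm gamma)^2 / 2 * 1" by (rule mult_left_mono[OF n2]) simp
 also have "... <= (norm gamma)^2" by simp
 finally show ?thesis by (simp add: norm_mult norm_power)
qed
ultimately have "norm (Lam y) <= drift_bound (fst y) + (norm gamma)^2" by linarith
moreover have "0 <= (1 + 2 * abs zeta + kappa^2 + (norm gamma)^2) * norm (fst y) + norm a" by simp
ultimately show ?thesis unfolding drift_bound_def distrib_left distrib_right mult_1_left mult_1_right by linarith
qed

lemma Lam_cyl_embed: "Re (Lam (cyl_embed p)) = Q a gamma kappa zeta (fst p) (snd p)"
proof -
have "to_circle (rep_circle c) = c" for c by (rule Quotient_abs_rep[OF Quotient_circle])
then show ?thesis using Lam_polar[of 1 "fst p" "rep_circle (snd p)"] by (simp add: cyl_embed_def)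
qed

theorem growth_rate:
assumes A: "hurwitz A" and K: "transition_function P F W A B a gamma kappa zeta K"
 and mu: "prob_space mu" "sets mu = sets borel"
 and uniq: "!!nu. prob_space nu ==> sets nu = sets borel ==> (ALL t>=0. nu \<bind> K t = nu) ==> nu = mu"
shows "integrable mu (%p. Q a gamma kappa zeta (fst p) (snd p))"
 "(p\<^sub>0, u\<^sub>0) ~= (0, 0) ==> has_growth_rate P F W A B a gamma kappa zeta v\<^sub>0 p\<^sub>0 u\<^sub>0 (LINT p|mu. Q a gamma kappa zeta (fst p) (snd p))"
proof -
let ?c = "1 + 2 * abs zeta + kappa^2 + norm a + (norm gamma)^2"
have q: "isCont (%y. Re (Lam y)) y" if "snd y ~= 0" for y by (rule isCont_Re[OF Lam_isCont[OF that]])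
have qh: "Re (Lam (v, r *\<^sub>R z)) = Re (Lam (v, z))" if "0 < r" for v r z by (simp only: Lam_homogeneous[OF that])
have qg: "abs (Re (Lam y)) <= ?c * (1 + norm (fst y))" if "snd y ~= 0" for y
 by (rule order_trans[OF abs_Re_le_cmod Lam_linear_growth[OF that]])
have c: "0 <= ?c" by simp
have avg: "integrable mu (%p. Re (Lam (cyl_embed p)))"
 "AE om in P. ((%T. itg T (%t. Re (Lam (Phi 0 x t om))) / T) ---> (LINT p|mu. Re (Lam (cyl_embed p)))) at_top"
 if x: "snd x ~= 0" for x by (rule time_average_linear_growth[OF A K mu _ x _ _ _ c]; rule uniq q qh qg; assumption)+
\<comment> \<open>A statement on \<open>mu\<close> alone, so any starting point off the zero section
  serves.\<close>
show "integrable mu (%p. Q a gamma kappa zeta (fst p) (snd p))" using avg(1)[of "(0, 1)"] unfolding Lam_cyl_embed by simp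
assume nz: "(p\<^sub>0, u\<^sub>0) ~= (0, 0)"
define x where "x = (v\<^sub>0, Complex p\<^sub>0 u\<^sub>0)"
have x: "snd x ~= 0" using nz by (auto simp: x_def complex_eq_iff)
let ?L = "\<integral>p. Q a gamma kappa zeta (fst p) (snd p) \<partial>mu"
show "has_growth_rate P F W A B a gamma kappa zeta v\<^sub>0 p\<^sub>0 u\<^sub>0 ?L" unfolding has_growth_rate_def
proof (intro allI impI, elim conjE)
 fix X assume X: "oscillator_solution P F W A B a gamma kappa zeta X" "AE om in P. X 0 om = (v\<^sub>0, p\<^sub>0, u\<^sub>0)"
 from oscillator_eq_flow[OF X, folded x_def] avg(2)[OF x, unfolded Lam_cyl_embed] growth_noise_sublinear[OF x] AE_space
 show "AE om in P. ((%t. 1 / t * ln (norm (snd (X t om)))) ---> ?L) at_top"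
 proof eventually_elim
  case (elim om)
  let ?I = "%t. itg t (%s. Re (Lam (Phi 0 x s om)))"
  have lim: "((%t. Re (lg x 0 om) / t + growth_noise x t om / t + ?I t / t) ---> 0 + 0 + ?L) at_top"
   by (intro tendsto_add elim(2,3) tendsto_divide_0[OF tendsto_const] filterlim_at_top_imp_at_infinity filterlim_ident)
  have eq: "Re (lg x 0 om) / t + growth_noise x t om / t + ?I t / t = 1 / t * ln (norm (snd (X t om)))" if t: "0 < t" for t
  proof -
   have i: "(%s. Lam (Phi 0 x s om)) integrable_on {0..t}" by (intro cont_integrable cont_subset[OF Lam_continuous[OF x elim(4)]]) auto
   have "Re (itg t (%s. Lam (Phi 0 x s om))) = ?I t" using integral_linear[OF i bounded_linear_Re] by (simp add: o_def)
   then have M: "growth_noise x t om = Re (lg x t om) - Re (lg x 0 om) - ?I t" by (simp add: growth_noise_def[OF x])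
   have "norm (snd (X t om)) = norm (Complex (fst (snd (X t om))) (snd (snd (X t om))))" by (simp add: norm_prod_def complex_norm)
   also have "... = norm (snd (Phi 0 x t om))" using elim(1) t by simp
   also have "... = exp (Re (lg x t om))" using lg(2)[OF x elim(4), of t] t by (simp flip: norm_exp_eq_Re)
   finally have "ln (norm (snd (X t om))) = Re (lg x t om)" by simp
   then show ?thesis unfolding M by (simp add: diff_divide_distrib)
  qed
  show ?case by (rule Lim_transform_eventually[where f = "%t. Re (lg x 0 om) / t + growth_noise x t om / t + ?I t / t"])
    (use lim in simp, rule eventually_mono[OF eventually_gt_at_top[of 0] eq])
 qed
qed
qed

end

theorem corollary4p1:
  fixes A :: "real^'d^'d" and B :: "real^'m^'d" and a :: "real^'d" and \<gamma> :: "real^'m"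
    and \<kappa> \<zeta>\<^sub>2 :: real
    and P :: "'w measure" and F :: "real \<Rightarrow> 'w measure" and W :: "real \<Rightarrow> 'w \<Rightarrow> real^'m"
    and \<mu> :: "((real^'d) \<times> circle) measure"
  assumes "hurwitz A" and "controllable A B" and "\<not> (a = 0 \<and> \<gamma> = 0)"
    and "\<kappa> > 0" and "\<zeta>\<^sub>2 > 0"
    and "brownian_motion P F W"
    and "stationary_measure P F W A B a \<gamma> \<kappa> \<zeta>\<^sub>2 \<mu>"
    and "\<And>\<nu>. stationary_measure P F W A B a \<gamma> \<kappa> \<zeta>\<^sub>2 \<nu> \<Longrightarrow> \<nu> = \<mu>"
  shows "integrable \<mu> (\<lambda>(v, \<psi>). Q a \<gamma> \<kappa> \<zeta>\<^sub>2 v \<psi>) \<and>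
    (\<forall>v\<^sub>0 \<phi>\<^sub>0 \<phi>\<^sub>0'. (\<phi>\<^sub>0, \<phi>\<^sub>0') \<noteq> (0, 0) \<longrightarrow>
       has_growth_rate P F W A B a \<gamma> \<kappa> \<zeta>\<^sub>2 v\<^sub>0 \<phi>\<^sub>0 \<phi>\<^sub>0' (\<integral>(v, \<psi>). Q a \<gamma> \<kappa> \<zeta>\<^sub>2 v \<psi> \<partial>\<mu>)) \<and>
    (\<exists>\<Lambda>. (\<forall>v\<^sub>0 \<phi>\<^sub>0 \<phi>\<^sub>0'. (\<phi>\<^sub>0, \<phi>\<^sub>0') \<noteq> (0, 0) \<longrightarrow>
            has_growth_rate P F W A B a \<gamma> \<kappa> \<zeta>\<^sub>2 v\<^sub>0 \<phi>\<^sub>0 \<phi>\<^sub>0' \<Lambda>) \<and>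
         \<Lambda> = (\<integral>(v, \<psi>). Q a \<gamma> \<kappa> \<zeta>\<^sub>2 v \<psi> \<partial>\<mu>))"
proof -
interpret osc_bm P F W A B a \<gamma> \<kappa> \<zeta>\<^sub>2 by unfold_locales (rule assms(6))
obtain K where \<mu>: "prob_space \<mu>" "sets \<mu> = sets borel" and K: "transition_function P F W A B a \<gamma> \<kappa> \<zeta>\<^sub>2 K"
 using assms(7) unfolding stationary_measure_def by blast
\<comment> \<open>Stationarity may be witnessed by any transition function; with the
  \<open>K\<close> obtained from \<open>\<mu>\<close> as witness, invariance under this one
  suffices.\<close>
have uniq: "\<nu> = \<mu>" if "prob_space \<nu>" "sets \<nu> = sets borel" "ALL t>=0. \<nu> \<bind> K t = \<nu>" for \<nu>
 by (rule assms(8)) (use that K in "auto simp: stationary_measure_def")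
note g = growth_rate[OF assms(1) K \<mu> uniq]
have Q: "(%(v, \<psi>). Q a \<gamma> \<kappa> \<zeta>\<^sub>2 v \<psi>) = (%p. Q a \<gamma> \<kappa> \<zeta>\<^sub>2 (fst p) (snd p))" by (simp add: fun_eq_iff)
show ?thesis unfolding Q using g by blast
qed

end
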